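(* Let $0<p\le q\le1$ and let $g$ be analytic in $\mathbb D$ given by a lacunary power series. Then $g\in\mathcal M(\mathcal D^p_{p-1}\cap BMOA,\ \mathcal D^q_{q-1}\cap BMOA)$ if and only if $g\in\mathcal D^q_{q-1}\cap BMOA_{\log}$.
   Context: $\mathbb D$ is the open unit disc, $dA=\frac1\pi dx\,dy$. A lacunary power series is $\sum_k a_kz^{n_k}$ with positive integers $n_{k+1}\ge\lambda n_k$ for all $k$, for some $\lambda>1$. For $0<p<\infty$, $\mathcal D^p_{p-1}$ is the space of analytic $f$ with $\int_{\mathbb D}(1-|z|)^{p-1}|f'(z)|^p\,dA(z)<\infty$. $BMOA$ is the space of $f\in H^1$ whose boundary values have bounded mean oscillation. For an arc $I\subset\partial\mathbb D$ of length $|I|$, $S(I)=\{re^{it}: e^{it}\in I,\ 1-\frac{|I|}{2\pi}\le r<1\}$. $BMOA_{\log}$ is the space of $g\in H^1$ for which there is $C>0$ with $\int_{S(I)}(1-|z|^2)|g'(z)|^2\,dA(z)\le C|I|(\log\frac{2}{|I|})^{-2}$ for every arc $I$. $\mathcal M(X,Y)=\{g\text{ analytic}: fg\in Y\ \forall f\in X\}$. *)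

theory Defs
  imports "HOL-Analysis.Analysis"
begin

text \<open>The open unit disc and the normalized area measure dA = (1/pi) dx dy
  (densities below carry the factor 1/pi; integrals are w.r.t. lborel on complex).\<close>

abbreviation udisc :: "complex set" where
  "udisc \<equiv> ball 0 1"

definition analytic_disc :: "(complex \<Rightarrow> complex) \<Rightarrow> bool" where
  "analytic_disc f \<longleftrightarrow> f holomorphic_on udisc"

definition lacunary_series :: "(complex \<Rightarrow> complex) \<Rightarrow> bool" where
  "lacunary_series g \<longleftrightarrow>
     (\<exists>(a::nat \<Rightarrow> complex) (n::nat \<Rightarrow> nat) (lam::real).
        lam > 1 \<and> (\<forall>k. 0 < n k \<and> lam * real (n k) \<le> real (n (Suc k))) \<and>
        (\<forall>z\<in>udisc. (\<lambda>k. a k * z ^ n k) sums g z))"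

definition Dspace :: "real \<Rightarrow> (complex \<Rightarrow> complex) set" where
  "Dspace p = {f. analytic_disc f \<and>
     (\<integral>\<^sup>+ z \<in> udisc. ennreal ((1 - cmod z) powr (p - 1) * cmod (deriv f z) powr p / pi) \<partial>lborel) < \<infinity>}"

definition H1 :: "(complex \<Rightarrow> complex) set" where
  "H1 = {f. analytic_disc f \<and>
     (\<exists>M::real. \<forall>r. 0 < r \<and> r < 1 \<longrightarrow>
        (\<integral>\<^sup>+ t \<in> {0..2*pi}. ennreal (cmod (f (complex_of_real r * cis t)) / (2*pi)) \<partial>lborel) \<le> ennreal M)}"

text \<open>Boundary function: F t is the radial limit of f at e^{it}, existing for a.e. t.
  Arcs are parametrized as {e^{it} : a <= t <= a + L} with 0 < L <= 2 pi, |I| = L.\<close>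

definition boundary_function :: "(complex \<Rightarrow> complex) \<Rightarrow> (real \<Rightarrow> complex) \<Rightarrow> bool" where
  "boundary_function f F \<longleftrightarrow>
     (AE t in lborel. ((\<lambda>r. f (complex_of_real r * cis t)) \<longlongrightarrow> F t) (at_left 1))"

definition bounded_mean_osc :: "(real \<Rightarrow> complex) \<Rightarrow> bool" where
  "bounded_mean_osc F \<longleftrightarrow>
     (\<exists>C::real. \<forall>a L. 0 < L \<and> L \<le> 2*pi \<longrightarrow>
        set_integrable lborel {a..a+L} F \<and>
        (\<integral>\<^sup>+ t \<in> {a..a+L}.
            ennreal (cmod (F t - (1 / L) *\<^sub>R (\<integral>s\<in>{a..a+L}. F s \<partial>lborel))) \<partial>lborel)
          \<le> ennreal (C * L))"

definition BMOA :: "(complex \<Rightarrow> complex) set" where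
  "BMOA = {f. f \<in> H1 \<and> (\<exists>F. boundary_function f F \<and> bounded_mean_osc F)}"

definition carleson_box :: "real \<Rightarrow> real \<Rightarrow> complex set" where
  "carleson_box a L = {complex_of_real r * cis t | r t.
      a \<le> t \<and> t \<le> a + L \<and> 1 - L / (2*pi) \<le> r \<and> r < 1}"

text \<open>BMOA_log. The condition  int_{S(I)} ... <= C |I| (log(2/|I|))^(-2)  is written
  multiplied out, so that for |I| = 2 (where the right-hand side is +infinity) it is vacuous.\<close>

definition BMOA_log :: "(complex \<Rightarrow> complex) set" where
  "BMOA_log = {g. g \<in> H1 \<and> (\<exists>C::real. C > 0 \<and> (\<forall>a L. 0 < L \<and> L \<le> 2*pi \<longrightarrow>
      (\<integral>\<^sup>+ z \<in> carleson_box a L.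
          ennreal ((1 - (cmod z)\<^sup>2) * (cmod (deriv g z))\<^sup>2 / pi) \<partial>lborel)
        * ennreal ((ln (2 / L))\<^sup>2) \<le> ennreal (C * L)))}"

definition multipliers :: "(complex \<Rightarrow> complex) set \<Rightarrow> (complex \<Rightarrow> complex) set \<Rightarrow> (complex \<Rightarrow> complex) set" where
  "multipliers X Y = {g. analytic_disc g \<and> (\<forall>f\<in>X. (\<lambda>z. f z * g z) \<in> Y)}"

end

theory Submission
  imports Defs "HOL-Complex_Analysis.Complex_Analysis" "HOL-Computational_Algebra.Fundamental_Theorem_Algebra"
begin

text \<open>For \<open>g z = (\<Sum>k. a k * z ^ n k)\<close> lacunary and \<open>0 < q \<le> 1\<close>, membership in \<open>D\<^sup>q\<close> amounts to
  \<open>(\<Sum>k. |a k| powr q) < \<infinity>\<close>, and membership in \<open>BMOA_log\<close> amounts (once the coefficients are summable) to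
  \<open>(\<Sum>j\<ge>k. |a j|\<^sup>2) = O(1 / ln\<^sup>2 (n k))\<close>. Both rest on the fact that, on an arc long compared with the
  longest wave, a lacunary exponential sum has \<open>L\<^sup>q\<close> mean comparable to its \<open>\<ell>\<^sup>2\<close> norm.

  Sufficiency. Let \<open>F\<close> and \<open>G\<close> be the boundary values of \<open>f\<close> and \<open>g\<close>. The mean \<open>F\<^sub>I\<close> of \<open>F\<close> over an arc \<open>I\<close>
  grows at most like \<open>ln (1/|I|)\<close>, so the oscillation of \<open>FG\<close> is controlled through
  \<open>|FG - F\<^sub>I P| \<le> |F - F\<^sub>I| |G| + |F\<^sub>I| |G - P|\<close>, with \<open>P\<close> the low frequency part of \<open>G\<close> at a point of \<open>I\<close>;
  the tail condition makes \<open>G - P\<close> of mean size \<open>O(1 / ln (1/|I|))\<close>. For the \<open>D\<^sup>q\<close> part, \<open>D\<^sup>p \<inter> BMOA\<close> lies in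
  \<open>D\<^sup>q\<close> because \<open>BMOA\<close> functions are Bloch functions.

  Necessity. The test function \<open>1\<close> gives \<open>g \<in> D\<^sup>q\<close>. The test function \<open>- ln (1 - z)\<close> is close to \<open>ln (1/L)\<close> on
  the arc \<open>[L, 2L]\<close>, so the mean oscillation of \<open>G\<close> there is \<open>O(1 / ln (1/L))\<close>. Taking
  \<open>L = n k powr (-1/2)\<close> isolates the single coefficient \<open>a k\<close>; this makes the frequencies below \<open>n k\<close>
  harmless at the scale \<open>L = M / n k\<close>, at which the oscillation bounds the whole tail.\<close>

text \<open>The mean value fact has two sources. The square mean is bounded below by near
  orthogonality, the fourth mean above by counting how often a number is nearly a sum of two
  frequencies; cutting the values at a level proportional to the square root of the coefficient sum
  then reaches every exponent \<open>q <= 1\<close>. Arcs carry the parabolic weight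
  \<open>(t - a) * (a + L - t)\<close> instead of a sharp cutoff: its Fourier transform decays
  quadratically, which makes the interaction of different frequencies summable on arcs of any
  length. Mean oscillation does not see constants, so the lower bounds have to hold whatever
  constant is added. The constant is therefore treated as one more term, of frequency 0. Since
  \<open>q <= 1\<close>, summability of \<open>|a k| powr q\<close> gives that of
  \<open>|a k|\<close>; hence \<open>g\<close> is continuous up to the circle and its boundary
  function is an explicit uniformly convergent series. For a general \<open>f\<close> in
  \<open>BMOA\<close> only radial limits almost everywhere are given. Its values inside are tied to
  \<open>F\<close> by the subharmonicity of \<open>sqrt |f|\<close>, and a dyadic splitting of the
  Poisson kernel then yields the Bloch bound.\<close>

section \<open>Area integrals in polar coordinates\<close>

text \<open>Both measures give a box the product of its side lengths. This opens the plane to Fubini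
  in the real and imaginary parts.\<close>

lemma lborel_complex_eq_distr:
  "(lborel :: complex measure) = distr (lborel \<Otimes>\<^sub>M lborel) borel (\<lambda>(x,y). Complex x y)"
proof (rule lborel_eqI)
  have meas: "(\<lambda>(x,y). Complex x y) \<in> borel_measurable (lborel \<Otimes>\<^sub>M lborel)"
    by (simp add: borel_measurable_complex_iff case_prod_unfold)
  fix l u :: complex
  assume le: "\<And>b. b \<in> Basis \<Longrightarrow> l \<bullet> b \<le> u \<bullet> b"
  have le': "Re l \<le> Re u" "Im l \<le> Im u"
    using le[of 1] le[of \<i>] by (auto simp: Basis_complex_def inner_complex_def)
  have vim: "(\<lambda>(x,y). Complex x y) -` box l u = {Re l<..<Re u} \<times> {Im l<..<Im u}"
    by (auto simp: in_box_complex_iff)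
  have "emeasure (distr (lborel \<Otimes>\<^sub>M lborel) borel (\<lambda>(x,y). Complex x y)) (box l u)
      = emeasure (lborel \<Otimes>\<^sub>M lborel) ({Re l<..<Re u} \<times> {Im l<..<Im u})"
    using meas by (subst emeasure_distr) (auto simp: vim space_pair_measure)
  also have "\<dots> = ennreal ((Re u - Re l) * (Im u - Im l))"
    using le' by (subst lborel.emeasure_pair_measure_Times) (auto simp: ennreal_mult)
  also have "(Re u - Re l) * (Im u - Im l) = prod ((\<bullet>) (u - l)) Basis"
    by (simp add: Basis_complex_def inner_complex_def complex_i_not_one)
  finally show "emeasure (distr (lborel \<Otimes>\<^sub>M lborel) borel (\<lambda>(x,y). Complex x y)) (box l u)
      = ennreal (prod ((\<bullet>) (u - l)) Basis)" .
qed simp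

lemma measurable_Complex_pair [measurable]:
  "(\<lambda>x. Complex (f x) (g x)) \<in> borel_measurable M"
  if "f \<in> borel_measurable M" "g \<in> borel_measurable M"
  using that by (simp add: borel_measurable_complex_iff)

lemma nn_integral_lborel_complex:
  fixes f :: "complex \<Rightarrow> ennreal"
  assumes [measurable]: "f \<in> borel_measurable borel"
  shows "(\<integral>\<^sup>+z. f z \<partial>lborel) = (\<integral>\<^sup>+x. \<integral>\<^sup>+y. f (Complex x y) \<partial>lborel \<partial>lborel)"
proof -
  have "(\<integral>\<^sup>+z. f z \<partial>lborel) = (\<integral>\<^sup>+p. f (case p of (x,y) \<Rightarrow> Complex x y) \<partial>(lborel \<Otimes>\<^sub>M lborel))"
    by (subst lborel_complex_eq_distr, subst nn_integral_distr)
       (auto simp: borel_measurable_complex_iff case_prod_unfold)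
  also have "\<dots> = (\<integral>\<^sup>+x. \<integral>\<^sup>+y. f (Complex x y) \<partial>lborel \<partial>lborel)"
    by (subst lborel.nn_integral_fst[symmetric]) (auto simp: case_prod_unfold)
  finally show ?thesis .
qed

text \<open>Continuity from below of the measure with density \<open>f\<close>. It carries a
  substitution valid on compact intervals over to their union.\<close>

lemma nn_integral_indicator_incseq_SUP:
  fixes f :: "'a \<Rightarrow> ennreal"
  assumes [measurable]: "f \<in> borel_measurable M" and A: "range A \<subseteq> sets M" "incseq A"
  shows "(\<integral>\<^sup>+x. f x * indicator (\<Union>n::nat. A n) x \<partial>M) = (SUP n. \<integral>\<^sup>+x. f x * indicator (A n) x \<partial>M)"
proof -
  have "(SUP n. emeasure (density M f) (A n)) = emeasure (density M f) (\<Union>n. A n)"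
    using A by (intro SUP_emeasure_incseq) auto
  moreover have "\<And>B. B \<in> sets M \<Longrightarrow> emeasure (density M f) B = (\<integral>\<^sup>+x. f x * indicator B x \<partial>M)"
    by (rule emeasure_density) auto
  moreover have "(\<Union>n. A n) \<in> sets M" using A by auto
  ultimately show ?thesis using A by (simp add: range_subsetD)
qed

lemma nn_integral_tan_substitution:
  fixes h :: "real \<Rightarrow> real"
  assumes h[measurable]: "h \<in> borel_measurable borel" and h0: "\<And>x. h x \<ge> 0"
  shows "(\<integral>\<^sup>+s. ennreal (h s) \<partial>lborel)
       = (\<integral>\<^sup>+t\<in>{-pi/2<..<pi/2}. ennreal (h (tan t) * inverse ((cos t)\<^sup>2)) \<partial>lborel)"
proof -
  \<comment> \<open>The compact intervals \<open>[-c n, c n]\<close> exhaust the open interval on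
    which \<open>tan\<close> is a smooth bijection onto the line.\<close>
  define b where "b n = pi/2 - 1 / (real n + 1)" for n
  define c where "c n = max 0 (b n)" for n
  have c: "0 \<le> c n" "c n < pi/2" for n
  proof -
    have "b n < pi/2" unfolding b_def by simp
    then show "0 \<le> c n" "c n < pi/2" using pi_gt_zero by (auto simp: c_def max_def)
  qed
  have cinc: "m \<le> n \<Longrightarrow> c m \<le> c n" for m n

  proof -
    assume "m \<le> n"
    then have "1 / (real n + 1) \<le> 1 / (real m + 1)" by (intro divide_left_mono) auto
    then show ?thesis by (auto simp: c_def b_def)
  qed
  have clim: "c \<longlonglongrightarrow> pi/2"
  proof -
    have "b \<longlonglongrightarrow> pi/2 - 0"
      unfolding b_def by (intro tendsto_intros) (use LIMSEQ_inverse_real_of_nat in \<open>simp add: inverse_eq_divide add.commute\<close>)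
    then have "c \<longlonglongrightarrow> max 0 (pi/2)" unfolding c_def by (intro tendsto_intros) auto
    then show ?thesis by simp
  qed
  have ev: "\<exists>n. x < c n" if "x < pi/2" for x
    using order_tendstoD(1)[OF clim that] by (auto simp: eventually_sequentially)
  have U1: "(\<Union>n. {-c n..c n}) = {-pi/2<..<pi/2}"
  proof (intro set_eqI iffI)
    fix x assume "x \<in> (\<Union>n. {-c n..c n})"
    then obtain n where "-c n \<le> x" "x \<le> c n" by auto
    then show "x \<in> {-pi/2<..<pi/2}" using c(2)[of n] by auto
  next
    fix x assume "x \<in> {-pi/2<..<pi/2}"
    then have "\<bar>x\<bar> < pi/2" by auto
    then obtain n where "\<bar>x\<bar> < c n" using ev by blast
    then show "x \<in> (\<Union>n. {-c n..c n})" by (intro UN_I[of n]) auto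
  qed
  have U2: "(\<Union>n. {tan (-c n)..tan (c n)}) = UNIV"
  proof (intro set_eqI iffI UNIV_I)
    fix x :: real
    have "\<bar>arctan x\<bar> < pi/2" using arctan_bounded[of x] by auto
    then obtain n where n: "\<bar>arctan x\<bar> < c n" using ev by blast
    have "tan (arctan x) < tan (c n)" "tan (-c n) < tan (arctan x)"
      by (rule tan_monotone; use n c[of n] arctan_bounded[of x] in auto)+
    then show "x \<in> (\<Union>n. {tan (-c n)..tan (c n)})" by (intro UN_I[of n]) (auto simp: tan_arctan)
  qed
  have tinc: "m \<le> n \<Longrightarrow> tan (c m) \<le> tan (c n)" for m n
    using cinc[of m n] c[of m] c[of n] by (intro tan_mono_le) auto
  have i1: "incseq (\<lambda>n. {-c n..c n})" "incseq (\<lambda>n. {tan (-c n)..tan (c n)})"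
    using cinc tinc by (force simp: incseq_def)+
  have [measurable]: "(\<lambda>t. ennreal (h (tan t) * inverse ((cos t)\<^sup>2))) \<in> borel_measurable borel"
    unfolding tan_def by measurable
  have "(\<integral>\<^sup>+s. ennreal (h s) \<partial>lborel) = (\<integral>\<^sup>+s. ennreal (h s) * indicator (\<Union>n. {tan (-c n)..tan (c n)}) s \<partial>lborel)"
    unfolding U2 by simp
  also have "\<dots> = (SUP n. \<integral>\<^sup>+s. ennreal (h s) * indicator {tan (-c n)..tan (c n)} s \<partial>lborel)"
    by (rule nn_integral_indicator_incseq_SUP) (use i1 in auto)
  also have "\<dots> = (SUP n. \<integral>\<^sup>+t. ennreal (h (tan t) * inverse ((cos t)\<^sup>2)) * indicator {-c n..c n} t \<partial>lborel)"
  proof (rule SUP_cong[OF refl])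
    fix n
    have "(\<integral>\<^sup>+s. ennreal (h s * indicator {tan (-c n)..tan (c n)} s) \<partial>lborel)
        = (\<integral>\<^sup>+t. ennreal (h (tan t) * inverse ((cos t)\<^sup>2) * indicator {-c n..c n} t) \<partial>lborel)"
    proof (rule nn_integral_substitution)
      show "set_borel_measurable borel {tan (- c n)..tan (c n)} h"
        unfolding set_borel_measurable_def by measurable
      fix x assume x: "x \<in> {-c n..c n}"
      have "cos x > 0" by (rule cos_gt_zero_pi) (use x c[of n] in auto)
      then show "(tan has_real_derivative inverse ((cos x)\<^sup>2)) (at x)" by (auto intro!: DERIV_tan)
    next
      have "cos x \<noteq> 0" if "x \<in> {-c n..c n}" for x
        using cos_gt_zero_pi[of x] that c[of n] by force
      then show "continuous_on {- c n..c n} (\<lambda>x. inverse ((cos x)\<^sup>2))"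
        by (intro continuous_intros) auto
    qed (use c[of n] in auto)
    then show "(\<integral>\<^sup>+s. ennreal (h s) * indicator {tan (-c n)..tan (c n)} s \<partial>lborel)
        = (\<integral>\<^sup>+t. ennreal (h (tan t) * inverse ((cos t)\<^sup>2)) * indicator {-c n..c n} t \<partial>lborel)"
      by (simp only: nn_integral_set_ennreal)
  qed
  also have "\<dots> = (\<integral>\<^sup>+t. ennreal (h (tan t) * inverse ((cos t)\<^sup>2)) * indicator (\<Union>n. {-c n..c n}) t \<partial>lborel)"
    by (rule nn_integral_indicator_incseq_SUP[symmetric]) (use i1 in auto)
  finally show ?thesis unfolding U1 .
qed

lemma measurable_cis [measurable]: "(\<lambda>x. cis (f x)) \<in> borel_measurable M"
  if "f \<in> borel_measurable M"
  using that by (simp add: borel_measurable_complex_iff)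

text \<open>The change of variables is split into three one-dimensional ones:
  \<open>y = x * s\<close> with \<open>s\<close> the slope, then
  \<open>x = r / sqrt (1 + s^2)\<close> for fixed \<open>s\<close>, then \<open>s = tan t\<close>.
  The factors \<open>x\<close>, \<open>1 / sqrt (1 + s^2)\<close> and \<open>1 / cos^2 t\<close>
  multiply to \<open>r\<close>.\<close>

lemma nn_integral_right_half_plane_polar:
  fixes \<phi> :: "complex \<Rightarrow> real"
  assumes [measurable]: "\<phi> \<in> borel_measurable borel" and p0: "\<And>z. \<phi> z \<ge> 0"
  shows "(\<integral>\<^sup>+x\<in>{0<..}. (\<integral>\<^sup>+y. ennreal (\<phi> (Complex x y)) \<partial>lborel) \<partial>lborel)
     = (\<integral>\<^sup>+r\<in>{0<..}. (\<integral>\<^sup>+t\<in>{-pi/2<..<pi/2}. ennreal (r * \<phi> (of_real r * cis t)) \<partial>lborel) \<partial>lborel)"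
proof -
  have "(\<integral>\<^sup>+x\<in>{0<..}. (\<integral>\<^sup>+y. ennreal (\<phi> (Complex x y)) \<partial>lborel) \<partial>lborel)
      = (\<integral>\<^sup>+x. (\<integral>\<^sup>+s. ennreal x * ennreal (\<phi> (Complex x (x * s))) * indicator {0<..} x \<partial>lborel) \<partial>lborel)"
  proof (rule nn_integral_cong)
    fix x :: real
    show "(\<integral>\<^sup>+y. ennreal (\<phi> (Complex x y)) \<partial>lborel) * indicator {0<..} x
       = (\<integral>\<^sup>+s. ennreal x * ennreal (\<phi> (Complex x (x * s))) * indicator {0<..} x \<partial>lborel)"
    proof (cases "x > 0")
      case True
      have "(\<integral>\<^sup>+y. ennreal (\<phi> (Complex x y)) \<partial>lborel)
         = ennreal \<bar>x\<bar> * (\<integral>\<^sup>+s. ennreal (\<phi> (Complex x (0 + x * s))) \<partial>lborel)"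
        using True by (intro nn_integral_real_affine) auto
      then show ?thesis using True by (simp add: nn_integral_cmult)
    qed simp
  qed
  also have "\<dots> = (\<integral>\<^sup>+s. (\<integral>\<^sup>+x. ennreal x * ennreal (\<phi> (Complex x (x * s))) * indicator {0<..} x \<partial>lborel) \<partial>lborel)"
    by (rule lborel_pair.Fubini') measurable
  also have "\<dots> = (\<integral>\<^sup>+s. (\<integral>\<^sup>+r. ennreal (r * \<phi> (of_real (r / sqrt (1 + s\<^sup>2)) * Complex 1 s) / (1 + s\<^sup>2)) * indicator {0<..} r \<partial>lborel) \<partial>lborel)"
  proof (rule nn_integral_cong)
    fix s :: real
    define w where "w = 1 / sqrt (1 + s\<^sup>2)"
    have s: "1 + s\<^sup>2 > 0" by (simp add: add_pos_nonneg)
    then have w: "w > 0" "w * w = 1 / (1 + s\<^sup>2)" by (auto simp: w_def)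
    have "(\<integral>\<^sup>+x. ennreal x * ennreal (\<phi> (Complex x (x * s))) * indicator {0<..} x \<partial>lborel)
      = ennreal \<bar>w\<bar> * (\<integral>\<^sup>+r. ennreal (0 + w*r) * ennreal (\<phi> (Complex (0 + w*r) ((0 + w*r) * s))) * indicator {0<..} (0 + w*r) \<partial>lborel)"
      using w by (intro nn_integral_real_affine) auto
    also have "\<dots> = (\<integral>\<^sup>+r. ennreal w * (ennreal (w*r) * ennreal (\<phi> (Complex (w*r) ((w*r) * s))) * indicator {0<..} (w*r)) \<partial>lborel)"
      using w by (subst nn_integral_cmult[symmetric]) auto
    also have "\<dots> = (\<integral>\<^sup>+r. ennreal (r * \<phi> (of_real (r / sqrt (1 + s\<^sup>2)) * Complex 1 s) / (1 + s\<^sup>2)) * indicator {0<..} r \<partial>lborel)"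
    proof (rule nn_integral_cong)
      fix r :: real
      have "Complex (w*r) ((w*r) * s) = of_real (r / sqrt (1 + s\<^sup>2)) * Complex 1 s"
        by (auto simp: complex_eq_iff w_def)
      moreover have "w * (w*r*q) = r * q / (1 + s\<^sup>2)" for q
        using w(2) by (metis (no_types, opaque_lifting) mult.assoc mult.commute mult.left_commute times_divide_eq_left mult_1)
      moreover have "w*r > 0 \<longleftrightarrow> r > 0" using w by (simp add: zero_less_mult_iff)
      ultimately show "ennreal w * (ennreal (w*r) * ennreal (\<phi> (Complex (w*r) ((w*r) * s))) * indicator {0<..} (w*r))
         = ennreal (r * \<phi> (of_real (r / sqrt (1 + s\<^sup>2)) * Complex 1 s) / (1 + s\<^sup>2)) * indicator {0<..} r"
        using w p0 by (auto simp: indicator_def ennreal_mult'[symmetric])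
    qed
    finally show "(\<integral>\<^sup>+x. ennreal x * ennreal (\<phi> (Complex x (x * s))) * indicator {0<..} x \<partial>lborel)
      = (\<integral>\<^sup>+r. ennreal (r * \<phi> (of_real (r / sqrt (1 + s\<^sup>2)) * Complex 1 s) / (1 + s\<^sup>2)) * indicator {0<..} r \<partial>lborel)" .
  qed
  also have "\<dots> = (\<integral>\<^sup>+r. (\<integral>\<^sup>+s. ennreal (r * \<phi> (of_real (r / sqrt (1 + s\<^sup>2)) * Complex 1 s) / (1 + s\<^sup>2)) * indicator {0<..} r \<partial>lborel) \<partial>lborel)"
    by (rule lborel_pair.Fubini') measurable
  also have "\<dots> = (\<integral>\<^sup>+r\<in>{0<..}. (\<integral>\<^sup>+t\<in>{-pi/2<..<pi/2}. ennreal (r * \<phi> (of_real r * cis t)) \<partial>lborel) \<partial>lborel)"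
  proof (rule nn_integral_cong)
    fix r :: real
    show "(\<integral>\<^sup>+s. ennreal (r * \<phi> (of_real (r / sqrt (1 + s\<^sup>2)) * Complex 1 s) / (1 + s\<^sup>2)) * indicator {0<..} r \<partial>lborel)
       = (\<integral>\<^sup>+t\<in>{-pi/2<..<pi/2}. ennreal (r * \<phi> (of_real r * cis t)) \<partial>lborel) * indicator {0<..} r"
    proof (cases "r > 0")
      case True
      define h where "h s = r * \<phi> (of_real (r / sqrt (1 + s\<^sup>2)) * Complex 1 s) / (1 + s\<^sup>2)" for s
      have [measurable]: "h \<in> borel_measurable borel" unfolding h_def by measurable
      have h0: "h s \<ge> 0" for s using True p0 by (auto simp: h_def intro!: divide_nonneg_nonneg add_nonneg_nonneg)
      have "(\<integral>\<^sup>+s. ennreal (h s) \<partial>lborel) = (\<integral>\<^sup>+t\<in>{-pi/2<..<pi/2}. ennreal (h (tan t) * inverse ((cos t)\<^sup>2)) \<partial>lborel)"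
        by (rule nn_integral_tan_substitution) (use h0 in auto)
      also have "\<dots> = (\<integral>\<^sup>+t\<in>{-pi/2<..<pi/2}. ennreal (r * \<phi> (of_real r * cis t)) \<partial>lborel)"
      proof (rule nn_integral_cong)
        fix t :: real
        show "ennreal (h (tan t) * inverse ((cos t)\<^sup>2)) * indicator {- pi / 2<..<pi / 2} t =
          ennreal (r * \<phi> (complex_of_real r * cis t)) * indicator {- pi / 2<..<pi / 2} t"
        proof (cases "t \<in> {- pi / 2<..<pi / 2}")
          case True
          then have ct: "cos t > 0" by (intro cos_gt_zero_pi) auto
          have sec: "1 + (tan t)\<^sup>2 = inverse ((cos t)\<^sup>2)" using tan_sec[of t] ct by (simp add: power_inverse)
          have "sqrt (1 + (tan t)\<^sup>2) = inverse (cos t)"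
            unfolding sec using ct by (simp add: real_sqrt_inverse)
          then have eq: "of_real (r / sqrt (1 + (tan t)\<^sup>2)) * Complex 1 (tan t) = of_real r * cis t"
            using ct by (auto simp: complex_eq_iff tan_def power2_eq_square)
          then have "h (tan t) * inverse ((cos t)\<^sup>2) = r * \<phi> (complex_of_real r * cis t)"
            unfolding h_def eq unfolding sec using ct by (simp add: inverse_eq_divide)
          then show ?thesis by simp
        qed simp
      qed
      finally show ?thesis using True by (simp add: h_def)
    qed simp
  qed
  finally show ?thesis .
qed

text \<open>The window is cut at a multiple of \<open>2*pi\<close> and the pieces are translated.
  Half-open intervals fit together without overlap; closing them changes only a null set.\<close>

lemma nn_integral_periodic_shift:
  fixes f :: "real \<Rightarrow> ennreal"
  assumes [measurable]: "f \<in> borel_measurable borel" and per: "\<And>t. f (t + 2*pi) = f t"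
  shows "(\<integral>\<^sup>+t\<in>{a..a+2*pi}. f t \<partial>lborel) = (\<integral>\<^sup>+t\<in>{b..b+2*pi}. f t \<partial>lborel)"
proof -
  have perk: "f (t + 2*pi*real_of_int k) = f t" for t k
  proof (induction k rule: int_induct[where k=0])
    case (step1 i) then show ?case using per[of "t + 2*pi*real_of_int i"] by (simp add: algebra_simps)
  next
    case (step2 i) then show ?case using per[of "t + 2*pi*real_of_int (i-1)"] by (simp add: algebra_simps)
  qed simp
  have shift: "(\<integral>\<^sup>+t\<in>{c + 2*pi*real_of_int k..<d + 2*pi*real_of_int k}. f t \<partial>lborel) = (\<integral>\<^sup>+t\<in>{c..<d}. f t \<partial>lborel)" for c d k
  proof -
    have "(\<integral>\<^sup>+t\<in>{c + 2*pi*real_of_int k..<d + 2*pi*real_of_int k}. f t \<partial>lborel)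
      = ennreal \<bar>1\<bar> * (\<integral>\<^sup>+t. f (2*pi*real_of_int k + 1 * t) * indicator {c + 2*pi*real_of_int k..<d + 2*pi*real_of_int k} (2*pi*real_of_int k + 1 * t) \<partial>lborel)"
      by (rule nn_integral_real_affine) auto
    also have "\<dots> = (\<integral>\<^sup>+t\<in>{c..<d}. f t \<partial>lborel)"
      by (auto intro!: nn_integral_cong simp: indicator_def perk add.commute)
    finally show ?thesis .
  qed
  have split: "(\<integral>\<^sup>+t\<in>{c..<e}. f t \<partial>lborel) = (\<integral>\<^sup>+t\<in>{c..<d}. f t \<partial>lborel) + (\<integral>\<^sup>+t\<in>{d..<e}. f t \<partial>lborel)"
    if "c \<le> d" "d \<le> e" for c d e
    using that by (subst nn_integral_add[symmetric]) (auto intro!: nn_integral_cong simp: indicator_def)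
  have closed: "(\<integral>\<^sup>+t\<in>{c..d}. f t \<partial>lborel) = (\<integral>\<^sup>+t\<in>{c..<d}. f t \<partial>lborel)" for c d
    by (intro nn_integral_cong_AE, use AE_lborel_singleton[of d] in eventually_elim) (auto simp: indicator_def)
  have std: "(\<integral>\<^sup>+t\<in>{c..<c+2*pi}. f t \<partial>lborel) = (\<integral>\<^sup>+t\<in>{0..<2*pi}. f t \<partial>lborel)" for c
  proof -
    define k where "k = \<lfloor>c / (2*pi)\<rfloor>"
    define u where "u = c - 2*pi*real_of_int k"
    have "real_of_int k \<le> c / (2*pi)" "c / (2*pi) < real_of_int k + 1" unfolding k_def by linarith+
    then have u: "0 \<le> u" "u \<le> 2*pi" by (auto simp: u_def field_simps)
    have "(\<integral>\<^sup>+t\<in>{c..<c+2*pi}. f t \<partial>lborel) = (\<integral>\<^sup>+t\<in>{u..<u+2*pi}. f t \<partial>lborel)"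
      using shift[of u k "u+2*pi"] by (simp add: u_def algebra_simps)
    also have "\<dots> = (\<integral>\<^sup>+t\<in>{u..<2*pi}. f t \<partial>lborel) + (\<integral>\<^sup>+t\<in>{2*pi..<u+2*pi}. f t \<partial>lborel)"
      by (rule split) (use u in auto)
    also have "(\<integral>\<^sup>+t\<in>{2*pi..<u+2*pi}. f t \<partial>lborel) = (\<integral>\<^sup>+t\<in>{0..<u}. f t \<partial>lborel)"
      using shift[of 0 1 u] by simp
    also have "(\<integral>\<^sup>+t\<in>{u..<2*pi}. f t \<partial>lborel) + (\<integral>\<^sup>+t\<in>{0..<u}. f t \<partial>lborel) = (\<integral>\<^sup>+t\<in>{0..<2*pi}. f t \<partial>lborel)"
      using split[of 0 u "2*pi"] u by (simp add: add.commute)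
    finally show ?thesis .
  qed
  show ?thesis unfolding closed by (simp add: std)
qed

text \<open>The left half plane is the right one turned by \<open>pi\<close>, and the imaginary axis
  is null. The start \<open>a\<close> of the angular window is left free so that a window can begin
  where an arc begins.\<close>

lemma nn_integral_polar:
  fixes \<phi> :: "complex \<Rightarrow> real"
  assumes [measurable]: "\<phi> \<in> borel_measurable borel" and p0: "\<And>z. \<phi> z \<ge> 0"
  shows "(\<integral>\<^sup>+z. ennreal (\<phi> z) \<partial>lborel)
     = (\<integral>\<^sup>+r\<in>{0<..}. (\<integral>\<^sup>+t\<in>{a..a+2*pi}. ennreal (r * \<phi> (of_real r * cis t)) \<partial>lborel) \<partial>lborel)"
proof -
  let ?F = "\<lambda>x. (\<integral>\<^sup>+y. ennreal (\<phi> (Complex x y)) \<partial>lborel)"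
  let ?P = "\<lambda>r t. ennreal (r * \<phi> (of_real r * cis t))"
  have neg: "(\<integral>\<^sup>+x\<in>{..<0}. ?F x \<partial>lborel)
     = (\<integral>\<^sup>+r\<in>{0<..}. (\<integral>\<^sup>+t\<in>{pi/2<..<3*pi/2}. ?P r t \<partial>lborel) \<partial>lborel)"
  proof -
    have "(\<integral>\<^sup>+x\<in>{..<0}. ?F x \<partial>lborel) = ennreal \<bar>-1\<bar> * (\<integral>\<^sup>+x. ?F (0 + -1 * x) * indicator {..<0} (0 + -1 * x) \<partial>lborel)"
      by (rule nn_integral_real_affine) auto
    also have "\<dots> = (\<integral>\<^sup>+x\<in>{0<..}. (\<integral>\<^sup>+y. ennreal (\<phi> (- Complex x y)) \<partial>lborel) \<partial>lborel)"
    proof -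
      have "?F (-x) = (\<integral>\<^sup>+y. ennreal (\<phi> (- Complex x y)) \<partial>lborel)" for x
      proof -
        have "?F (-x) = ennreal \<bar>-1\<bar> * (\<integral>\<^sup>+y. ennreal (\<phi> (Complex (-x) (0 + -1 * y))) \<partial>lborel)"
          by (rule nn_integral_real_affine) auto
        moreover have "Complex (-x) (-y) = - Complex x y" for y by (simp add: complex_eq_iff)
        ultimately show ?thesis by simp
      qed
      then show ?thesis by (auto intro!: nn_integral_cong simp: indicator_def)
    qed
    also have "\<dots> = (\<integral>\<^sup>+r\<in>{0<..}. (\<integral>\<^sup>+t\<in>{-pi/2<..<pi/2}. ennreal (r * \<phi> (- (of_real r * cis t))) \<partial>lborel) \<partial>lborel)"
      by (rule nn_integral_right_half_plane_polar) (use p0 in auto)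
    also have "\<dots> = (\<integral>\<^sup>+r\<in>{0<..}. (\<integral>\<^sup>+t\<in>{pi/2<..<3*pi/2}. ?P r t \<partial>lborel) \<partial>lborel)"
    proof -
      have "(\<integral>\<^sup>+t\<in>{pi/2<..<3*pi/2}. ?P r t \<partial>lborel) = (\<integral>\<^sup>+t\<in>{-pi/2<..<pi/2}. ennreal (r * \<phi> (- (of_real r * cis t))) \<partial>lborel)" for r
      proof -
        have "(\<integral>\<^sup>+t\<in>{pi/2<..<3*pi/2}. ?P r t \<partial>lborel)
          = ennreal \<bar>1\<bar> * (\<integral>\<^sup>+t. ?P r (pi + 1 * t) * indicator {pi/2<..<3*pi/2} (pi + 1 * t) \<partial>lborel)"
          by (rule nn_integral_real_affine) auto
        moreover have "cis (pi + t) = - cis t" for t by (simp add: complex_eq_iff)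
        moreover have "indicator {pi/2<..<3*pi/2} (pi + t) = (indicator {-pi/2<..<pi/2} t :: ennreal)" for t
          by (auto simp: indicator_def)
        ultimately show ?thesis by simp
      qed
      then show ?thesis by simp
    qed
    finally show ?thesis .
  qed
  have "(\<integral>\<^sup>+z. ennreal (\<phi> z) \<partial>lborel) = (\<integral>\<^sup>+x. ?F x \<partial>lborel)"
    by (rule nn_integral_lborel_complex) auto
  also have "\<dots> = (\<integral>\<^sup>+x. ?F x * indicator {0<..} x + ?F x * indicator {..<0} x \<partial>lborel)"
    by (intro nn_integral_cong_AE, use AE_lborel_singleton[of 0] in eventually_elim) (auto simp: indicator_def)
  also have "\<dots> = (\<integral>\<^sup>+x\<in>{0<..}. ?F x \<partial>lborel) + (\<integral>\<^sup>+x\<in>{..<0}. ?F x \<partial>lborel)"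
    by (rule nn_integral_add) auto
  also have "\<dots> = (\<integral>\<^sup>+r\<in>{0<..}. (\<integral>\<^sup>+t\<in>{-pi/2<..<pi/2}. ?P r t \<partial>lborel) \<partial>lborel)
     + (\<integral>\<^sup>+r\<in>{0<..}. (\<integral>\<^sup>+t\<in>{pi/2<..<3*pi/2}. ?P r t \<partial>lborel) \<partial>lborel)"
    unfolding neg by (subst nn_integral_right_half_plane_polar) (use p0 in auto)
  also have "\<dots> = (\<integral>\<^sup>+r. ((\<integral>\<^sup>+t\<in>{-pi/2<..<pi/2}. ?P r t \<partial>lborel) + (\<integral>\<^sup>+t\<in>{pi/2<..<3*pi/2}. ?P r t \<partial>lborel)) * indicator {0<..} r \<partial>lborel)"
    by (subst nn_integral_add[symmetric]) (auto intro!: nn_integral_cong simp: indicator_def)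
  also have "\<dots> = (\<integral>\<^sup>+r\<in>{0<..}. (\<integral>\<^sup>+t\<in>{a..a+2*pi}. ?P r t \<partial>lborel) \<partial>lborel)"
  proof -
    have "(\<integral>\<^sup>+t\<in>{-pi/2<..<pi/2}. ?P r t \<partial>lborel) + (\<integral>\<^sup>+t\<in>{pi/2<..<3*pi/2}. ?P r t \<partial>lborel)
       = (\<integral>\<^sup>+t\<in>{a..a+2*pi}. ?P r t \<partial>lborel)" for r
    proof -
      have "(\<integral>\<^sup>+t\<in>{-pi/2<..<pi/2}. ?P r t \<partial>lborel) + (\<integral>\<^sup>+t\<in>{pi/2<..<3*pi/2}. ?P r t \<partial>lborel)
        = (\<integral>\<^sup>+t. ?P r t * indicator {-pi/2<..<pi/2} t + ?P r t * indicator {pi/2<..<3*pi/2} t \<partial>lborel)"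
        by (rule nn_integral_add[symmetric]) auto
      also have "\<dots> = (\<integral>\<^sup>+t\<in>{-pi/2..-pi/2+2*pi}. ?P r t \<partial>lborel)"
        by (intro nn_integral_cong_AE, use AE_lborel_singleton[of "-pi/2"] AE_lborel_singleton[of "pi/2"] AE_lborel_singleton[of "3*pi/2"] in eventually_elim)
           (auto simp: indicator_def)
      also have "\<dots> = (\<integral>\<^sup>+t\<in>{a..a+2*pi}. ?P r t \<partial>lborel)"
        by (rule nn_integral_periodic_shift) (auto simp: cis_mult[symmetric])
      finally show ?thesis .
    qed
    then show ?thesis by simp
  qed
  finally show ?thesis .
qed

text \<open>\<open>h\<close> is controlled only inside the disc. Cutting it off by the indicator of
  the disc makes it a Borel function on the plane, to which the polar formula applies.\<close>

lemma nn_integral_udisc_polar: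
  fixes h :: "complex \<Rightarrow> real"
  assumes h: "continuous_on udisc h" and h0: "\<And>z. z \<in> udisc \<Longrightarrow> h z \<ge> 0"
    and A[measurable]: "A \<in> sets borel" and sub: "A \<subseteq> udisc"
  shows "(\<integral>\<^sup>+z\<in>A. ennreal (h z) \<partial>lborel)
    = (\<integral>\<^sup>+r\<in>{0<..<1}. (\<integral>\<^sup>+t\<in>{a..a+2*pi}. ennreal (r * h (of_real r * cis t)) * indicator A (of_real r * cis t) \<partial>lborel) \<partial>lborel)"
proof -
  define \<phi> where "\<phi> z = indicator A z * h z" for z
  have phi: "\<phi> = (\<lambda>z. indicator A z *\<^sub>R (indicator udisc z *\<^sub>R h z))"
    using sub by (auto simp: \<phi>_def fun_eq_iff indicator_def)
  have [measurable]: "\<phi> \<in> borel_measurable borel"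
    unfolding phi by (intro borel_measurable_scaleR borel_measurable_indicator borel_measurable_continuous_on_indicator h) auto
  have phi0: "\<phi> z \<ge> 0" for z using sub h0 by (auto simp: \<phi>_def indicator_def)
  have "(\<integral>\<^sup>+z\<in>A. ennreal (h z) \<partial>lborel) = (\<integral>\<^sup>+z. ennreal (\<phi> z) \<partial>lborel)"
    by (intro nn_integral_cong) (auto simp: \<phi>_def indicator_def)
  also have "\<dots> = (\<integral>\<^sup>+r\<in>{0<..}. (\<integral>\<^sup>+t\<in>{a..a+2*pi}. ennreal (r * \<phi> (of_real r * cis t)) \<partial>lborel) \<partial>lborel)"
    by (rule nn_integral_polar) (use phi0 in auto)
  also have "\<dots> = (\<integral>\<^sup>+r\<in>{0<..<1}. (\<integral>\<^sup>+t\<in>{a..a+2*pi}. ennreal (r * h (of_real r * cis t)) * indicator A (of_real r * cis t) \<partial>lborel) \<partial>lborel)"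
  proof (rule nn_integral_cong)
    fix r :: real
    have out: "of_real r * cis t \<notin> A" if "r \<ge> 1" for t
    proof
      assume "of_real r * cis t \<in> A"
      then have "norm (of_real r * cis t) < 1" using sub by auto
      then show False using that by (simp add: norm_mult)
    qed
    have "ennreal (r * \<phi> (of_real r * cis t)) = ennreal (r * h (of_real r * cis t)) * indicator A (of_real r * cis t)" for t
      by (auto simp: \<phi>_def indicator_def)
    then show "(\<integral>\<^sup>+t\<in>{a..a+2*pi}. ennreal (r * \<phi> (of_real r * cis t)) \<partial>lborel) * indicator {0<..} r =
       (\<integral>\<^sup>+t\<in>{a..a+2*pi}. ennreal (r * h (of_real r * cis t)) * indicator A (of_real r * cis t) \<partial>lborel) * indicator {0<..<1} r"
      using out by (cases "r < 1") (auto simp: indicator_def)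
  qed
  finally show ?thesis .
qed

lemma nn_integral_udisc_polar_full:
  fixes h :: "complex \<Rightarrow> real"
  assumes h: "continuous_on udisc h" and h0: "\<And>z. z \<in> udisc \<Longrightarrow> h z \<ge> 0"
  shows "(\<integral>\<^sup>+z\<in>udisc. ennreal (h z) \<partial>lborel)
    = (\<integral>\<^sup>+r\<in>{0<..<1}. (\<integral>\<^sup>+t\<in>{a..a+2*pi}. ennreal (r * h (of_real r * cis t)) \<partial>lborel) \<partial>lborel)"
  unfolding nn_integral_udisc_polar[OF h h0 _ subset_refl, of a, simplified]
  by (intro nn_integral_cong) (auto simp: indicator_def norm_mult intro!: nn_integral_cong)

section \<open>Carleson boxes\<close>

text \<open>The box is open towards the circle, so it is a union of countably many compact images of
  closed rectangles.\<close>

lemma borel_carleson_box: "carleson_box a L \<in> sets borel"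
proof -
  define K where "K n = (\<lambda>(r,t). of_real r * cis t) ` ({1 - L/(2*pi)..1 - 1/(real n + 1)} \<times> {a..a+L})" for n
  have "closed (K n)" for n
    unfolding K_def case_prod_unfold
    by (intro compact_imp_closed compact_continuous_image compact_Times continuous_intros) auto
  moreover have "carleson_box a L = (\<Union>n. K n)"
  proof (intro set_eqI iffI)
    fix z assume "z \<in> carleson_box a L"
    then obtain r t where rt: "z = of_real r * cis t" "a \<le> t" "t \<le> a + L" "1 - L/(2*pi) \<le> r" "r < 1"
      by (auto simp: carleson_box_def)
    obtain n where "1 / (real n + 1) < 1 - r"
      using reals_Archimedean[of "1 - r"] rt by (auto simp: inverse_eq_divide add.commute)
    then have "z \<in> K n" unfolding K_def using rt by (intro image_eqI[of _ _ "(r,t)"]) auto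
    then show "z \<in> (\<Union>n. K n)" by blast
  next
    fix z assume "z \<in> (\<Union>n. K n)"
    then obtain n r t where rt: "z = of_real r * cis t" "a \<le> t" "t \<le> a + L" "1 - L/(2*pi) \<le> r" "r \<le> 1 - 1/(real n + 1)"
      by (auto simp: K_def)
    have "0 < 1/(real n + 1)" by simp
    then have "r < 1" using rt(5) by linarith
    then show "z \<in> carleson_box a L" using rt unfolding carleson_box_def by blast
  qed
  ultimately show ?thesis by auto
qed

lemma carleson_box_subset_udisc:
  assumes "L \<le> 2*pi" shows "carleson_box a L \<subseteq> udisc"
proof
  fix z assume "z \<in> carleson_box a L"
  then obtain r t where rt: "z = of_real r * cis t" "1 - L/(2*pi) \<le> r" "r < 1"
    by (auto simp: carleson_box_def)
  have "L/(2*pi) \<le> 1" using assms by simp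
  then have "r \<ge> 0" using rt by linarith
  then show "z \<in> udisc" using rt by (simp add: norm_mult)
qed

lemma cis_eq_iff_close:
  assumes "cis s = cis t" "\<bar>s - t\<bar> < 2*pi"
  shows "s = t"
proof -
  have "exp (\<i> * of_real s) = exp (\<i> * of_real t)" using assms(1) by (simp add: cis_conv_exp)
  then obtain k where k: "\<i> * of_real s = \<i> * of_real t + (of_int (2 * k) * pi) * \<i>"
    unfolding exp_eq by blast
  from arg_cong[OF this, of Im] have "s = t + 2 * of_int k * pi" by simp
  then have "\<bar>real_of_int k\<bar> < 1" using assms(2) by (simp add: abs_mult)
  then have "k = 0" by linarith
  then show ?thesis using \<open>s = t + 2 * of_int k * pi\<close> by simp
qed

lemma nn_integral_carleson_box_le:
  fixes h :: "complex \<Rightarrow> real"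
  assumes h: "continuous_on udisc h" and h0: "\<And>z. z \<in> udisc \<Longrightarrow> h z \<ge> 0" and L: "0 < L" "L \<le> 2*pi"
  shows "(\<integral>\<^sup>+z\<in>carleson_box a L. ennreal (h z) \<partial>lborel)
   \<le> (\<integral>\<^sup>+r\<in>{0<..<1} \<inter> {1 - L/(2*pi)..}. (\<integral>\<^sup>+t\<in>{a..a+L}. ennreal (r * h (of_real r * cis t)) \<partial>lborel) \<partial>lborel)"
  unfolding nn_integral_udisc_polar[OF h h0 borel_carleson_box carleson_box_subset_udisc[OF L(2)], of a a, simplified]
proof (rule nn_integral_mono)
  fix r :: real
  \<comment> \<open>A point of the box is given by some angle \<open>t'\<close> on the arc. Angles
    in the window \<open>[a, a + 2*pi)\<close> are unique, so \<open>t\<close> itself has to lie on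
    the arc.\<close>
  have *: "1 - L/(2*pi) \<le> r \<and> t \<in> {a..a+L}"
    if r: "0 < r" "r < 1" and t: "t \<in> {a..a+2*pi}" "t \<noteq> a + 2*pi" and box: "of_real r * cis t \<in> carleson_box a L" for t
  proof -
    obtain r' t' where rt: "of_real r * cis t = of_real r' * cis t'" "a \<le> t'" "t' \<le> a + L" "1 - L/(2*pi) \<le> r'" "r' < 1"
      using box by (auto simp: carleson_box_def)
    have "L/(2*pi) \<le> 1" using L by simp
    then have "r' \<ge> 0" using rt by linarith
    then have rr: "r = r'" using arg_cong[OF rt(1), of norm] r by (simp add: norm_mult)
    then have c: "cis t = cis t'" using rt r by simp
    \<comment> \<open>The end point \<open>a + 2*pi\<close> belongs to the arc only for a full
      circle, where it is the same point as the angle \<open>a\<close>.\<close>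
    show ?thesis
    proof (cases "t' = a + 2*pi")
      case True
      then have "cis t = cis a" using c by (simp flip: cis_mult)
      then have "t = a" using t by (intro cis_eq_iff_close) auto
      then show ?thesis using rr rt L by auto
    next
      case False
      then have "t = t'" using c t rt L by (intro cis_eq_iff_close) auto
      then show ?thesis using rr rt by auto
    qed
  qed
  show "(\<integral>\<^sup>+t\<in>{a..a+2*pi}. ennreal (r * h (of_real r * cis t)) * indicator (carleson_box a L) (of_real r * cis t) \<partial>lborel) * indicator {0<..<1} r
     \<le> (\<integral>\<^sup>+t\<in>{a..a+L}. ennreal (r * h (of_real r * cis t)) \<partial>lborel) * indicator ({0<..<1} \<inter> {1 - L/(2*pi)..}) r"
  proof (cases "0 < r \<and> r < 1")
    case True
    have "AE t in lborel. t \<noteq> a + 2*pi" by (rule AE_lborel_singleton)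
    then have "(\<integral>\<^sup>+t\<in>{a..a+2*pi}. ennreal (r * h (of_real r * cis t)) * indicator (carleson_box a L) (of_real r * cis t) \<partial>lborel)
      \<le> (\<integral>\<^sup>+t. ennreal (r * h (of_real r * cis t)) * indicator {a..a+L} t * indicator {1 - L/(2*pi)..} r \<partial>lborel)"
      by (intro nn_integral_mono_AE, elim eventually_mono) (use True * in \<open>fastforce simp: indicator_def\<close>)
    also have "\<dots> = (\<integral>\<^sup>+t\<in>{a..a+L}. ennreal (r * h (of_real r * cis t)) \<partial>lborel) * indicator {1 - L/(2*pi)..} r"
      by (auto simp: indicator_def)
    finally show ?thesis using True by (simp add: indicator_inter_arith)
  qed auto
qed

text \<open>An arc of length \<open>2*pi / m\<close> carries a box of height exactly
  \<open>1 / m\<close>, so \<open>m\<close> consecutive boxes fill the annulus. This turns a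
  condition on boxes into one on annuli.\<close>

lemma carleson_boxes_cover:
  assumes m: "m > 0" and z: "1 - 1 / real m \<le> norm z" "norm z < 1"
  shows "\<exists>j<m. z \<in> carleson_box (2*pi*real j / real m) (2*pi / real m)"
proof -
  define t where "t = Arg2pi z"
  have t: "0 \<le> t" "t < 2*pi" and zt: "z = of_real (norm z) * cis t"
    unfolding t_def using Arg2pi_ge_0[of z] Arg2pi_lt_2pi[of z] Arg2pi_eq[of z] by (auto simp: cis_conv_exp)
  define x where "x = t * real m / (2*pi)"
  define j where "j = nat \<lfloor>x\<rfloor>"
  have x0: "x \<ge> 0" using t by (simp add: x_def)
  have tx: "t = 2*pi * x / real m" using m by (simp add: x_def)
  have "x < real m" using t m by (simp add: x_def divide_less_eq)
  have j1: "real j \<le> x" "x < real j + 1" using x0 unfolding j_def by linarith+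
  have "real j < real m" using j1 \<open>x < real m\<close> by linarith
  then have "j < m" by simp
  moreover have "2*pi*real j / real m \<le> t" unfolding tx using j1 m by (intro divide_right_mono mult_left_mono) auto
  moreover have "t \<le> 2*pi*real j / real m + 2*pi / real m"
  proof -
    have "2*pi*x / real m \<le> 2*pi*(real j + 1) / real m" using j1 m by (intro divide_right_mono mult_left_mono) auto
    then show ?thesis unfolding tx by (simp add: algebra_simps add_divide_distrib)
  qed
  ultimately show ?thesis using z zt m unfolding carleson_box_def
    by (intro exI[of _ j] conjI CollectI exI[of _ "norm z"] exI[of _ t]) auto
qed

section \<open>Lacunary sequences and sparse families of frequencies\<close>

text \<open>Real terms, because the frequencies get multiplied by an arc length and are also
  replaced by their square roots.\<close>

definition lacunary_real :: "real \<Rightarrow> (nat \<Rightarrow> real) \<Rightarrow> bool" where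
  "lacunary_real lam y \<longleftrightarrow> lam > 1 \<and> (\<forall>k. 0 < y k \<and> lam * y k \<le> y (Suc k))"

lemma lacunary_real_mono:
  assumes "lacunary_real lam y" "i \<le> j"
  shows "y i \<le> y j"
proof -
  have "y k \<le> y (Suc k)" for k
    using assms(1) unfolding lacunary_real_def by (smt (verit) mult_less_cancel_right1)
  then show ?thesis using assms(2) lift_Suc_mono_le by blast
qed

lemma lacunary_real_gap:
  assumes "lacunary_real lam y" "i < j"
  shows "lam * y i \<le> y j"
proof -
  have "lam * y i \<le> y (Suc i)" using assms(1) by (simp add: lacunary_real_def)
  also have "\<dots> \<le> y j" using assms by (intro lacunary_real_mono[OF assms(1)]) auto
  finally show ?thesis .
qed

text \<open>The gap is measured against \<open>y j\<close> even if \<open>y i\<close> is the larger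
  one. In that case it is at least \<open>(lam - 1) * y j\<close>, and
  \<open>lam + 1/lam >= 2\<close> gives the same form as in the other case.\<close>

lemma lacunary_real_gap_abs:
  assumes "lacunary_real lam y" "i \<noteq> j"
  shows "\<bar>y i - y j\<bar> \<ge> (1 - 1/lam) * y j"
proof (cases "i < j")
  case True
  have "lam > 1" "lam * y i \<le> y j" using lacunary_real_gap[OF assms(1) True] assms(1)
    by (auto simp: lacunary_real_def)
  then have "y i \<le> y j / lam" by (simp add: field_simps)
  then show ?thesis by (simp add: algebra_simps)
next
  case False
  then have ji: "j < i" using assms by auto
  have lam: "lam > 1" "0 < y j" using assms by (auto simp: lacunary_real_def)
  have "lam * y j \<le> y i" by (rule lacunary_real_gap[OF assms(1) ji])
  then have "(lam - 1) * y j \<le> \<bar>y i - y j\<bar>" by (simp add: algebra_simps)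
  moreover have "1 - 1/lam \<le> lam - 1"
  proof -
    have "(lam - 1) * (lam - 1) \<ge> 0" by simp
    then show ?thesis using lam by (simp add: field_simps)
  qed
  then have "(1 - 1/lam) * y j \<le> (lam - 1) * y j" using lam by (intro mult_right_mono) auto
  ultimately show ?thesis by linarith
qed

text \<open>A geometric series read from its largest term downwards.\<close>

lemma lacunary_real_sum_le:
  assumes lac: "lacunary_real lam y" and "finite J" "\<And>j. j \<in> J \<Longrightarrow> y j \<le> x" "0 \<le> x"
  shows "sum y J \<le> lam / (lam - 1) * x"
proof (cases "J = {}")
  case True
  then show ?thesis using assms by (auto simp: lacunary_real_def)
next
  case False
  have lam: "lam > 1" and pos: "\<And>k. y k > 0" using lac by (auto simp: lacunary_real_def)
  have "sum y {..m} \<le> lam / (lam - 1) * y m" for m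
  proof (induction m)
    case 0 show ?case using lam pos[of 0] by (simp add: field_simps)
  next
    case (Suc m)
    have "sum y {..Suc m} \<le> lam * y m / (lam - 1) + y (Suc m)" using Suc by simp
    also have "\<dots> \<le> y (Suc m) / (lam - 1) + y (Suc m)"
      using lac lam by (intro add_right_mono divide_right_mono) (auto simp: lacunary_real_def)
    also have "\<dots> = lam / (lam - 1) * y (Suc m)" using lam by (simp add: field_simps)
    finally show ?case .
  qed note * = this
  have "sum y J \<le> sum y {..Max J}" using assms False pos by (intro sum_mono2) (auto intro: less_imp_le)
  also have "\<dots> \<le> lam / (lam - 1) * y (Max J)" by (rule *)
  also have "\<dots> \<le> lam / (lam - 1) * x" using assms False lam by (intro mult_left_mono) auto
  finally show ?thesis .
qed

lemma lacunary_real_sum_inverse_le: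
  assumes lac: "lacunary_real lam y" and "finite J" "\<And>j. j \<in> J \<Longrightarrow> x \<le> y j" "0 < x"
  shows "(\<Sum>j\<in>J. 1 / y j) \<le> lam / (lam - 1) / x"
proof (cases "J = {}")
  case True
  then show ?thesis using assms by (auto simp: lacunary_real_def)
next
  case False
  have lam: "lam > 1" and pos: "\<And>k. y k > 0" using lac by (auto simp: lacunary_real_def)
  define m where "m = Min J"
  have m: "m \<in> J" using False assms by (simp add: m_def)
  \<comment> \<open>The subtracted term makes the bound telescope: shrinking it by one step of the
    ratio \<open>lam\<close> pays for the next reciprocal.\<close>
  have *: "(\<Sum>j=m..M. 1 / y j) \<le> lam / (lam - 1) / y m - 1 / (lam - 1) / y M" if "m \<le> M" for M
    using that
  proof (induction M rule: dec_induct)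
    case base
    have "lam / (lam - 1) - 1 / (lam - 1) = 1" using lam by (simp flip: diff_divide_distrib)
    then have "lam / (lam - 1) / y m - 1 / (lam - 1) / y m = 1 / y m" by (metis diff_divide_distrib)
    then show ?case by simp
  next
    case (step M)
    have "lam / y (Suc M) \<le> 1 / y M"
      using lac lam pos[of M] pos[of "Suc M"] by (auto simp: lacunary_real_def field_simps)
    then have "lam / y (Suc M) / (lam - 1) \<le> 1 / y M / (lam - 1)" using lam by (intro divide_right_mono) auto
    moreover have "lam / y (Suc M) / (lam - 1) = 1 / y (Suc M) + 1 / (lam - 1) / y (Suc M)"
      using lam pos[of "Suc M"] by (simp add: field_simps)
    moreover have "1 / y M / (lam - 1) = 1 / (lam - 1) / y M" by simp
    ultimately show ?case using step by (simp del: divide_divide_eq_left)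
  qed
  have "(\<Sum>j\<in>J. 1 / y j) \<le> (\<Sum>j=m..Max J. 1 / y j)"
    using assms False pos by (intro sum_mono2) (auto simp: m_def intro: less_imp_le)
  also have "\<dots> \<le> lam / (lam - 1) / y m - 1 / (lam - 1) / y (Max J)"
    using m assms by (intro *) auto
  also have "\<dots> \<le> lam / (lam - 1) / y m" using lam pos[of "Max J"] by simp
  also have "\<dots> \<le> lam / (lam - 1) / x"
    using lam pos[of m] assms m by (intro divide_left_mono) auto
  finally show ?thesis .
qed

text \<open>Sparseness of a finite family of frequencies, in a form that is stable under adding
  the frequency 0.\<close>

definition sparse_family :: "real \<Rightarrow> 'k set \<Rightarrow> ('k \<Rightarrow> real) \<Rightarrow> bool" where
  "sparse_family C K y \<longleftrightarrow> finite K \<and> C \<ge> 0 \<and> (\<forall>k\<in>K. y k \<ge> 0) \<and> (\<Sum>k\<in>K. 1 / max 1 (y k)) \<le> C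
     \<and> (\<forall>x\<ge>0. (\<Sum>k\<in>{k\<in>K. y k \<le> x}. y k) \<le> C * x)"

text \<open>If \<open>y k\<close> is not comparable with \<open>|x|\<close>, then
  \<open>|x - y k| >= y k / 2\<close> and the term is at most \<open>4 / y k\<close>, which the sum
  of reciprocals controls. The comparable terms are at most 1, hence at most
  \<open>2 * y k / |x|\<close>, and the linear bound on the sum of the \<open>y k\<close> limits how
  many there can be. Each group contributes \<open>4 * C\<close>.\<close>

lemma sparse_family_sum_le:
  assumes "sparse_family C K y"
  shows "(\<Sum>k\<in>K. 1 / (1 + (x - y k)\<^sup>2)) \<le> 8 * C"
proof -
  have fin: "finite K" and C0: "C \<ge> 0" and y0: "\<And>k. k \<in> K \<Longrightarrow> y k \<ge> 0"
    and H1: "(\<Sum>k\<in>K. 1 / max 1 (y k)) \<le> C"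
    and H2: "\<And>x. x \<ge> 0 \<Longrightarrow> (\<Sum>k\<in>{k\<in>K. y k \<le> x}. y k) \<le> C * x"
    using assms by (auto simp: sparse_family_def)
  have pt: "1 / (1 + (x - y k)\<^sup>2) \<le> 4 / max 1 (y k) + (if y k \<le> 2 * \<bar>x\<bar> then 2 * y k / \<bar>x\<bar> else 0)"
    if k: "k \<in> K" for k
  proof -
    let ?y = "y k"
    have y: "?y \<ge> 0" using y0 k by auto
    have nn: "0 \<le> (if y k \<le> 2 * \<bar>x\<bar> then 2 * y k / \<bar>x\<bar> else 0)" using y by auto
    have le1: "1 / (1 + (x - ?y)\<^sup>2) \<le> 1" by (simp add: divide_le_eq_1 add_pos_nonneg)
    show ?thesis
    proof (cases "?y \<le> 1")
      case True then show ?thesis using nn le1 by simp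
    next
      case False
      show ?thesis
      proof (cases "\<bar>x\<bar> < 2 * ?y \<and> ?y \<le> 2 * \<bar>x\<bar>")
        case True
        then have "2 * ?y / \<bar>x\<bar> \<ge> 1" using False by (auto simp: field_simps)
        moreover have "4 / max 1 ?y \<ge> 0" by simp
        ultimately show ?thesis using le1 True by (smt (verit))
      next
        case F2: False
        then have "\<bar>x - ?y\<bar> \<ge> ?y / 2" using False by (auto simp: abs_if split: if_splits)
        then have "(x - ?y)\<^sup>2 \<ge> (?y/2)\<^sup>2" using y by (intro abs_le_square_iff[THEN iffD1]) auto
        also have "(?y/2)\<^sup>2 \<ge> ?y / 4" using False by (simp add: power2_eq_square)
        finally have "1 / (1 + (x - ?y)\<^sup>2) \<le> 1 / (?y / 4)" using False by (intro divide_left_mono) (auto simp: add_pos_nonneg)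
        then show ?thesis using False nn by (simp add: max_def)
      qed
    qed
  qed
  have "(\<Sum>k\<in>K. 1 / (1 + (x - y k)\<^sup>2)) \<le> (\<Sum>k\<in>K. 4 / max 1 (y k) + (if y k \<le> 2 * \<bar>x\<bar> then 2 * y k / \<bar>x\<bar> else 0))"
    by (intro sum_mono pt)
  also have "\<dots> = 4 * (\<Sum>k\<in>K. 1 / max 1 (y k)) + (\<Sum>k\<in>{k\<in>K. y k \<le> 2 * \<bar>x\<bar>}. 2 * y k / \<bar>x\<bar>)"
    using fin by (simp add: sum.distrib sum_distrib_left sum.If_cases Int_def)
  also have "(\<Sum>k\<in>{k\<in>K. y k \<le> 2 * \<bar>x\<bar>}. 2 * y k / \<bar>x\<bar>) = 2 / \<bar>x\<bar> * (\<Sum>k\<in>{k\<in>K. y k \<le> 2 * \<bar>x\<bar>}. y k)"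
    by (simp add: sum_distrib_left)
  also have "\<dots> \<le> 4 * C"
  proof (cases "x = 0")
    case False
    have "2 / \<bar>x\<bar> * (\<Sum>k\<in>{k\<in>K. y k \<le> 2 * \<bar>x\<bar>}. y k) \<le> 2 / \<bar>x\<bar> * (C * (2 * \<bar>x\<bar>))"
      by (intro mult_left_mono H2) auto
    then show ?thesis using False by simp
  qed (use C0 in auto)
  finally show ?thesis using H1 by simp
qed

text \<open>This counts the pairs whose sum is near \<open>x\<close>, the quantity behind a fourth
  moment. The larger entry \<open>y v\<close> decides: unless it is comparable with
  \<open>|x|\<close>, the distance from \<open>x\<close> to the sum is at least
  \<open>y v / 2\<close>, and the term splits into a product of reciprocals. Otherwise
  \<open>v\<close> is frozen and the single sum bound is applied at the point
  \<open>x - y v\<close>.\<close>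

lemma sparse_family_double_sum_le:
  assumes sp: "sparse_family C K y"
  shows "(\<Sum>(u,v)\<in>K\<times>K. 1 / (1 + (x - (y u + y v))\<^sup>2)) \<le> 136 * C\<^sup>2"
proof -
  have fin: "finite K" and C0: "C \<ge> 0" and y0: "\<And>k. k \<in> K \<Longrightarrow> y k \<ge> 0"
    and H1: "(\<Sum>k\<in>K. 1 / max 1 (y k)) \<le> C"
    and H2: "\<And>x. x \<ge> 0 \<Longrightarrow> (\<Sum>k\<in>{k\<in>K. y k \<le> x}. y k) \<le> C * x"
    using sp by (auto simp: sparse_family_def)
  define w where "w s = 1 / (1 + s\<^sup>2)" for s :: real
  have w0: "w s \<ge> 0" for s by (auto simp: w_def)
  have w1: "w s \<le> 1" for s by (simp add: w_def divide_le_eq_1 add_pos_nonneg)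
  have wle: "w s \<le> 4 / b" if "b > 0" "s\<^sup>2 \<ge> b / 4" for s b
  proof -
    have "w s \<le> 1 / (b/4)" unfolding w_def using that by (intro divide_left_mono) (auto simp: add_pos_nonneg)
    then show ?thesis by simp
  qed
  define Y where "Y k = max 1 (y k)" for k
  have Y: "Y k \<ge> 1" "Y k \<ge> y k" for k by (auto simp: Y_def)
  \<comment> \<open>Majorant of the pairs with \<open>y u <= y v\<close>; pairs in the other order
    are covered by \<open>T v u\<close>.\<close>
  define T where "T u v = 4 / (Y u * Y v) + (if y v \<le> 2 * \<bar>x\<bar> then 4 * y v / \<bar>x\<bar> else 0) * w ((x - y v) - y u)" for u v
  have T0: "T u v \<ge> 0" if "v \<in> K" for u v
    unfolding T_def using Y[of u] Y[of v] y0[OF that] w0 by (intro add_nonneg_nonneg mult_nonneg_nonneg divide_nonneg_nonneg) auto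
  have pt: "w (x - (y u + y v)) \<le> T u v" if uv: "u \<in> K" "v \<in> K" "y u \<le> y v" for u v
  proof (cases "y v \<le> 1")
    case True
    then have "Y u = 1" "Y v = 1" using uv by (auto simp: Y_def)
    moreover have "(if y v \<le> 2 * \<bar>x\<bar> then 4 * y v / \<bar>x\<bar> else 0) * w ((x - y v) - y u) \<ge> 0"
      using y0[OF uv(2)] w0 by auto
    ultimately show ?thesis using w1[of "x - (y u + y v)"] unfolding T_def by simp
  next
    case False
    have Yv: "Y v = y v" using False by (auto simp: Y_def)
    have Yu: "Y u \<le> y v" using False uv by (auto simp: Y_def)
    have u0: "y u \<ge> 0" using y0 uv by auto
    have eq: "x - y v - y u = x - (y u + y v)" by simp
    show ?thesis
    proof (cases "y v \<le> 2 * \<bar>x\<bar> \<and> \<bar>x\<bar> < 4 * y v")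
      case True
      then have "4 * y v / \<bar>x\<bar> \<ge> 1" using False by (auto simp: field_simps)
      then have "1 * w (x - y v - y u) \<le> 4 * y v / \<bar>x\<bar> * w (x - y v - y u)" by (intro mult_right_mono w0)
      moreover have "4 / (Y u * Y v) \<ge> 0" using Y[of u] Y[of v] by simp
      ultimately show ?thesis unfolding T_def eq using True by (smt (verit, best))
    next
      case F2: False
      have "\<bar>x - (y u + y v)\<bar> \<ge> y v / 2"
        using F2 u0 uv(3) False by (auto simp: abs_if split: if_splits)
      then have "(x - (y u + y v))\<^sup>2 \<ge> (y v/2)\<^sup>2" using False by (intro abs_le_square_iff[THEN iffD1]) auto
      also have "(y v/2)\<^sup>2 \<ge> Y u * Y v / 4" using Yu Yv False by (simp add: power2_eq_square)
      finally have "w (x - (y u + y v)) \<le> 4 / (Y u * Y v)" using Y[of u] Y[of v] by (intro wle) (auto simp: mult_pos_pos)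
      moreover have "(if y v \<le> 2 * \<bar>x\<bar> then 4 * y v / \<bar>x\<bar> else 0) * w ((x - y v) - y u) \<ge> 0"
        using y0[OF uv(2)] w0 by auto
      ultimately show ?thesis unfolding T_def by simp
    qed
  qed
  have pt2: "w (x - (y u + y v)) \<le> T u v + T v u" if "u \<in> K" "v \<in> K" for u v
    using pt[of u v] pt[of v u] T0[of u v] T0[of v u] that by (cases "y u \<le> y v") (auto simp: add.commute)
  \<comment> \<open>The product of reciprocals gives \<open>4 * C^2\<close>. The comparable
    \<open>v\<close> have total weight at most \<open>8 * C\<close>, and each of them carries a
    single sum of at most \<open>8 * C\<close>. Both orders of a pair together give 136.\<close>
  have ST: "(\<Sum>v\<in>K. \<Sum>u\<in>K. T u v) \<le> 68 * C\<^sup>2"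
  proof -
    have "(\<Sum>v\<in>K. \<Sum>u\<in>K. T u v) = (\<Sum>v\<in>K. \<Sum>u\<in>K. 4 / (Y u * Y v)) + (\<Sum>v\<in>K. (if y v \<le> 2 * \<bar>x\<bar> then 4 * y v / \<bar>x\<bar> else 0) * (\<Sum>u\<in>K. w ((x - y v) - y u)))"
      unfolding T_def by (simp add: sum.distrib sum_distrib_left)
    also have "(\<Sum>v\<in>K. \<Sum>u\<in>K. 4 / (Y u * Y v)) = 4 * ((\<Sum>u\<in>K. 1 / Y u) * (\<Sum>v\<in>K. 1 / Y v))"
      by (simp add: sum_product sum_distrib_left mult.commute)
    also have "\<dots> \<le> 4 * (C * C)"
      using H1 C0 Y unfolding Y_def by (intro mult_left_mono mult_mono) (auto intro!: sum_nonneg)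
    also have "(\<Sum>v\<in>K. (if y v \<le> 2 * \<bar>x\<bar> then 4 * y v / \<bar>x\<bar> else 0) * (\<Sum>u\<in>K. w ((x - y v) - y u)))
       \<le> (\<Sum>v\<in>K. (if y v \<le> 2 * \<bar>x\<bar> then 4 * y v / \<bar>x\<bar> else 0) * (8 * C))"
      using sparse_family_sum_le[OF sp] y0 unfolding w_def by (intro sum_mono mult_left_mono) auto
    also have "\<dots> = 8 * C * (4 / \<bar>x\<bar> * (\<Sum>v\<in>{v\<in>K. y v \<le> 2 * \<bar>x\<bar>}. y v))"
      using fin unfolding sum_distrib_right[symmetric] by (simp add: sum.If_cases Int_def sum_distrib_left sum_distrib_right mult_ac)
    also have "\<dots> \<le> 8 * C * (8 * C)"
    proof (intro mult_left_mono)
      show "4 / \<bar>x\<bar> * (\<Sum>v\<in>{v\<in>K. y v \<le> 2 * \<bar>x\<bar>}. y v) \<le> 8 * C"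
      proof (cases "x = 0")
        case False
        have "4 / \<bar>x\<bar> * (\<Sum>v\<in>{v\<in>K. y v \<le> 2 * \<bar>x\<bar>}. y v) \<le> 4 / \<bar>x\<bar> * (C * (2 * \<bar>x\<bar>))"
          by (intro mult_left_mono H2) auto
        then show ?thesis using False by simp
      qed (use C0 in auto)
    qed (use C0 in auto)
    finally show ?thesis by (simp add: power2_eq_square)
  qed
  have "(\<Sum>(u,v)\<in>K\<times>K. w (x - (y u + y v))) \<le> (\<Sum>(u,v)\<in>K\<times>K. T u v + T v u)"
    using pt2 by (intro sum_mono) auto
  also have "\<dots> = (\<Sum>v\<in>K. \<Sum>u\<in>K. T u v) + (\<Sum>v\<in>K. \<Sum>u\<in>K. T u v)"
    by (simp add: sum.cartesian_product[symmetric] sum.distrib sum.swap[of T])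
  finally show ?thesis using ST by (simp add: w_def)
qed

subsection \<open>A parabolic weight\<close>

text \<open>A parabola that is positive inside the arc and zero at its ends. The vanishing at the
  ends improves the decay of the Fourier transform from first to second order.\<close>

definition arc_weight :: "real \<Rightarrow> real \<Rightarrow> real \<Rightarrow> real" where
  "arc_weight a L t = (t - a) * (a + L - t)"

definition arc_weight_ft :: "real \<Rightarrow> real \<Rightarrow> real \<Rightarrow> complex" where
  "arc_weight_ft a L \<xi> = integral {a..a+L} (\<lambda>t. of_real (arc_weight a L t) * cis (\<xi> * t))"

lemma arc_weight_nonneg: "t \<in> {a..a+L} \<Longrightarrow> 0 \<le> arc_weight a L t"
  by (auto simp: arc_weight_def)

lemma arc_weight_le: "arc_weight a L t \<le> L\<^sup>2 / 4"
proof -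
  have "0 \<le> (2 * (t - a) - L)\<^sup>2" by simp
  then show ?thesis by (simp add: arc_weight_def power2_eq_square algebra_simps)
qed

lemma continuous_on_arc_weight [continuous_intros]: "continuous_on S (arc_weight a L)"
  unfolding arc_weight_def by (intro continuous_intros)

lemma has_integral_arc_weight:
  assumes "L \<ge> 0"
  shows "(arc_weight a L has_integral L^3 / 6) {a..a+L}"
proof -
  have "((\<lambda>t. arc_weight a L t) has_integral
      (L * (a+L-a)^2/2 - (a+L-a)^3/3) - (L * (a-a)^2/2 - (a-a)^3/3)) {a..a+L}"
  proof (rule fundamental_theorem_of_calculus)
    fix t assume "t \<in> {a..a+L}"
    show "((\<lambda>t. L * (t-a)^2/2 - (t-a)^3/3) has_vector_derivative arc_weight a L t) (at t within {a..a+L})"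
      unfolding arc_weight_def has_real_derivative_iff_has_vector_derivative[symmetric]
      by (auto intro!: derivative_eq_intros simp: field_simps power2_eq_square power3_eq_cube)
  qed (use assms in auto)
  also have "(L * (a+L-a)^2/2 - (a+L-a)^3/3) - (L * (a-a)^2/2 - (a-a)^3/3) = L^3/6"
    by (simp add: power2_eq_square power3_eq_cube)
  finally show ?thesis by simp
qed

lemma arc_weight_ft_0:
  assumes "L \<ge> 0" shows "arc_weight_ft a L 0 = of_real (L^3 / 6)"
  using has_integral_of_real[OF has_integral_arc_weight[OF assms, of a], where 'b=complex]
  by (simp add: arc_weight_ft_def integral_unique)

text \<open>Three integrations by parts exhaust the quadratic weight; \<open>E\<close> is the
  resulting antiderivative. Its term of order \<open>1 / \<xi>\<close> drops out because the weight
  vanishes at both ends.\<close>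

lemma norm_arc_weight_ft_le_aux:
  assumes L: "L \<ge> 0" and xi: "\<xi> \<noteq> 0"
  shows "norm (arc_weight_ft a L \<xi>) \<le> 2 * L / \<xi>\<^sup>2 + 4 / \<bar>\<xi>\<bar>^3"
proof -
  define k where "k = \<i> * complex_of_real \<xi>"
  have k: "k \<noteq> 0" "norm k = \<bar>\<xi>\<bar>" using xi by (auto simp: k_def norm_mult)
  define E where "E t = cis (\<xi> * t) * (of_real (arc_weight a L t) / k - of_real (L - 2 * (t - a)) / k\<^sup>2 + (-2) / k^3)" for t
  have "((\<lambda>t. of_real (arc_weight a L t) * cis (\<xi> * t)) has_integral E (a+L) - E a) {a..a+L}"
  proof (rule fundamental_theorem_of_calculus)
    fix t assume "t \<in> {a..a+L}"
    have c: "((\<lambda>t. cis (\<xi> * t)) has_vector_derivative (k * cis (\<xi> * t))) (at t within {a..a+L})"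
    proof -
      have "((\<lambda>t. exp (k * of_real t)) has_vector_derivative (k * exp (k * of_real t))) (at t within {a..a+L})"
        by (rule has_vector_derivative_real_field) (auto intro!: derivative_eq_intros)
      then show ?thesis by (simp add: k_def cis_conv_exp mult_ac)
    qed
    have w: "((\<lambda>t. of_real (arc_weight a L t) :: complex) has_vector_derivative of_real (L - 2 * (t - a))) (at t within {a..a+L})"
      unfolding arc_weight_def by (rule has_vector_derivative_of_real)
         (auto intro!: derivative_eq_intros simp: has_real_derivative_iff_has_vector_derivative[symmetric])
    have w': "((\<lambda>t. of_real (L - 2 * (t - a)) :: complex) has_vector_derivative of_real (-2)) (at t within {a..a+L})"
      by (rule has_vector_derivative_of_real)
         (auto intro!: derivative_eq_intros simp: has_real_derivative_iff_has_vector_derivative[symmetric])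
    have "((\<lambda>t. of_real (arc_weight a L t) / k - of_real (L - 2 * (t - a)) / k\<^sup>2 + (-2) / k^3) has_vector_derivative
        (of_real (L - 2 * (t - a)) / k - of_real (-2) / k\<^sup>2 + 0)) (at t within {a..a+L})"
      by (intro has_vector_derivative_add has_vector_derivative_diff has_vector_derivative_divide w w' has_vector_derivative_const)
    from has_vector_derivative_mult[OF c this]
    have "(E has_vector_derivative (cis (\<xi> * t) * (of_real (L - 2 * (t - a)) / k - of_real (-2) / k\<^sup>2 + 0)
        + k * cis (\<xi> * t) * (of_real (arc_weight a L t) / k - of_real (L - 2 * (t - a)) / k\<^sup>2 + (-2) / k^3))) (at t within {a..a+L})"
      unfolding E_def .
    also have "(cis (\<xi> * t) * (of_real (L - 2 * (t - a)) / k - of_real (-2) / k\<^sup>2 + 0)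
        + k * cis (\<xi> * t) * (of_real (arc_weight a L t) / k - of_real (L - 2 * (t - a)) / k\<^sup>2 + (-2) / k^3))
        = of_real (arc_weight a L t) * cis (\<xi> * t)"
      using k by (simp add: field_simps power2_eq_square power3_eq_cube)
    finally show "(E has_vector_derivative of_real (arc_weight a L t) * cis (\<xi> * t)) (at t within {a..a+L})" .
  qed (use L in auto)
  then have "arc_weight_ft a L \<xi> = E (a+L) - E a" by (simp add: arc_weight_ft_def integral_unique)
  also have "norm \<dots> \<le> norm (E (a+L)) + norm (E a)" by (rule norm_triangle_ineq4)
  also have "norm (E a) \<le> L / \<xi>\<^sup>2 + 2 / \<bar>\<xi>\<bar>^3"
  proof -
    have "norm (E a) = norm (- of_real L / k\<^sup>2 + (-2) / k^3)" by (simp add: E_def norm_mult arc_weight_def)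
    also have "\<dots> \<le> norm (- of_real L / k\<^sup>2) + norm ((-2) / k^3)" by (rule norm_triangle_ineq)
    also have "\<dots> = L / \<xi>\<^sup>2 + 2 / \<bar>\<xi>\<bar>^3" using L k by (simp add: norm_divide norm_power)
    finally show ?thesis .
  qed
  also have "norm (E (a+L)) \<le> L / \<xi>\<^sup>2 + 2 / \<bar>\<xi>\<bar>^3"
  proof -
    have "norm (E (a+L)) = norm (of_real L / k\<^sup>2 + (-2) / k^3)" by (simp add: E_def norm_mult arc_weight_def)
    also have "\<dots> \<le> norm (of_real L / k\<^sup>2) + norm ((-2) / k^3)" by (rule norm_triangle_ineq)
    also have "\<dots> = L / \<xi>\<^sup>2 + 2 / \<bar>\<xi>\<bar>^3" using L k by (simp add: norm_divide norm_power)
    finally show ?thesis .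
  qed
  finally show ?thesis by simp
qed

text \<open>Scale-invariant form, with the kernel \<open>1 / (1 + x^2)\<close> for which the sparse
  sums are estimated. For \<open>|x| <= 1\<close> the total mass \<open>L^3 / 6\<close> is used; for
  \<open>|x| > 1\<close> the decay, where \<open>2/x^2 + 4/x^3 <= 6/x^2\<close> and
  \<open>1 + x^2 <= 2 * x^2\<close> produce the constant 12.\<close>

lemma norm_arc_weight_ft_le:
  assumes L: "L > 0"
  shows "norm (arc_weight_ft a L \<xi>) \<le> L^3 * (12 / (1 + (L * \<xi>)\<^sup>2))"
proof (cases "\<bar>L * \<xi>\<bar> \<le> 1")
  case True
  have "norm (arc_weight_ft a L \<xi>) \<le> integral {a..a+L} (arc_weight a L)"
    unfolding arc_weight_ft_def
  proof (rule integral_norm_bound_integral)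
    show "(\<lambda>t. of_real (arc_weight a L t) * cis (\<xi> * t)) integrable_on {a..a+L}"
      by (intro integrable_continuous_interval continuous_intros)
    show "arc_weight a L integrable_on {a..a+L}"
      by (intro integrable_continuous_interval continuous_intros)
  qed (auto simp: norm_mult arc_weight_nonneg)
  also have "\<dots> = L^3/6" using has_integral_arc_weight[of L a] L by (simp add: integral_unique)
  also have "\<dots> \<le> L^3 * (12 / (1 + (L * \<xi>)\<^sup>2))"
  proof -
    have "(L * \<xi>)\<^sup>2 \<le> 1" using True by (simp add: abs_square_le_1)
    then have "1/6 \<le> 12 / (1 + (L * \<xi>)\<^sup>2)" by (simp add: field_simps add_pos_nonneg)
    from mult_left_mono[OF this, of "L^3"] show ?thesis using L by simp
  qed
  finally show ?thesis .
next
  case False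
  define x where "x = \<bar>L * \<xi>\<bar>"
  have x: "x > 1" using False by (simp add: x_def)
  have xi: "\<xi> \<noteq> 0" using False by auto
  have xl: "\<bar>\<xi>\<bar> = x / L" using L by (simp add: x_def abs_mult)
  have xi2: "\<xi>\<^sup>2 = (x/L)\<^sup>2" using xl by (metis power2_abs)
  then have "2 * L / \<xi>\<^sup>2 + 4 / \<bar>\<xi>\<bar>^3 = L^3 * (2 / x\<^sup>2 + 4 / x^3)"
    using L x unfolding xl xi2 by (simp add: field_simps power2_eq_square power3_eq_cube)
  also have "\<dots> \<le> L^3 * (12 / (1 + x\<^sup>2))"
  proof (intro mult_left_mono)
    have "4 / x^3 \<le> 4 / x\<^sup>2" using x by (intro divide_left_mono power_increasing) auto
    moreover have "6 / x\<^sup>2 \<le> 12 / (1 + x\<^sup>2)"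
    proof -
      have "1 \<le> x\<^sup>2" using x by (simp add: power2_eq_square) (metis less_eq_real_def mult_mono' mult_1 zero_le_one)
      then show ?thesis using x by (simp add: field_simps add_pos_pos)
    qed
    ultimately show "2 / x\<^sup>2 + 4 / x^3 \<le> 12 / (1 + x\<^sup>2)" by (simp add: field_simps)
  qed (use L in auto)
  finally have "2 * L / \<xi>\<^sup>2 + 4 / \<bar>\<xi>\<bar>^3 \<le> L^3 * (12 / (1 + (L * \<xi>)\<^sup>2))" by (simp add: x_def)
  then show ?thesis using norm_arc_weight_ft_le_aux[of L \<xi> a] L xi by linarith
qed

subsection \<open>Weighted mean values of exponential sums\<close>

lemma integral_weight_exp_sum_square:
  fixes c :: "'k \<Rightarrow> complex"
  assumes "finite K"
  shows "complex_of_real (integral {a..a+L} (\<lambda>t. arc_weight a L t * (norm (\<Sum>k\<in>K. c k * cis (\<mu> k * t)))\<^sup>2))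
       = (\<Sum>k\<in>K. \<Sum>l\<in>K. c k * cnj (c l) * arc_weight_ft a L (\<mu> k - \<mu> l))"
proof -
  have "((\<lambda>t. complex_of_real (arc_weight a L t * (norm (\<Sum>k\<in>K. c k * cis (\<mu> k * t)))\<^sup>2)) has_integral
     complex_of_real (integral {a..a+L} (\<lambda>t. arc_weight a L t * (norm (\<Sum>k\<in>K. c k * cis (\<mu> k * t)))\<^sup>2))) {a..a+L}"
    by (intro has_integral_of_real integrable_integral integrable_continuous_interval continuous_intros)
  moreover have "((\<lambda>t. \<Sum>k\<in>K. \<Sum>l\<in>K. c k * cnj (c l) * (of_real (arc_weight a L t) * cis ((\<mu> k - \<mu> l) * t)))
      has_integral (\<Sum>k\<in>K. \<Sum>l\<in>K. c k * cnj (c l) * arc_weight_ft a L (\<mu> k - \<mu> l))) {a..a+L}"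
    unfolding arc_weight_ft_def
    by (intro has_integral_sum assms has_integral_mult_right integrable_integral integrable_continuous_interval continuous_intros)
  moreover have "complex_of_real (arc_weight a L t * (norm (\<Sum>k\<in>K. c k * cis (\<mu> k * t)))\<^sup>2)
     = (\<Sum>k\<in>K. \<Sum>l\<in>K. c k * cnj (c l) * (of_real (arc_weight a L t) * cis ((\<mu> k - \<mu> l) * t)))" for t
  proof -
    have "complex_of_real ((norm (\<Sum>k\<in>K. c k * cis (\<mu> k * t)))\<^sup>2)
       = (\<Sum>k\<in>K. c k * cis (\<mu> k * t)) * cnj (\<Sum>l\<in>K. c l * cis (\<mu> l * t))"
      by (metis complex_norm_square of_real_power)
    also have "\<dots> = (\<Sum>k\<in>K. \<Sum>l\<in>K. c k * cnj (c l) * cis ((\<mu> k - \<mu> l) * t))"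
      unfolding cnj_sum sum_product
      by (intro sum.cong refl) (simp add: left_diff_distrib flip: cis_divide cis_cnj, simp add: divide_inverse cis_cnj cis_inverse)
    finally show ?thesis by (simp add: sum_distrib_left mult_ac)
  qed
  ultimately show ?thesis using has_integral_unique by (smt (verit, ccfv_SIG) has_integral_cong)
qed

text \<open>Schur's test: the arithmetic-geometric mean inequality separates the two coefficients,
  and symmetry of the majorant \<open>B\<close> reduces both halves to row sums.\<close>

lemma norm_hermitian_sum_le:
  fixes c :: "'k \<Rightarrow> complex" and A :: "'k \<Rightarrow> 'k \<Rightarrow> complex"
  assumes fin: "finite K" and A: "\<And>k l. k \<in> K \<Longrightarrow> l \<in> K \<Longrightarrow> norm (A k l) \<le> B k l"
    and sym: "\<And>k l. B k l = B l k" and S: "\<And>k. k \<in> K \<Longrightarrow> (\<Sum>l\<in>K. B k l) \<le> S"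
  shows "norm (\<Sum>k\<in>K. \<Sum>l\<in>K. c k * cnj (c l) * A k l) \<le> S * (\<Sum>k\<in>K. (norm (c k))\<^sup>2)"
proof -
  have "norm (\<Sum>k\<in>K. \<Sum>l\<in>K. c k * cnj (c l) * A k l) \<le> (\<Sum>k\<in>K. \<Sum>l\<in>K. norm (c k) * norm (c l) * norm (A k l))"
    by (intro sum_norm_le) (simp add: norm_mult sum_norm_le)
  also have "\<dots> \<le> (\<Sum>k\<in>K. \<Sum>l\<in>K. ((norm (c k))\<^sup>2 / 2 * B k l + (norm (c l))\<^sup>2 / 2 * B l k))"
  proof (intro sum_mono)
    fix k l assume kl: "k \<in> K" "l \<in> K"
    have "norm (c k) * norm (c l) * norm (A k l) \<le> ((norm (c k))\<^sup>2 + (norm (c l))\<^sup>2) / 2 * B k l"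
    proof (intro mult_mono)
      show "norm (c k) * norm (c l) \<le> ((norm (c k))\<^sup>2 + (norm (c l))\<^sup>2) / 2"
        using sum_squares_bound[of "norm (c k)" "norm (c l)"] by simp
    qed (use A[OF kl] in auto)
    then show "norm (c k) * norm (c l) * norm (A k l) \<le> (norm (c k))\<^sup>2 / 2 * B k l + (norm (c l))\<^sup>2 / 2 * B l k"
      by (simp add: sym[of l k] algebra_simps add_divide_distrib)
  qed
  also have "\<dots> = (\<Sum>k\<in>K. (norm (c k))\<^sup>2 / 2 * (\<Sum>l\<in>K. B k l)) + (\<Sum>l\<in>K. (norm (c l))\<^sup>2 / 2 * (\<Sum>k\<in>K. B l k))"
    unfolding sum.distrib sum_distrib_left by (subst (2) sum.swap) simp
  also have "\<dots> \<le> (\<Sum>k\<in>K. (norm (c k))\<^sup>2 / 2 * S) + (\<Sum>l\<in>K. (norm (c l))\<^sup>2 / 2 * S)"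
    by (intro add_mono sum_mono mult_left_mono S) auto
  also have "\<dots> = S * (\<Sum>k\<in>K. (norm (c k))\<^sup>2)"
    by (simp add: sum_distrib_left sum.distrib[symmetric] mult.commute)
  finally show ?thesis .
qed

lemma weighted_exp_sum_square_upper:
  fixes c :: "'k \<Rightarrow> complex"
  assumes fin: "finite K" and L: "L > 0"
    and S: "\<And>k. k \<in> K \<Longrightarrow> (\<Sum>l\<in>K. 1 / (1 + (L * (\<mu> k - \<mu> l))\<^sup>2)) \<le> S"
  shows "integral {a..a+L} (\<lambda>t. arc_weight a L t * (norm (\<Sum>k\<in>K. c k * cis (\<mu> k * t)))\<^sup>2)
      \<le> 12 * S * L^3 * (\<Sum>k\<in>K. (norm (c k))\<^sup>2)"
proof -
  have "norm (\<Sum>k\<in>K. \<Sum>l\<in>K. c k * cnj (c l) * arc_weight_ft a L (\<mu> k - \<mu> l))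
     \<le> (12 * S * L^3) * (\<Sum>k\<in>K. (norm (c k))\<^sup>2)"
  proof (rule norm_hermitian_sum_le[OF fin])
    show "norm (arc_weight_ft a L (\<mu> k - \<mu> l)) \<le> L^3 * (12 / (1 + (L * (\<mu> k - \<mu> l))\<^sup>2))" for k l
      by (rule norm_arc_weight_ft_le[OF L])
    show "L^3 * (12 / (1 + (L * (\<mu> k - \<mu> l))\<^sup>2)) = L^3 * (12 / (1 + (L * (\<mu> l - \<mu> k))\<^sup>2))" for k l
      by (simp add: power_mult_distrib power2_commute)
    fix k assume "k \<in> K"
    have "(\<Sum>l\<in>K. L^3 * (12 / (1 + (L * (\<mu> k - \<mu> l))\<^sup>2))) = 12 * L^3 * (\<Sum>l\<in>K. 1 / (1 + (L * (\<mu> k - \<mu> l))\<^sup>2))"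
      by (simp add: sum_distrib_left mult_ac)
    also have "\<dots> \<le> 12 * L^3 * S" using L S[OF \<open>k \<in> K\<close>] by (intro mult_left_mono) auto
    finally show "(\<Sum>l\<in>K. L^3 * (12 / (1 + (L * (\<mu> k - \<mu> l))\<^sup>2))) \<le> 12 * S * L^3" by (simp add: mult_ac)
  qed
  then show ?thesis
    unfolding integral_weight_exp_sum_square[OF fin, of a L c \<mu>, symmetric] by simp
qed

text \<open>The diagonal contributes \<open>L^3 / 6\<close> per coefficient. The bound 1/144 is
  chosen so that the rows off the diagonal sum to at most \<open>12 * L^3 / 144 = L^3 / 12\<close>,
  half of that.\<close>

lemma weighted_exp_sum_square_lower:
  fixes c :: "'k \<Rightarrow> complex"
  assumes fin: "finite K" and L: "L > 0"
    and S: "\<And>k. k \<in> K \<Longrightarrow> (\<Sum>l\<in>K - {k}. 1 / (1 + (L * (\<mu> k - \<mu> l))\<^sup>2)) \<le> 1/144"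
  shows "L^3 / 12 * (\<Sum>k\<in>K. (norm (c k))\<^sup>2)
     \<le> integral {a..a+L} (\<lambda>t. arc_weight a L t * (norm (\<Sum>k\<in>K. c k * cis (\<mu> k * t)))\<^sup>2)"
proof -
  define B where "B k l = (if k = l then 0 else L^3 * (12 / (1 + (L * (\<mu> k - \<mu> l))\<^sup>2)))" for k l
  define A where "A k l = (if k = l then 0 else arc_weight_ft a L (\<mu> k - \<mu> l))" for k l
  define D where "D = (\<Sum>k\<in>K. (norm (c k))\<^sup>2)"
  let ?I = "integral {a..a+L} (\<lambda>t. arc_weight a L t * (norm (\<Sum>k\<in>K. c k * cis (\<mu> k * t)))\<^sup>2)"
  have "norm (\<Sum>k\<in>K. \<Sum>l\<in>K. c k * cnj (c l) * A k l) \<le> (L^3/12) * D"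
    unfolding D_def
  proof (rule norm_hermitian_sum_le[OF fin, where B=B])
    show "norm (A k l) \<le> B k l" for k l
      using norm_arc_weight_ft_le[OF L] by (auto simp: A_def B_def)
    show "B k l = B l k" for k l by (simp add: B_def power_mult_distrib power2_commute)
    fix k assume k: "k \<in> K"
    have "(\<Sum>l\<in>K. B k l) = (\<Sum>l\<in>K-{k}. B k l)" using fin k by (subst sum.remove[of _ k]) (auto simp: B_def)
    also have "\<dots> = 12 * L^3 * (\<Sum>l\<in>K-{k}. 1 / (1 + (L * (\<mu> k - \<mu> l))\<^sup>2))"
      unfolding sum_distrib_left by (intro sum.cong refl) (auto simp: B_def)
    also have "\<dots> \<le> 12 * L^3 * (1/144)" using L S[OF k] by (intro mult_left_mono) auto
    finally show "(\<Sum>l\<in>K. B k l) \<le> L^3/12" by simp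
  qed
  moreover have "complex_of_real ?I = of_real (L^3/6 * D) + (\<Sum>k\<in>K. \<Sum>l\<in>K. c k * cnj (c l) * A k l)"
  proof -
    have "c k * cnj (c l) * arc_weight_ft a L (\<mu> k - \<mu> l) = (if k = l then of_real (L^3/6 * (norm (c k))\<^sup>2) else 0) + c k * cnj (c l) * A k l" for k l
      using arc_weight_ft_0[of L a] L by (auto simp: A_def complex_norm_square[symmetric] mult_ac)
    then have "complex_of_real ?I = (\<Sum>k\<in>K. \<Sum>l\<in>K. (if k = l then of_real (L^3/6 * (norm (c k))\<^sup>2) else 0)) + (\<Sum>k\<in>K. \<Sum>l\<in>K. c k * cnj (c l) * A k l)"
      unfolding integral_weight_exp_sum_square[OF fin, of a L c \<mu>] by (simp add: sum.distrib)
    then show ?thesis using fin by (simp add: D_def sum_distrib_left)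
  qed
  ultimately have "norm (complex_of_real (?I - L^3/6 * D)) \<le> L^3/12 * D" by simp
  then have "\<bar>?I - L^3/6 * D\<bar> \<le> L^3/12 * D" by (simp only: norm_of_real)
  then show ?thesis unfolding D_def[symmetric] by (simp only: abs_le_iff) linarith
qed

text \<open>The square of the sum is an exponential sum over pairs with frequencies
  \<open>\<mu> k + \<mu> l\<close>, and its coefficient norm factors. Coinciding frequencies such as
  those of \<open>(k,l)\<close> and \<open>(l,k)\<close> are allowed, since the upper bound asks
  only for row sums. The constant is \<open>12 * 136\<close>.\<close>

lemma weighted_exp_sum_fourth_upper:
  fixes c :: "'k \<Rightarrow> complex"
  assumes L: "L > 0" and sp: "sparse_family C K (\<lambda>k. L * \<mu> k)"
  shows "integral {a..a+L} (\<lambda>t. arc_weight a L t * (norm (\<Sum>k\<in>K. c k * cis (\<mu> k * t)))^4)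
      \<le> 1632 * C\<^sup>2 * L^3 * (\<Sum>k\<in>K. (norm (c k))\<^sup>2)\<^sup>2"
proof -
  have fin: "finite K" using sp by (simp add: sparse_family_def)
  define d where "d = (\<lambda>(k,l). c k * c l)"
  define \<nu> where "\<nu> = (\<lambda>(k,l). \<mu> k + \<mu> l)"
  have eq: "(norm (\<Sum>k\<in>K. c k * cis (\<mu> k * t)))^4 = (norm (\<Sum>p\<in>K\<times>K. d p * cis (\<nu> p * t)))\<^sup>2" for t
  proof -
    have "(\<Sum>k\<in>K. c k * cis (\<mu> k * t))\<^sup>2 = (\<Sum>p\<in>K\<times>K. d p * cis (\<nu> p * t))"
      unfolding power2_eq_square sum_product sum.cartesian_product d_def \<nu>_def
      by (intro sum.cong) (auto simp: cis_mult algebra_simps)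
    then have "(norm ((\<Sum>k\<in>K. c k * cis (\<mu> k * t))\<^sup>2))\<^sup>2 = (norm (\<Sum>p\<in>K\<times>K. d p * cis (\<nu> p * t)))\<^sup>2" by simp
    then show ?thesis by (simp add: norm_power)
  qed
  have "integral {a..a+L} (\<lambda>t. arc_weight a L t * (norm (\<Sum>p\<in>K\<times>K. d p * cis (\<nu> p * t)))\<^sup>2)
      \<le> 12 * (136 * C\<^sup>2) * L^3 * (\<Sum>p\<in>K\<times>K. (norm (d p))\<^sup>2)"
  proof (rule weighted_exp_sum_square_upper[OF _ L])
    fix p
    have "(\<Sum>q\<in>K\<times>K. 1 / (1 + (L * (\<nu> p - \<nu> q))\<^sup>2)) = (\<Sum>(u,v)\<in>K\<times>K. 1 / (1 + (L * \<nu> p - (L * \<mu> u + L * \<mu> v))\<^sup>2))"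
      by (intro sum.cong) (auto simp: \<nu>_def algebra_simps)
    also have "\<dots> \<le> 136 * C\<^sup>2" by (rule sparse_family_double_sum_le[OF sp])
    finally show "(\<Sum>q\<in>K\<times>K. 1 / (1 + (L * (\<nu> p - \<nu> q))\<^sup>2)) \<le> 136 * C\<^sup>2" .
  qed (use fin in auto)
  also have "(\<Sum>p\<in>K\<times>K. (norm (d p))\<^sup>2) = (\<Sum>k\<in>K. (norm (c k))\<^sup>2)\<^sup>2"
    unfolding power2_eq_square[of "sum _ _"] sum_product sum.cartesian_product d_def
    by (intro sum.cong) (auto simp: norm_mult power_mult_distrib)
  finally show ?thesis by (simp add: eq)
qed

text \<open>Interpolation between exponents by a cutoff at the level \<open>s\<close>: values below
  it are charged to the power \<open>q\<close>, values above it to the fourth power.\<close>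

lemma square_le_powr_plus_fourth:
  fixes x s q :: real
  assumes "x \<ge> 0" "s > 0" "q \<le> 2"
  shows "x\<^sup>2 \<le> s powr (2 - q) * x powr q + x^4 / s\<^sup>2"
proof (cases "x \<le> s")
  case True
  have "x\<^sup>2 \<le> s powr (2 - q) * x powr q"
  proof (cases "x = 0")
    case False
    then have "x\<^sup>2 = x powr (2 - q) * x powr q" using assms by (simp add: powr_add[symmetric])
    also have "\<dots> \<le> s powr (2 - q) * x powr q" using True assms by (intro mult_right_mono powr_mono2) auto
    finally show ?thesis .
  qed simp
  then show ?thesis using assms by (smt (verit) divide_nonneg_nonneg zero_le_power)
next
  case False
  have "x\<^sup>2 * s\<^sup>2 \<le> x\<^sup>2 * x\<^sup>2" using False assms by (intro mult_left_mono power_mono) auto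
  then have "x\<^sup>2 \<le> x^4 / s\<^sup>2" using assms by (simp add: field_simps)
  moreover have "s powr (2 - q) * x powr q \<ge> 0" by simp
  ultimately show ?thesis by linarith
qed

text \<open>A bounded ratio of the fourth moment to the square of the second keeps the sum from
  concentrating on a small set, so that a mean of low order is already as large as the second moment
  predicts.\<close>

lemma weighted_exp_sum_powr_lower:
  fixes c :: "'k \<Rightarrow> complex"
  assumes L: "L > 0" and q: "0 < q" "q \<le> 1" and C: "C > 0" and sp: "sparse_family C K (\<lambda>k. L * \<mu> k)"
    and S: "\<And>k. k \<in> K \<Longrightarrow> (\<Sum>l\<in>K - {k}. 1 / (1 + (L * (\<mu> k - \<mu> l))\<^sup>2)) \<le> 1/144"
  shows "L^3 / (24 * (39168 * C\<^sup>2) powr (1 - q/2)) * (\<Sum>k\<in>K. (norm (c k))\<^sup>2) powr (q/2)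
     \<le> integral {a..a+L} (\<lambda>t. arc_weight a L t * norm (\<Sum>k\<in>K. c k * cis (\<mu> k * t)) powr q)"
proof -
  have fin: "finite K" using sp by (simp add: sparse_family_def)
  define h where "h t = (\<Sum>k\<in>K. c k * cis (\<mu> k * t))" for t
  define A where "A = (\<Sum>k\<in>K. (norm (c k))\<^sup>2)"
  have hc: "continuous_on T h" for T unfolding h_def by (intro continuous_intros)
  have hq: "continuous_on T (\<lambda>t. norm (h t) powr q)" for T
    using q by (intro continuous_on_powr' continuous_intros hc) auto
  let ?J = "integral {a..a+L} (\<lambda>t. arc_weight a L t * norm (h t) powr q)"
  have J0: "?J \<ge> 0" by (intro integral_nonneg integrable_continuous_interval continuous_intros hq) (auto intro!: mult_nonneg_nonneg arc_weight_nonneg)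
  have A0: "A \<ge> 0" by (auto simp: A_def intro: sum_nonneg)
  show ?thesis
  proof (cases "A = 0")
    case True then show ?thesis using J0 by (simp add: A_def[symmetric] h_def[symmetric])
  next
    case False
    \<comment> \<open>\<open>39168 = 24 * 1632\<close>: at this level the fourth moment term equals
      \<open>L^3 / 24 * A\<close>, half of the lower bound for the square mean.\<close>
    define s where "s = sqrt (39168 * C\<^sup>2 * A)"
    have s2: "s\<^sup>2 = 39168 * C\<^sup>2 * A" using A0 by (simp add: s_def)
    have s: "s > 0" using C A0 False by (simp add: s_def)
    have "L^3 / 12 * A \<le> integral {a..a+L} (\<lambda>t. arc_weight a L t * (norm (h t))\<^sup>2)"
      unfolding A_def h_def by (rule weighted_exp_sum_square_lower[OF fin L S])
    also have "\<dots> \<le> integral {a..a+L} (\<lambda>t. s powr (2-q) * (arc_weight a L t * norm (h t) powr q) + (1 / s\<^sup>2) * (arc_weight a L t * norm (h t)^4))"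
    proof (rule integral_le)
      fix t assume t: "t \<in> {a..a+L}"
      have "arc_weight a L t * (norm (h t))\<^sup>2 \<le> arc_weight a L t * (s powr (2 - q) * norm (h t) powr q + norm (h t)^4 / s\<^sup>2)"
        using s q t by (intro mult_left_mono square_le_powr_plus_fourth arc_weight_nonneg) auto
      then show "arc_weight a L t * (norm (h t))\<^sup>2 \<le> s powr (2-q) * (arc_weight a L t * norm (h t) powr q) + (1 / s\<^sup>2) * (arc_weight a L t * norm (h t)^4)"
        by (simp add: algebra_simps)
    qed (use s in \<open>auto intro!: integrable_continuous_interval continuous_intros hc hq\<close>)
    also have "\<dots> = s powr (2-q) * ?J + (1 / s\<^sup>2) * integral {a..a+L} (\<lambda>t. arc_weight a L t * norm (h t)^4)"
      using s by (subst integral_add) (auto intro!: integrable_continuous_interval continuous_intros hc hq)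
    also have "\<dots> \<le> s powr (2-q) * ?J + (1 / s\<^sup>2) * (1632 * C\<^sup>2 * L^3 * A\<^sup>2)"
      unfolding A_def h_def by (intro add_left_mono mult_left_mono weighted_exp_sum_fourth_upper[OF L sp]) auto
    also have "(1 / s\<^sup>2) * (1632 * C\<^sup>2 * L^3 * A\<^sup>2) = L^3/24 * A"
      unfolding s2 using C False by (simp add: field_simps power2_eq_square)
    finally have *: "L^3/24 * A \<le> s powr (2-q) * ?J" by (simp add: field_simps)
    have "s powr (2-q) = (39168 * C\<^sup>2 * A) powr (1 - q/2)"
    proof -
      have "s powr (2-q) = (s powr 2) powr (1 - q/2)" by (simp add: powr_powr algebra_simps)
      then show ?thesis using s s2 by simp
    qed
    also have "\<dots> = (39168 * C\<^sup>2) powr (1 - q/2) * A powr (1 - q/2)" by (rule powr_mult)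
    finally have sp': "s powr (2-q) = (39168 * C\<^sup>2) powr (1 - q/2) * A powr (1 - q/2)" .
    have AA: "A = A powr (1 - q/2) * A powr (q/2)" using A0 False by (simp add: powr_add[symmetric])
    define P where "P = (39168 * C\<^sup>2) powr (1 - q/2)"
    have P: "P > 0" using C by (simp add: P_def)
    have Ap: "A powr (1 - q/2) > 0" using False by simp
    have "A powr (1 - q/2) * (L^3/24 * A powr (q/2)) \<le> A powr (1 - q/2) * (P * ?J)"
    proof -
      have "L^3/24 * A = A powr (1 - q/2) * (L^3/24 * A powr (q/2))"
        by (subst AA) (simp only: mult_ac)
      then show ?thesis using * unfolding sp' P_def[symmetric] by (simp only: mult_ac)
    qed
    then have "L^3/24 * A powr (q/2) \<le> P * ?J" using Ap by (subst (asm) mult_le_cancel_left_pos)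
    then show ?thesis using P unfolding A_def[symmetric] h_def[symmetric] P_def[symmetric] by (simp add: field_simps)
  qed
qed

subsection \<open>Lacunary exponential sums on an arc\<close>

lemma lacunary_real_scale:
  "lacunary_real lam y \<Longrightarrow> 0 < L \<Longrightarrow> lacunary_real lam (\<lambda>k. L * y k)"
  by (auto simp: lacunary_real_def mult.left_commute)

text \<open>Bounds the sum of the terms, and of the reciprocals, of a lacunary sequence against the
  extreme one. Its inverse is the relative gap \<open>1 - 1/lam\<close>.\<close>

definition lac_const :: "real \<Rightarrow> real" where
  "lac_const lam = lam / (lam - 1)"

text \<open>Chosen so that its square is at least \<open>144 * (1 + C^3)\<close> with
  \<open>C = lac_const lam\<close>, which is what the row sums off the diagonal require.\<close>

definition lac_threshold :: "real \<Rightarrow> real" where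
  "lac_threshold lam = 12 * (1 + lac_const lam ^ 3)"

lemma lac_const_pos: "lam > 1 \<Longrightarrow> lac_const lam > 0" by (simp add: lac_const_def)

lemma lac_threshold_ge: "lam > 1 \<Longrightarrow> lac_threshold lam \<ge> 12"
  using lac_const_pos[of lam] by (simp add: lac_threshold_def)

lemma sparse_family_lacunary:
  assumes lac: "lacunary_real lam y" and J: "finite J" "\<And>j. j \<in> J \<Longrightarrow> 1 \<le> y j"
  shows "sparse_family (lac_const lam) J y"
  unfolding sparse_family_def
proof (intro conjI allI impI ballI)
  have lam: "lam > 1" "\<And>k. y k > 0" using lac by (auto simp: lacunary_real_def)
  show "finite J" by fact
  show "0 \<le> lac_const lam" using lam by (simp add: lac_const_def)
  show "0 \<le> y k" for k using lam(2)[of k] by simp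
  have "(\<Sum>k\<in>J. 1 / max 1 (y k)) = (\<Sum>k\<in>J. 1 / y k)" using J by (intro sum.cong) (auto simp: max_def)
  also have "\<dots> \<le> lam / (lam - 1) / 1" using lac J by (intro lacunary_real_sum_inverse_le) auto
  finally show "(\<Sum>k\<in>J. 1 / max 1 (y k)) \<le> lac_const lam" by (simp add: lac_const_def)
  show "sum y {k \<in> J. y k \<le> x} \<le> lac_const lam * x" if "0 \<le> x" for x
    unfolding lac_const_def using lac J that by (intro lacunary_real_sum_le) auto
qed

text \<open>\<open>None\<close> stands for the frequency 0, that is, for an added constant. It costs
  1 in the sum of reciprocals and nothing in the linear sum.\<close>

lemma sparse_family_lacunary_zero:
  assumes lac: "lacunary_real lam y" and J: "finite J" "\<And>j. j \<in> J \<Longrightarrow> 1 \<le> y j"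
  shows "sparse_family (lac_const lam + 1) (insert None (Some ` J)) (case_option 0 y)"
proof -
  have sp: "sparse_family (lac_const lam) J y" by (rule sparse_family_lacunary[OF assms])
  have "{k \<in> insert None (Some ` J). case_option 0 y k \<le> x} = insert None (Some ` {k\<in>J. y k \<le> x})" if "x \<ge> 0" for x
    using that by auto
  then have "sum (case_option 0 y) {k \<in> insert None (Some ` J). case_option 0 y k \<le> x} \<le> (lac_const lam + 1) * x" if "x \<ge> 0" for x
    using sp that J by (simp add: sum.reindex sparse_family_def algebra_simps)
      (metis add_increasing2 add.commute)
  moreover have "(\<Sum>k\<in>insert None (Some ` J). 1 / max 1 (case_option 0 y k)) = 1 + (\<Sum>k\<in>J. 1 / max 1 (y k))"
    using J by (simp add: sum.reindex)
  ultimately show ?thesis using sp J unfolding sparse_family_def by auto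
qed

text \<open>With \<open>C = lac_const lam\<close> and \<open>M\<close> the threshold, the gap to
  \<open>y j\<close> is at least \<open>y j / C\<close>, and one factor of its square is replaced by
  \<open>M\<close>. Summing the reciprocals gives \<open>C^3 / M^2\<close>; the frequency 0 adds
  \<open>1 / M^2\<close>.\<close>

lemma lacunary_gap_sum_le:
  assumes lac: "lacunary_real lam y" and J: "finite J" "\<And>j. j \<in> J \<Longrightarrow> lac_threshold lam \<le> y j"
    and k: "k \<in> insert None (Some ` J)"
  shows "(\<Sum>l\<in>insert None (Some ` J) - {k}. 1 / (1 + (case_option 0 y k - case_option 0 y l)\<^sup>2)) \<le> 1/144"
proof -
  define C M where "C = lac_const lam" and "M = lac_threshold lam"
  have lam: "lam > 1" "\<And>k. y k > 0" using lac by (auto simp: lacunary_real_def)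
  have C: "C > 0" "1 - 1/lam = 1 / C" using lam by (auto simp: C_def lac_const_def field_simps)
  have M: "M \<ge> 12" using lac_threshold_ge[OF lam(1)] by (simp add: M_def)
  have M2: "144 * (1 + C^3) \<le> M\<^sup>2"
  proof -
    have "1 * (1 + C^3) \<le> (1 + C^3) * (1 + C^3)" using C by (intro mult_right_mono) auto
    then show ?thesis by (simp add: M_def lac_threshold_def C_def power2_eq_square algebra_simps)
  qed
  have tbd: "1 / (1 + (case_option 0 y k - y j)\<^sup>2) \<le> C\<^sup>2 / M * (1 / y j)" if j: "j \<in> J" "k \<noteq> Some j" for j
  proof -
    have "\<bar>case_option 0 y k - y j\<bar> \<ge> (1/C) * y j"
    proof (cases k)
      case None
      have "1/C \<le> 1" using C(2) lam by (simp add: field_simps flip: C(2))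
      then have "(1/C) * y j \<le> 1 * y j" using lam(2)[of j] by (intro mult_right_mono) auto
      then show ?thesis using None lam(2)[of j] by simp
    next
      case (Some i) then show ?thesis using lacunary_real_gap_abs[OF lac, of i j] j C by auto
    qed
    then have "((1/C) * y j)\<^sup>2 \<le> (case_option 0 y k - y j)\<^sup>2"
      using C lam(2)[of j] by (intro abs_le_square_iff[THEN iffD1]) auto
    moreover have "y j * M / C\<^sup>2 \<le> ((1/C) * y j)\<^sup>2"
    proof -
      have "y j * M \<le> y j * y j" using J(2)[OF j(1)] lam(2)[of j] by (intro mult_left_mono) (auto simp: M_def)
      then show ?thesis using C by (simp add: field_simps power2_eq_square)
    qed
    ultimately have "y j * M / C\<^sup>2 \<le> 1 + (case_option 0 y k - y j)\<^sup>2" by linarith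
    then have "1 / (1 + (case_option 0 y k - y j)\<^sup>2) \<le> 1 / (y j * M / C\<^sup>2)"
      using lam(2)[of j] M C by (intro divide_left_mono mult_pos_pos divide_pos_pos) (auto simp: add_pos_nonneg)
    then show ?thesis by (simp add: mult.commute)
  qed
  have S1: "(\<Sum>j\<in>{j\<in>J. k \<noteq> Some j}. 1 / (1 + (case_option 0 y k - y j)\<^sup>2)) \<le> C^3 / M\<^sup>2"
  proof -
    have "(\<Sum>j\<in>{j\<in>J. k \<noteq> Some j}. 1 / (1 + (case_option 0 y k - y j)\<^sup>2)) \<le> (\<Sum>j\<in>{j\<in>J. k \<noteq> Some j}. C\<^sup>2 / M * (1 / y j))"
      by (intro sum_mono tbd) auto
    also have "\<dots> = C\<^sup>2 / M * (\<Sum>j\<in>{j\<in>J. k \<noteq> Some j}. 1 / y j)" by (simp only: sum_distrib_left)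
    also have "\<dots> \<le> C\<^sup>2 / M * (C / M)"
      unfolding C_def[unfolded lac_const_def, symmetric]
      using M J lac C unfolding C_def lac_const_def by (intro mult_left_mono lacunary_real_sum_inverse_le[OF lac]) (auto simp: M_def)
    finally show ?thesis by (simp add: power2_eq_square power3_eq_cube)
  qed
  have S2: "(if k = None then 0 else 1 / (1 + (case_option 0 y k)\<^sup>2)) \<le> 1 / M\<^sup>2"
  proof (cases k)
    case (Some i)
    then have "i \<in> J" using k by auto
    then have "M\<^sup>2 \<le> (y i)\<^sup>2" using J(2) M by (intro power_mono) (auto simp: M_def)
    then have "1 / (1 + (y i)\<^sup>2) \<le> 1 / M\<^sup>2" using M by (intro divide_left_mono) (auto simp: add_pos_nonneg)
    then show ?thesis using Some by simp
  qed simp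
  have split: "insert None (Some ` J) - {k} = (if k = None then {} else {None}) \<union> Some ` {j\<in>J. k \<noteq> Some j}" by auto
  have "(\<Sum>l\<in>insert None (Some ` J) - {k}. 1 / (1 + (case_option 0 y k - case_option 0 y l)\<^sup>2))
     = (if k = None then 0 else 1 / (1 + (case_option 0 y k)\<^sup>2)) + (\<Sum>j\<in>{j\<in>J. k \<noteq> Some j}. 1 / (1 + (case_option 0 y k - y j)\<^sup>2))"
    unfolding split using J(1) by (subst sum.union_disjoint) (auto simp: sum.reindex)
  also have "\<dots> \<le> 1 / M\<^sup>2 + C^3 / M\<^sup>2" using S1 S2 by linarith
  also have "\<dots> \<le> 1/144" using M2 M by (simp add: field_simps add_divide_distrib[symmetric])
  finally show ?thesis .
qed

lemma lacunary_sum_powr_lower: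
  fixes c :: "nat \<Rightarrow> complex"
  assumes lac: "lacunary_real lam y" and L: "L > 0" and q: "0 < q" "q \<le> 1" and J: "finite J"
    and big: "\<And>j. j \<in> J \<Longrightarrow> lac_threshold lam \<le> L * y j"
  shows "L^3 / (24 * (39168 * (lac_const lam + 1)\<^sup>2) powr (1 - q/2)) * ((norm c0)\<^sup>2 + (\<Sum>j\<in>J. (norm (c j))\<^sup>2)) powr (q/2)
     \<le> integral {a..a+L} (\<lambda>t. arc_weight a L t * norm (c0 + (\<Sum>j\<in>J. c j * cis (y j * t))) powr q)"
proof -
  have lam: "lam > 1" using lac by (simp add: lacunary_real_def)
  have lac': "lacunary_real lam (\<lambda>k. L * y k)" by (rule lacunary_real_scale[OF lac L])
  define K where "K = insert None (Some ` J)"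
  define \<mu> where "\<mu> = case_option 0 y"
  have mu: "(\<lambda>k. L * \<mu> k) = case_option 0 (\<lambda>k. L * y k)" by (auto simp: \<mu>_def fun_eq_iff split: option.splits)
  have 1: "sparse_family (lac_const lam + 1) K (\<lambda>k. L * \<mu> k)"
    unfolding mu K_def using big lac_threshold_ge[OF lam] by (intro sparse_family_lacunary_zero lac' J) force
  have 2: "(\<Sum>l\<in>K - {k}. 1 / (1 + (L * (\<mu> k - \<mu> l))\<^sup>2)) \<le> 1/144" if "k \<in> K" for k
  proof -
    have "L * (\<mu> k - \<mu> l) = case_option 0 (\<lambda>k. L * y k) k - case_option 0 (\<lambda>k. L * y k) l" for k l
      by (auto simp: \<mu>_def algebra_simps split: option.splits)
    then show ?thesis using lacunary_gap_sum_le[OF lac' J big] that unfolding K_def by simp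
  qed
  have s1: "(\<Sum>k\<in>K. f k) = f None + (\<Sum>j\<in>J. f (Some j))" for f :: "nat option \<Rightarrow> 'z::comm_monoid_add"
    unfolding K_def using J by (simp add: sum.reindex)
  have "L^3 / (24 * (39168 * (lac_const lam + 1)\<^sup>2) powr (1 - q/2)) * (\<Sum>k\<in>K. (norm (case_option c0 c k))\<^sup>2) powr (q/2)
     \<le> integral {a..a+L} (\<lambda>t. arc_weight a L t * norm (\<Sum>k\<in>K. case_option c0 c k * cis (\<mu> k * t)) powr q)"
    using lac_const_pos[OF lam] by (intro weighted_exp_sum_powr_lower[OF L q _ 1 2]) auto
  then show ?thesis unfolding s1 \<mu>_def by simp
qed

lemma lacunary_sum_square_lower:
  fixes c :: "nat \<Rightarrow> complex"
  assumes lac: "lacunary_real lam y" and L: "L > 0" and J: "finite J"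
    and big: "\<And>j. j \<in> J \<Longrightarrow> lac_threshold lam \<le> L * y j"
  shows "L^3 / 12 * (\<Sum>j\<in>J. (norm (c j))\<^sup>2)
     \<le> integral {a..a+L} (\<lambda>t. arc_weight a L t * (norm (\<Sum>j\<in>J. c j * cis (y j * t)))\<^sup>2)"
proof (rule weighted_exp_sum_square_lower[OF J L])
  fix k assume k: "k \<in> J"
  have lac': "lacunary_real lam (\<lambda>k. L * y k)" by (rule lacunary_real_scale[OF lac L])
  have "(\<Sum>l\<in>J - {k}. 1 / (1 + (L * (y k - y l))\<^sup>2)) =
    (\<Sum>l\<in>Some ` (J - {k}). 1 / (1 + (case_option 0 (\<lambda>k. L * y k) (Some k) - case_option 0 (\<lambda>k. L * y k) l)\<^sup>2))"
    by (simp add: sum.reindex right_diff_distrib)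
  also have "\<dots> \<le> (\<Sum>l\<in>insert None (Some ` J) - {Some k}. 1 / (1 + (case_option 0 (\<lambda>k. L * y k) (Some k) - case_option 0 (\<lambda>k. L * y k) l)\<^sup>2))"
    using J by (intro sum_mono2) auto
  also have "\<dots> \<le> 1/144" using lacunary_gap_sum_le[OF lac' J big, of "Some k"] k by blast
  finally show "(\<Sum>l\<in>J - {k}. 1 / (1 + (L * (y k - y l))\<^sup>2)) \<le> 1/144" .
qed

text \<open>The weight vanishes at the ends of its arc, so the plain integral is compared with the
  weighted one over the tripled arc, on whose middle third the weight is at least
  \<open>2 * L^2\<close>. The constant is \<open>12 * 8 * 27 / 2\<close>.\<close>

lemma lacunary_sum_square_upper:
  fixes c :: "nat \<Rightarrow> complex"
  assumes lac: "lacunary_real lam y" and L: "L > 0" and J: "finite J"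
    and big: "\<And>j. j \<in> J \<Longrightarrow> 1 \<le> L * y j"
  shows "integral {a..a+L} (\<lambda>t. (norm (\<Sum>j\<in>J. c j * cis (y j * t)))\<^sup>2)
    \<le> 1296 * lac_const lam * L * (\<Sum>j\<in>J. (norm (c j))\<^sup>2)"
proof -
  have lam: "lam > 1" "\<And>k. y k > 0" using lac by (auto simp: lacunary_real_def)
  let ?h = "\<lambda>t. (norm (\<Sum>j\<in>J. c j * cis (y j * t)))\<^sup>2"
  define b where "b = a - L"
  have bL: "b + 3 * L = a + 2 * L" by (simp add: b_def)
  have lac': "lacunary_real lam (\<lambda>k. (3*L) * y k)" using lacunary_real_scale[OF lac, of "3*L"] L by simp
  have sp: "sparse_family (lac_const lam) J (\<lambda>k. (3*L) * y k)"
  proof (rule sparse_family_lacunary[OF lac' J])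
    show "1 \<le> 3 * L * y j" if "j \<in> J" for j using big[OF that] by simp
  qed
  have "integral {a..a+L} (\<lambda>t. 2 * L\<^sup>2 * ?h t) \<le> integral {a..a+L} (\<lambda>t. arc_weight b (3*L) t * ?h t)"
  proof (rule integral_le)
    fix t assume t: "t \<in> {a..a+L}"
    have "0 \<le> (t - a) * (a + L - t)" using t by auto
    \<comment> \<open>With \<open>s = t - a\<close> the weight is
      \<open>(s + L) * (2 * L - s) = 2 * L^2 + s * (L - s)\<close>.\<close>
    then have "2 * L\<^sup>2 \<le> arc_weight b (3*L) t"
      by (simp add: arc_weight_def b_def power2_eq_square algebra_simps)
    then show "2 * L\<^sup>2 * ?h t \<le> arc_weight b (3*L) t * ?h t" by (intro mult_right_mono) auto
  qed (intro integrable_continuous_interval continuous_intros)+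
  also have "\<dots> \<le> integral {b..b+3*L} (\<lambda>t. arc_weight b (3*L) t * ?h t)"
    using L by (intro integral_subset_le integrable_continuous_interval continuous_intros)
      (auto simp: b_def intro!: mult_nonneg_nonneg arc_weight_nonneg[of _ b "3*L", unfolded b_def])
  also have "\<dots> \<le> 12 * (8 * lac_const lam) * (3*L)^3 * (\<Sum>k\<in>J. (norm (c k))\<^sup>2)"
  proof (rule weighted_exp_sum_square_upper[OF J])
    fix k
    show "(\<Sum>l\<in>J. 1 / (1 + (3 * L * (y k - y l))\<^sup>2)) \<le> 8 * lac_const lam"
      using sparse_family_sum_le[OF sp, of "3 * L * y k"] by (simp add: right_diff_distrib)
  qed (use L in auto)
  also have "\<dots> = 2 * L\<^sup>2 * (1296 * lac_const lam * L * (\<Sum>j\<in>J. (norm (c j))\<^sup>2))"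
    by (simp add: power2_eq_square power3_eq_cube)
  finally have "2 * L\<^sup>2 * integral {a..a+L} ?h \<le> 2 * L\<^sup>2 * (1296 * lac_const lam * L * (\<Sum>j\<in>J. (norm (c j))\<^sup>2))"
    by simp
  then show ?thesis using L by (subst (asm) mult_le_cancel_left_pos) auto
qed

lemma summable_lacunary_cis:
  fixes c :: "nat \<Rightarrow> complex"
  assumes "summable (\<lambda>j. norm (c j))"
  shows "summable (\<lambda>j. c j * cis (y j * t))"
  by (rule summable_norm_cancel, rule summable_comparison_test[OF _ assms]) (auto simp: norm_mult)

lemma uniform_limit_cis_series:
  fixes c :: "nat \<Rightarrow> complex"
  assumes "summable (\<lambda>j. norm (c j))"
  shows "uniform_limit UNIV (\<lambda>m t. \<Sum>j<m. c j * cis (y j * t)) (\<lambda>t. \<Sum>j. c j * cis (y j * t)) sequentially"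
  using assms by (intro Weierstrass_m_test) (auto simp: norm_mult)

lemma continuous_on_cis_series:
  fixes c :: "nat \<Rightarrow> complex"
  assumes "summable (\<lambda>j. norm (c j))"
  shows "continuous_on T (\<lambda>t. \<Sum>j. c j * cis (y j * t))"
proof -
  have "continuous_on UNIV (\<lambda>t. \<Sum>j. c j * cis (y j * t))"
    by (rule uniform_limit_theorem[OF _ uniform_limit_cis_series[OF assms]])
       (auto intro!: always_eventually continuous_intros)
  then show ?thesis by (rule continuous_on_subset) auto
qed

lemma norm_cis_series_le:
  fixes c :: "nat \<Rightarrow> complex"
  assumes "summable (\<lambda>j. norm (c j))"
  shows "norm (\<Sum>j. c j * cis (y j * t)) \<le> (\<Sum>j. norm (c j))"
    and "norm (\<Sum>j<m. c j * cis (y j * t)) \<le> (\<Sum>j. norm (c j))"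
proof -
  have "norm (\<Sum>j. c j * cis (y j * t)) \<le> (\<Sum>j. norm (c j * cis (y j * t)))"
    by (rule summable_norm) (use assms in \<open>simp add: norm_mult\<close>)
  then show "norm (\<Sum>j. c j * cis (y j * t)) \<le> (\<Sum>j. norm (c j))" by (simp add: norm_mult)
  have "norm (\<Sum>j<m. c j * cis (y j * t)) \<le> (\<Sum>j<m. norm (c j))"
    by (rule sum_norm_le) (simp add: norm_mult)
  also have "\<dots> \<le> (\<Sum>j. norm (c j))" using assms by (intro sum_le_suminf) auto
  finally show "norm (\<Sum>j<m. c j * cis (y j * t)) \<le> (\<Sum>j. norm (c j))" .
qed

text \<open>Partial sums of an absolutely summable series have a common bound, so the finite
  estimates pass to the limit. The free weight covers the parabolic and the constant one.\<close>

lemma integral_cis_series_tendsto: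
  fixes c :: "nat \<Rightarrow> complex"
  assumes c: "summable (\<lambda>j. norm (c j))" and q: "q > 0" and w: "continuous_on {a..b} w"
  shows "(\<lambda>m. integral {a..b} (\<lambda>t. w t * norm (c0 + (\<Sum>j<m. c j * cis (y j * t))) powr q))
     \<longlonglongrightarrow> integral {a..b} (\<lambda>t. w t * norm (c0 + (\<Sum>j. c j * cis (y j * t))) powr q)"
proof (rule dominated_convergence(2))
  fix m
  show "(\<lambda>t. w t * norm (c0 + (\<Sum>j<m. c j * cis (y j * t))) powr q) integrable_on {a..b}"
    using q by (intro integrable_continuous_interval continuous_intros w continuous_on_powr') auto
  show "(\<lambda>t. \<bar>w t\<bar> * (norm c0 + (\<Sum>j. norm (c j))) powr q) integrable_on {a..b}"
    by (intro integrable_continuous_interval continuous_intros w)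
  fix t assume "t \<in> {a..b}"
  have "norm (c0 + (\<Sum>j<m. c j * cis (y j * t))) \<le> norm c0 + (\<Sum>j. norm (c j))"
    using norm_triangle_ineq[of c0 "\<Sum>j<m. c j * cis (y j * t)"] norm_cis_series_le(2)[OF c, of y t m] by linarith
  then have "norm (c0 + (\<Sum>j<m. c j * cis (y j * t))) powr q \<le> (norm c0 + (\<Sum>j. norm (c j))) powr q"
    using q by (intro powr_mono2) auto
  then show "norm (w t * norm (c0 + (\<Sum>j<m. c j * cis (y j * t))) powr q) \<le> \<bar>w t\<bar> * (norm c0 + (\<Sum>j. norm (c j))) powr q"
    by (simp add: abs_mult mult_left_mono)
next
    fix t
    show "(\<lambda>m. w t * norm (c0 + (\<Sum>j<m. c j * cis (y j * t))) powr q) \<longlonglongrightarrow> w t * norm (c0 + (\<Sum>j. c j * cis (y j * t))) powr q"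
      using q by (intro tendsto_intros tendsto_powr' summable_LIMSEQ summable_lacunary_cis c) auto
qed

text \<open>The bound does not depend on \<open>c0\<close>. Whatever constant is subtracted from the
  series, its mean size on the arc still controls the coefficients.\<close>

lemma lacunary_series_powr_lower:
  fixes c :: "nat \<Rightarrow> complex"
  assumes lac: "lacunary_real lam y" and L: "L > 0" and q: "0 < q" "q \<le> 1"
    and c: "summable (\<lambda>j. norm (c j))"
    and big: "\<And>j. lac_threshold lam \<le> L * y j"
  shows "L^3 / (24 * (39168 * (lac_const lam + 1)\<^sup>2) powr (1 - q/2)) * (\<Sum>j<m. (norm (c j))\<^sup>2) powr (q/2)
     \<le> integral {a..a+L} (\<lambda>t. arc_weight a L t * norm (c0 + (\<Sum>j. c j * cis (y j * t))) powr q)"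
    (is "?P * _ \<le> _")
proof (rule LIMSEQ_le_const[OF integral_cis_series_tendsto[OF c q(1) continuous_on_arc_weight]], intro exI[of _ m] allI impI)
  fix n assume n: "m \<le> n"
  have "?P * (\<Sum>j<m. (norm (c j))\<^sup>2) powr (q/2) \<le> ?P * ((norm c0)\<^sup>2 + (\<Sum>j<n. (norm (c j))\<^sup>2)) powr (q/2)"
    using n q L by (intro mult_left_mono powr_mono2 add_increasing sum_mono2) (auto intro: sum_nonneg)
  also have "\<dots> \<le> integral {a..a+L} (\<lambda>t. arc_weight a L t * norm (c0 + (\<Sum>j<n. c j * cis (y j * t))) powr q)"
    by (rule lacunary_sum_powr_lower[OF lac L q]) (use big in auto)
  finally show "?P * (\<Sum>j<m. (norm (c j))\<^sup>2) powr (q/2) \<le> integral {a..a+L} (\<lambda>t. arc_weight a L t * norm (c0 + (\<Sum>j<n. c j * cis (y j * t))) powr q)" .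
qed

lemma lacunary_series_square_lower:
  fixes c :: "nat \<Rightarrow> complex"
  assumes lac: "lacunary_real lam y" and L: "L > 0" and c: "summable (\<lambda>j. norm (c j))"
    and big: "\<And>j. lac_threshold lam \<le> L * y j"
  shows "L^3 / 12 * (\<Sum>j<m. (norm (c j))\<^sup>2)
     \<le> integral {a..a+L} (\<lambda>t. arc_weight a L t * (norm (\<Sum>j. c j * cis (y j * t)))\<^sup>2)"
proof -
  have "(\<lambda>m. integral {a..a+L} (\<lambda>t. arc_weight a L t * (norm (\<Sum>j<m. c j * cis (y j * t)))\<^sup>2))
     \<longlonglongrightarrow> integral {a..a+L} (\<lambda>t. arc_weight a L t * (norm (\<Sum>j. c j * cis (y j * t)))\<^sup>2)"
    using integral_cis_series_tendsto[OF c, of 2 a "a+L" "arc_weight a L" 0 y]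
    by (simp add: continuous_on_arc_weight)
  then show ?thesis
  proof (rule LIMSEQ_le_const, intro exI[of _ m] allI impI)
    fix n assume n: "m \<le> n"
    have "L^3 / 12 * (\<Sum>j<m. (norm (c j))\<^sup>2) \<le> L^3 / 12 * (\<Sum>j<n. (norm (c j))\<^sup>2)"
      using n L by (intro mult_left_mono sum_mono2) auto
    also have "\<dots> \<le> integral {a..a+L} (\<lambda>t. arc_weight a L t * (norm (\<Sum>j<n. c j * cis (y j * t)))\<^sup>2)"
      by (rule lacunary_sum_square_lower[OF lac L]) (use big in auto)
    finally show "L^3 / 12 * (\<Sum>j<m. (norm (c j))\<^sup>2) \<le> integral {a..a+L} (\<lambda>t. arc_weight a L t * (norm (\<Sum>j<n. c j * cis (y j * t)))\<^sup>2)" .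
  qed
qed

lemma lacunary_series_square_upper:
  fixes c :: "nat \<Rightarrow> complex"
  assumes lac: "lacunary_real lam y" and L: "L > 0" and c: "summable (\<lambda>j. norm (c j))"
    and big: "\<And>j. 1 \<le> L * y j" and c2: "summable (\<lambda>j. (norm (c j))\<^sup>2)"
  shows "integral {a..a+L} (\<lambda>t. (norm (\<Sum>j. c j * cis (y j * t)))\<^sup>2)
    \<le> 1296 * lac_const lam * L * (\<Sum>j. (norm (c j))\<^sup>2)"
proof -
  have lam: "lam > 1" using lac by (auto simp: lacunary_real_def)
  have "(\<lambda>m. integral {a..a+L} (\<lambda>t. (norm (\<Sum>j<m. c j * cis (y j * t)))\<^sup>2))
     \<longlonglongrightarrow> integral {a..a+L} (\<lambda>t. (norm (\<Sum>j. c j * cis (y j * t)))\<^sup>2)"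
    using integral_cis_series_tendsto[OF c, of 2 a "a+L" "\<lambda>_. 1" 0 y] by simp
  then show ?thesis
  proof (rule LIMSEQ_le_const2, intro exI[of _ 0] allI impI)
    fix n
    have "integral {a..a+L} (\<lambda>t. (norm (\<Sum>j<n. c j * cis (y j * t)))\<^sup>2) \<le> 1296 * lac_const lam * L * (\<Sum>j<n. (norm (c j))\<^sup>2)"
      by (rule lacunary_sum_square_upper[OF lac L]) (use big in auto)
    also have "\<dots> \<le> 1296 * lac_const lam * L * (\<Sum>j. (norm (c j))\<^sup>2)"
      using c2 L lac_const_pos[OF lam] by (intro mult_left_mono sum_le_suminf) auto
    finally show "integral {a..a+L} (\<lambda>t. (norm (\<Sum>j<n. c j * cis (y j * t)))\<^sup>2) \<le> 1296 * lac_const lam * L * (\<Sum>j. (norm (c j))\<^sup>2)" .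
  qed
qed

lemma nn_integral_eq_integral_continuous:
  fixes f :: "real \<Rightarrow> real"
  assumes "continuous_on {a..b} f" "\<And>t. t \<in> {a..b} \<Longrightarrow> f t \<ge> 0"
  shows "(\<integral>\<^sup>+t\<in>{a..b}. ennreal (f t) \<partial>lborel) = ennreal (integral {a..b} f)"
proof -
  have i: "set_integrable lborel {a..b} f" by (rule borel_integrable_atLeastAtMost') (rule assms)
  have "(\<integral>\<^sup>+t\<in>{a..b}. ennreal (f t) \<partial>lborel) = (\<integral>\<^sup>+t. ennreal (indicator {a..b} t *\<^sub>R f t) \<partial>lborel)"
    by (intro nn_integral_cong) (auto simp: indicator_def)
  also have "\<dots> = ennreal (set_lebesgue_integral lborel {a..b} f)"
    unfolding set_lebesgue_integral_def
    by (rule nn_integral_eq_integral) (use i assms(2) in \<open>auto simp: set_integrable_def indicator_def\<close>)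
  also have "set_lebesgue_integral lborel {a..b} f = integral {a..b} f"
    by (rule set_borel_integral_eq_integral(2)[OF i])
  finally show ?thesis .
qed

section \<open>The Poisson kernel and subharmonicity of the square root of the modulus\<close>

text \<open>Not normalized: the mass over a period is \<open>2 * pi\<close>.\<close>

definition poisson :: "complex \<Rightarrow> real \<Rightarrow> real" where
  "poisson z t = (1 - (norm z)\<^sup>2) / (norm (cis t - z))\<^sup>2"

lemma poisson_denominator_pos:
  assumes "norm z < 1" shows "norm (cis t - z) > 0"
proof -
  have "cis t \<noteq> z" using assms by (metis norm_cis less_irrefl)
  then show ?thesis by simp
qed

lemma poisson_pos: "norm z < 1 \<Longrightarrow> poisson z t > 0"
  unfolding poisson_def using poisson_denominator_pos[of z t]
  by (intro divide_pos_pos) (auto simp: power_less_one_iff abs_square_less_1)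

lemma continuous_on_poisson [continuous_intros]:
  assumes "norm z < 1" shows "continuous_on S (poisson z)"
  unfolding poisson_def using poisson_denominator_pos[OF assms]
  by (intro continuous_intros) (auto simp: less_imp_neq[symmetric])

text \<open>Cauchy's formula at \<open>z\<close> for
  \<open>h w = s w * (1 - |z|^2) / (1 - cnj z * w)\<close>, which agrees with \<open>s\<close> at
  \<open>z\<close>. On the circle \<open>1 - cnj z * w = w * cnj (w - z)\<close>, which turns the
  Cauchy kernel into the Poisson kernel.\<close>

lemma poisson_formula:
  fixes s :: "complex \<Rightarrow> complex"
  assumes z: "norm z < 1" and s: "s holomorphic_on ball 0 R" "R > 1"
  shows "((\<lambda>t. of_real (poisson z t) * s (cis t)) has_integral (2 * pi * s z)) {0..2*pi}"
proof -
  define h where "h w = s w * (1 - (norm z)\<^sup>2) / (1 - cnj z * w)" for w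
  have nz: "1 - cnj z * w \<noteq> 0" if "norm w \<le> 1" for w
  proof
    assume "1 - cnj z * w = 0"
    then have "norm (cnj z * w) = 1" by (metis eq_iff_diff_eq_0 norm_one)
    moreover have "norm (cnj z * w) \<le> norm z * 1" using that unfolding norm_mult complex_mod_cnj by (intro mult_left_mono) auto
    ultimately show False using z by simp
  qed
  have sc: "s holomorphic_on cball 0 1" using s by (auto intro: holomorphic_on_subset)
  have "h holomorphic_on cball 0 1" unfolding h_def using nz by (intro holomorphic_intros sc) auto
  then have "((\<lambda>u. h u / (u - z)) has_contour_integral 2 * of_real pi * \<i> * h z) (circlepath 0 1)"
    using z by (intro Cauchy_integral_circlepath) (auto intro: holomorphic_on_imp_continuous_on holomorphic_on_subset)
  moreover have "h z = s z"
  proof -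
    have e: "1 - cnj z * z = of_real (1 - (norm z)\<^sup>2)" by (simp add: complex_norm_square[symmetric] mult.commute)
    have "1 - (norm z)\<^sup>2 \<noteq> 0" using abs_square_less_1[of "norm z"] z by simp
    then have "(of_real (1 - (norm z)\<^sup>2) :: complex) \<noteq> 0" by (simp only: of_real_eq_0_iff not_False_eq_True)
    then show ?thesis unfolding h_def e by simp
  qed
  ultimately have "((\<lambda>t. h (cis t) / (cis t - z) * (\<i> * cis t)) has_integral (2 * of_real pi * \<i> * s z)) {0..2*pi}"
    unfolding circlepath_def by (subst (asm) has_contour_integral_part_circlepath_iff) (simp_all add: mult_ac)
  then have "((\<lambda>t. -\<i> * (h (cis t) / (cis t - z) * (\<i> * cis t))) has_integral (-\<i> * (2 * of_real pi * \<i> * s z))) {0..2*pi}"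
    by (rule has_integral_mult_right)
  moreover have ii: "-\<i> * (X * (\<i> * Y)) = X * Y" for X Y
    by (simp add: complex_eq_iff)
  moreover have "-\<i> * (h (cis t) / (cis t - z) * (\<i> * cis t)) = of_real (poisson z t) * s (cis t)" for t
  proof -
    have c: "cis t * cnj (cis t) = 1" by (simp add: complex_norm_square[symmetric])
    have "1 - cnj z * cis t = cis t * cnj (cis t - z)"
      unfolding complex_cnj_diff right_diff_distrib c by (rule arg_cong[OF mult.commute])
    then have "h (cis t) = s (cis t) * (1 - (norm z)\<^sup>2) / (cis t * cnj (cis t - z))" by (simp only: h_def)
    then have "h (cis t) / (cis t - z) * cis t = s (cis t) * (1 - (norm z)\<^sup>2) / (cnj (cis t - z) * (cis t - z))"
      by simp
    also have "cnj (cis t - z) * (cis t - z) = of_real ((norm (cis t - z))\<^sup>2)"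
      by (metis complex_norm_square mult.commute of_real_power)
    finally have e: "h (cis t) / (cis t - z) * cis t = s (cis t) * (1 - (norm z)\<^sup>2) / of_real ((norm (cis t - z))\<^sup>2)" .
    have "-\<i> * (h (cis t) / (cis t - z) * (\<i> * cis t)) = h (cis t) / (cis t - z) * cis t"
      by (rule ii)
    also have "\<dots> = of_real (poisson z t) * s (cis t)" unfolding e poisson_def by simp
    finally show ?thesis .
  qed
  moreover have "-\<i> * (2 * of_real pi * \<i> * s z) = 2 * pi * s z"
    using ii[of "2 * of_real pi" "s z"] by (simp only: mult.assoc of_real_mult of_real_numeral)
  ultimately show ?thesis by (simp only:)
qed

lemma integral_poisson: assumes "norm z < 1" shows "(poisson z has_integral 2*pi) {0..2*pi}"
proof -
  have "((\<lambda>t. of_real (poisson z t) :: complex) has_integral (2 * pi)) {0..2*pi}"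
    using poisson_formula[OF assms, of "\<lambda>_. 1" 2] by simp
  from has_integral_Re[OF this] show ?thesis by simp
qed

text \<open>Replacing each root inside the disc by its reflection keeps the modulus on the circle and
  does not decrease it inside.\<close>

lemma poly_root_reflection:
  fixes p :: "complex poly"
  assumes "p \<noteq> 0"
  shows "\<exists>q. (\<forall>w. norm w = 1 \<longrightarrow> norm (poly q w) = norm (poly p w)) \<and>
     (\<forall>w. norm w < 1 \<longrightarrow> norm (poly p w) \<le> norm (poly q w) \<and> poly q w \<noteq> 0)"
proof -
  obtain A where A: "p = smult (lead_coeff p) (\<Prod>x\<in>#A. [:- x, 1:])"
    using alg_closed_imp_factorization[OF assms] by blast
  have "\<exists>q. (\<forall>w. norm w = 1 \<longrightarrow> norm (poly q w) = norm (poly (\<Prod>x\<in>#A. [:- x, 1:]) w)) \<and>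
     (\<forall>w. norm w < 1 \<longrightarrow> norm (poly (\<Prod>x\<in>#A. [:- x, 1:]) w) \<le> norm (poly q w) \<and> poly q w \<noteq> 0)" for A :: "complex multiset"
  proof (induction A)
    case empty show ?case by (intro exI[of _ 1]) auto
  next
    case (add a A)
    then obtain q where q: "\<And>w. norm w = 1 \<Longrightarrow> norm (poly q w) = norm (poly (\<Prod>x\<in>#A. [:- x, 1:]) w)"
      "\<And>w. norm w < 1 \<Longrightarrow> norm (poly (\<Prod>x\<in>#A. [:- x, 1:]) w) \<le> norm (poly q w) \<and> poly q w \<noteq> 0" by blast
    \<comment> \<open>A root \<open>a\<close> inside the disc is moved to its mirror image in the
      circle. The identity \<open>sq\<close> below compares the two linear factors.\<close>
    define l where "l = (if norm a < 1 then [:1, - cnj a:] else [:-a, 1:])"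
    have sq: "(norm (1 - cnj a * w))\<^sup>2 - (norm (w - a))\<^sup>2 = (1 - (norm a)\<^sup>2) * (1 - (norm w)\<^sup>2)" for w
      unfolding cmod_power2 by (simp add: power2_eq_square algebra_simps)
    have l1: "norm (poly l w) = norm (poly [:-a, 1:] w)" if "norm w = 1" for w
    proof -
      have "(norm (1 - cnj a * w))\<^sup>2 = (norm (w - a))\<^sup>2" using sq[of w] that by simp
      then have "norm (1 - cnj a * w) = norm (w - a)" by (simp add: power2_eq_iff_nonneg)
      then show ?thesis by (simp add: l_def mult.commute)
    qed
    have l2: "norm (poly [:-a, 1:] w) \<le> norm (poly l w) \<and> poly l w \<noteq> 0" if w: "norm w < 1" for w
    proof (cases "norm a < 1")
      case True
      have "(1 - (norm a)\<^sup>2) * (1 - (norm w)\<^sup>2) > 0"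
        using True w by (intro mult_pos_pos) (auto simp: abs_square_less_1)
      then have "(norm (w - a))\<^sup>2 < (norm (1 - cnj a * w))\<^sup>2" using sq[of w] by linarith
      then have "norm (w - a) < norm (1 - cnj a * w)" by (rule power2_less_imp_less) simp
      then show ?thesis using True by (auto simp: l_def mult.commute)
    next
      case False
      then have "w \<noteq> a" using w by auto
      then show ?thesis using False by (auto simp: l_def)
    qed
    have pm: "norm (poly (\<Prod>x\<in>#add_mset a A. [:- x, 1:]) w) = norm (poly [:-a, 1:] w) * norm (poly (\<Prod>x\<in>#A. [:- x, 1:]) w)" for w
      by (simp only: image_mset_add_mset prod_mset.add_mset poly_mult norm_mult)
    show ?case
    proof (intro exI[of _ "l * q"] conjI allI impI)
      show "norm (poly (l * q) w) = norm (poly (\<Prod>x\<in>#add_mset a A. [:- x, 1:]) w)" if "norm w = 1" for w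
        by (simp only: pm poly_mult norm_mult l1[OF that] q(1)[OF that])
      show "norm (poly (\<Prod>x\<in>#add_mset a A. [:- x, 1:]) w) \<le> norm (poly (l * q) w)" if "norm w < 1" for w
        using l2[OF that] q(2)[OF that] unfolding pm poly_mult norm_mult by (intro mult_mono) auto
      show "poly (l * q) w \<noteq> 0" if "norm w < 1" for w
        using l2[OF that] q(2)[OF that] by (simp only: poly_mult mult_eq_0_iff) blast
    qed
  qed
  from this[of A] obtain q where q: "\<And>w. norm w = 1 \<Longrightarrow> norm (poly q w) = norm (poly (\<Prod>x\<in>#A. [:- x, 1:]) w)"
      "\<And>w. norm w < 1 \<Longrightarrow> norm (poly (\<Prod>x\<in>#A. [:- x, 1:]) w) \<le> norm (poly q w) \<and> poly q w \<noteq> 0" by blast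
  have lc: "lead_coeff p \<noteq> 0" using assms by simp
  have pp: "poly p w = lead_coeff p * poly (\<Prod>x\<in>#A. [:- x, 1:]) w" for w
    by (subst A) simp
  show ?thesis
    by (intro exI[of _ "smult (lead_coeff p) q"]) (use q lc in \<open>auto simp: pp norm_mult intro: mult_left_mono\<close>)
qed

text \<open>The reflected polynomial has no zero inside, so each of its dilations has a holomorphic
  square root beyond the closed disc. The Poisson formula for that root and the triangle inequality
  give the claim for the dilation. The factors \<open>R k\<close> tend to 1 because zeros may remain
  on the circle itself.\<close>

lemma sqrt_norm_poly_le_poisson:
  fixes p :: "complex poly"
  assumes z: "norm z < 1"
  shows "2 * pi * sqrt (norm (poly p z)) \<le> integral {0..2*pi} (\<lambda>t. poisson z t * sqrt (norm (poly p (cis t))))"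
proof (cases "p = 0")
  case False
  obtain q where q: "\<And>w. norm w = 1 \<Longrightarrow> norm (poly q w) = norm (poly p w)"
    "\<And>w. norm w < 1 \<Longrightarrow> norm (poly p w) \<le> norm (poly q w)" "\<And>w. norm w < 1 \<Longrightarrow> poly q w \<noteq> 0"
    using poly_root_reflection[OF False] by blast
  have *: "2 * pi * sqrt (norm (poly q (of_real r * z))) \<le> integral {0..2*pi} (\<lambda>t. poisson z t * sqrt (norm (poly q (of_real r * cis t))))"
    if r: "0 < r" "r < 1" for r
  proof -
    define u where "u w = poly q (of_real r * w)" for w
    have rw: "norm (of_real r * w) < 1" if "w \<in> ball 0 (1/r)" for w :: complex
      using that r by (simp add: norm_mult field_simps)
    have uh: "u holomorphic_on ball 0 (1/r)" unfolding u_def by (intro holomorphic_intros)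
    have u0: "u w \<noteq> 0" if "w \<in> ball 0 (1/r)" for w using q(3)[OF rw[OF that]] by (simp add: u_def)
    obtain s where s: "s holomorphic_on ball 0 (1/r)" "\<And>w. w \<in> ball 0 (1/r) \<Longrightarrow> u w = (s w)\<^sup>2"
      using simply_connected_eq_holomorphic_sqrt[OF open_ball, of 0 "1/r"] convex_imp_simply_connected[OF convex_ball] uh u0
      by blast
    have r1: "1/r > 1" using r by simp
    have in_b: "cis t \<in> ball 0 (1/r)" for t using r1 by simp
    have zb: "z \<in> ball 0 (1/r)" using z r1 by auto
    have su: "norm (s w) = sqrt (norm (u w))" if "w \<in> ball 0 (1/r)" for w
      using s(2)[OF that] by (simp add: norm_power)
    have "norm (2 * pi * s z) \<le> integral {0..2*pi} (\<lambda>t. poisson z t * norm (s (cis t)))"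
    proof -
      have hi: "((\<lambda>t. of_real (poisson z t) * s (cis t)) has_integral (2 * pi * s z)) {0..2*pi}"
        by (rule poisson_formula[OF z s(1) r1])
      have sc: "continuous_on {0..2*pi} (\<lambda>t. s (cis t))"
        by (rule continuous_on_compose2[OF holomorphic_on_imp_continuous_on[OF s(1)]]) (use in_b in \<open>auto intro!: continuous_intros\<close>)
      have "norm (integral {0..2*pi} (\<lambda>t. of_real (poisson z t) * s (cis t))) \<le> integral {0..2*pi} (\<lambda>t. poisson z t * norm (s (cis t)))"
        using hi poisson_pos[OF z] sc z
        by (intro integral_norm_bound_integral integrable_continuous_interval continuous_intros)
           (auto simp: norm_mult less_imp_le)
      then show ?thesis using hi by (simp add: integral_unique)
    qed
    then show ?thesis using su[OF zb] su[OF in_b] by (simp add: norm_mult u_def)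
  qed
  define R where "R k = 1 - 1 / (real k + 2)" for k :: nat
  have R: "0 < R k" "R k < 1" for k unfolding R_def by (auto simp: field_simps)
  have Rlim: "R \<longlonglongrightarrow> 1"
  proof -
    have "(\<lambda>k. 1 / (real k + 2)) \<longlonglongrightarrow> 0" by real_asymp
    from tendsto_diff[OF tendsto_const[of 1] this] show ?thesis by (simp add: R_def[abs_def])
  qed
  have cont: "continuous_on (cball 0 1) (\<lambda>w. sqrt (norm (poly q w)))" by (intro continuous_intros)
  obtain B where B: "\<And>w. w \<in> cball 0 1 \<Longrightarrow> sqrt (norm (poly q w)) \<le> B"
    using compact_imp_bounded[OF compact_continuous_image[OF cont compact_cball]]
    unfolding bounded_iff by (metis imageI real_norm_def abs_le_D1)
  have "(\<lambda>k. integral {0..2*pi} (\<lambda>t. poisson z t * sqrt (norm (poly q (of_real (R k) * cis t)))))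
     \<longlonglongrightarrow> integral {0..2*pi} (\<lambda>t. poisson z t * sqrt (norm (poly q (of_real 1 * cis t))))"
  proof (rule dominated_convergence(2))
    fix k
    show "(\<lambda>t. poisson z t * sqrt (norm (poly q (of_real (R k) * cis t)))) integrable_on {0..2*pi}"
      using z by (intro integrable_continuous_interval continuous_intros)
    show "(\<lambda>t. poisson z t * B) integrable_on {0..2*pi}"
      using z by (intro integrable_continuous_interval continuous_intros)
    fix t
    have "of_real (R k) * cis t \<in> cball 0 1" using R[of k] by (simp add: norm_mult)
    from B[OF this] show "norm (poisson z t * sqrt (norm (poly q (of_real (R k) * cis t)))) \<le> poisson z t * B"
      using poisson_pos[OF z, of t] by (simp add: abs_mult)
  next
    fix t
    show "(\<lambda>k. poisson z t * sqrt (norm (poly q (of_real (R k) * cis t)))) \<longlonglongrightarrow> poisson z t * sqrt (norm (poly q (of_real 1 * cis t)))"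
      by (intro tendsto_intros Rlim)
  qed
  moreover have "(\<lambda>k. 2 * pi * sqrt (norm (poly q (of_real (R k) * z)))) \<longlonglongrightarrow> 2 * pi * sqrt (norm (poly q (of_real 1 * z)))"
    by (intro tendsto_intros Rlim)
  ultimately have A: "2 * pi * sqrt (norm (poly q (of_real 1 * z))) \<le> integral {0..2*pi} (\<lambda>t. poisson z t * sqrt (norm (poly q (of_real 1 * cis t))))"
    using *[OF R] LIMSEQ_le by blast
  have "2 * pi * sqrt (norm (poly p z)) \<le> 2 * pi * sqrt (norm (poly q z))"
    using q(2)[OF z] by (intro mult_left_mono) auto
  also have "\<dots> \<le> integral {0..2*pi} (\<lambda>t. poisson z t * sqrt (norm (poly q (cis t))))"
    using A by simp
  also have "\<dots> = integral {0..2*pi} (\<lambda>t. poisson z t * sqrt (norm (poly p (cis t))))"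
    by (simp add: q(1))
  finally show ?thesis .
qed simp

text \<open>Taylor polynomials converge uniformly on the closed disc, and for polynomials the zeros
  can be reflected one by one.\<close>

lemma sqrt_norm_holomorphic_le_poisson:
  assumes z: "norm z < 1" and f: "f holomorphic_on ball 0 R" and R: "R > 1"
  shows "2 * pi * sqrt (norm (f z)) \<le> integral {0..2*pi} (\<lambda>t. poisson z t * sqrt (norm (f (cis t))))"
proof -
  define c where "c n = (deriv ^^ n) f 0 / fact n" for n
  define p where "p m = (\<Sum>n<m. monom (c n) n)" for m
  have pp: "poly (p m) w = (\<Sum>n<m. c n * w ^ n)" for m w by (simp add: p_def poly_sum poly_monom)
  have "uniform_limit (cball 0 1) (\<lambda>m w. poly (p m) w) f sequentially"
  proof -
    define rho where "rho = (1 + R) / 2"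
    have rho: "1 < rho" "rho < R" using R by (auto simp: rho_def)
    have sm: "(\<lambda>n. c n * w ^ n) sums f w" if "w \<in> ball 0 R" for w
      using holomorphic_power_series[OF f that] by (simp add: c_def)
    have "summable (\<lambda>n. c n * of_real rho ^ n)" using sm[of "of_real rho"] rho by (auto simp: sums_iff)
    then have "summable (\<lambda>n. norm (c n * of_real 1 ^ n))"
      by (rule powser_insidea) (use rho in auto)
    then have "uniform_limit (cball 0 1) (\<lambda>m w. \<Sum>n<m. c n * w ^ n) (\<lambda>w. \<Sum>n. c n * w ^ n) sequentially"
      by (intro Weierstrass_m_test) (auto simp: norm_mult norm_power mult_left_le power_le_one)
    moreover have "(\<Sum>n. c n * w ^ n) = f w" if "w \<in> cball 0 1" for w
      using sm[of w] that R by (auto simp: sums_iff)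
    ultimately show ?thesis unfolding pp by (subst (asm) uniform_limit_cong'[OF refl]) auto
  qed note ul = this
  have lim: "(\<lambda>m. poly (p m) w) \<longlonglongrightarrow> f w" if "w \<in> cball 0 1" for w
    by (rule tendsto_uniform_limitI[OF ul that])
  have fc: "continuous_on (cball 0 1) f"
    using f R by (auto intro!: holomorphic_on_imp_continuous_on intro: holomorphic_on_subset)
  obtain B where B: "\<And>w. w \<in> cball 0 1 \<Longrightarrow> norm (f w) \<le> B"
    using compact_imp_bounded[OF compact_continuous_image[OF fc compact_cball]]
    unfolding bounded_iff by (metis imageI)
  have "\<forall>\<^sub>F m in sequentially. \<forall>w\<in>cball 0 1. dist (poly (p m) w) (f w) < 1"
    using ul by (simp add: uniform_limit_iff)
  then obtain N where N: "\<And>m w. m \<ge> N \<Longrightarrow> w \<in> cball 0 1 \<Longrightarrow> dist (poly (p m) w) (f w) < 1"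
    unfolding eventually_sequentially by blast
  have B1: "norm (poly (p (m + N)) w) \<le> B + 1" if "w \<in> cball 0 1" for w m
    using N[of "m+N" w] B[OF that] that norm_triangle_ineq2[of "poly (p (m + N)) w" "f w"] by (simp add: dist_norm)
  have "(\<lambda>m. integral {0..2*pi} (\<lambda>t. poisson z t * sqrt (norm (poly (p (m + N)) (cis t)))))
     \<longlonglongrightarrow> integral {0..2*pi} (\<lambda>t. poisson z t * sqrt (norm (f (cis t))))"
  proof (rule dominated_convergence(2))
    fix k
    show "(\<lambda>t. poisson z t * sqrt (norm (poly (p (k+N)) (cis t)))) integrable_on {0..2*pi}"
      using z by (intro integrable_continuous_interval continuous_intros)
    show "(\<lambda>t. poisson z t * sqrt (B+1)) integrable_on {0..2*pi}"
      using z by (intro integrable_continuous_interval continuous_intros)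
    fix t
    show "norm (poisson z t * sqrt (norm (poly (p (k+N)) (cis t)))) \<le> poisson z t * sqrt (B+1)"
      using poisson_pos[OF z, of t] B1[of "cis t" k] by (simp add: abs_mult)
  next
    fix t
    show "(\<lambda>k. poisson z t * sqrt (norm (poly (p (k+N)) (cis t)))) \<longlonglongrightarrow> poisson z t * sqrt (norm (f (cis t)))"
      by (intro tendsto_intros LIMSEQ_ignore_initial_segment lim) auto
  qed
  moreover have "(\<lambda>k. 2 * pi * sqrt (norm (poly (p (k+N)) z))) \<longlonglongrightarrow> 2 * pi * sqrt (norm (f z))"
    using z by (intro tendsto_intros LIMSEQ_ignore_initial_segment lim) auto
  ultimately show ?thesis using sqrt_norm_poly_le_poisson[OF z] LIMSEQ_le by blast
qed

subsection \<open>Mean values over arcs\<close>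

definition arc_mean :: "(real \<Rightarrow> complex) \<Rightarrow> real \<Rightarrow> real \<Rightarrow> complex" where
  "arc_mean F a L = (1 / L) *\<^sub>R (LINT s:{a..a+L}|lborel. F s)"

lemma set_integral_const_Icc:
  fixes c :: "'a::{banach, second_countable_topology}"
  assumes "a \<le> b"
  shows "set_integrable lborel {a..b::real} (\<lambda>_. c)" "(LINT t:{a..b}|lborel. c) = (b - a) *\<^sub>R c"
  using assms by (simp_all add: set_integrable_def set_lebesgue_integral_def)

lemma set_integrable_norm_diff:
  fixes F :: "real \<Rightarrow> complex"
  assumes "set_integrable lborel {a..b} F" "a \<le> b"
  shows "set_integrable lborel {a..b} (\<lambda>t. norm (F t - c))"
  by (intro set_integrable_norm set_integral_diff set_integral_const_Icc assms)

lemma arc_mean_diff_le: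
  assumes F: "set_integrable lborel {a..a+L} F" and L: "L > 0"
  shows "L * norm (arc_mean F a L - c) \<le> (LINT t:{a..a+L}|lborel. norm (F t - c))"
proof -
  have cc: "set_integrable lborel {a..a+L} (\<lambda>_. c)" "(LINT t:{a..a+L}|lborel. c) = L *\<^sub>R c"
    using set_integral_const_Icc[of a "a+L" c] L by auto
  have "(LINT t:{a..a+L}|lborel. F t - c) = L *\<^sub>R (arc_mean F a L - c)"
    using set_integral_diff(2)[OF F cc(1)] cc(2) L by (simp add: arc_mean_def scaleR_diff_right)
  then have "L * norm (arc_mean F a L - c) = norm (LINT t:{a..a+L}|lborel. F t - c)" using L by simp
  also have "\<dots> \<le> (LINT t:{a..a+L}|lborel. norm (F t - c))"
    by (rule set_integral_norm_bound) (intro set_integral_diff F cc)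
  finally show ?thesis .
qed

lemma set_integral_subset_le:
  fixes f :: "real \<Rightarrow> real"
  assumes f: "set_integrable lborel B f" and A: "A \<in> sets lborel" "A \<subseteq> B" and nn: "\<And>t. t \<in> B \<Longrightarrow> f t \<ge> 0"
  shows "(LINT t:A|lborel. f t) \<le> (LINT t:B|lborel. f t)"
proof -
  have "set_integrable lborel A f" by (rule set_integrable_subset[OF f A])
  then show ?thesis using f A nn unfolding set_lebesgue_integral_def set_integrable_def
    by (intro integral_mono) (auto simp: indicator_def)
qed

lemma set_nn_integral_eq_set_integral_norm:
  fixes F :: "real \<Rightarrow> complex"
  assumes "set_integrable lborel {a..b} F" "a \<le> b"
  shows "(\<integral>\<^sup>+t\<in>{a..b}. ennreal (norm (F t - c)) \<partial>lborel) = ennreal (LINT t:{a..b}|lborel. norm (F t - c))"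
proof -
  have i: "set_integrable lborel {a..b} (\<lambda>t. norm (F t - c))" by (rule set_integrable_norm_diff[OF assms])
  have "(\<integral>\<^sup>+t\<in>{a..b}. ennreal (norm (F t - c)) \<partial>lborel) = (\<integral>\<^sup>+t. ennreal (indicator {a..b} t *\<^sub>R norm (F t - c)) \<partial>lborel)"
    by (intro nn_integral_cong) (auto simp: indicator_def)
  also have "\<dots> = ennreal (LINT t:{a..b}|lborel. norm (F t - c))"
    unfolding set_lebesgue_integral_def
    by (rule nn_integral_eq_integral) (use i in \<open>auto simp: set_integrable_def\<close>)
  finally show ?thesis .
qed

text \<open>The constant is replaced by its maximum with 0, since \<open>ennreal\<close> reads a
  negative bound as 0.\<close>

lemma bounded_mean_oscD:
  assumes "bounded_mean_osc F"
  obtains C where "C \<ge> 0" "\<And>a L. 0 < L \<Longrightarrow> L \<le> 2*pi \<Longrightarrow> set_integrable lborel {a..a+L} F"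
    "\<And>a L. 0 < L \<Longrightarrow> L \<le> 2*pi \<Longrightarrow> (LINT t:{a..a+L}|lborel. norm (F t - arc_mean F a L)) \<le> C * L"
proof -
  obtain C where C: "\<And>a L. 0 < L \<Longrightarrow> L \<le> 2*pi \<Longrightarrow> set_integrable lborel {a..a+L} F"
    "\<And>a L. 0 < L \<Longrightarrow> L \<le> 2*pi \<Longrightarrow> (\<integral>\<^sup>+t\<in>{a..a+L}. ennreal (norm (F t - arc_mean F a L)) \<partial>lborel) \<le> ennreal (C * L)"
    using assms unfolding bounded_mean_osc_def arc_mean_def by blast
  show thesis
  proof (rule that[of "max C 0"])
    show "0 \<le> max C 0" by simp
    show "set_integrable lborel {a..a+L} F" if "0 < L" "L \<le> 2*pi" for a L by (rule C(1)[OF that])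
    show "(LINT t:{a..a+L}|lborel. norm (F t - arc_mean F a L)) \<le> max C 0 * L" if L: "0 < L" "L \<le> 2*pi" for a L
    proof -
      have "ennreal (LINT t:{a..a+L}|lborel. norm (F t - arc_mean F a L)) \<le> ennreal (C * L)"
        using C(2)[OF L] by (subst (asm) set_nn_integral_eq_set_integral_norm[OF C(1)[OF L]]) (use L in auto)
      also have "\<dots> \<le> ennreal (max C 0 * L)" using L by (intro ennreal_leI mult_right_mono) auto
      finally show ?thesis by (subst (asm) ennreal_le_iff) (use L in auto)
    qed
  qed
qed

text \<open>Any centre \<open>c\<close> may replace the mean at the price of a factor 2, because the
  mean is no farther from \<open>c\<close> than the average of
  \<open>norm (F t - c)\<close>.\<close>

lemma bounded_mean_oscI:
  assumes int: "\<And>a L. 0 < L \<Longrightarrow> L \<le> 2*pi \<Longrightarrow> set_integrable lborel {a..a+L} F"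
    and osc: "\<And>a L. 0 < L \<Longrightarrow> L \<le> 2*pi \<Longrightarrow> \<exists>c. (LINT t:{a..a+L}|lborel. norm (F t - c)) \<le> C * L"
  shows "bounded_mean_osc F"
  unfolding bounded_mean_osc_def
proof (intro exI[of _ "2 * C"] allI impI conjI)
  fix a L :: real assume "0 < L \<and> L \<le> 2*pi"
  then have L: "0 < L" "L \<le> 2*pi" by auto
  show i: "set_integrable lborel {a..a+L} F" by (rule int[OF L])
  obtain c where c: "(LINT t:{a..a+L}|lborel. norm (F t - c)) \<le> C * L" using osc[OF L] by blast
  have "(LINT t:{a..a+L}|lborel. norm (F t - arc_mean F a L)) \<le> (LINT t:{a..a+L}|lborel. norm (F t - c) + norm (arc_mean F a L - c))"
  proof (rule set_integral_mono)
    show "set_integrable lborel {a..a+L} (\<lambda>t. norm (F t - c) + norm (arc_mean F a L - c))"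
      using L by (intro set_integral_add set_integrable_norm_diff i set_integral_const_Icc) auto
    show "norm (F t - arc_mean F a L) \<le> norm (F t - c) + norm (arc_mean F a L - c)" for t
      using norm_triangle_ineq4[of "F t - c" "arc_mean F a L - c"] by simp
  qed (use L in \<open>auto intro: set_integrable_norm_diff i\<close>)
  also have "\<dots> = (LINT t:{a..a+L}|lborel. norm (F t - c)) + L * norm (arc_mean F a L - c)"
    using L set_integral_const_Icc[of a "a+L" "norm (arc_mean F a L - c)"]
    by (subst set_integral_add) (auto intro: set_integrable_norm_diff i)
  also have "\<dots> \<le> C * L + C * L" using c arc_mean_diff_le[OF i L(1), of c] by linarith
  finally have "(LINT t:{a..a+L}|lborel. norm (F t - arc_mean F a L)) \<le> 2 * C * L" by simp
  then show "(\<integral>\<^sup>+ t \<in> {a..a+L}. ennreal (cmod (F t - (1 / L) *\<^sub>R (LINT s:{a..a+L}|lborel. F s))) \<partial>lborel) \<le> ennreal (2 * C * L)"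
    unfolding arc_mean_def[symmetric] using L by (subst set_nn_integral_eq_set_integral_norm[OF i]) (auto intro: ennreal_leI)
qed

text \<open>Enlarging the domain of integration from the small arc to the large one costs the ratio
  of the lengths. Along chains of arcs that double in length this is a constant per step.\<close>

lemma arc_mean_subarc_le:
  assumes int: "set_integrable lborel {b..b+M} F" and sub: "{a..a+L} \<subseteq> {b..b+M}" and L: "L > 0" "M > 0"
    and osc: "(LINT t:{b..b+M}|lborel. norm (F t - arc_mean F b M)) \<le> C * M"
  shows "norm (arc_mean F a L - arc_mean F b M) \<le> C * M / L"
proof -
  have i: "set_integrable lborel {a..a+L} F" by (rule set_integrable_subset[OF int _ sub]) auto
  have "L * norm (arc_mean F a L - arc_mean F b M) \<le> (LINT t:{a..a+L}|lborel. norm (F t - arc_mean F b M))"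
    by (rule arc_mean_diff_le[OF i L(1)])
  also have "\<dots> \<le> (LINT t:{b..b+M}|lborel. norm (F t - arc_mean F b M))"
    using sub L by (intro set_integral_subset_le set_integrable_norm_diff int) auto
  also have "\<dots> \<le> C * M" by (rule osc)
  finally show ?thesis using L by (simp add: field_simps)
qed

subsection \<open>Poisson domination for H1 functions\<close>

lemma one_mem_H1: "(\<lambda>z. 1) \<in> H1"
  unfolding H1_def analytic_disc_def
proof (intro CollectI conjI exI[of _ 1] allI impI)
  fix r :: real
  have "(\<integral>\<^sup>+ t \<in> {0..2*pi}. ennreal (cmod 1 / (2*pi)) \<partial>lborel) = ennreal (1 / (2*pi)) * emeasure lborel {0..2*pi}"
    using nn_integral_cmult_indicator[of "{0..2*pi}" lborel "ennreal (1/(2*pi))"] by simp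
  also have "\<dots> = ennreal 1" by (simp add: ennreal_mult'[symmetric])
  finally show "(\<integral>\<^sup>+ t \<in> {0..2*pi}. ennreal (cmod 1 / (2*pi)) \<partial>lborel) \<le> ennreal 1" by simp
qed auto

lemma analytic_disc_radial:
  assumes "f holomorphic_on udisc" "0 < r" "r < 1"
  shows "continuous_on S (\<lambda>t. f (of_real r * cis t))" "(\<lambda>w. f (of_real r * w)) holomorphic_on ball 0 (1/r)"
proof -
  have "of_real r * cis t \<in> udisc" for t using assms by (simp add: norm_mult)
  then show "continuous_on S (\<lambda>t. f (of_real r * cis t))"
    by (intro continuous_on_compose2[OF holomorphic_on_imp_continuous_on[OF assms(1)]] continuous_intros) auto
  have "of_real r * w \<in> udisc" if "w \<in> ball 0 (1/r)" for w
    using that assms by (simp add: norm_mult field_simps)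
  then show "(\<lambda>w. f (of_real r * w)) holomorphic_on ball 0 (1/r)"
    by (intro holomorphic_on_compose_gen[OF _ assms(1), unfolded o_def] holomorphic_intros) auto
qed

lemma H1_arc_bound:
  assumes "f \<in> H1"
  obtains M where "M > 0" "\<And>r b. 0 < r \<Longrightarrow> r < 1 \<Longrightarrow> integral {b..b+2*pi} (\<lambda>t. norm (f (of_real r * cis t))) \<le> M"
proof -
  have hol: "f holomorphic_on udisc" using assms by (simp add: H1_def analytic_disc_def)
  obtain M where M: "\<And>r. 0 < r \<Longrightarrow> r < 1 \<Longrightarrow>
     (\<integral>\<^sup>+ t \<in> {0..2*pi}. ennreal (cmod (f (complex_of_real r * cis t)) / (2*pi)) \<partial>lborel) \<le> ennreal M"
    using assms unfolding H1_def by blast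
  show thesis
  proof (rule that[of "2*pi*max M 1"])
    show "0 < 2*pi*max M 1" by simp
    fix r b :: real assume r: "0 < r" "r < 1"
    have c: "continuous_on S (\<lambda>t. norm (f (of_real r * cis t)) / (2*pi))" for S
      by (intro continuous_intros analytic_disc_radial[OF hol r]) auto
    then have [measurable]: "(\<lambda>t. norm (f (of_real r * cis t)) / (2*pi)) \<in> borel_measurable borel"
      by (rule borel_measurable_continuous_onI)
    have "(\<integral>\<^sup>+t\<in>{b..b+2*pi}. ennreal (norm (f (of_real r * cis t)) / (2*pi)) \<partial>lborel)
      = (\<integral>\<^sup>+t\<in>{0..0+2*pi}. ennreal (norm (f (of_real r * cis t)) / (2*pi)) \<partial>lborel)"
      by (rule nn_integral_periodic_shift) (auto simp flip: cis_mult)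
    also have "\<dots> \<le> ennreal M" using M[OF r] by simp
    finally have "ennreal (integral {b..b+2*pi} (\<lambda>t. norm (f (of_real r * cis t)) / (2*pi))) \<le> ennreal M"
      by (subst (asm) nn_integral_eq_integral_continuous) (auto intro: c)
    also have "\<dots> \<le> ennreal (max M 1)" by (intro ennreal_leI) auto
    finally have "integral {b..b+2*pi} (\<lambda>t. norm (f (of_real r * cis t)) / (2*pi)) \<le> max M 1"
      by (subst (asm) ennreal_le_iff) auto
    then show "integral {b..b+2*pi} (\<lambda>t. norm (f (of_real r * cis t))) \<le> 2*pi*max M 1"
      by (simp add: field_simps)
  qed
qed

text \<open>Rotation by \<open>cis b\<close>. The boundary functions live on the line, and a window
  centred at the argument of \<open>z\<close> keeps the arcs around that point free of
  wrap-around.\<close>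

lemma sqrt_norm_holomorphic_le_poisson_arc:
  assumes z: "norm z < 1" and f: "f holomorphic_on ball 0 R" and R: "R > 1"
  shows "2 * pi * sqrt (norm (f z)) \<le> integral {b..b+2*pi} (\<lambda>t. poisson z t * sqrt (norm (f (cis t))))"
proof -
  define z' where "z' = cis (-b) * z"
  have z': "norm z' < 1" "cis b * z' = z" using z by (auto simp: z'_def norm_mult cis_mult mult.assoc[symmetric])
  have "cis b * w \<in> ball 0 R" if "w \<in> ball 0 R" for w using that by (simp add: norm_mult)
  then have "(\<lambda>w. f (cis b * w)) holomorphic_on ball 0 R"
    by (intro holomorphic_on_compose_gen[OF _ f, unfolded o_def] holomorphic_intros) auto
  from sqrt_norm_holomorphic_le_poisson[OF z'(1) this R]
  have "2 * pi * sqrt (norm (f z)) \<le> integral {0..2*pi} (\<lambda>t. poisson z' t * sqrt (norm (f (cis b * cis t))))"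
    by (simp only: z'(2))
  also have "(\<lambda>t. poisson z' t * sqrt (norm (f (cis b * cis t)))) = (\<lambda>t. poisson z (t + b) * sqrt (norm (f (cis (t + b)))))"
  proof
    fix t
    have "norm (cis t - z') = norm (cis b * (cis t - z'))" by (simp add: norm_mult)
    also have "cis b * (cis t - z') = cis (t + b) - z" using z'(2) by (simp add: right_diff_distrib cis_mult add.commute)
    finally have "poisson z' t = poisson z (t + b)" by (simp add: poisson_def z'_def norm_mult)
    then show "poisson z' t * sqrt (norm (f (cis b * cis t))) = poisson z (t + b) * sqrt (norm (f (cis (t + b))))"
      by (simp add: cis_mult add.commute)
  qed
  also have "integral {0..2*pi} \<dots> = integral {b..b+2*pi} (\<lambda>t. poisson z t * sqrt (norm (f (cis t))))"
    using integral_shift_real_ivl[of b b "b+2*pi" "\<lambda>t. poisson z t * sqrt (norm (f (cis t)))"] by simp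
  finally show ?thesis .
qed

lemma integral_poisson_arc: assumes z: "norm z < 1" shows "integral {b..b+2*pi} (poisson z) = 2*pi"
proof -
  have "(\<integral>\<^sup>+t\<in>{b..b+2*pi}. ennreal (poisson z t) \<partial>lborel) = (\<integral>\<^sup>+t\<in>{0..0+2*pi}. ennreal (poisson z t) \<partial>lborel)"
  proof (rule nn_integral_periodic_shift)
    have "poisson z \<in> borel_measurable borel"
      by (rule borel_measurable_continuous_onI) (intro continuous_intros z)
    then show "(\<lambda>t. ennreal (poisson z t)) \<in> borel_measurable borel" by simp
  qed (simp add: poisson_def flip: cis_mult)
  then have "ennreal (integral {b..b+2*pi} (poisson z)) = ennreal (integral {0..0+2*pi} (poisson z))"
    using poisson_pos[OF z] z by (subst (asm) (1 2) nn_integral_eq_integral_continuous) (auto intro!: continuous_intros less_imp_le)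
  moreover have "integral {b..b+2*pi} (poisson z) \<ge> 0"
    using poisson_pos[OF z] z by (intro integral_nonneg integrable_continuous_interval continuous_intros less_imp_le) auto
  ultimately show ?thesis using integral_poisson[OF z] by (simp add: integral_unique ennreal_inj)
qed

lemma set_integrable_poisson_mult:
  assumes z: "norm z < 1" and F: "set_integrable lborel {a..b} (F :: real \<Rightarrow> real)"
  shows "set_integrable lborel {a..b} (\<lambda>t. poisson z t * F t)"
proof -
  have [measurable]: "poisson z \<in> borel_measurable borel"
    by (rule borel_measurable_continuous_onI) (intro continuous_intros z)
  obtain B where B: "\<And>t. t \<in> {a..b} \<Longrightarrow> norm (poisson z t) \<le> B"
    using compact_imp_bounded[OF compact_continuous_image[OF continuous_on_poisson[OF z] compact_Icc, of a b]]
    unfolding bounded_iff by (metis imageI)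
  show ?thesis unfolding set_integrable_def
  proof (rule Bochner_Integration.integrable_bound)
    show "integrable lborel (\<lambda>t. B * (indicator {a..b} t *\<^sub>R F t))" using F by (simp add: set_integrable_def)
    have "(\<lambda>t. indicator {a..b} t *\<^sub>R F t) \<in> borel_measurable lborel" using F by (simp add: set_integrable_def borel_measurable_integrable)
    then have "(\<lambda>t. poisson z t * (indicator {a..b} t *\<^sub>R F t)) \<in> borel_measurable lborel" by measurable
    then show "(\<lambda>t. indicator {a..b} t *\<^sub>R (poisson z t * F t)) \<in> borel_measurable lborel" by (simp add: mult_ac)
    show "AE t in lborel. norm (indicator {a..b} t *\<^sub>R (poisson z t * F t)) \<le> norm (B * (indicator {a..b} t *\<^sub>R F t))"
      using B by (intro AE_I2) (force simp: indicator_def abs_mult intro!: mult_right_mono)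
  qed
qed

text \<open>One fixed sequence increasing to 1, so that limit theorems for sequences of integrals
  apply to radial limits.\<close>

definition radii :: "nat \<Rightarrow> real" where "radii k = 1 - 1 / (real k + 2)"

lemma radii: "0 < radii k" "radii k < 1" by (auto simp: radii_def field_simps)

lemma radii_tendsto_left: "filterlim radii (at_left 1) sequentially"
proof -
  have "(\<lambda>k. 1 / (real k + 2)) \<longlonglongrightarrow> 0" by real_asymp
  from tendsto_diff[OF tendsto_const[of 1] this] have "radii \<longlonglongrightarrow> 1" by (simp add: radii_def[abs_def])
  then show ?thesis using radii by (auto simp: filterlim_at less_imp_neq)
qed

lemma radii_tendsto: "radii \<longlonglongrightarrow> 1"
  using radii_tendsto_left by (simp add: filterlim_at)

text \<open>The means of \<open>|f|\<close> are only bounded in \<open>L\<^sup>1\<close>, but those of \<open>|f| powr (1/2)\<close> are bounded in \<open>L\<^sup>2\<close>,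
  which lets their Poisson integrals pass to the boundary.\<close>

lemma H1_le_poisson:
  assumes f: "f \<in> H1" and bd: "boundary_function f F" and z: "norm z < 1"
    and F: "set_integrable lborel {b..b+2*pi} F"
  shows "2 * pi * norm (f z) \<le> (LINT t:{b..b+2*pi}|lborel. poisson z t * norm (F t))"
proof (cases "f z = 0")
  case True
  have "(LINT t:{b..b+2*pi}|lborel. poisson z t * norm (F t)) \<ge> 0"
    using less_imp_le[OF poisson_pos[OF z]] unfolding set_lebesgue_integral_def by (intro integral_nonneg_AE AE_I2) auto
  then show ?thesis using True by simp
next
  case False
  define s where "s = sqrt (norm (f z))"
  have s: "s > 0" "s * s = norm (f z)" using False by (auto simp: s_def)
  let ?I = "{b..b+2*pi}"
  have hol: "f holomorphic_on udisc" using f by (simp add: H1_def analytic_disc_def)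
  obtain M where M: "M > 0" "\<And>r. 0 < r \<Longrightarrow> r < 1 \<Longrightarrow> integral ?I (\<lambda>t. norm (f (of_real r * cis t))) \<le> M"
    using H1_arc_bound[OF f] by metis
  have Pc: "continuous_on S (poisson z)" for S by (rule continuous_on_poisson[OF z])
  have [measurable]: "poisson z \<in> borel_measurable borel"
    by (rule borel_measurable_continuous_onI[OF Pc])
  have P0: "poisson z t \<ge> 0" for t using poisson_pos[OF z] by (simp add: less_imp_le)
  obtain B where B: "\<And>t. t \<in> ?I \<Longrightarrow> norm (poisson z t) \<le> B"
    using compact_imp_bounded[OF compact_continuous_image[OF Pc compact_Icc]]
    unfolding bounded_iff by (metis imageI)
  have iF: "set_integrable lborel ?I (\<lambda>t. norm (F t))" by (rule set_integrable_norm[OF F])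
  define J where "J = (LINT t:?I|lborel. poisson z t * norm (F t))"
  \<comment> \<open>The square root is cut at the height \<open>K\<close>. The cut part converges by
    domination; the excess is at most \<open>x / K\<close> and so bounded by
    \<open>B * M / K\<close>, using the uniform \<open>L^1\<close> bound alone.\<close>
  have main: "2 * pi * s \<le> J / (2 * s) + pi * s + B * M / K" if K: "K > 0" for K
  proof -
    define h where "h k t = poisson z t * min (sqrt (norm (f (of_real (radii k) * cis t)))) K" for k t
    have hc: "continuous_on S (h k)" for S k
      unfolding h_def by (intro continuous_intros Pc analytic_disc_radial[OF hol radii])
    have step: "2 * pi * sqrt (norm (f (of_real (radii k) * z))) \<le> integral ?I (h k) + B * M / K" for k
    proof -
      let ?g = "\<lambda>t. norm (f (of_real (radii k) * cis t))"
      have gc: "continuous_on S ?g" for S by (intro continuous_intros analytic_disc_radial[OF hol radii])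
      have "2 * pi * sqrt (norm (f (of_real (radii k) * z))) \<le> integral ?I (\<lambda>t. poisson z t * sqrt (?g t))"
        using radii[of k] by (intro sqrt_norm_holomorphic_le_poisson_arc[OF z analytic_disc_radial(2)[OF hol radii]]) auto
      also have "\<dots> \<le> integral ?I (\<lambda>t. h k t + B / K * ?g t)"
      proof (rule integral_le)
        fix t assume t: "t \<in> ?I"
        have "sqrt x \<le> min (sqrt x) K + x / K" if "x \<ge> 0" for x
        proof (cases "sqrt x \<le> K")
          case False
          then have "sqrt x * K \<le> sqrt x * sqrt x" using that by (intro mult_left_mono) auto
          then have "sqrt x \<le> x / K" using K that by (simp add: field_simps)
          then show ?thesis using K False by simp
        qed (use K that in auto)
        then have "poisson z t * sqrt (?g t) \<le> poisson z t * (min (sqrt (?g t)) K + ?g t / K)"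
          by (intro mult_left_mono P0) auto
        also have "\<dots> = h k t + poisson z t * (?g t / K)" by (simp add: h_def distrib_left)
        also have "\<dots> \<le> h k t + B * (?g t / K)" using B[OF t] K by (intro add_left_mono mult_right_mono) auto
        finally show "poisson z t * sqrt (?g t) \<le> h k t + B / K * ?g t" by simp
      qed (intro integrable_continuous_interval continuous_intros hc gc Pc)+
      also have "\<dots> = integral ?I (h k) + B / K * integral ?I ?g"
        using K by (subst integral_add) (auto intro!: integrable_continuous_interval continuous_intros hc gc)
      also have "B / K * integral ?I ?g \<le> B / K * M"
      proof (intro mult_left_mono M radii divide_nonneg_pos K)
        show "0 \<le> B" using B[of b] by (smt (verit) atLeastAtMost_iff norm_ge_zero pi_gt_zero)
      qed
      finally show ?thesis by simp
    qed
    define H where "H t = poisson z t * min (sqrt (norm (F t))) K" for t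
    have [measurable]: "(\<lambda>t. indicator ?I t *\<^sub>R F t) \<in> borel_measurable borel"
      using borel_measurable_integrable[OF F[unfolded set_integrable_def]] by simp
    have Hm: "(\<lambda>t. indicator ?I t *\<^sub>R H t) \<in> borel_measurable lborel"
    proof -
      have "(\<lambda>t. indicator ?I t * (poisson z t * min (sqrt (norm (indicator ?I t *\<^sub>R F t))) K)) \<in> borel_measurable lborel"
        by measurable
      moreover have "(\<lambda>t. indicator ?I t * (poisson z t * min (sqrt (norm (indicator ?I t *\<^sub>R F t))) K)) = (\<lambda>t. indicator ?I t *\<^sub>R H t)"
        by (auto simp: H_def indicator_def fun_eq_iff)
      ultimately show ?thesis by simp
    qed
    have lim: "(\<lambda>k. LINT t|lborel. indicator ?I t *\<^sub>R h k t) \<longlonglongrightarrow> (LINT t|lborel. indicator ?I t *\<^sub>R H t)"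
    proof (rule integral_dominated_convergence)
      show "(\<lambda>t. indicator ?I t *\<^sub>R H t) \<in> borel_measurable lborel" by (rule Hm)
      show "(\<lambda>t. indicator ?I t *\<^sub>R h k t) \<in> borel_measurable lborel" for k
        using borel_measurable_continuous_onI[OF hc] by measurable
      show "integrable lborel (\<lambda>t. indicator ?I t *\<^sub>R (poisson z t * K))"
        using set_integrable_poisson_mult[OF z set_integral_const_Icc(1)[of b "b+2*pi" K]] by (simp add: set_integrable_def)
      show "AE t in lborel. norm (indicator ?I t *\<^sub>R h k t) \<le> indicator ?I t *\<^sub>R (poisson z t * K)" for k
        using P0 K by (intro AE_I2) (auto simp: indicator_def h_def abs_mult intro!: mult_left_mono)
      show "AE t in lborel. (\<lambda>k. indicator ?I t *\<^sub>R h k t) \<longlonglongrightarrow> indicator ?I t *\<^sub>R H t"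
        using bd unfolding boundary_function_def
      proof (eventually_elim)
        case (elim t)
        have "(\<lambda>k. f (of_real (radii k) * cis t)) \<longlonglongrightarrow> F t"
          by (rule filterlim_compose[OF elim radii_tendsto_left])
        then show ?case unfolding h_def H_def by (intro tendsto_intros)
      qed
    qed
    have hk: "integral ?I (h k) = (LINT t|lborel. indicator ?I t *\<^sub>R h k t)" for k
      using set_borel_integral_eq_integral(2)[OF borel_integrable_atLeastAtMost'[OF hc]]
      by (simp add: set_lebesgue_integral_def)
    have "(\<lambda>k. of_real (radii k) * z) \<longlonglongrightarrow> of_real 1 * z" by (intro tendsto_intros radii_tendsto)
    then have "(\<lambda>k. f (of_real (radii k) * z)) \<longlonglongrightarrow> f z"
      using z continuous_on_interior[OF holomorphic_on_imp_continuous_on[OF hol], of z]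
      by (auto intro!: isCont_tendsto_compose[of z f] simp: interior_open)
    then have "(\<lambda>k. 2 * pi * sqrt (norm (f (of_real (radii k) * z)))) \<longlonglongrightarrow> 2 * pi * sqrt (norm (f z))"
      by (intro tendsto_intros)
    moreover have "(\<lambda>k. integral ?I (h k) + B * M / K) \<longlonglongrightarrow> (LINT t|lborel. indicator ?I t *\<^sub>R H t) + B * M / K"
      unfolding hk by (intro tendsto_intros lim)
    ultimately have "2 * pi * s \<le> (LINT t|lborel. indicator ?I t *\<^sub>R H t) + B * M / K"
      unfolding s_def using step LIMSEQ_le by blast
    also have "(LINT t|lborel. indicator ?I t *\<^sub>R H t) \<le> (LINT t:?I|lborel. poisson z t * norm (F t) / (2 * s) + poisson z t * (s/2))"
      unfolding set_lebesgue_integral_def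
    proof (rule integral_mono)
      show "integrable lborel (\<lambda>t. indicator ?I t *\<^sub>R H t)"
      proof (rule Bochner_Integration.integrable_bound[OF _ Hm])
        show "integrable lborel (\<lambda>t. indicator ?I t *\<^sub>R (poisson z t * K))"
          using set_integrable_poisson_mult[OF z set_integral_const_Icc(1)[of b "b+2*pi" K]] by (simp add: set_integrable_def)
        show "AE t in lborel. norm (indicator ?I t *\<^sub>R H t) \<le> norm (indicator ?I t *\<^sub>R (poisson z t * K))"
          using P0 K by (intro AE_I2) (auto simp: indicator_def H_def abs_mult intro!: mult_left_mono)
      qed
      show "integrable lborel (\<lambda>t. indicator ?I t *\<^sub>R (poisson z t * norm (F t) / (2 * s) + poisson z t * (s/2)))"
        unfolding set_integrable_def[symmetric]
        by (intro set_integral_add set_integrable_divide set_integrable_poisson_mult z iF set_integral_const_Icc) auto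
      fix t
      \<comment> \<open>Tangent to the square root at \<open>s^2 = norm (f z)\<close>: the
        inequality \<open>0 <= (sqrt x - s)^2\<close> turns the integral of \<open>sqrt |F|\<close>
        into that of \<open>|F|\<close> without loss at the value in question.\<close>
      have "min (sqrt x) K \<le> x / (2 * s) + s/2" if "x \<ge> 0" for x
      proof -
        have "0 \<le> (sqrt x - s)\<^sup>2" by simp
        also have "\<dots> = x + s\<^sup>2 - 2 * s * sqrt x" using that by (simp add: power2_diff)
        finally have "sqrt x \<le> x / (2 * s) + s/2" using s by (simp add: field_simps power2_eq_square)
        then show ?thesis by linarith
      qed
      then have "H t \<le> poisson z t * (norm (F t) / (2 * s) + s/2)" unfolding H_def by (intro mult_left_mono P0) auto
      then show "indicator ?I t *\<^sub>R H t \<le> indicator ?I t *\<^sub>R (poisson z t * norm (F t) / (2 * s) + poisson z t * (s/2))"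
        by (auto simp: indicator_def distrib_left)
    qed
    also have "(LINT t:?I|lborel. poisson z t * norm (F t) / (2 * s) + poisson z t * (s/2)) = J / (2 * s) + pi * s"
    proof -
      have "(LINT t:?I|lborel. poisson z t) = 2*pi"
        using set_borel_integral_eq_integral(2)[OF borel_integrable_atLeastAtMost'[OF Pc]] integral_poisson_arc[OF z]
        by simp
      then show ?thesis
        unfolding J_def using z iF by (subst set_integral_add) (auto intro!: set_integrable_divide set_integrable_poisson_mult set_integral_const_Icc)
    qed
    finally show ?thesis by simp
  qed
  \<comment> \<open>\<open>K\<close> tends to infinity; the value used below makes the remainder at
    most \<open>e\<close>.\<close>
  have "2 * pi * s \<le> J / (2 * s) + pi * s"
  proof (rule field_le_epsilon)
    fix e :: real assume e: "e > 0"
    have "B * M / (\<bar>B * M\<bar> / e + 1) \<le> e"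
    proof -
      have "e * (\<bar>B * M\<bar> / e + 1) = \<bar>B * M\<bar> + e" using e by (simp add: distrib_left)
      then have "B * M \<le> e * (\<bar>B * M\<bar> / e + 1)" using e by linarith
      moreover have "\<bar>B * M\<bar> / e + 1 > 0" using e by (simp add: add_nonneg_pos)
      ultimately show ?thesis by (subst pos_divide_le_eq)
    qed
    moreover have "\<bar>B * M\<bar> / e + 1 > 0" using e by (simp add: add_nonneg_pos)
    ultimately show "2 * pi * s \<le> J / (2 * s) + pi * s + e" using main[of "\<bar>B * M\<bar> / e + 1"] by linarith
  qed
  then have "pi * s \<le> J / (2 * s)" by linarith
  then have "pi * s * (2 * s) \<le> J" using s(1) by (subst (asm) pos_le_divide_eq) auto
  then have "2 * pi * (s * s) \<le> J" by (simp only: mult_ac)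
  then show ?thesis unfolding s(2) J_def .
qed

subsection \<open>BMOA is contained in the Bloch space\<close>

lemma norm_cis_diff: "norm (cis s - cis t) = 2 * \<bar>sin ((s - t) / 2)\<bar>"
proof -
  have "(norm (cis s - cis t))\<^sup>2 = (2 * \<bar>sin ((s - t) / 2)\<bar>)\<^sup>2"
  proof -
    have "(norm (cis s - cis t))\<^sup>2 = 2 - 2 * cos (s - t)"
      by (simp add: cmod_power2 cos_diff power2_diff algebra_simps sin_squared_eq)
    also have "cos (s - t) = 1 - 2 * (sin ((s - t) / 2))\<^sup>2"
    proof -
      have "2 * ((s - t) / 2) = s - t" by simp
      then show ?thesis using cos_double_sin[of "(s-t)/2"] by (simp only:)
    qed
    finally show ?thesis by (simp add: power_mult_distrib)
  qed
  then show ?thesis by (subst (asm) power2_eq_iff_nonneg) auto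
qed

lemma norm_cis_diff_le: "norm (cis s - cis t) \<le> \<bar>s - t\<bar>"
  unfolding norm_cis_diff using abs_sin_x_le_abs_x[of "(s - t)/2"] by simp

text \<open>Jordan's inequality: a concave function lies above its chord.\<close>

lemma sin_ge_two_over_pi:
  assumes "0 \<le> x" "x \<le> pi / 2" shows "sin x \<ge> 2 / pi * x"
proof -
  have "concave_on {0..pi/2} sin"
  proof -
    have "convex_on {0..pi/2} (\<lambda>x. - sin x)"
    proof (rule f''_ge0_imp_convex)
      show "((\<lambda>x. - sin x) has_real_derivative - cos x) (at x)" for x by (auto intro!: derivative_eq_intros)
      show "((\<lambda>x. - cos x) has_real_derivative sin x) (at x)" for x by (auto intro!: derivative_eq_intros)
      show "0 \<le> sin x" if "x \<in> {0..pi/2}" for x using that by (intro sin_ge_zero) auto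
    qed auto
    then show ?thesis by (simp add: concave_on_def)
  qed
  then have "sin ((1 - 2 / pi * x) *\<^sub>R 0 + (2 / pi * x) *\<^sub>R (pi/2)) \<ge> (1 - 2 / pi * x) * sin 0 + (2 / pi * x) * sin (pi/2)"
    using assms by (intro concave_onD) (auto simp: field_simps)
  then show ?thesis by simp
qed

lemma norm_cis_diff_ge:
  assumes "\<bar>s - t\<bar> \<le> pi" shows "norm (cis s - cis t) \<ge> 2 / pi * \<bar>s - t\<bar>"
proof -
  have "\<bar>sin ((s - t)/2)\<bar> = sin (\<bar>s - t\<bar>/2)"
  proof (cases "s \<ge> t")
    case True
    then have "sin ((s - t)/2) \<ge> 0" using assms by (intro sin_ge_zero) auto
    then show ?thesis using True by simp
  next
    case False
    then have "sin ((t - s)/2) \<ge> 0" using assms by (intro sin_ge_zero) auto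
    moreover have "sin ((s - t)/2) = - sin ((t - s)/2)" by (metis minus_diff_eq minus_divide_left sin_minus)
    ultimately show ?thesis using False by simp
  qed
  moreover have "sin (\<bar>s - t\<bar>/2) \<ge> 2 / pi * (\<bar>s - t\<bar>/2)" using assms by (intro sin_ge_two_over_pi) auto
  ultimately show ?thesis unfolding norm_cis_diff by simp
qed

text \<open>Total over dyadic arcs: the kernel falls like \<open>4^j\<close>, the lengths grow like
  \<open>2^j\<close>, and the deviation from the central mean grows like
  \<open>1 + 2 * j\<close>.\<close>

lemma sum_odd_over_power: "(\<Sum>j\<le>m. (1 + 2 * real j) / 2 ^ j) \<le> 6"
proof -
  have "(\<Sum>j\<le>m. (1 + 2 * real j) / 2 ^ j) = 6 - (2 * real m + 5) / 2 ^ m"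
    by (induction m) (auto simp: field_simps)
  then show ?thesis by simp
qed

text \<open>On the disc of radius \<open>\<delta> / 2\<close> about \<open>z\<close>, with
  \<open>\<delta> = 1 - norm z\<close>, the function differs boundedly from the mean
  \<open>c 0\<close> of \<open>F\<close> over an arc of length about \<open>\<delta>\<close> below
  \<open>z\<close>. Cauchy's estimate on that disc bounds
  \<open>\<delta> * norm (deriv f z)\<close>.\<close>

lemma BMOA_imp_Bloch:
  assumes f: "f \<in> BMOA"
  obtains B where "B \<ge> 0" "\<And>z. z \<in> udisc \<Longrightarrow> (1 - norm z) * norm (deriv f z) \<le> B"
proof -
  obtain F where fH: "f \<in> H1" and bd: "boundary_function f F" and bmo: "bounded_mean_osc F"
    using f by (auto simp: BMOA_def)
  have hol: "f holomorphic_on udisc" using fH by (simp add: H1_def analytic_disc_def)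
  obtain C where C: "C \<ge> 0" and int: "\<And>a L. 0 < L \<Longrightarrow> L \<le> 2*pi \<Longrightarrow> set_integrable lborel {a..a+L} F"
    and osc: "\<And>a L. 0 < L \<Longrightarrow> L \<le> 2*pi \<Longrightarrow> (LINT t:{a..a+L}|lborel. norm (F t - arc_mean F a L)) \<le> C * L"
    using bounded_mean_oscD[OF bmo] by metis
  show thesis
  proof (rule that[of "1152 * C"])
    show "0 \<le> 1152 * C" using C by simp
    fix z :: complex assume "z \<in> udisc"
    then have z: "norm z < 1" by simp
    define \<delta> where "\<delta> = 1 - norm z"
    have d: "0 < \<delta>" "\<delta> \<le> 1" using z by (auto simp: \<delta>_def)
    define \<theta> where "\<theta> = Arg2pi z"
    have zt: "z = of_real (norm z) * cis \<theta>" unfolding \<theta>_def using Arg2pi_eq[of z] by (simp add: cis_conv_exp)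
    \<comment> \<open>\<open>\<delta>\<close> is rounded up to a power of 1/2, at most by a factor
      2, so that doubling the smallest arc \<open>m\<close> times gives exactly the full
      circle.\<close>
    define m where "m = nat \<lfloor>log 2 (1/\<delta>)\<rfloor>"
    have m: "\<delta> \<le> 1 / 2^m" "1 / 2^m < 2 * \<delta>"
    proof -
      have l0: "log 2 (1/\<delta>) \<ge> 0" using d by (simp add: zero_le_log_cancel_iff)
      then have m1: "real m \<le> log 2 (1/\<delta>)" "log 2 (1/\<delta>) < real m + 1" unfolding m_def by linarith+
      have "2 powr real m \<le> 2 powr (log 2 (1/\<delta>))" using m1 by (intro powr_mono) auto
      then have "2 ^ m \<le> 1/\<delta>" using d by (simp add: powr_realpow)
      then show "\<delta> \<le> 1 / 2^m" using d by (simp add: field_simps)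
      have "2 powr (log 2 (1/\<delta>)) < 2 powr (real m + 1)" using m1 by (intro powr_less_mono) auto
      then have "1/\<delta> < 2 * 2^m" using d by (simp add: powr_add powr_realpow)
      then show "1 / 2^m < 2 * \<delta>" using d by (simp add: field_simps)
    qed
    define h where "h j = 2^j * (pi / 2^m)" for j :: nat
    define a where "a j = \<theta> - h j" for j
    define L where "L j = 2 * h j" for j
    define I where "I j = {a j..a j + L j}" for j
    have hpos: "h j > 0" for j by (simp add: h_def)
    have hle: "h j \<le> pi" if "j \<le> m" for j
    proof -
      have "(2::real)^j \<le> 2^m" using that by (intro power_increasing) auto
      then show ?thesis by (simp add: h_def field_simps)
    qed
    have L: "0 < L j" "j \<le> m \<Longrightarrow> L j \<le> 2*pi" for j using hpos hle by (auto simp: L_def)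
    have Iin: "t \<in> I j \<longleftrightarrow> \<bar>t - \<theta>\<bar> \<le> h j" for t j by (auto simp: I_def a_def L_def)
    have Im: "I m = {a m..a m + 2*pi}" by (simp add: I_def L_def h_def)
    have Isub: "I i \<subseteq> I j" if "i \<le> j" for i j
    proof -
      have "(2::real)^i \<le> 2^j" using that by (intro power_increasing) auto
      then have "h i \<le> h j" by (simp add: h_def divide_right_mono mult_right_mono)
      then show ?thesis using Iin by force
    qed
    define c where "c j = arc_mean F (a j) (L j)" for j
    have iI: "set_integrable lborel (I j) F" if "j \<le> m" for j unfolding I_def using int L that by auto
    have iIn: "set_integrable lborel (I j) (\<lambda>t. norm (F t - e))" if "j \<le> m" for j e
      using set_integrable_norm_diff[of "a j" "a j + L j" F e] iI[OF that] L(1)[of j] by (simp add: I_def)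
    have oI: "(LINT t:I j|lborel. norm (F t - c j)) \<le> C * L j" if "j \<le> m" for j
      unfolding I_def c_def using osc L that by auto
    \<comment> \<open>Each doubling moves the mean by at most \<open>2 * C\<close>.\<close>
    have cdiff: "norm (c j - c 0) \<le> 2 * C * real j" if "j \<le> m" for j
      using that
    proof (induction j)
      case (Suc j)
      have "norm (c j - c (Suc j)) \<le> C * L (Suc j) / L j"
        unfolding c_def
      proof (rule arc_mean_subarc_le)
        show "set_integrable lborel {a (Suc j)..a (Suc j) + L (Suc j)} F" using iI[OF Suc.prems] by (simp add: I_def)
        show "{a j..a j + L j} \<subseteq> {a (Suc j)..a (Suc j) + L (Suc j)}" using Isub[of j "Suc j"] by (simp add: I_def)
        show "(LINT t:{a (Suc j)..a (Suc j) + L (Suc j)}|lborel. norm (F t - arc_mean F (a (Suc j)) (L (Suc j)))) \<le> C * L (Suc j)"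
          using oI[OF Suc.prems] by (simp add: I_def c_def)
      qed (rule L)+
      also have "C * L (Suc j) / L j = 2 * C" using hpos[of j] by (simp add: L_def h_def)
      finally have "norm (c j - c (Suc j)) \<le> 2 * C" .
      moreover have "norm (c (Suc j) - c 0) \<le> norm (c j - c 0) + norm (c j - c (Suc j))"
        using norm_triangle_ineq4[of "c j - c 0" "c j - c (Suc j)"] by simp
      ultimately show ?case using Suc by (simp add: algebra_simps)
    qed simp
    have LF: "(LINT t:I j|lborel. norm (F t - c 0)) \<le> C * L j * (1 + 2 * real j)" if j: "j \<le> m" for j
    proof -
      have cc: "set_integrable lborel (I j) (\<lambda>_. norm (c j - c 0))" "(LINT t:I j|lborel. norm (c j - c 0)) = L j * norm (c j - c 0)"
        using set_integral_const_Icc[of "a j" "a j + L j" "norm (c j - c 0)"] L(1)[of j] by (auto simp: I_def)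
      have "(LINT t:I j|lborel. norm (F t - c 0)) \<le> (LINT t:I j|lborel. norm (F t - c j) + norm (c j - c 0))"
      proof (rule set_integral_mono)
        show "norm (F t - c 0) \<le> norm (F t - c j) + norm (c j - c 0)" for t
          using norm_triangle_ineq[of "F t - c j" "c j - c 0"] by simp
      qed (intro iIn[OF j] set_integral_add cc)+
      also have "\<dots> = (LINT t:I j|lborel. norm (F t - c j)) + L j * norm (c j - c 0)"
        by (subst set_integral_add(2)) (use iIn[OF j] cc in auto)
      also have "\<dots> \<le> C * L j + L j * (2 * C * real j)"
        using oI[OF j] cdiff[OF j] L(1)[of j] by (intro add_mono mult_left_mono) auto
      finally show ?thesis by (simp add: algebra_simps)
    qed
    \<comment> \<open>The kernel is replaced by a step function on the nested arcs. The estimate is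
      uniform over the whole disc of radius \<open>\<delta> / 2\<close>: there
      \<open>1 - (norm w)^2 <= 3 * \<delta>\<close>, and the distance to \<open>cis t\<close> is at
      least half of that from \<open>z\<close>.\<close>
    have kernel: "poisson w t \<le> (\<Sum>j\<le>m. 48 / (4^j * \<delta>) * indicator (I j) t)"
      if w: "norm (w - z) \<le> \<delta>/2" and t: "t \<in> I m" for w t
    proof -
      have ez: "norm (cis t - z) \<ge> \<delta>" using norm_triangle_ineq2[of "cis t" z] by (simp add: \<delta>_def)
      have ew: "norm (cis t - w) \<ge> norm (cis t - z) / 2"
        using norm_triangle_ineq2[of "cis t - z" "w - z"] w ez by simp
      have pw: "poisson w t \<le> 12 * \<delta> / (norm (cis t - z))\<^sup>2"
      proof -
        have "norm w \<ge> norm z - \<delta>/2" "norm w \<le> norm z + \<delta>/2"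
          using norm_triangle_ineq3[of w z] w by (auto simp: abs_if split: if_splits)
        then have nw: "1 - norm w \<le> 3 * \<delta> / 2" "1 - norm w \<ge> 0" "norm w \<le> 1"
          using d \<delta>_def by linarith+
        have "1 - (norm w)\<^sup>2 = (1 - norm w) * (1 + norm w)" by (simp add: power2_eq_square algebra_simps)
        also have "\<dots> \<le> (3 * \<delta> / 2) * 2" using nw d by (intro mult_mono) auto
        finally have n1: "1 - (norm w)\<^sup>2 \<le> 3 * \<delta>" by simp
        have n2: "(norm (cis t - z))\<^sup>2 / 4 \<le> (norm (cis t - w))\<^sup>2"
          using power_mono[OF ew, of 2] by (simp add: power_divide)
        have zpos: "(norm (cis t - z))\<^sup>2 > 0" using ez d by auto
        have "poisson w t \<le> 3 * \<delta> / ((norm (cis t - z))\<^sup>2 / 4)"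
          unfolding poisson_def using n1 n2 zpos d by (intro frac_le) auto
        then show ?thesis by simp
      qed
      \<comment> \<open>Take the first arc containing \<open>t\<close>. Then \<open>t\<close> lies
        outside the previous one, and Jordan's inequality gives
        \<open>norm (cis t - z) >= 2^j / 2 * \<delta>\<close>; for \<open>j = 0\<close> the distance
        \<open>\<delta>\<close> from \<open>z\<close> to the circle is enough.\<close>
      have ex: "\<exists>j\<le>m. t \<in> I j \<and> 12 * \<delta> / (norm (cis t - z))\<^sup>2 \<le> 48 / (4^j * \<delta>)"
      proof -
        define j where "j = (LEAST j. t \<in> I j)"
        have jt: "t \<in> I j" and jm: "j \<le> m" unfolding j_def using t by (auto intro: LeastI Least_le)
        have zp: "norm (cis t - z) \<ge> 2^j / 2 * \<delta>"
        proof (cases j)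
          case 0
          then show ?thesis using ez d by simp
        next
          case (Suc i)
          have "t \<notin> I i" using not_less_Least[of i "\<lambda>j. t \<in> I j"] Suc by (simp add: j_def)
          then have t1: "h i < \<bar>t - \<theta>\<bar>" by (simp add: Iin)
          have t2: "\<bar>t - \<theta>\<bar> \<le> pi" using t by (simp add: Iin h_def)
          have "norm (cis t - cis \<theta>) \<le> norm (cis t - z) + norm (z - cis \<theta>)"
            using norm_triangle_ineq[of "cis t - z" "z - cis \<theta>"] by simp
          also have "norm (z - cis \<theta>) = \<delta>"
          proof -
            have "z - cis \<theta> = of_real (norm z - 1) * cis \<theta>" by (subst zt) (simp add: algebra_simps)
            then show ?thesis using z by (simp add: norm_mult \<delta>_def del: of_real_diff)
          qed
          finally have "norm (cis t - cis \<theta>) \<le> 2 * norm (cis t - z)" using ez by linarith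
          moreover have "2 / pi * \<bar>t - \<theta>\<bar> \<le> norm (cis t - cis \<theta>)" by (rule norm_cis_diff_ge[OF t2])
          moreover have "2 / pi * h i \<le> 2 / pi * \<bar>t - \<theta>\<bar>" using t1 by (intro mult_left_mono) auto
          moreover have "2 / pi * h i = 2 * 2^i / 2^m" by (simp add: h_def)
          ultimately have "2 * 2^i / 2^m \<le> 2 * norm (cis t - z)" by linarith
          moreover have "2 * 2^i * \<delta> \<le> 2 * 2^i * (1 / 2^m)" using m by (intro mult_left_mono) auto
          ultimately show ?thesis using Suc by simp
        qed
        then have "(2^j / 2 * \<delta>)\<^sup>2 \<le> (norm (cis t - z))\<^sup>2" using d by (intro power_mono) auto
        then have "12 * \<delta> / (norm (cis t - z))\<^sup>2 \<le> 12 * \<delta> / (2^j / 2 * \<delta>)\<^sup>2"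
        proof (rule divide_left_mono)
          have "norm (cis t - z) > 0" using ez d by linarith
          moreover have "2^j / 2 * \<delta> > 0" using d by simp
          ultimately show "0 < (norm (cis t - z))\<^sup>2 * (2^j / 2 * \<delta>)\<^sup>2" by (metis mult_pos_pos zero_less_power)
        qed (use d in auto)
        also have "\<dots> = 48 / (4^j * \<delta>)"
        proof -
          have "(4::real)^j = 2^j * 2^j" by (simp flip: power_mult_distrib)
          then show ?thesis using d by (simp add: field_simps power2_eq_square)
        qed
        finally show ?thesis using jt jm by blast
      qed
      then obtain j where j: "j \<le> m" "t \<in> I j" "12 * \<delta> / (norm (cis t - z))\<^sup>2 \<le> 48 / (4^j * \<delta>)" by blast
      have "48 / (4^j * \<delta>) = 48 / (4^j * \<delta>) * indicator (I j) t" using j by simp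
      also have "\<dots> \<le> (\<Sum>j\<le>m. 48 / (4^j * \<delta>) * indicator (I j) t)"
        using j d by (intro member_le_sum) auto
      finally show ?thesis using pw j by linarith
    qed
    have est: "norm (f w - c 0) \<le> 576 * C" if w: "norm (w - z) \<le> \<delta>/2" for w
    proof -
      have w1: "norm w < 1" using norm_triangle_ineq2[of w z] w d by (simp add: \<delta>_def)
      have f1: "(\<lambda>w. f w - c 0) \<in> H1"
      proof -
        have hol1: "(\<lambda>w. f w - c 0) holomorphic_on udisc" by (intro holomorphic_intros hol)
        obtain M where M: "M > 0" "\<And>r b. 0 < r \<Longrightarrow> r < 1 \<Longrightarrow> integral {b..b+2*pi} (\<lambda>t. norm (f (of_real r * cis t))) \<le> M"
          using H1_arc_bound[OF fH] by metis
        show ?thesis unfolding H1_def analytic_disc_def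
        proof (intro CollectI conjI exI[of _ "(M + 2*pi*norm (c 0)) / (2*pi)"] allI impI hol1)
          fix r :: real assume "0 < r \<and> r < 1"
          then have r: "0 < r" "r < 1" by auto
          have fc: "continuous_on S (\<lambda>t. f (of_real r * cis t))" for S by (rule analytic_disc_radial(1)[OF hol r])
          have "(\<integral>\<^sup>+ t \<in> {0..2*pi}. ennreal (cmod (f (complex_of_real r * cis t) - c 0) / (2*pi)) \<partial>lborel)
            = ennreal (integral {0..2*pi} (\<lambda>t. cmod (f (complex_of_real r * cis t) - c 0) / (2*pi)))"
            by (intro nn_integral_eq_integral_continuous continuous_intros fc) auto
          also have "\<dots> \<le> ennreal ((M + 2*pi*norm (c 0)) / (2*pi))"
          proof (intro ennreal_leI)
            have "integral {0..2*pi} (\<lambda>t. cmod (f (complex_of_real r * cis t) - c 0) / (2*pi))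
              \<le> integral {0..2*pi} (\<lambda>t. (cmod (f (complex_of_real r * cis t)) + norm (c 0)) / (2*pi))"
              by (intro integral_le integrable_continuous_interval continuous_intros fc divide_right_mono norm_triangle_ineq4) auto
            also have "\<dots> = (integral {0..2*pi} (\<lambda>t. cmod (f (complex_of_real r * cis t))) + 2*pi*norm (c 0)) / (2*pi)"
              by (subst integral_divide, subst integral_add) (auto intro!: integrable_continuous_interval continuous_intros fc)
            also have "\<dots> \<le> (M + 2*pi*norm (c 0)) / (2*pi)"
              using M(2)[OF r, of 0] by (intro divide_right_mono add_right_mono) auto
            finally show "integral {0..2*pi} (\<lambda>t. cmod (f (complex_of_real r * cis t) - c 0) / (2*pi)) \<le> (M + 2*pi*norm (c 0)) / (2*pi)" .
          qed
          finally show "(\<integral>\<^sup>+ t \<in> {0..2*pi}. ennreal (cmod (f (complex_of_real r * cis t) - c 0) / (2*pi)) \<partial>lborel) \<le> ennreal ((M + 2*pi*norm (c 0)) / (2*pi))" .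
        qed
      qed
      have b1: "boundary_function (\<lambda>w. f w - c 0) (\<lambda>t. F t - c 0)"
        using bd unfolding boundary_function_def by (elim eventually_mono) (intro tendsto_intros)
      have i1: "set_integrable lborel {a m..a m + 2*pi} (\<lambda>t. F t - c 0)"
        using iI[of m] unfolding Im by (intro set_integral_diff set_integral_const_Icc) auto
      have "2 * pi * norm (f w - c 0) \<le> (LINT t:I m|lborel. poisson w t * norm (F t - c 0))"
        unfolding Im by (rule H1_le_poisson[OF f1 b1 w1 i1])
      also have "\<dots> \<le> (LINT t:I m|lborel. \<Sum>j\<le>m. 48 / (4^j * \<delta>) * (indicator (I j) t * norm (F t - c 0)))"
      proof (rule set_integral_mono)
        show "set_integrable lborel (I m) (\<lambda>t. poisson w t * norm (F t - c 0))"
          using iIn[of m "c 0"] unfolding Im by (intro set_integrable_poisson_mult w1) auto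
        have "integrable lborel (\<lambda>t. indicator (I m) t *\<^sub>R (48 / (4^j * \<delta>) * (indicator (I j) t * norm (F t - c 0))))" if j: "j \<le> m" for j
        proof -
          have "integrable lborel (\<lambda>t. 48 / (4^j * \<delta>) * (indicator (I j) t *\<^sub>R norm (F t - c 0)))"
            using iIn[OF j, of "c 0"] unfolding set_integrable_def by (rule integrable_mult_right)
          then show ?thesis
            by (rule Bochner_Integration.integrable_cong[THEN iffD1, rotated -1]) (use Isub[OF j] in \<open>auto simp: indicator_def\<close>)
        qed
        then show "set_integrable lborel (I m) (\<lambda>t. \<Sum>j\<le>m. 48 / (4^j * \<delta>) * (indicator (I j) t * norm (F t - c 0)))"
          unfolding set_integrable_def scaleR_sum_right by (intro Bochner_Integration.integrable_sum) auto
        fix t assume t: "t \<in> I m"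
        have "poisson w t * norm (F t - c 0) \<le> (\<Sum>j\<le>m. 48 / (4^j * \<delta>) * indicator (I j) t) * norm (F t - c 0)"
          by (intro mult_right_mono kernel[OF w t]) auto
        then show "poisson w t * norm (F t - c 0) \<le> (\<Sum>j\<le>m. 48 / (4^j * \<delta>) * (indicator (I j) t * norm (F t - c 0)))"
          by (simp add: sum_distrib_right mult.assoc)
      qed
      also have "\<dots> = (\<Sum>j\<le>m. 48 / (4^j * \<delta>) * (LINT t:I j|lborel. norm (F t - c 0)))"
      proof -
        have "(LINT t:I m|lborel. \<Sum>j\<le>m. 48 / (4^j * \<delta>) * (indicator (I j) t * norm (F t - c 0)))
          = (LINT t|lborel. (\<Sum>j\<le>m. 48 / (4^j * \<delta>) * (indicator (I j) t *\<^sub>R norm (F t - c 0))))"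
          unfolding set_lebesgue_integral_def
        proof (rule Bochner_Integration.integral_cong[OF refl])
          fix t
          show "indicator (I m) t *\<^sub>R (\<Sum>j\<le>m. 48 / (4^j * \<delta>) * (indicator (I j) t * norm (F t - c 0))) = (\<Sum>j\<le>m. 48 / (4^j * \<delta>) * (indicator (I j) t *\<^sub>R norm (F t - c 0)))"
            unfolding scaleR_sum_right using Isub by (intro sum.cong refl) (auto simp: indicator_def)
        qed
        also have "\<dots> = (\<Sum>j\<le>m. 48 / (4^j * \<delta>) * (LINT t:I j|lborel. norm (F t - c 0)))"
          using iIn[of _ "c 0"] unfolding set_lebesgue_integral_def set_integrable_def
          by (subst Bochner_Integration.integral_sum) auto
        finally show ?thesis .
      qed
      \<comment> \<open>\<open>L j <= 4 * pi * 2^j * \<delta>\<close> cancels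
        \<open>\<delta>\<close> and half of the decay \<open>4^j\<close>. The remaining sum is at
        most 6, which leads to \<open>2 * pi * 576 * C\<close>.\<close>
      also have "\<dots> \<le> (\<Sum>j\<le>m. 192 * pi * C * ((1 + 2 * real j) / 2^j))"
      proof (rule sum_mono)
        fix j assume "j \<in> {..m}"
        then have j: "j \<le> m" by simp
        have Lj: "L j \<le> 4 * pi * 2^j * \<delta>"
        proof -
          have "L j = 2 * pi * 2^j * (1 / 2^m)" by (simp add: L_def h_def)
          also have "\<dots> \<le> 2 * pi * 2^j * (2 * \<delta>)" using m by (intro mult_left_mono) auto
          finally show ?thesis by simp
        qed
        have "48 / (4^j * \<delta>) * (LINT t:I j|lborel. norm (F t - c 0)) \<le> 48 / (4^j * \<delta>) * (C * (4 * pi * 2^j * \<delta>) * (1 + 2 * real j))"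
        proof (intro mult_left_mono)
          have "C * L j * (1 + 2 * real j) \<le> C * (4 * pi * 2^j * \<delta>) * (1 + 2 * real j)"
            using Lj C by (intro mult_right_mono mult_left_mono) auto
          then show "(LINT t:I j|lborel. norm (F t - c 0)) \<le> C * (4 * pi * 2^j * \<delta>) * (1 + 2 * real j)"
            using LF[OF j] by linarith
        qed (use d in auto)
        also have "\<dots> = 192 * pi * C * ((1 + 2 * real j) / 2^j)"
        proof -
          have "(4::real)^j = 2^j * 2^j" by (simp flip: power_mult_distrib)
          then show ?thesis using d by (simp add: field_simps)
        qed
        finally show "48 / (4^j * \<delta>) * (LINT t:I j|lborel. norm (F t - c 0)) \<le> 192 * pi * C * ((1 + 2 * real j) / 2^j)" .
      qed
      also have "\<dots> = 192 * pi * C * (\<Sum>j\<le>m. (1 + 2 * real j) / 2^j)" by (simp add: sum_distrib_left)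
      also have "\<dots> \<le> 192 * pi * C * 6" using C by (intro mult_left_mono sum_odd_over_power) auto
      finally have "pi * (2 * norm (f w - c 0)) \<le> pi * (1152 * C)" by simp
      then have "2 * norm (f w - c 0) \<le> 1152 * C" by (subst (asm) mult_le_cancel_left_pos) auto
      then show ?thesis by simp
    qed
    have sub: "cball z (\<delta>/2) \<subseteq> udisc"
    proof
      fix w assume "w \<in> cball z (\<delta>/2)"
      then have "norm (w - z) \<le> \<delta>/2" by (simp add: dist_norm norm_minus_commute)
      then show "w \<in> udisc" using norm_triangle_ineq2[of w z] d by (simp add: \<delta>_def)
    qed
    have "norm ((deriv ^^ 1) (\<lambda>w. f w - c 0) z) \<le> fact 1 * (576 * C) / (\<delta>/2)^1"
    proof (rule Cauchy_inequality)
      have hc: "(\<lambda>w. f w - c 0) holomorphic_on cball z (\<delta>/2)"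
        using hol sub by (intro holomorphic_intros) (auto intro: holomorphic_on_subset)
      then show "continuous_on (cball z (\<delta>/2)) (\<lambda>w. f w - c 0)" by (rule holomorphic_on_imp_continuous_on)
      show "(\<lambda>w. f w - c 0) holomorphic_on ball z (\<delta>/2)" using hc by (rule holomorphic_on_subset) auto
      show "norm (f x - c 0) \<le> 576 * C" if "norm (z - x) = \<delta>/2" for x
        using est[of x] that by (simp add: norm_minus_commute)
    qed (use d in auto)
    moreover have "deriv (\<lambda>w. f w - c 0) z = deriv f z"
      using hol z by (subst deriv_diff) (auto intro: holomorphic_on_imp_differentiable_at)
    ultimately have "norm (deriv f z) \<le> 576 * C / (\<delta>/2)" by simp
    then show "(1 - norm z) * norm (deriv f z) \<le> 1152 * C" using d unfolding \<delta>_def[symmetric] by (simp add: field_simps)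
  qed
qed

subsection \<open>Logarithmic growth of the means\<close>

text \<open>Fatou's lemma along the circles of radius \<open>radii k\<close>.\<close>

lemma H1_boundary_L1:
  assumes f: "f \<in> H1" and bd: "boundary_function f F"
  obtains M where "M > 0" "\<And>b. set_integrable lborel {b..b+2*pi} F \<Longrightarrow> (LINT t:{b..b+2*pi}|lborel. norm (F t)) \<le> M"
proof -
  have hol: "f holomorphic_on udisc" using f by (simp add: H1_def analytic_disc_def)
  obtain M where M: "M > 0" "\<And>r b. 0 < r \<Longrightarrow> r < 1 \<Longrightarrow> integral {b..b+2*pi} (\<lambda>t. norm (f (of_real r * cis t))) \<le> M"
    using H1_arc_bound[OF f] by metis
  show thesis
  proof (rule that[OF M(1)])
    fix b assume i: "set_integrable lborel {b..b+2*pi} F"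
    let ?I = "{b..b+2*pi}"
    have fc: "continuous_on S (\<lambda>t. f (of_real (radii k) * cis t))" for S k by (rule analytic_disc_radial(1)[OF hol radii])
    have [measurable]: "(\<lambda>t. f (of_real (radii k) * cis t)) \<in> borel_measurable borel" for k
      by (rule borel_measurable_continuous_onI[OF fc])
    have "(\<integral>\<^sup>+t\<in>?I. ennreal (norm (F t)) \<partial>lborel) = (\<integral>\<^sup>+t. liminf (\<lambda>k. ennreal (norm (f (of_real (radii k) * cis t))) * indicator ?I t) \<partial>lborel)"
    proof (rule nn_integral_cong_AE)
      show "AE t in lborel. ennreal (norm (F t)) * indicator ?I t = liminf (\<lambda>k. ennreal (norm (f (of_real (radii k) * cis t))) * indicator ?I t)"
        using bd unfolding boundary_function_def
      proof eventually_elim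
        case (elim t)
        have "(\<lambda>k. f (of_real (radii k) * cis t)) \<longlonglongrightarrow> F t"
          by (rule filterlim_compose[OF elim radii_tendsto_left])
        then have "(\<lambda>k. ennreal (norm (f (of_real (radii k) * cis t)))) \<longlonglongrightarrow> ennreal (norm (F t))"
          by (intro tendsto_ennrealI tendsto_norm)
        then have "(\<lambda>k. ennreal (norm (f (of_real (radii k) * cis t))) * indicator ?I t) \<longlonglongrightarrow> ennreal (norm (F t)) * indicator ?I t"
          by (cases "t \<in> ?I") auto
        then show ?case by (intro lim_imp_Liminf[symmetric]) auto
      qed
    qed
    also have "\<dots> \<le> liminf (\<lambda>k. \<integral>\<^sup>+t\<in>?I. ennreal (norm (f (of_real (radii k) * cis t))) \<partial>lborel)"
      by (rule nn_integral_liminf) measurable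
    also have "\<dots> \<le> liminf (\<lambda>k. ennreal M)"
    proof (intro Liminf_mono always_eventually allI)
      fix k
      have "(\<integral>\<^sup>+t\<in>?I. ennreal (norm (f (of_real (radii k) * cis t))) \<partial>lborel) = ennreal (integral ?I (\<lambda>t. norm (f (of_real (radii k) * cis t))))"
        by (intro nn_integral_eq_integral_continuous continuous_intros fc) auto
      also have "\<dots> \<le> ennreal M" by (intro ennreal_leI M radii)
      finally show "(\<integral>\<^sup>+t\<in>?I. ennreal (norm (f (of_real (radii k) * cis t))) \<partial>lborel) \<le> ennreal M" .
    qed
    also have "\<dots> = ennreal M" by (simp add: Liminf_const)
    finally have "(\<integral>\<^sup>+t\<in>?I. ennreal (norm (F t - 0)) \<partial>lborel) \<le> ennreal M" by simp
    then show "(LINT t:?I|lborel. norm (F t)) \<le> M"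
      by (subst (asm) set_nn_integral_eq_set_integral_norm[OF i]) (use M(1) in \<open>auto simp: ennreal_le_iff\<close>)
  qed
qed

lemma ln_two_pi_le: "ln (2*pi) \<le> 2"
proof -
  have "2 * pi \<le> 2 * 3.2" using pi_approx by simp
  moreover have "exp (1::real) \<ge> 2.6" using e_approx_32 by (simp add: abs_if split: if_splits)
  then have "exp (1::real) * exp 1 \<ge> 2.6 * 2.6" by (intro mult_mono) auto
  then have "exp (2::real) \<ge> 6.76" by (simp flip: exp_add)
  ultimately have "2 * pi \<le> exp 2" by simp
  then have "ln (2*pi) \<le> ln (exp 2)" by (subst ln_le_cancel_iff) auto
  then show ?thesis by simp
qed

text \<open>Doubling an arc moves the mean by at most \<open>2 * C\<close>. About
  \<open>log 2 (2*pi / L)\<close> doublings reach an arc longer than \<open>pi\<close>, where the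
  mean is bounded by the \<open>L^1\<close> norm over a period.\<close>

lemma arc_mean_log_growth:
  assumes f: "f \<in> H1" and bd: "boundary_function f F" and C: "C \<ge> 0"
    and int: "\<And>a L. 0 < L \<Longrightarrow> L \<le> 2*pi \<Longrightarrow> set_integrable lborel {a..a+L} F"
    and osc: "\<And>a L. 0 < L \<Longrightarrow> L \<le> 2*pi \<Longrightarrow> (LINT t:{a..a+L}|lborel. norm (F t - arc_mean F a L)) \<le> C * L"
  obtains D where "D \<ge> 0" "\<And>a L. 0 < L \<Longrightarrow> L \<le> 2*pi \<Longrightarrow> norm (arc_mean F a L) \<le> D * (1 + \<bar>ln L\<bar>)"
proof -
  obtain M where M: "M > 0" "\<And>b. set_integrable lborel {b..b+2*pi} F \<Longrightarrow> (LINT t:{b..b+2*pi}|lborel. norm (F t)) \<le> M"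
    using H1_boundary_L1[OF f bd] by metis
  show thesis
  proof (rule that[of "M + 8 * C"])
    show "0 \<le> M + 8 * C" using M C by simp
    fix a L :: real assume L: "0 < L" "L \<le> 2*pi"
    \<comment> \<open>The number of doublings that still fit into one turn; the last arc then has
      length between \<open>pi\<close> and \<open>2 * pi\<close>.\<close>
    define m where "m = nat \<lfloor>log 2 (2*pi/L)\<rfloor>"
    have l0: "log 2 (2*pi/L) \<ge> 0" using L by (simp add: zero_le_log_cancel_iff)
    then have m1: "real m \<le> log 2 (2*pi/L)" "log 2 (2*pi/L) < real m + 1" unfolding m_def by linarith+
    have ma: "2^m * L \<le> 2*pi"
    proof -
      have "2 powr real m \<le> 2 powr (log 2 (2*pi/L))" using m1 by (intro powr_mono) auto
      then have "2 ^ m \<le> 2*pi/L" using L by (simp add: powr_realpow)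
      then show ?thesis using L by (simp add: field_simps)
    qed
    have mb: "pi < 2^m * L"
    proof -
      have "2 powr (log 2 (2*pi/L)) < 2 powr (real m + 1)" using m1 by (intro powr_less_mono) auto
      then have "2*pi/L < 2 * 2^m" using L by (simp add: powr_add powr_realpow)
      then show ?thesis using L by (simp add: field_simps)
    qed
    have Lj: "0 < 2^j * L" "j \<le> m \<Longrightarrow> 2^j * L \<le> 2*pi" for j
    proof -
      show "0 < 2^j * L" using L by simp
      assume "j \<le> m"
      then have "(2::real)^j * L \<le> 2^m * L" using L by (intro mult_right_mono power_increasing) auto
      then show "2^j * L \<le> 2*pi" using ma by linarith
    qed
    have "norm (arc_mean F a L - arc_mean F a (2^j * L)) \<le> 2 * C * real j" if "j \<le> m" for j
      using that
    proof (induction j)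
      case (Suc j)
      have "norm (arc_mean F a (2^j * L) - arc_mean F a (2^Suc j * L)) \<le> C * (2^Suc j * L) / (2^j * L)"
      proof (rule arc_mean_subarc_le)
        show "set_integrable lborel {a..a + 2 ^ Suc j * L} F" by (rule int[OF Lj(1) Lj(2)[OF Suc.prems]])
        show "(LINT t:{a..a + 2 ^ Suc j * L}|lborel. norm (F t - arc_mean F a (2^Suc j * L))) \<le> C * (2 ^ Suc j * L)"
          by (rule osc[OF Lj(1) Lj(2)[OF Suc.prems]])
      qed (use L in auto)
      also have "\<dots> = 2 * C" using L by simp
      finally have 1: "norm (arc_mean F a (2^j * L) - arc_mean F a (2^Suc j * L)) \<le> 2 * C" .
      have "norm (arc_mean F a L - arc_mean F a (2^Suc j * L)) \<le> norm (arc_mean F a L - arc_mean F a (2^j * L)) + norm (arc_mean F a (2^j * L) - arc_mean F a (2^Suc j * L))"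
        using norm_triangle_ineq[of "arc_mean F a L - arc_mean F a (2^j * L)" "arc_mean F a (2^j * L) - arc_mean F a (2^Suc j * L)"] by simp
      then show ?case using Suc 1 by (simp add: algebra_simps)
    qed simp
    from this[of m] have A: "norm (arc_mean F a L - arc_mean F a (2^m * L)) \<le> 2 * C * real m" by simp
    have i2: "set_integrable lborel {a..a+2*pi} F" by (rule int) auto
    have im: "set_integrable lborel {a..a+2^m*L} F" by (rule int[OF Lj(1) ma])
    have "(2^m * L) * norm (arc_mean F a (2^m * L) - 0) \<le> (LINT t:{a..a+2^m*L}|lborel. norm (F t - 0))"
      by (rule arc_mean_diff_le[OF im Lj(1)])
    also have "\<dots> \<le> (LINT t:{a..a+2*pi}|lborel. norm (F t - 0))"
      using ma by (intro set_integral_subset_le set_integrable_norm_diff i2) auto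
    also have "\<dots> \<le> M" using M(2)[OF i2] by simp
    finally have B1: "(2^m * L) * norm (arc_mean F a (2^m * L)) \<le> M" by simp
    have "1 * norm (arc_mean F a (2^m * L)) \<le> (2^m * L) * norm (arc_mean F a (2^m * L))"
      using mb pi_gt3 by (intro mult_right_mono) auto
    then have B: "norm (arc_mean F a (2^m * L)) \<le> M" using B1 by simp
    have ml: "real m \<le> 4 * (1 + \<bar>ln L\<bar>)"
    proof -
      have "ln 2 \<ge> (1/2 :: real)" using ln_2_less_1 ln2_ge_two_thirds by simp
      moreover have "real m * ln 2 \<le> ln (2*pi/L)" using m1(1) by (simp add: log_def field_simps)
      moreover have "ln (2*pi/L) = ln (2*pi) - ln L" using L by (simp add: ln_div)
      moreover note ln_two_pi_le
      ultimately have "real m * (1/2) \<le> 2 + \<bar>ln L\<bar>"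
        using mult_left_mono[of "1/2" "ln 2" "real m"] by linarith
      then show ?thesis by simp
    qed
    have "norm (arc_mean F a L) \<le> norm (arc_mean F a L - arc_mean F a (2^m * L)) + norm (arc_mean F a (2^m * L))"
      using norm_triangle_ineq[of "arc_mean F a L - arc_mean F a (2^m * L)" "arc_mean F a (2^m * L)"] by simp
    also have "\<dots> \<le> 2 * C * real m + M" using A B by linarith
    also have "\<dots> \<le> 2 * C * (4 * (1 + \<bar>ln L\<bar>)) + M * (1 + \<bar>ln L\<bar>)"
      using ml C M(1) by (intro add_mono mult_left_mono) auto
    finally show "norm (arc_mean F a L) \<le> (M + 8 * C) * (1 + \<bar>ln L\<bar>)" by (simp add: algebra_simps)
  qed
qed

subsection \<open>Elementary inequalities\<close>

lemma powr_add_le: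
  fixes x y q :: real
  assumes "x \<ge> 0" "y \<ge> 0" "0 < q" "q \<le> 1"
  shows "(x + y) powr q \<le> x powr q + y powr q"
proof (cases "x + y = 0")
  case True
  then show ?thesis by simp
next
  case False
  define s where "s = x + y"
  have s: "s > 0" using False assms by (simp add: s_def)
  have *: "u / s \<le> (u / s) powr q" if "0 \<le> u" "u \<le> s" for u
  proof (cases "u = 0")
    case False
    have "(u / s) powr 1 \<le> (u / s) powr q"
      using that s assms False by (intro powr_mono') auto
    then show ?thesis using that s False by simp
  qed simp
  have "x / s + y / s \<le> (x / s) powr q + (y / s) powr q"
    using *[of x] *[of y] assms by (simp add: s_def)
  also have "x / s + y / s = 1" using s by (simp add: s_def add_divide_distrib[symmetric])
  finally have "1 \<le> (x powr q + y powr q) / s powr q" by (simp add: powr_divide add_divide_distrib)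
  then show ?thesis using s by (simp add: s_def[symmetric])
qed

lemma square_powr_half:
  fixes x q :: real
  assumes "x \<ge> 0"
  shows "(x\<^sup>2) powr (q/2) = x powr q"
proof (cases "x = 0")
  case False
  then have "x\<^sup>2 = x powr 2" using assms by simp
  then show ?thesis by (simp only: powr_powr) simp
qed simp

lemma powr_sum_le:
  fixes x :: "'a \<Rightarrow> real"
  assumes "\<And>i. i \<in> A \<Longrightarrow> x i \<ge> 0" "0 < q" "q \<le> 1" "finite A"
  shows "(sum x A) powr q \<le> (\<Sum>i\<in>A. x i powr q)"
  using assms(4,1)
proof (induction A)
  case (insert i A)
  have "(sum x (insert i A)) powr q \<le> x i powr q + (sum x A) powr q"
    using insert assms by (simp add: powr_add_le sum_nonneg)
  also have "\<dots> \<le> x i powr q + (\<Sum>i\<in>A. x i powr q)" using insert by simp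
  finally show ?case using insert by simp
qed simp

text \<open>Subadditivity of the power \<open>q\<close> for series. The right side is an extended
  real and may be infinite.\<close>

lemma powr_suminf_le:
  fixes x :: "nat \<Rightarrow> real"
  assumes x: "\<And>i. x i \<ge> 0" "summable x" and q: "0 < q" "q \<le> 1"
  shows "ennreal ((suminf x) powr q) \<le> (\<Sum>i. ennreal (x i powr q))"
proof (rule LIMSEQ_le_const2)
  have "(\<lambda>m. (\<Sum>i<m. x i) powr q) \<longlonglongrightarrow> (suminf x) powr q"
    using q x by (intro tendsto_powr' summable_LIMSEQ tendsto_const) (auto intro!: always_eventually sum_nonneg)
  then show "(\<lambda>m. ennreal ((\<Sum>i<m. x i) powr q)) \<longlonglongrightarrow> ennreal ((suminf x) powr q)"
    by (rule tendsto_ennrealI)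
  show "\<exists>N. \<forall>n\<ge>N. ennreal ((\<Sum>i<n. x i) powr q) \<le> (\<Sum>i. ennreal (x i powr q))"
  proof (intro exI allI impI)
    fix n
    have "ennreal ((\<Sum>i<n. x i) powr q) \<le> ennreal (\<Sum>i<n. x i powr q)"
      using x q by (intro ennreal_leI powr_sum_le) auto
    also have "\<dots> = (\<Sum>i<n. ennreal (x i powr q))" by (rule sum_ennreal[symmetric]) simp
    also have "\<dots> \<le> (\<Sum>i. ennreal (x i powr q))" by (intro sum_le_suminf) auto
    finally show "ennreal ((\<Sum>i<n. x i) powr q) \<le> (\<Sum>i. ennreal (x i powr q))" .
  qed
qed

text \<open>The base is the inverse of \<open>1 + 1/m\<close> with \<open>m = n - 1\<close>, and
  \<open>(1 + 1/m)^m <= e < 3\<close>. Up to distance \<open>1/n\<close> from the circle the power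
  of degree \<open>n - 1\<close> has not yet decayed.\<close>

lemma power_one_minus_inverse_ge:
  assumes "n > 0" shows "(1 - 1 / real n) ^ (n - 1) \<ge> 1/3"
proof (cases "n = 1")
  case False
  define m where "m = n - 1"
  have m: "m > 0" "real n = real m + 1" using assms False by (auto simp: m_def)
  have e: "1 - 1 / real n = inverse (1 + 1 / real m)" using m by (simp add: field_simps)
  have "(1 + 1 / real m) ^ m \<le> (exp (1 / real m)) ^ m" by (intro power_mono) (auto intro: exp_ge_add_one_self add_nonneg_nonneg)
  also have "\<dots> = exp 1" using m by (simp flip: exp_of_nat_mult)
  also have "\<dots> \<le> 3" using e_less_272 by simp
  finally have "inverse ((1 + 1 / real m) ^ m) \<ge> inverse 3" using m by (intro le_imp_inverse_le) (auto intro!: zero_less_power add_pos_pos)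
  then show ?thesis unfolding e m_def[symmetric] by (simp add: power_inverse)
qed simp

lemma nn_integral_powr_unit:
  assumes "a > -1" "0 \<le> c"
  shows "(\<integral>\<^sup>+x\<in>{0..c}. ennreal (x powr a) \<partial>lborel) = ennreal (c powr (a + 1) / (a + 1))"
  by (rule nn_integral_has_integral_lebesgue'[OF _ has_integral_powr_from_0]) (use assms in auto)

lemma nn_integral_one_minus_powr:
  assumes "a > -1" "0 \<le> c"
  shows "(\<integral>\<^sup>+r\<in>{1-c..1}. ennreal ((1 - r) powr a) \<partial>lborel) = ennreal (c powr (a + 1) / (a + 1))"
proof -
  have "(\<integral>\<^sup>+r\<in>{1-c..1}. ennreal ((1 - r) powr a) \<partial>lborel)
    = ennreal \<bar>-1\<bar> * (\<integral>\<^sup>+x. ennreal ((1 - (1 + -1 * x)) powr a) * indicator {1-c..1} (1 + -1 * x) \<partial>lborel)"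
    by (rule nn_integral_real_affine) auto
  also have "\<dots> = (\<integral>\<^sup>+x\<in>{0..c}. ennreal (x powr a) \<partial>lborel)"
    by (auto intro!: nn_integral_cong simp: indicator_def)
  finally show ?thesis using nn_integral_powr_unit[OF assms] by simp
qed

text \<open>The integral is split at \<open>1 - 1/n\<close>. Nearer to 1 the power of
  \<open>r\<close> is dropped; farther away \<open>(1 - r) powr (q - 1)\<close> is at most
  \<open>n powr (1 - q)\<close>. Both parts have the size \<open>n powr (-q)\<close>, which cancels
  the factor from differentiating \<open>z ^ n\<close>.\<close>

lemma nn_integral_beta_le:
  assumes q: "0 < q" "q \<le> 1" and n: "n > 0"
  shows "(\<integral>\<^sup>+r\<in>{0<..<1}. ennreal ((1 - r) powr (q - 1) * (r ^ (n - 1)) powr q) \<partial>lborel) \<le> ennreal (2 / q * real n powr (- q))"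
proof -
  let ?N = "real n"
  have N: "?N \<ge> 1" using n by simp
  have pt: "ennreal ((1 - r) powr (q - 1) * (r ^ (n - 1)) powr q) * indicator {0<..<1} r
     \<le> ennreal (?N powr (1 - q)) * (ennreal (r powr (q * (?N - 1))) * indicator {0..1} r)
       + ennreal ((1 - r) powr (q - 1)) * indicator {1 - 1/?N..1} r" for r
  proof (cases "0 < r \<and> r < 1")
    case True
    have e: "(r ^ (n - 1)) powr q = r powr (q * (?N - 1))"
      using True n by (simp add: powr_realpow[symmetric] powr_powr of_nat_diff mult.commute)
    show ?thesis
    proof (cases "r \<ge> 1 - 1/?N")
      case r: True
      have "(r ^ (n - 1)) powr q \<le> 1" using True q by (intro powr_le1) (auto simp: power_le_one)
      then have "(1 - r) powr (q - 1) * (r ^ (n - 1)) powr q \<le> (1 - r) powr (q - 1)" by (simp add: mult_left_le)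
      then show ?thesis using True r by (simp add: ennreal_leI add_increasing)
    next
      case False
      then have "1/?N \<le> 1 - r" by simp
      then have "(1 - r) powr (q - 1) \<le> (1/?N) powr (q - 1)" using N q by (intro powr_mono2') auto
      also have "\<dots> = ?N powr (1 - q)" using N by (simp add: powr_divide powr_minus_divide[symmetric])
      finally have "(1 - r) powr (q - 1) * (r ^ (n - 1)) powr q \<le> ?N powr (1 - q) * r powr (q * (?N - 1))"
        unfolding e by (intro mult_right_mono) auto
      then have "ennreal ((1 - r) powr (q - 1) * (r ^ (n - 1)) powr q) \<le> ennreal (?N powr (1 - q)) * ennreal (r powr (q * (?N - 1)))"
        by (simp add: ennreal_mult'[symmetric] ennreal_leI)
      then show ?thesis using True False by simp
    qed
  qed simp
  have "(\<integral>\<^sup>+r\<in>{0<..<1}. ennreal ((1 - r) powr (q - 1) * (r ^ (n - 1)) powr q) \<partial>lborel)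
    \<le> (\<integral>\<^sup>+r. ennreal (?N powr (1 - q)) * (ennreal (r powr (q * (?N - 1))) * indicator {0..1} r)
       + ennreal ((1 - r) powr (q - 1)) * indicator {1 - 1/?N..1} r \<partial>lborel)"
    by (intro nn_integral_mono pt)
  also have "\<dots> = ennreal (?N powr (1 - q)) * (\<integral>\<^sup>+r\<in>{0..1}. ennreal (r powr (q * (?N - 1))) \<partial>lborel)
     + (\<integral>\<^sup>+r\<in>{1 - 1/?N..1}. ennreal ((1 - r) powr (q - 1)) \<partial>lborel)"
    by (subst nn_integral_add) (auto simp: nn_integral_cmult)
  also have "(\<integral>\<^sup>+r\<in>{0..1}. ennreal (r powr (q * (?N - 1))) \<partial>lborel) = ennreal (1 / (q * (?N - 1) + 1))"
    using q N by (subst nn_integral_powr_unit) (auto intro: less_le_trans[of _ 0])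
  also have "(\<integral>\<^sup>+r\<in>{1 - 1/?N..1}. ennreal ((1 - r) powr (q - 1)) \<partial>lborel) = ennreal ((1/?N) powr q / q)"
    using q by (subst nn_integral_one_minus_powr) auto
  also have "ennreal (?N powr (1 - q)) * ennreal (1 / (q * (?N - 1) + 1)) + ennreal ((1/?N) powr q / q)
     \<le> ennreal (1 / q * ?N powr (- q)) + ennreal (1 / q * ?N powr (- q))"
  proof (intro add_mono)
    have "q * ?N \<le> q * (?N - 1) + 1" using q by (simp add: algebra_simps)
    moreover have "q * ?N > 0" using q N by simp
    ultimately have "1 / (q * (?N - 1) + 1) \<le> 1 / (q * ?N)" by (intro frac_le) auto
    then have "?N powr (1 - q) * (1 / (q * (?N - 1) + 1)) \<le> ?N powr (1 - q) * (1 / (q * ?N))" by (intro mult_left_mono) auto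
    also have "\<dots> = 1 / q * ?N powr (- q)" using N q by (simp add: powr_diff powr_minus field_simps)
    finally show "ennreal (?N powr (1 - q)) * ennreal (1 / (q * (?N - 1) + 1)) \<le> ennreal (1 / q * ?N powr (- q))"
      by (simp add: ennreal_mult'[symmetric] ennreal_leI)
    show "ennreal ((1/?N) powr q / q) \<le> ennreal (1 / q * ?N powr (- q))"
      using N by (simp add: powr_divide powr_minus_divide mult.commute)
  qed
  also have "\<dots> = ennreal (2 / q * ?N powr (- q))" using q by (subst ennreal_plus[symmetric]) auto
  finally show ?thesis .
qed

text \<open>Winding \<open>m\<close> times around the circle makes an arc long enough for the
  lacunary estimates.\<close>

lemma nn_integral_periodic_multiple_le:
  fixes f :: "real \<Rightarrow> ennreal"
  assumes [measurable]: "f \<in> borel_measurable borel" and per: "\<And>t. f (t + 2*pi) = f t"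
  shows "(\<integral>\<^sup>+t\<in>{0..2*pi*real m}. f t \<partial>lborel) \<le> of_nat m * (\<integral>\<^sup>+t\<in>{0..2*pi}. f t \<partial>lborel)"
proof (induction m)
  case 0
  have "AE t in lborel. f t * indicator {0..0} t = 0"
    using AE_lborel_singleton[of "0::real"] by eventually_elim auto
  then have "(\<integral>\<^sup>+t\<in>{0..0}. f t \<partial>lborel) = 0" by (subst nn_integral_0_iff_AE) auto
  then show ?case by simp
next
  case (Suc m)
  let ?b = "2*pi*real m"
  have "(\<integral>\<^sup>+t\<in>{0..2*pi*real (Suc m)}. f t \<partial>lborel) \<le> (\<integral>\<^sup>+t. f t * indicator {0..?b} t + f t * indicator {?b..?b+2*pi} t \<partial>lborel)"
    by (intro nn_integral_mono) (auto simp: indicator_def algebra_simps)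
  also have "\<dots> = (\<integral>\<^sup>+t\<in>{0..?b}. f t \<partial>lborel) + (\<integral>\<^sup>+t\<in>{?b..?b+2*pi}. f t \<partial>lborel)"
    by (rule nn_integral_add) auto
  also have "(\<integral>\<^sup>+t\<in>{?b..?b+2*pi}. f t \<partial>lborel) = (\<integral>\<^sup>+t\<in>{0..0+2*pi}. f t \<partial>lborel)"
    by (rule nn_integral_periodic_shift) (auto simp: per)
  also have "(\<integral>\<^sup>+t\<in>{0..?b}. f t \<partial>lborel) + (\<integral>\<^sup>+t\<in>{0..0+2*pi}. f t \<partial>lborel) \<le> of_nat m * (\<integral>\<^sup>+t\<in>{0..2*pi}. f t \<partial>lborel) + (\<integral>\<^sup>+t\<in>{0..2*pi}. f t \<partial>lborel)"
    using Suc by (intro add_mono) auto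
  finally show ?case by (simp add: algebra_simps)
qed

lemma continuous_Dspace_integrand:
  assumes "continuous_on udisc f" "0 < p"
  shows "continuous_on udisc (\<lambda>z. (1 - norm z) powr (p' - 1) * norm (f z) powr p / pi)"
proof -
  have "continuous_on udisc (\<lambda>z. (1 - norm z) powr (p' - 1))"
    by (intro continuous_on_powr continuous_intros) auto
  moreover have "continuous_on udisc (\<lambda>z. norm (f z) powr p)"
    using assms by (intro continuous_on_powr' continuous_on_norm continuous_on_const) auto
  ultimately show ?thesis by (intro continuous_on_divide continuous_on_mult continuous_on_const) auto
qed

subsection \<open>Functions given by lacunary power series\<close>

locale lacunary_function =
  fixes g :: "complex \<Rightarrow> complex" and a :: "nat \<Rightarrow> complex" and n :: "nat \<Rightarrow> nat" and lam :: real
  assumes lam: "lam > 1" and n_pos: "\<And>k. 0 < n k" and n_gap: "\<And>k. lam * real (n k) \<le> real (n (Suc k))"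
    and g_sums: "\<And>z. z \<in> udisc \<Longrightarrow> (\<lambda>k. a k * z ^ n k) sums g z"
begin

lemma lac: "lacunary_real lam (\<lambda>k. real (n k))"
  using lam n_pos n_gap by (auto simp: lacunary_real_def)

lemma lac_shift: "lacunary_real lam (\<lambda>k. real (n (k + i)))"
  using lam n_pos n_gap by (auto simp: lacunary_real_def)

lemma n_less_Suc: "n k < n (Suc k)"
proof -
  have "real (n k) < lam * real (n k)" using lam n_pos[of k] by simp
  then have "real (n k) < real (n (Suc k))" using n_gap[of k] by linarith
  then show ?thesis by simp
qed

lemma strict_mono_n: "strict_mono n"
  using n_less_Suc by (simp add: strict_mono_Suc_iff)

lemma n_ge: "n k \<ge> Suc k"
proof (induction k)
  case 0 show ?case using n_pos[of 0] by simp
next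
  case (Suc k) then show ?case using n_less_Suc[of k] by simp
qed

lemma n_mono: "i \<le> j \<Longrightarrow> n i \<le> n j"
  using strict_mono_n by (simp add: strict_mono_less_eq)

text \<open>Coefficients padded with zeros: \<open>g\<close> becomes an ordinary power series, which
  can be differentiated term by term.\<close>

definition coeff_full :: "nat \<Rightarrow> complex" where
  "coeff_full m = (if m \<in> range n then a (inv n m) else 0)"

lemma coeff_full_n [simp]: "coeff_full (n k) = a k"
  using strict_mono_imp_inj_on[OF strict_mono_n] by (simp add: coeff_full_def inv_f_f)

lemma coeff_full_sums: assumes "z \<in> udisc" shows "(\<lambda>m. coeff_full m * z ^ m) sums g z"
proof -
  have "(\<lambda>k. coeff_full (n k) * z ^ n k) sums g z" using g_sums[OF assms] by simp
  then show ?thesis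
    by (subst (asm) sums_mono_reindex[OF strict_mono_n, of "\<lambda>m. coeff_full m * z ^ m"]) (auto simp: coeff_full_def)
qed

lemma summable_diffs: assumes "norm z < 1" shows "summable (\<lambda>m. diffs coeff_full m * z ^ m)"
  by (rule termdiff_converges[OF assms]) (use coeff_full_sums in \<open>auto simp: sums_iff\<close>)

lemma strict_mono_n_minus: "strict_mono (\<lambda>k. n k - 1)"
  unfolding strict_mono_Suc_iff using n_less_Suc n_pos by (metis diff_less_mono Suc_leI One_nat_def)

lemma diffs_zero: assumes "m \<notin> range (\<lambda>k. n k - 1)" shows "diffs coeff_full m = 0"
proof -
  have "Suc m \<notin> range n"
  proof
    assume "Suc m \<in> range n"
    then obtain k where "Suc m = n k" by auto
    then have "m = n k - 1" by simp
    then show False using assms by auto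
  qed
  then show ?thesis by (simp add: diffs_def coeff_full_def)
qed

lemma diffs_n: "diffs coeff_full (n k - Suc 0) = of_nat (n k) * a k"
proof -
  have "Suc (n k - Suc 0) = n k" using n_pos[of k] by simp
  then show ?thesis by (simp add: diffs_def)
qed

lemma deriv_g_sums:
  assumes z: "z \<in> udisc"
  shows "(\<lambda>k. of_nat (n k) * a k * z ^ (n k - 1)) sums deriv g z"
proof -
  have z1: "norm z < 1" using z by simp
  have "((\<lambda>z. \<Sum>m. coeff_full m * z ^ m) has_field_derivative (\<Sum>m. diffs coeff_full m * z ^ m)) (at z)"
    by (rule termdiffs_strong'[OF _ z1]) (use coeff_full_sums in \<open>auto simp: sums_iff\<close>)
  then have "(g has_field_derivative (\<Sum>m. diffs coeff_full m * z ^ m)) (at z)"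
    by (rule DERIV_cong_ev[OF refl _ refl, THEN iffD1, rotated])
       (use z coeff_full_sums in \<open>auto simp: sums_iff eventually_nhds intro!: exI[of _ udisc]\<close>)
  then have d: "deriv g z = (\<Sum>m. diffs coeff_full m * z ^ m)" by (rule DERIV_imp_deriv)
  have "(\<lambda>m. diffs coeff_full m * z ^ m) sums deriv g z"
    unfolding d using summable_diffs[OF z1] by (rule summable_sums)
  then show ?thesis
    by (subst (asm) sums_mono_reindex[OF strict_mono_n_minus, symmetric]) (auto simp: diffs_zero diffs_n)
qed

text \<open>Coefficients of \<open>cis t * deriv g (r * cis t)\<close>. The extra factor of modulus
  1 raises the frequencies from \<open>n k - 1\<close> to \<open>n k\<close>, so that they stay
  positive and lacunary with the same ratio.\<close>

definition dcoeff :: "real \<Rightarrow> nat \<Rightarrow> complex" where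
  "dcoeff r k = of_nat (n k) * a k * of_real (r ^ (n k - 1))"

lemma norm_dcoeff: "r \<ge> 0 \<Longrightarrow> norm (dcoeff r k) = real (n k) * norm (a k) * r ^ (n k - 1)"
  by (simp add: dcoeff_def norm_mult norm_power)

lemma summable_norm_dcoeff:
  assumes r: "0 \<le> r" "r < 1"
  shows "summable (\<lambda>k. norm (dcoeff r k))"
proof -
  define R where "R = (1 + r) / 2"
  have R: "r < R" "R < 1" "0 < R" using r by (auto simp: R_def)
  have "summable (\<lambda>m. diffs coeff_full m * (of_real R) ^ m)" using R by (intro summable_diffs) auto
  then have "summable (\<lambda>m. norm (diffs coeff_full m * (of_real r) ^ m))"
    by (rule powser_insidea) (use R r in auto)
  then have "summable (\<lambda>k. norm (diffs coeff_full (n k - 1) * (of_real r) ^ (n k - 1)))"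
    by (subst summable_mono_reindex[OF strict_mono_n_minus]) (auto simp: diffs_zero)
  then show ?thesis by (simp add: diffs_n dcoeff_def)
qed

lemma deriv_g_circle:
  assumes r: "0 \<le> r" "r < 1"
  shows "norm (deriv g (of_real r * cis t)) = norm (\<Sum>k. dcoeff r k * cis (real (n k) * t))"
proof -
  have z: "of_real r * cis t \<in> udisc" using r by (simp add: norm_mult)
  have "(\<lambda>k. cis t * (of_nat (n k) * a k * (of_real r * cis t) ^ (n k - 1))) sums (cis t * deriv g (of_real r * cis t))"
    by (intro sums_mult deriv_g_sums z)
  moreover have "cis t * (of_nat (n k) * a k * (of_real r * cis t) ^ (n k - 1)) = dcoeff r k * cis (real (n k) * t)" for k
  proof -
    have "cis t * cis t ^ (n k - 1) = cis t ^ n k" using n_pos[of k] by (metis power_Suc Suc_diff_1)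
    moreover have "cis (real (n k) * t) = cis t ^ n k" by (rule Complex.DeMoivre[symmetric])
    ultimately show ?thesis by (simp add: dcoeff_def power_mult_distrib mult_ac)
  qed
  ultimately have "(\<Sum>k. dcoeff r k * cis (real (n k) * t)) = cis t * deriv g (of_real r * cis t)"
    by (simp add: sums_iff)
  then show ?thesis by (simp add: norm_mult)
qed

lemma norm_deriv_g_le:
  assumes r: "0 \<le> r" "r < 1"
  shows "norm (deriv g (of_real r * cis t)) \<le> (\<Sum>k. norm (dcoeff r k))"
  unfolding deriv_g_circle[OF r] by (rule norm_cis_series_le(1)[OF summable_norm_dcoeff[OF r]])

lemma analytic_g: "analytic_disc g"
  unfolding analytic_disc_def
proof (rule holomorphic_on_open[OF open_ball, THEN iffD2], intro ballI)
  fix z assume z: "z \<in> udisc"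
  then have z1: "norm z < 1" by simp
  have "((\<lambda>z. \<Sum>m. coeff_full m * z ^ m) has_field_derivative (\<Sum>m. diffs coeff_full m * z ^ m)) (at z)"
    by (rule termdiffs_strong'[OF _ z1]) (use coeff_full_sums in \<open>auto simp: sums_iff\<close>)
  then have "(g has_field_derivative (\<Sum>m. diffs coeff_full m * z ^ m)) (at z)"
    by (rule DERIV_cong_ev[OF refl _ refl, THEN iffD1, rotated])
       (use z coeff_full_sums in \<open>auto simp: sums_iff eventually_nhds intro!: exI[of _ udisc]\<close>)
  then show "\<exists>f'. (g has_field_derivative f') (at z)" by blast
qed

lemma hol_g: "g holomorphic_on udisc" using analytic_g by (simp add: analytic_disc_def)

lemma continuous_deriv_g: "continuous_on udisc (deriv g)"
  by (intro holomorphic_on_imp_continuous_on holomorphic_deriv hol_g) auto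

text \<open>Of the whole coefficient sum only the single term \<open>k\<close> is kept. The point is
  that \<open>\<kappa>\<close> depends neither on \<open>r\<close> nor on \<open>k\<close>.\<close>

lemma deriv_g_circle_powr_lower:
  assumes q: "0 < q" "q \<le> 1"
  obtains \<kappa> where "\<kappa> > 0" "\<And>r k. 0 < r \<Longrightarrow> r < 1 \<Longrightarrow>
    ennreal (\<kappa> * norm (dcoeff r k) powr q) \<le> (\<integral>\<^sup>+t\<in>{0..2*pi}. ennreal (norm (deriv g (of_real r * cis t)) powr q) \<partial>lborel)"
proof -
  \<comment> \<open>\<open>n 0\<close> may be 1, so one turn can be too short for the threshold;
    \<open>m\<close> turns make \<open>L * n k\<close> large enough for every
    \<open>k\<close>.\<close>
  define m where "m = nat \<lceil>lac_threshold lam\<rceil>"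
  have m: "real m \<ge> lac_threshold lam" "m > 0"
    using lac_threshold_ge[OF lam] unfolding m_def by linarith+
  define L where "L = 2 * pi * real m"
  have L: "L > 0" using m by (simp add: L_def)
  have big: "lac_threshold lam \<le> L * real (n k)" for k
  proof -
    have "1 * 1 \<le> 2 * pi * real (n k)" using n_pos[of k] pi_gt3 by (intro mult_mono) auto
    then have "real m * 1 \<le> real m * (2 * pi * real (n k))" by (intro mult_left_mono) auto
    moreover have "L * real (n k) = real m * (2 * pi * real (n k))" by (simp add: L_def)
    ultimately show ?thesis using m by linarith
  qed
  define \<delta> where "\<delta> = L^3 / (24 * (39168 * (lac_const lam + 1)\<^sup>2) powr (1 - q/2))"
  have d: "\<delta> > 0" using L lac_const_pos[OF lam] unfolding \<delta>_def by (intro divide_pos_pos mult_pos_pos) auto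
  define \<kappa> where "\<kappa> = \<delta> / (L\<^sup>2/4 * real m)"
  show thesis
  proof (rule that[of \<kappa>])
    show "\<kappa> > 0" using d L m by (simp add: \<kappa>_def)
    fix r :: real and k assume r: "0 < r" "r < 1"
    let ?h = "\<lambda>t. \<Sum>k. dcoeff r k * cis (real (n k) * t)"
    have sm: "summable (\<lambda>k. norm (dcoeff r k))" using r by (intro summable_norm_dcoeff) auto
    have hc: "continuous_on S ?h" for S by (rule continuous_on_cis_series[OF sm])
    have hq: "continuous_on S (\<lambda>t. norm (?h t) powr q)" for S
      using q by (intro continuous_on_powr' continuous_intros hc) auto
    have [measurable]: "(\<lambda>t. norm (?h t) powr q) \<in> borel_measurable borel" by (rule borel_measurable_continuous_onI[OF hq])
    have per: "?h (t + 2*pi) = ?h t" for t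
    proof -
      have "cis (real (n k) * (t + 2*pi)) = cis (real (n k) * t)" for k
      proof -
        have "cis (real (n k) * (2*pi)) = cis (2*pi) ^ n k" by (rule Complex.DeMoivre[symmetric])
        then show ?thesis by (simp only: distrib_left cis_mult[symmetric] cis_2pi power_one mult_1_right)
      qed
      then show ?thesis by simp
    qed
    let ?X = "\<integral>\<^sup>+t\<in>{0..2*pi}. ennreal (norm (?h t) powr q) \<partial>lborel"
    have "\<delta> * norm (dcoeff r k) powr q = \<delta> * ((norm (dcoeff r k))\<^sup>2) powr (q/2)"
      by (simp only: square_powr_half norm_ge_zero)
    also have "\<dots> \<le> \<delta> * (\<Sum>j<Suc k. (norm (dcoeff r j))\<^sup>2) powr (q/2)"
      using d q by (intro mult_left_mono powr_mono2 member_le_sum) auto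
    also have "\<dots> \<le> integral {0..0+L} (\<lambda>t. arc_weight 0 L t * norm (0 + ?h t) powr q)"
      unfolding \<delta>_def by (rule lacunary_series_powr_lower[OF lac L q sm big])
    also have "\<dots> \<le> integral {0..L} (\<lambda>t. L\<^sup>2/4 * norm (?h t) powr q)"
      unfolding add_0_left by (intro integral_le integrable_continuous_interval continuous_intros hq mult_right_mono arc_weight_le) auto
    also have "\<dots> = L\<^sup>2/4 * integral {0..L} (\<lambda>t. norm (?h t) powr q)" by simp
    finally have "ennreal (\<delta> * norm (dcoeff r k) powr q) \<le> ennreal (L\<^sup>2/4 * integral {0..L} (\<lambda>t. norm (?h t) powr q))"
      by (rule ennreal_leI)
    also have "\<dots> = ennreal (L\<^sup>2/4) * ennreal (integral {0..L} (\<lambda>t. norm (?h t) powr q))"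
      by (rule ennreal_mult') simp
    also have "ennreal (integral {0..L} (\<lambda>t. norm (?h t) powr q)) = (\<integral>\<^sup>+t\<in>{0..L}. ennreal (norm (?h t) powr q) \<partial>lborel)"
      by (rule nn_integral_eq_integral_continuous[OF hq, symmetric]) auto
    also have "ennreal (L\<^sup>2/4) * (\<integral>\<^sup>+t\<in>{0..L}. ennreal (norm (?h t) powr q) \<partial>lborel) \<le> ennreal (L\<^sup>2/4) * (of_nat m * ?X)"
      unfolding L_def by (intro mult_left_mono nn_integral_periodic_multiple_le) (auto simp: per)
    also have "\<dots> = ennreal (L\<^sup>2/4 * real m) * ?X"
    proof -
      have "ennreal (L\<^sup>2/4) * of_nat m = ennreal (L\<^sup>2/4 * real m)"
        by (subst ennreal_mult) (auto simp: ennreal_of_nat_eq_real_of_nat)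
      then show ?thesis by (simp only: mult.assoc[symmetric])
    qed
    finally have *: "ennreal (\<delta> * norm (dcoeff r k) powr q) \<le> ennreal (L\<^sup>2/4 * real m) * ?X" .
    have pos: "L\<^sup>2/4 * real m > 0" using L m by simp
    have "ennreal (\<kappa> * norm (dcoeff r k) powr q) = ennreal (1 / (L\<^sup>2/4 * real m)) * ennreal (\<delta> * norm (dcoeff r k) powr q)"
      using pos d by (subst ennreal_mult[symmetric]) (auto simp: \<kappa>_def)
    also have "\<dots> \<le> ennreal (1 / (L\<^sup>2/4 * real m)) * (ennreal (L\<^sup>2/4 * real m) * ?X)"
      by (intro mult_left_mono *) auto
    also have "\<dots> = ?X"
    proof -
      have "ennreal (1 / c) * ennreal c = 1" if "c > 0" for c :: real
        using that by (subst ennreal_mult[symmetric]) auto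
      from this[OF pos] show ?thesis by (simp only: mult.assoc[symmetric] mult_1_left)
    qed
    finally show "ennreal (\<kappa> * norm (dcoeff r k) powr q) \<le> (\<integral>\<^sup>+t\<in>{0..2*pi}. ennreal (norm (deriv g (of_real r * cis t)) powr q) \<partial>lborel)"
      using deriv_g_circle[of r] r by simp
  qed
qed

text \<open>Each coefficient is read off on its own annulus at distance about \<open>1 / n k\<close>
  from the circle. There the weight, the factor \<open>n k powr q\<close> and the width of the
  annulus multiply to a constant.\<close>

lemma Dspace_imp_summable:
  assumes gD: "g \<in> Dspace q" and q: "0 < q" "q \<le> 1"
  shows "summable (\<lambda>k. norm (a k) powr q)"
proof -
  obtain \<kappa> where k0: "\<kappa> > 0" and kap: "\<And>r k. 0 < r \<Longrightarrow> r < 1 \<Longrightarrow>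
    ennreal (\<kappa> * norm (dcoeff r k) powr q) \<le> (\<integral>\<^sup>+t\<in>{0..2*pi}. ennreal (norm (deriv g (of_real r * cis t)) powr q) \<partial>lborel)"
    by (rule deriv_g_circle_powr_lower[OF q]) blast
  define I where "I = (\<integral>\<^sup>+ z \<in> udisc. ennreal ((1 - cmod z) powr (q - 1) * cmod (deriv g z) powr q / pi) \<partial>lborel)"
  have Ifin: "I < \<infinity>" using gD by (simp add: Dspace_def I_def)
  \<comment> \<open>The outer end is \<open>1 - 1 / (lam * n k)\<close> because the gap condition
    puts the next annulus beyond it.\<close>
  define J where "J k = {1 - 1 / real (n k)..<1 - 1 / (lam * real (n k))}" for k
  have Jdisj: "J i \<inter> J k = {}" if "i < k" for i k
  proof -
    have "lam * real (n i) \<le> real (n k)" using lacunary_real_gap[OF lac that] by simp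
    then have "1 / real (n k) \<le> 1 / (lam * real (n i))" using lam n_pos[of i] by (intro frac_le) auto
    then show ?thesis by (auto simp: J_def)
  qed
  \<comment> \<open>The factor 1/2 comes from \<open>r >= 1/2\<close>, 1/3 from the power of
    \<open>r\<close>, \<open>1 - 1/lam\<close> from the width of the annulus multiplied by
    \<open>n k\<close>.\<close>
  define w where "w = \<kappa> / (6 * pi) * (1 - 1/lam)"
  have w: "w > 0" using k0 lam by (simp add: w_def)
  \<comment> \<open>The index 0 is left out: if \<open>n 0 = 1\<close> its annulus reaches down to
    the centre, where \<open>r >= 1/2\<close> fails.\<close>
  have bound: "(\<Sum>k\<in>{1..<N}. ennreal (w * norm (a k) powr q)) \<le> I" for N
  proof -
    have Jint: "ennreal (w * norm (a k) powr q) \<le> (\<integral>\<^sup>+r. ennreal (r * (1 - r) powr (q - 1) / pi) * ennreal (\<kappa> * norm (dcoeff r k) powr q) * indicator (J k) r \<partial>lborel)"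
      if k: "k \<ge> 1" for k
    proof -
      let ?N = "real (n k)"
      have N: "?N \<ge> 2" using n_ge[of k] k by simp
      have "ennreal (w * norm (a k) powr q) = (\<integral>\<^sup>+r. ennreal (?N * \<kappa> / (6*pi) * norm (a k) powr q) * indicator (J k) r \<partial>lborel)"
      proof -
        have "1 / (lam * ?N) \<le> 1 / ?N" using lam N by (intro frac_le) auto
        then have "emeasure lborel (J k) = ennreal ((1 - 1 / (lam * ?N)) - (1 - 1 / ?N))"
          unfolding J_def by (subst emeasure_lborel_Ico) auto
        also have "(1 - 1 / (lam * ?N)) - (1 - 1 / ?N) = (1 - 1/lam) / ?N" using lam N by (simp add: field_simps)
        finally have "(\<integral>\<^sup>+r. ennreal (?N * \<kappa> / (6*pi) * norm (a k) powr q) * indicator (J k) r \<partial>lborel) = ennreal (?N * \<kappa> / (6*pi) * norm (a k) powr q) * ennreal ((1 - 1/lam) / ?N)"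
          by (subst nn_integral_cmult_indicator) (auto simp: J_def)
        also have "\<dots> = ennreal (w * norm (a k) powr q)"
          using N k0 lam by (subst ennreal_mult'[symmetric]) (auto simp: w_def)
        finally show ?thesis by simp
      qed
      also have "\<dots> \<le> (\<integral>\<^sup>+r. ennreal (r * (1 - r) powr (q - 1) / pi) * ennreal (\<kappa> * norm (dcoeff r k) powr q) * indicator (J k) r \<partial>lborel)"
      proof (rule nn_integral_mono)
        fix r
        show "ennreal (?N * \<kappa> / (6*pi) * norm (a k) powr q) * indicator (J k) r \<le> ennreal (r * (1 - r) powr (q - 1) / pi) * ennreal (\<kappa> * norm (dcoeff r k) powr q) * indicator (J k) r"
        proof (cases "r \<in> J k")
          case True
          have r1: "1 - 1/?N \<le> r" "r < 1 - 1 / (lam * ?N)" using True by (auto simp: J_def)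
          have "1 / (lam * ?N) > 0" using lam N by simp
          then have r2: "r < 1" using r1 by linarith
          have "1/?N \<le> 1/2" using N by (intro divide_left_mono) auto
          then have r3: "r \<ge> 1/2" using r1 by linarith
          have "1 - r \<le> 1/?N" using r1 by simp
          then have A: "?N powr (1 - q) \<le> (1 - r) powr (q - 1)"
          proof -
            have "(1/?N) powr (q - 1) \<le> (1 - r) powr (q - 1)" using \<open>1 - r \<le> 1/?N\<close> r2 q by (intro powr_mono2') auto
            moreover have "(1/?N) powr (q - 1) = ?N powr (1 - q)" using N by (simp add: powr_divide powr_minus_divide[symmetric])
            ultimately show ?thesis by simp
          qed
          have "1/3 \<le> (1 - 1/?N) ^ (n k - 1)" by (rule power_one_minus_inverse_ge[OF n_pos])
          also have "\<dots> \<le> r ^ (n k - 1)" using r1 N by (intro power_mono) auto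
          finally have rn: "1/3 \<le> r ^ (n k - 1)" .
          have "(1/3::real) powr 1 \<le> (1/3) powr q" using q by (intro powr_mono') auto
          also have "\<dots> \<le> (r ^ (n k - 1)) powr q" using rn q by (intro powr_mono2) auto
          finally have B: "1/3 \<le> (r ^ (n k - 1)) powr q" by simp
          have "norm (dcoeff r k) powr q = ?N powr q * norm (a k) powr q * (r ^ (n k - 1)) powr q"
            using r3 by (simp add: norm_dcoeff powr_mult)
          also have "\<dots> \<ge> ?N powr q * norm (a k) powr q * (1/3)" by (intro mult_left_mono B) auto
          finally have D: "?N powr q * norm (a k) powr q * (1/3) \<le> norm (dcoeff r k) powr q" .
          have "?N * \<kappa> / (6*pi) * norm (a k) powr q = (1/2 * ?N powr (1 - q) / pi) * (\<kappa> * (?N powr q * norm (a k) powr q * (1/3)))"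
          proof -
            have "?N = ?N powr (1 - q) * ?N powr q" using N by (simp flip: powr_add)
            then show ?thesis by (simp add: field_simps)
          qed
          also have "\<dots> \<le> (r * (1 - r) powr (q - 1) / pi) * (\<kappa> * norm (dcoeff r k) powr q)"
            using A D r3 k0 by (intro mult_mono divide_right_mono) auto
          finally have "ennreal (?N * \<kappa> / (6*pi) * norm (a k) powr q) \<le> ennreal (r * (1 - r) powr (q - 1) / pi) * ennreal (\<kappa> * norm (dcoeff r k) powr q)"
            using r3 by (subst ennreal_mult'[symmetric]) (auto intro: ennreal_leI)
          then show ?thesis using True by simp
        qed simp
      qed
      finally show ?thesis .
    qed
    have [measurable]: "(\<lambda>r. norm (dcoeff r k)) \<in> borel_measurable borel" for k unfolding dcoeff_def by measurable
    have [measurable]: "J k \<in> sets borel" for k by (simp add: J_def)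
    have "(\<Sum>k\<in>{1..<N}. ennreal (w * norm (a k) powr q)) \<le> (\<Sum>k\<in>{1..<N}. (\<integral>\<^sup>+r. ennreal (r * (1 - r) powr (q - 1) / pi) * ennreal (\<kappa> * norm (dcoeff r k) powr q) * indicator (J k) r \<partial>lborel))"
      by (intro sum_mono Jint) auto
    also have "\<dots> = (\<integral>\<^sup>+r. (\<Sum>k\<in>{1..<N}. ennreal (r * (1 - r) powr (q - 1) / pi) * ennreal (\<kappa> * norm (dcoeff r k) powr q) * indicator (J k) r) \<partial>lborel)"
      by (rule nn_integral_sum[symmetric]) measurable
    also have "\<dots> \<le> (\<integral>\<^sup>+r\<in>{0<..<1}. (\<integral>\<^sup>+t\<in>{0..0+2*pi}. ennreal (r * ((1 - cmod (of_real r * cis t)) powr (q - 1) * cmod (deriv g (of_real r * cis t)) powr q / pi)) \<partial>lborel) \<partial>lborel)"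
    proof (rule nn_integral_mono)
      fix r
      let ?R = "(\<integral>\<^sup>+t\<in>{0..0+2*pi}. ennreal (r * ((1 - cmod (of_real r * cis t)) powr (q - 1) * cmod (deriv g (of_real r * cis t)) powr q / pi)) \<partial>lborel) * indicator {0<..<1} r"
      have Jr: "0 < r \<and> r < 1" if "r \<in> J k" "k \<ge> 1" for k
      proof -
        have "1 / real (n k) < 1" using n_ge[of k] that by simp
        moreover have "1 / (lam * real (n k)) > 0" using lam n_pos[of k] by simp
        moreover have "1 - 1 / real (n k) \<le> r" "r < 1 - 1 / (lam * real (n k))" using that(1) by (auto simp: J_def)
        ultimately show ?thesis by linarith
      qed
      show "(\<Sum>k\<in>{1..<N}. ennreal (r * (1 - r) powr (q - 1) / pi) * ennreal (\<kappa> * norm (dcoeff r k) powr q) * indicator (J k) r) \<le> ?R"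
      proof (cases "\<exists>k\<in>{1..<N}. r \<in> J k")
        case False
        then have "(\<Sum>k\<in>{1..<N}. ennreal (r * (1 - r) powr (q - 1) / pi) * ennreal (\<kappa> * norm (dcoeff r k) powr q) * indicator (J k) r) = 0"
          by (intro sum.neutral) auto
        then show ?thesis by (simp only: zero_le)
      next
        case True
        then obtain k where k: "k \<in> {1..<N}" "r \<in> J k" by blast
        have r: "0 < r" "r < 1" using Jr[OF k(2)] k by auto
        have out: "r \<notin> J i" if "i \<noteq> k" for i using Jdisj[of i k] Jdisj[of k i] k that by (cases "i < k") auto
        have dc: "continuous_on S (\<lambda>t. deriv g (of_real r * cis t))" for S
          by (rule analytic_disc_radial(1)[OF holomorphic_deriv[OF hol_g] r]) auto
        have [measurable]: "(\<lambda>t. deriv g (of_real r * cis t)) \<in> borel_measurable borel"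
          by (rule borel_measurable_continuous_onI[OF dc])
        have "(\<Sum>k\<in>{1..<N}. ennreal (r * (1 - r) powr (q - 1) / pi) * ennreal (\<kappa> * norm (dcoeff r k) powr q) * indicator (J k) r)
          = ennreal (r * (1 - r) powr (q - 1) / pi) * ennreal (\<kappa> * norm (dcoeff r k) powr q)"
          using k out by (subst sum.remove[of _ k]) (auto intro!: sum.neutral)
        also have "\<dots> \<le> ennreal (r * (1 - r) powr (q - 1) / pi) * (\<integral>\<^sup>+t\<in>{0..2*pi}. ennreal (norm (deriv g (of_real r * cis t)) powr q) \<partial>lborel)"
          by (intro mult_left_mono kap r) auto
        also have "\<dots> = (\<integral>\<^sup>+t\<in>{0..2*pi}. ennreal (r * (1 - r) powr (q - 1) / pi) * ennreal (norm (deriv g (of_real r * cis t)) powr q) \<partial>lborel)"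
          by (subst nn_integral_cmult[symmetric]) (auto simp: mult.assoc)
        also have "\<dots> = ?R"
          using r by (auto intro!: nn_integral_cong simp: ennreal_mult'[symmetric] norm_mult mult_ac)
        finally show ?thesis .
      qed
    qed
    also have "\<dots> = I"
      unfolding I_def by (rule nn_integral_udisc_polar_full[symmetric])
        (intro continuous_Dspace_integrand continuous_deriv_g q, auto)
    finally show ?thesis .
  qed
  obtain B where B: "B \<ge> 0" "I = ennreal B" using Ifin by (cases I) auto
  have "(\<Sum>k\<in>{1..<N}. w * norm (a k) powr q) \<le> B" for N
  proof -
    have "ennreal (\<Sum>k\<in>{1..<N}. w * norm (a k) powr q) \<le> ennreal B"
      using bound[of N] B w by (subst sum_ennreal[symmetric]) auto
    then show ?thesis using B by (simp add: ennreal_le_iff)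
  qed note b2 = this
  have "summable (\<lambda>k. w * norm (a (Suc k)) powr q)"
  proof (rule bounded_imp_summable)
    fix N
    have "(\<Sum>k\<le>N. w * norm (a (Suc k)) powr q) = (\<Sum>k\<in>{1..<Suc (Suc N)}. w * norm (a k) powr q)"
      by (rule sum.reindex_bij_witness[of _ "\<lambda>k. k - 1" Suc]) auto
    then show "(\<Sum>k\<le>N. w * norm (a (Suc k)) powr q) \<le> B" by (simp only: b2)
  qed (use w in auto)
  from summable_mult[OF this, of "1/w"] have "summable (\<lambda>k. norm (a (Suc k)) powr q)" using w by simp
  then show ?thesis using summable_Suc_iff[of "\<lambda>k. norm (a k) powr q"] by simp
qed

text \<open>On each circle \<open>g'\<close> is bounded by the sum of its coefficient moduli, a
  quantity independent of the angle, so it leaves the inner integral and only the mean of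
  \<open>|f| powr q\<close> remains. Subadditivity of the power then reduces to one radial integral
  per coefficient.\<close>

lemma nn_integral_mult_deriv_finite:
  assumes f: "f \<in> H1" and q: "0 < q" "q \<le> 1" and sm: "summable (\<lambda>k. norm (a k) powr q)"
  shows "(\<integral>\<^sup>+ z \<in> udisc. ennreal ((1 - cmod z) powr (q - 1) * cmod (f z * deriv g z) powr q / pi) \<partial>lborel) < \<infinity>"
proof -
  have hol: "f holomorphic_on udisc" using f by (simp add: H1_def analytic_disc_def)
  obtain M where M: "M > 0" "\<And>r b. 0 < r \<Longrightarrow> r < 1 \<Longrightarrow> integral {b..b+2*pi} (\<lambda>t. norm (f (of_real r * cis t))) \<le> M"
    using H1_arc_bound[OF f] by metis
  \<comment> \<open>\<open>x powr q <= 1 + x\<close> bounds the \<open>q\<close>-means of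
    \<open>f\<close> over circles by its first means.\<close>
  define B where "B = 2*pi + M"
  have B: "B > 0" using M by (simp add: B_def add_pos_pos)
  have fq: "(\<integral>\<^sup>+t\<in>{0..0+2*pi}. ennreal (norm (f (of_real r * cis t)) powr q) \<partial>lborel) \<le> ennreal B" if r: "0 < r" "r < 1" for r
  proof -
    have fc: "continuous_on S (\<lambda>t. f (of_real r * cis t))" for S by (rule analytic_disc_radial(1)[OF hol r])
    have "(\<integral>\<^sup>+t\<in>{0..0+2*pi}. ennreal (norm (f (of_real r * cis t)) powr q) \<partial>lborel) \<le> (\<integral>\<^sup>+t\<in>{0..0+2*pi}. ennreal (1 + norm (f (of_real r * cis t))) \<partial>lborel)"
    proof (intro nn_integral_mono mult_right_mono ennreal_leI)
      fix t
      show "norm (f (of_real r * cis t)) powr q \<le> 1 + norm (f (of_real r * cis t))"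
        using powr_mono2[of q "norm (f (of_real r * cis t))" "1 + norm (f (of_real r * cis t))"]
          powr_mono[of q 1 "1 + norm (f (of_real r * cis t))"] q by simp
    qed auto
    also have "\<dots> = ennreal (integral {0..0+2*pi} (\<lambda>t. 1 + norm (f (of_real r * cis t))))"
      by (rule nn_integral_eq_integral_continuous) (auto intro!: continuous_intros fc)
    also have "integral {0..0+2*pi} (\<lambda>t. 1 + norm (f (of_real r * cis t))) = 2*pi + integral {0..0+2*pi} (\<lambda>t. norm (f (of_real r * cis t)))"
      by (subst integral_add) (auto intro!: integrable_continuous_interval continuous_intros fc)
    also have "ennreal \<dots> \<le> ennreal B" unfolding B_def using M(2)[OF r, of 0] by (intro ennreal_leI) auto
    finally show ?thesis .
  qed
  let ?w = "\<lambda>k r. ennreal ((real (n k) * norm (a k)) powr q) * (ennreal ((1 - r) powr (q - 1) * (r ^ (n k - 1)) powr q) * indicator {0<..<1} r)"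
  have pt: "(\<integral>\<^sup>+t\<in>{0..0+2*pi}. ennreal (r * ((1 - cmod (of_real r * cis t)) powr (q - 1) * cmod (f (of_real r * cis t) * deriv g (of_real r * cis t)) powr q / pi)) \<partial>lborel) * indicator {0<..<1} r
      \<le> ennreal B * (\<Sum>k. ?w k r)" for r :: real
  proof (cases "0 < r \<and> r < 1")
    case True
    then have r: "0 < r" "r < 1" by auto
    have sd: "summable (\<lambda>k. norm (dcoeff r k))" using r by (intro summable_norm_dcoeff) auto
    define S where "S = (\<Sum>k. norm (dcoeff r k))"
    have fc: "continuous_on T (\<lambda>t. f (of_real r * cis t))" for T by (rule analytic_disc_radial(1)[OF hol r])
    have [measurable]: "(\<lambda>t. f (of_real r * cis t)) \<in> borel_measurable borel" by (rule borel_measurable_continuous_onI[OF fc])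
    have "(\<integral>\<^sup>+t\<in>{0..0+2*pi}. ennreal (r * ((1 - cmod (of_real r * cis t)) powr (q - 1) * cmod (f (of_real r * cis t) * deriv g (of_real r * cis t)) powr q / pi)) \<partial>lborel)
      \<le> (\<integral>\<^sup>+t. ennreal ((1 - r) powr (q - 1) * S powr q) * (ennreal (norm (f (of_real r * cis t)) powr q) * indicator {0..0+2*pi} t) \<partial>lborel)"
    proof (rule nn_integral_mono)
      fix t
      have "cmod (f (of_real r * cis t) * deriv g (of_real r * cis t)) powr q \<le> norm (f (of_real r * cis t)) powr q * S powr q"
        using norm_deriv_g_le[of r t] r q unfolding S_def norm_mult powr_mult by (intro mult_left_mono powr_mono2) auto
      then have "(1 - r) powr (q - 1) * cmod (f (of_real r * cis t) * deriv g (of_real r * cis t)) powr q \<le> (1 - r) powr (q - 1) * (norm (f (of_real r * cis t)) powr q * S powr q)"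
        by (intro mult_left_mono) auto
      moreover have "r * (x / pi) \<le> x" if "x \<ge> 0" for x
      proof -
        have "r * x \<le> pi * x" using r pi_gt3 that by (intro mult_right_mono) auto
        then show ?thesis by (simp add: field_simps)
      qed
      ultimately have "r * ((1 - r) powr (q - 1) * cmod (f (of_real r * cis t) * deriv g (of_real r * cis t)) powr q / pi)
         \<le> (1 - r) powr (q - 1) * (norm (f (of_real r * cis t)) powr q * S powr q)"
        by (meson order_trans mult_nonneg_nonneg powr_ge_zero)
      then have "ennreal (r * ((1 - cmod (of_real r * cis t)) powr (q - 1) * cmod (f (of_real r * cis t) * deriv g (of_real r * cis t)) powr q / pi))
        \<le> ennreal ((1 - r) powr (q - 1) * S powr q) * ennreal (norm (f (of_real r * cis t)) powr q)"
        using r by (subst ennreal_mult[symmetric]) (auto simp: norm_mult mult_ac intro!: ennreal_leI)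
      then show "ennreal (r * ((1 - cmod (of_real r * cis t)) powr (q - 1) * cmod (f (of_real r * cis t) * deriv g (of_real r * cis t)) powr q / pi)) * indicator {0..0+2*pi} t
         \<le> ennreal ((1 - r) powr (q - 1) * S powr q) * (ennreal (norm (f (of_real r * cis t)) powr q) * indicator {0..0+2*pi} t)"
        by (auto simp: indicator_def)
    qed
    also have "\<dots> = ennreal ((1 - r) powr (q - 1) * S powr q) * (\<integral>\<^sup>+t\<in>{0..0+2*pi}. ennreal (norm (f (of_real r * cis t)) powr q) \<partial>lborel)"
      by (rule nn_integral_cmult) measurable
    also have "\<dots> \<le> ennreal ((1 - r) powr (q - 1) * S powr q) * ennreal B"
      by (intro mult_left_mono fq r) auto
    also have "\<dots> = ennreal B * (ennreal ((1 - r) powr (q - 1)) * ennreal (S powr q))"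
      by (simp add: ennreal_mult mult.commute)
    also have "\<dots> \<le> ennreal B * (ennreal ((1 - r) powr (q - 1)) * (\<Sum>k. ennreal (norm (dcoeff r k) powr q)))"
      unfolding S_def by (intro mult_left_mono powr_suminf_le sd q) auto
    also have "\<dots> = ennreal B * (\<Sum>k. ?w k r)"
    proof -
      have "ennreal ((1 - r) powr (q - 1)) * ennreal (norm (dcoeff r k) powr q) = ?w k r" for k
        using r by (simp add: norm_dcoeff powr_mult ennreal_mult mult_ac)
      then show ?thesis by (simp only: ennreal_suminf_cmult[symmetric])
    qed
    finally show ?thesis using r by simp
  qed simp
  have "(\<integral>\<^sup>+ z \<in> udisc. ennreal ((1 - cmod z) powr (q - 1) * cmod (f z * deriv g z) powr q / pi) \<partial>lborel)
    = (\<integral>\<^sup>+r\<in>{0<..<1}. (\<integral>\<^sup>+t\<in>{0..0+2*pi}. ennreal (r * ((1 - cmod (of_real r * cis t)) powr (q - 1) * cmod (f (of_real r * cis t) * deriv g (of_real r * cis t)) powr q / pi)) \<partial>lborel) \<partial>lborel)"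
    by (rule nn_integral_udisc_polar_full)
       (intro continuous_Dspace_integrand continuous_on_mult holomorphic_on_imp_continuous_on[OF hol] continuous_deriv_g q, auto)
  also have "\<dots> \<le> (\<integral>\<^sup>+r. ennreal B * (\<Sum>k. ?w k r) \<partial>lborel)" by (intro nn_integral_mono pt)
  also have "\<dots> = ennreal B * (\<Sum>k. \<integral>\<^sup>+r. ?w k r \<partial>lborel)"
    by (subst nn_integral_cmult, measurable, subst nn_integral_suminf) measurable
  also have "\<dots> \<le> ennreal B * (\<Sum>k. ennreal (2 / q * norm (a k) powr q))"
  proof (intro mult_left_mono suminf_le)
    fix k
    have "(\<integral>\<^sup>+r. ?w k r \<partial>lborel) = ennreal ((real (n k) * norm (a k)) powr q) * (\<integral>\<^sup>+r\<in>{0<..<1}. ennreal ((1 - r) powr (q - 1) * (r ^ (n k - 1)) powr q) \<partial>lborel)"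
      by (rule nn_integral_cmult) measurable
    also have "\<dots> \<le> ennreal ((real (n k) * norm (a k)) powr q) * ennreal (2 / q * real (n k) powr (- q))"
      by (intro mult_left_mono nn_integral_beta_le q n_pos) auto
    also have "\<dots> = ennreal (2 / q * norm (a k) powr q)"
    proof -
      have "real (n k) powr q * real (n k) powr (- q) = 1" using n_pos[of k] by (simp flip: powr_add)
      then have "(real (n k) * norm (a k)) powr q * (2 / q * real (n k) powr (- q)) = 2 / q * norm (a k) powr q"
        by (simp add: powr_mult mult_ac)
      then show ?thesis using q by (subst ennreal_mult[symmetric]) auto
    qed
    finally show "(\<integral>\<^sup>+r. ?w k r \<partial>lborel) \<le> ennreal (2 / q * norm (a k) powr q)" .
  qed auto
  also have "\<dots> = ennreal B * ennreal (\<Sum>k. 2 / q * norm (a k) powr q)"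
    using q sm by (subst suminf_ennreal2) (auto intro: summable_mult)
  also have "\<dots> < \<infinity>" by (simp add: ennreal_mult_less_top)
  finally show ?thesis .
qed

text \<open>The terms are eventually at most 1, where \<open>x <= x powr q\<close>. From here on
  \<open>g\<close> is bounded and its boundary series converges uniformly.\<close>

lemma summable_norm_coeff:
  assumes sm: "summable (\<lambda>k. norm (a k) powr q)" and q: "0 < q" "q \<le> 1"
  shows "summable (\<lambda>k. norm (a k))"
proof -
  have "(\<lambda>k. norm (a k) powr q) \<longlonglongrightarrow> 0" by (rule summable_LIMSEQ_zero[OF sm])
  then have "eventually (\<lambda>k. norm (a k) powr q < 1) sequentially" by (rule order_tendstoD) simp
  then have "eventually (\<lambda>k. norm (norm (a k)) \<le> norm (a k) powr q) sequentially"
  proof eventually_elim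
    case (elim k)
    show ?case
    proof (cases "a k = 0")
      case False
      have "norm (a k) \<le> 1"
      proof (rule ccontr)
        assume "\<not> norm (a k) \<le> 1"
        then have "norm (a k) powr q \<ge> 1" using q by (intro ge_one_powr_ge_zero) auto
        then show False using elim by simp
      qed
      then have "norm (a k) powr 1 \<le> norm (a k) powr q" using q False by (intro powr_mono') auto
      then show ?thesis using False by simp
    qed simp
  qed
  then show ?thesis by (rule summable_comparison_test_ev[OF _ sm])
qed

end

section \<open>Inclusion between the spaces \<open>D^p\<close> on \<open>BMOA\<close>, and products
  in \<open>D^q\<close>\<close>

lemma borel_measurable_Dspace_integrand:
  assumes "continuous_on udisc f" "0 < p"
  shows "(\<lambda>z. ennreal ((1 - cmod z) powr (p' - 1) * cmod (f z) powr p / pi) * indicator udisc z) \<in> borel_measurable borel"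
proof -
  have [measurable]: "udisc \<in> sets borel" by simp
  have "(\<lambda>z. indicator udisc z *\<^sub>R f z) \<in> borel_measurable borel"
    using assms by (intro borel_measurable_continuous_on_indicator) auto
  then have "(\<lambda>z. ennreal ((1 - cmod z) powr (p' - 1) * cmod (indicator udisc z *\<^sub>R f z) powr p / pi) * indicator udisc z) \<in> borel_measurable borel"
    by measurable
  also have "(\<lambda>z. ennreal ((1 - cmod z) powr (p' - 1) * cmod (indicator udisc z *\<^sub>R f z) powr p / pi) * indicator udisc z)
    = (\<lambda>z. ennreal ((1 - cmod z) powr (p' - 1) * cmod (f z) powr p / pi) * indicator udisc z)"
    by (auto simp: fun_eq_iff indicator_def)
  finally show ?thesis .
qed

text \<open>The integrand for \<open>q\<close> is the one for \<open>p\<close> times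
  \<open>((1 - |z|) * |f'|) powr (q - p)\<close>, and the Bloch bound controls that factor.\<close>

lemma Dspace_mono_BMOA:
  assumes f: "f \<in> Dspace p" "f \<in> BMOA" and pq: "0 < p" "p \<le> q"
  shows "f \<in> Dspace q"
proof -
  have an: "analytic_disc f" using f by (simp add: Dspace_def)
  obtain B where B: "B \<ge> 0" "\<And>z. z \<in> udisc \<Longrightarrow> (1 - norm z) * norm (deriv f z) \<le> B"
    using BMOA_imp_Bloch[OF f(2)] by metis
  have "(\<integral>\<^sup>+ z \<in> udisc. ennreal ((1 - cmod z) powr (q - 1) * cmod (deriv f z) powr q / pi) \<partial>lborel)
    \<le> (\<integral>\<^sup>+ z. ennreal (B powr (q - p)) * (ennreal ((1 - cmod z) powr (p - 1) * cmod (deriv f z) powr p / pi) * indicator udisc z) \<partial>lborel)"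
  proof (rule nn_integral_mono)
    fix z :: complex
    show "ennreal ((1 - cmod z) powr (q - 1) * cmod (deriv f z) powr q / pi) * indicator udisc z
      \<le> ennreal (B powr (q - p)) * (ennreal ((1 - cmod z) powr (p - 1) * cmod (deriv f z) powr p / pi) * indicator udisc z)"
    proof (cases "z \<in> udisc")
      case True
      let ?d = "1 - cmod z" and ?e = "cmod (deriv f z)"
      have d: "?d > 0" using True by simp
      have "?d powr (q - 1) * ?e powr q \<le> B powr (q - p) * (?d powr (p - 1) * ?e powr p)"
      proof (cases "?e = 0")
        case False
        have "?d powr (q - 1) * ?e powr q = (?d * ?e) powr (q - p) * (?d powr (p - 1) * ?e powr p)"
        proof -
          have "?d powr (q - 1) = ?d powr (q - p) * ?d powr (p - 1)" by (simp flip: powr_add)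
          moreover have "?e powr q = ?e powr (q - p) * ?e powr p" by (simp flip: powr_add)
          ultimately show ?thesis by (simp add: powr_mult)
        qed
        also have "\<dots> \<le> B powr (q - p) * (?d powr (p - 1) * ?e powr p)"
          using B(2)[OF True] pq d by (intro mult_right_mono powr_mono2) auto
        finally show ?thesis .
      qed simp
      then have "?d powr (q - 1) * ?e powr q / pi \<le> B powr (q - p) * (?d powr (p - 1) * ?e powr p) / pi"
        by (intro divide_right_mono) auto
      then show ?thesis using True by (simp add: ennreal_mult'[symmetric] ennreal_leI)
    qed simp
  qed
  also have "\<dots> = ennreal (B powr (q - p)) * (\<integral>\<^sup>+ z \<in> udisc. ennreal ((1 - cmod z) powr (p - 1) * cmod (deriv f z) powr p / pi) \<partial>lborel)"
  proof (rule nn_integral_cmult)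
    have "continuous_on udisc (deriv f)"
      using an unfolding analytic_disc_def by (intro holomorphic_on_imp_continuous_on holomorphic_deriv) auto
    then show "(\<lambda>z. ennreal ((1 - cmod z) powr (p - 1) * cmod (deriv f z) powr p / pi) * indicator udisc z) \<in> borel_measurable lborel"
      using borel_measurable_Dspace_integrand[OF _ pq(1)] by simp
  qed
  also have "\<dots> < \<infinity>" using f(1) by (simp add: Dspace_def ennreal_mult_less_top)
  finally show ?thesis using an by (simp add: Dspace_def)
qed

text \<open>Leibniz' rule and subadditivity of the power: \<open>f' * g\<close> is handled by the
  bound on \<open>g\<close>, and \<open>f * g'\<close> is the integral estimated above.\<close>

lemma (in lacunary_function) mult_mem_Dspace:
  assumes f: "f \<in> Dspace q" "f \<in> H1" and q: "0 < q" "q \<le> 1" and sm: "summable (\<lambda>k. norm (a k) powr q)"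
    and G: "\<And>z. z \<in> udisc \<Longrightarrow> norm (g z) \<le> G"
  shows "(\<lambda>z. f z * g z) \<in> Dspace q"
proof -
  have an: "f holomorphic_on udisc" using f by (simp add: Dspace_def analytic_disc_def)
  have cf: "continuous_on udisc f" by (rule holomorphic_on_imp_continuous_on[OF an])
  have cf': "continuous_on udisc (deriv f)" by (intro holomorphic_on_imp_continuous_on holomorphic_deriv an) auto
  let ?E = "\<lambda>F z. ennreal ((1 - cmod z) powr (q - 1) * cmod (F z) powr q / pi) * indicator udisc z"
  have "(\<integral>\<^sup>+ z. ?E (deriv (\<lambda>z. f z * g z)) z \<partial>lborel) \<le> (\<integral>\<^sup>+ z. ennreal (G powr q) * ?E (deriv f) z + ?E (\<lambda>z. f z * deriv g z) z \<partial>lborel)"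
  proof (rule nn_integral_mono)
    fix z :: complex
    show "?E (deriv (\<lambda>z. f z * g z)) z \<le> ennreal (G powr q) * ?E (deriv f) z + ?E (\<lambda>z. f z * deriv g z) z"
    proof (cases "z \<in> udisc")
      case z: True
      have "deriv (\<lambda>z. f z * g z) z = f z * deriv g z + deriv f z * g z"
        by (intro deriv_mult holomorphic_on_imp_differentiable_at[OF an] holomorphic_on_imp_differentiable_at[OF hol_g] z) auto
      then have "cmod (deriv (\<lambda>z. f z * g z) z) \<le> cmod (deriv f z) * cmod (g z) + cmod (f z * deriv g z)"
        by (metis add.commute norm_mult norm_triangle_ineq)
      also have "\<dots> \<le> cmod (deriv f z) * G + cmod (f z * deriv g z)"
        by (intro add_right_mono mult_left_mono G z) auto
      finally have 1: "cmod (deriv (\<lambda>z. f z * g z) z) \<le> cmod (deriv f z) * G + cmod (f z * deriv g z)" .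
      have G0: "G \<ge> 0" using G[OF z] norm_ge_zero order_trans by blast
      have "cmod (deriv (\<lambda>z. f z * g z) z) powr q \<le> (cmod (deriv f z) * G + cmod (f z * deriv g z)) powr q"
        using 1 q by (intro powr_mono2) auto
      also have "\<dots> \<le> (cmod (deriv f z) * G) powr q + cmod (f z * deriv g z) powr q"
        using G0 q by (intro powr_add_le) auto
      also have "(cmod (deriv f z) * G) powr q = G powr q * cmod (deriv f z) powr q" by (simp add: powr_mult mult.commute)
      finally have 2: "cmod (deriv (\<lambda>z. f z * g z) z) powr q \<le> G powr q * cmod (deriv f z) powr q + cmod (f z * deriv g z) powr q" .
      define A where "A = (1 - cmod z) powr (q - 1) / pi"
      have A: "A \<ge> 0" by (simp add: A_def)
      have "A * cmod (deriv (\<lambda>z. f z * g z) z) powr q \<le> A * (G powr q * cmod (deriv f z) powr q + cmod (f z * deriv g z) powr q)"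
        by (intro mult_left_mono 2 A)
      then have "ennreal (A * cmod (deriv (\<lambda>z. f z * g z) z) powr q) \<le> ennreal (G powr q * (A * cmod (deriv f z) powr q) + A * cmod (f z * deriv g z) powr q)"
        by (intro ennreal_leI) (simp add: algebra_simps)
      also have "\<dots> = ennreal (G powr q) * ennreal (A * cmod (deriv f z) powr q) + ennreal (A * cmod (f z * deriv g z) powr q)"
        using A by (subst ennreal_plus) (auto simp: ennreal_mult)
      finally show ?thesis using z by (simp add: A_def)
    qed simp
  qed
  also have "\<dots> = ennreal (G powr q) * (\<integral>\<^sup>+ z. ?E (deriv f) z \<partial>lborel) + (\<integral>\<^sup>+ z. ?E (\<lambda>z. f z * deriv g z) z \<partial>lborel)"
  proof -
    have m: "?E (deriv f) \<in> borel_measurable lborel" "?E (\<lambda>z. f z * deriv g z) \<in> borel_measurable lborel"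
      using borel_measurable_Dspace_integrand[OF cf' q(1)]
        borel_measurable_Dspace_integrand[OF continuous_on_mult[OF cf continuous_deriv_g] q(1)] by auto
    then show ?thesis by (subst nn_integral_add) (auto simp: nn_integral_cmult)
  qed
  also have "\<dots> < \<infinity>"
    using f(1) nn_integral_mult_deriv_finite[OF f(2) q sm] by (simp add: Dspace_def ennreal_mult_less_top)
  finally have "(\<integral>\<^sup>+ z. ?E (deriv (\<lambda>z. f z * g z)) z \<partial>lborel) < \<infinity>" .
  moreover have "(\<lambda>z. f z * g z) holomorphic_on udisc" by (intro holomorphic_intros an hol_g)
  ultimately show ?thesis by (simp add: Dspace_def analytic_disc_def)
qed

subsection \<open>Logarithmic decay of the tails\<close>

lemma one_plus_ln_le:
  assumes "x \<ge> 1" shows "1 + ln x \<le> 2 * sqrt x"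
proof -
  have "ln (sqrt x) \<le> sqrt x - 1" using assms by (intro ln_le_minus_one) auto
  moreover have "ln (sqrt x) = ln x / 2" using assms by (simp add: ln_sqrt)
  moreover have "sqrt x \<ge> 1" using assms by simp
  ultimately show ?thesis by linarith
qed

text \<open>\<open>1 + ln\<close> is submultiplicative on numbers at least 1, and
  \<open>1 + ln (N/x) <= 2 * sqrt (N/x)\<close>. Thus \<open>x / (1 + ln x)\<close> is compared with
  \<open>sqrt x\<close>, which is geometric along a lacunary sequence.\<close>

lemma lin_over_log_le:
  assumes "1 \<le> x" "x \<le> N"
  shows "x / (1 + ln x) \<le> 2 * sqrt N * sqrt x / (1 + ln N)"
proof -
  have lx: "ln x \<ge> 0" and lN: "ln N \<ge> 0" using assms by auto
  have l: "ln (N / x) \<ge> 0" "ln N = ln x + ln (N/x)" using assms by (auto simp: ln_div)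
  have "1 + ln N \<le> (1 + ln x) * (1 + ln (N/x))" using l lx by (simp add: algebra_simps)
  also have "\<dots> \<le> (1 + ln x) * (2 * sqrt (N/x))" using lx assms by (intro mult_left_mono one_plus_ln_le) auto
  finally have "x * (1 + ln N) \<le> x * ((1 + ln x) * (2 * sqrt (N/x)))" using assms by (intro mult_left_mono) auto
  also have "\<dots> = (2 * sqrt N * sqrt x) * (1 + ln x)"
  proof -
    have "x * sqrt (N/x) = sqrt N * sqrt x"
      using assms by (simp add: real_sqrt_divide field_simps)
    then show ?thesis by (metis (no_types, opaque_lifting) mult.assoc mult.commute mult.left_commute)
  qed
  finally show ?thesis using lx lN by (simp add: divide_le_eq pos_le_divide_eq add_pos_nonneg)
qed

lemma summable_norm_square:
  fixes c :: "nat \<Rightarrow> complex"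
  assumes "summable (\<lambda>k. norm (c k))" shows "summable (\<lambda>k. (norm (c k))\<^sup>2)"
proof -
  have "(\<lambda>k. norm (c k)) \<longlonglongrightarrow> 0" by (rule summable_LIMSEQ_zero[OF assms])
  then have "eventually (\<lambda>k. norm (c k) < 1) sequentially" by (rule order_tendstoD) simp
  then have "eventually (\<lambda>k. norm ((norm (c k))\<^sup>2) \<le> norm (c k)) sequentially"
    by eventually_elim (simp add: power2_eq_square mult_left_le)
  then show ?thesis by (rule summable_comparison_test_ev[OF _ assms])
qed


lemma H1_mult_bounded:
  assumes f: "f \<in> H1" and h: "h holomorphic_on udisc" and G: "\<And>z. z \<in> udisc \<Longrightarrow> norm (h z) \<le> G"
  shows "(\<lambda>z. f z * h z) \<in> H1"
proof -
  have hol: "f holomorphic_on udisc" using f by (simp add: H1_def analytic_disc_def)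
  obtain M where M: "M > 0" "\<And>r b. 0 < r \<Longrightarrow> r < 1 \<Longrightarrow> integral {b..b+2*pi} (\<lambda>t. norm (f (of_real r * cis t))) \<le> M"
    using H1_arc_bound[OF f] by metis
  have G0: "G \<ge> 0" using G[of 0] by (auto intro: order_trans[OF norm_ge_zero])
  show ?thesis unfolding H1_def analytic_disc_def
  proof (intro CollectI conjI exI[of _ "M * G"] allI impI)
    show "(\<lambda>z. f z * h z) holomorphic_on udisc" by (intro holomorphic_intros hol h)
    fix r :: real assume "0 < r \<and> r < 1"
    then have r: "0 < r" "r < 1" by auto
    have fc: "continuous_on S (\<lambda>t. f (of_real r * cis t))" for S by (rule analytic_disc_radial(1)[OF hol r])
    have "(\<integral>\<^sup>+ t \<in> {0..2*pi}. ennreal (cmod (f (complex_of_real r * cis t) * h (complex_of_real r * cis t)) / (2*pi)) \<partial>lborel)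
      \<le> (\<integral>\<^sup>+ t \<in> {0..2*pi}. ennreal (cmod (f (complex_of_real r * cis t)) * G) \<partial>lborel)"
    proof (intro nn_integral_mono mult_right_mono ennreal_leI)
      fix t
      have z: "of_real r * cis t \<in> udisc" using r by (simp add: norm_mult)
      have "cmod (f (of_real r * cis t) * h (of_real r * cis t)) / (2*pi) \<le> cmod (f (of_real r * cis t) * h (of_real r * cis t)) / 1"
        using pi_gt3 by (intro divide_left_mono) auto
      also have "\<dots> \<le> cmod (f (of_real r * cis t)) * G" using G[OF z] by (simp add: norm_mult mult_left_mono)
      finally show "cmod (f (of_real r * cis t) * h (of_real r * cis t)) / (2*pi) \<le> cmod (f (of_real r * cis t)) * G" .
    qed auto
    also have "\<dots> = ennreal (integral {0..2*pi} (\<lambda>t. cmod (f (complex_of_real r * cis t)) * G))"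
      using G0 by (intro nn_integral_eq_integral_continuous continuous_intros fc) auto
    also have "\<dots> \<le> ennreal (M * G)" using M(2)[OF r, of 0] G0 by (intro ennreal_leI) (simp add: mult_right_mono)
    finally show "(\<integral>\<^sup>+ t \<in> {0..2*pi}. ennreal (cmod (f (complex_of_real r * cis t) * h (complex_of_real r * cis t)) / (2*pi)) \<partial>lborel) \<le> ennreal (M * G)" .
  qed
qed

lemma set_integrable_mult_bounded:
  fixes F H :: "real \<Rightarrow> complex"
  assumes F: "set_integrable lborel {b..e} F" and H: "continuous_on UNIV H" "\<And>t. norm (H t) \<le> G"
  shows "set_integrable lborel {b..e} (\<lambda>t. F t * H t)"
  unfolding set_integrable_def
proof (rule Bochner_Integration.integrable_bound)
  show "integrable lborel (\<lambda>t. G *\<^sub>R (indicator {b..e} t *\<^sub>R F t))"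
    using F unfolding set_integrable_def by (rule integrable_scaleR_right)
  have [measurable]: "H \<in> borel_measurable borel" by (rule borel_measurable_continuous_onI[OF H(1)])
  have "(\<lambda>t. indicator {b..e} t *\<^sub>R F t) \<in> borel_measurable lborel" using F by (simp add: set_integrable_def borel_measurable_integrable)
  then have "(\<lambda>t. (indicator {b..e} t *\<^sub>R F t) * H t) \<in> borel_measurable lborel" by measurable
  then show "(\<lambda>t. indicator {b..e} t *\<^sub>R (F t * H t)) \<in> borel_measurable lborel" by simp
  show "AE t in lborel. norm (indicator {b..e} t *\<^sub>R (F t * H t)) \<le> norm (G *\<^sub>R (indicator {b..e} t *\<^sub>R F t))"
  proof (rule AE_I2)
    fix t
    have "norm (F t) * norm (H t) \<le> norm (F t) * \<bar>G\<bar>" using H(2)[of t] by (intro mult_left_mono) auto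
    then show "norm (indicator {b..e} t *\<^sub>R (F t * H t)) \<le> norm (G *\<^sub>R (indicator {b..e} t *\<^sub>R F t))"
      by (auto simp: indicator_def norm_mult mult.commute)
  qed
qed

text \<open>Arcs of length \<open>2*pi / m\<close> have \<open>2 / L = m / pi\<close>. The bound 16
  keeps that logarithm a fixed fraction of \<open>1 + ln m\<close>, away from its zero at
  \<open>pi\<close>.\<close>

lemma ln_over_pi_ge:
  assumes "x \<ge> 16" shows "ln (x / pi) \<ge> (1 + ln x) / 4"
proof -
  have "ln (16::real) = 4 * ln 2" using ln_realpow[of 2 4] by simp
  then have "ln (16::real) \<ge> 8/3" using ln2_ge_two_thirds by simp
  moreover have "ln 16 \<le> ln x" using assms by simp
  moreover have "ln (2*pi) = ln 2 + ln pi" by (simp add: ln_mult)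
  then have "ln pi \<le> 4/3" using ln_two_pi_le ln2_ge_two_thirds by linarith
  moreover have "ln (x/pi) = ln x - ln pi" using assms by (simp add: ln_div)
  ultimately show ?thesis by (simp add: field_simps)
qed

context lacunary_function begin

text \<open>The summand 1 keeps the weight positive if \<open>n 0 = 1\<close>. Finite blocks give
  the condition a meaning before any convergence is known.\<close>

definition tail_log :: "real \<Rightarrow> bool" where
  "tail_log C \<longleftrightarrow> C \<ge> 0 \<and> (\<forall>k J. (\<Sum>j=k..<J. (norm (a j))\<^sup>2) * (1 + ln (real (n k)))\<^sup>2 \<le> C)"

lemma one_plus_ln_n_ge: "1 + ln (real (n k)) \<ge> 1"
  using n_pos[of k] by simp

lemma tail_log_coeff:
  assumes "tail_log C" shows "norm (a k) * (1 + ln (real (n k))) \<le> sqrt C"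
proof -
  have "(norm (a k) * (1 + ln (real (n k))))\<^sup>2 \<le> C"
    using assms[unfolded tail_log_def, THEN conjunct2, rule_format, of k "Suc k"] by (simp add: power_mult_distrib)
  then show ?thesis by (rule real_le_rsqrt)
qed

text \<open>The decay \<open>D / (1 + ln (n k))\<close> is too slow to disturb the geometric growth
  of \<open>n k\<close>: after comparison with \<open>sqrt (n k)\<close>, a lacunary sequence of
  ratio \<open>sqrt lam\<close>, the largest frequency dominates.\<close>

lemma low_frequency_sum_le:
  assumes D: "\<And>k. norm (a k) * (1 + ln (real (n k))) \<le> D" and N: "N \<ge> 1"
    and K: "finite K" "\<And>k. k \<in> K \<Longrightarrow> real (n k) \<le> N"
  shows "(\<Sum>k\<in>K. real (n k) * norm (a k)) \<le> 2 * D * lac_const (sqrt lam) * (N / (1 + ln N))"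
proof -
  have D0: "D \<ge> 0" using D[of 0] one_plus_ln_n_ge[of 0] by (smt (verit) mult_nonneg_nonneg norm_ge_zero)
  have lN: "1 + ln N \<ge> 1" using N by simp
  have "(\<Sum>k\<in>K. real (n k) * norm (a k)) \<le> (\<Sum>k\<in>K. D * (2 * sqrt N / (1 + ln N)) * sqrt (real (n k)))"
  proof (rule sum_mono)
    fix k assume k: "k \<in> K"
    have "norm (a k) \<le> D / (1 + ln (real (n k)))"
      using D[of k] one_plus_ln_n_ge[of k] by (simp add: pos_le_divide_eq)
    then have "real (n k) * norm (a k) \<le> real (n k) * (D / (1 + ln (real (n k))))" by (intro mult_left_mono) auto
    also have "\<dots> = D * (real (n k) / (1 + ln (real (n k))))" by simp
    also have "\<dots> \<le> D * (2 * sqrt N * sqrt (real (n k)) / (1 + ln N))"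
      using K(2)[OF k] n_pos[of k] D0 by (intro mult_left_mono lin_over_log_le) auto
    finally show "real (n k) * norm (a k) \<le> D * (2 * sqrt N / (1 + ln N)) * sqrt (real (n k))" by simp
  qed
  also have "\<dots> = D * (2 * sqrt N / (1 + ln N)) * (\<Sum>k\<in>K. sqrt (real (n k)))" by (simp add: sum_distrib_left)
  also have "\<dots> \<le> D * (2 * sqrt N / (1 + ln N)) * (lac_const (sqrt lam) * sqrt N)"
  proof (intro mult_left_mono)
    have "sqrt lam * sqrt (real (n k)) \<le> sqrt (real (n (Suc k)))" for k
      using n_gap[of k] by (simp flip: real_sqrt_mult)
    then have l: "lacunary_real (sqrt lam) (\<lambda>k. sqrt (real (n k)))"
      using lam n_pos by (simp add: lacunary_real_def)
    show "(\<Sum>k\<in>K. sqrt (real (n k))) \<le> lac_const (sqrt lam) * sqrt N"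
      unfolding lac_const_def using K N by (intro lacunary_real_sum_le[OF l]) auto
    show "0 \<le> D * (2 * sqrt N / (1 + ln N))" using D0 lN N by simp
  qed
  also have "\<dots> = 2 * D * lac_const (sqrt lam) * ((sqrt N * sqrt N) / (1 + ln N))" by simp
  also have "sqrt N * sqrt N = N" using N by simp
  finally show ?thesis .
qed

text \<open>At \<open>x = 1/L\<close> this index separates the terms that hardly move on an arc of
  length \<open>L\<close> from those that oscillate there.\<close>

definition first_ge :: "real \<Rightarrow> nat" where "first_ge x = (LEAST k. x \<le> real (n k))"

lemma first_ge: "x \<le> real (n (first_ge x))" "k < first_ge x \<Longrightarrow> real (n k) < x"
proof -
  obtain m :: nat where "x \<le> real m" using real_arch_simple by blast
  then have "x \<le> real (n m)" using n_ge[of m] by linarith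
  then show "x \<le> real (n (first_ge x))" unfolding first_ge_def by (rule LeastI)
  show "k < first_ge x \<Longrightarrow> real (n k) < x" unfolding first_ge_def using not_less_Least by fastforce
qed

definition bdry :: "real \<Rightarrow> complex" where
  "bdry t = (\<Sum>k. a k * cis (real (n k) * t))"

lemma split_series:
  fixes c :: "nat \<Rightarrow> complex"
  assumes "summable (\<lambda>k. norm (c k))"
  shows "(\<Sum>k. c k * cis (real (n k) * t)) = (\<Sum>k<K. c k * cis (real (n k) * t)) + (\<Sum>j. c (j + K) * cis (real (n (j + K)) * t))"
  using suminf_split_initial_segment[OF summable_lacunary_cis[OF assms], of "\<lambda>k. real (n k)" t K] by (simp add: add.commute)

lemma tail_log_suminf:
  assumes T: "tail_log C" and s: "summable (\<lambda>k. norm (a k))"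
  shows "(\<Sum>j. (norm (a (j + k)))\<^sup>2) * (1 + ln (real (n k)))\<^sup>2 \<le> C"
proof -
  have pos: "(1 + ln (real (n k)))\<^sup>2 > 0" using one_plus_ln_n_ge[of k] by simp
  have "(\<Sum>j. (norm (a (j + k)))\<^sup>2) \<le> C / (1 + ln (real (n k)))\<^sup>2"
  proof (rule suminf_le_const)
    show "summable (\<lambda>j. (norm (a (j + k)))\<^sup>2)"
      using summable_norm_square[OF s] by (simp add: summable_iff_shift[of "\<lambda>j. (norm (a j))\<^sup>2"])
    fix m
    have "(\<Sum>j<m. (norm (a (j + k)))\<^sup>2) = (\<Sum>j=k..<m+k. (norm (a j))\<^sup>2)"
      using sum.shift_bounds_nat_ivl[of "\<lambda>j. (norm (a j))\<^sup>2" 0 k m] by (simp add: atLeast0LessThan)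
    then show "(\<Sum>j<m. (norm (a (j + k)))\<^sup>2) \<le> C / (1 + ln (real (n k)))\<^sup>2"
      using T[unfolded tail_log_def, THEN conjunct2, rule_format, of k "m+k"] pos by (simp add: pos_le_divide_eq)
  qed
  then show ?thesis using pos by (simp add: pos_le_divide_eq)
qed

text \<open>For \<open>L <= 1\<close> the factor 1 would do; the factor 3 covers arcs between 1 and
  \<open>2*pi\<close>, where \<open>ln L <= 2\<close>.\<close>

lemma log_scale_le:
  assumes L: "0 < L" "L \<le> 2*pi" and k: "1 / L \<le> real (n k)"
  shows "1 + \<bar>ln L\<bar> \<le> 3 * (1 + ln (real (n k)))"
proof (cases "L \<le> 1")
  case True
  have "ln (1/L) \<le> ln (real (n k))" using k L n_pos[of k] by (subst ln_le_cancel_iff) auto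
  then have "\<bar>ln L\<bar> \<le> ln (real (n k))" using True L by (simp add: ln_div)
  then have "1 + \<bar>ln L\<bar> \<le> 1 + ln (real (n k))" by simp
  also have "\<dots> \<le> 3 * (1 + ln (real (n k)))" using one_plus_ln_n_ge[of k] by simp
  finally show ?thesis .
next
  case False
  have "ln L \<le> ln (2*pi)" using L by (subst ln_le_cancel_iff) auto
  then have "ln L \<le> 2" using ln_two_pi_le by (rule order_trans)
  moreover have "0 \<le> ln L" using False by simp
  ultimately have "1 + \<bar>ln L\<bar> \<le> 3 * 1" by linarith
  also have "\<dots> \<le> 3 * (1 + ln (real (n k)))" by (intro mult_left_mono one_plus_ln_n_ge) auto
  finally show ?thesis .
qed

lemma low_frequency_scale_le:
  assumes D: "\<And>k. norm (a k) * (1 + ln (real (n k))) \<le> D" and L: "0 < L"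
  shows "(\<Sum>k<first_ge (1/L). real (n k) * norm (a k)) \<le> 2 * D * lac_const (sqrt lam) * (1 / (L * (1 + \<bar>ln L\<bar>)))"
proof (cases "L \<le> 1")
  case True
  have "(\<Sum>k<first_ge (1/L). real (n k) * norm (a k)) \<le> 2 * D * lac_const (sqrt lam) * ((1/L) / (1 + ln (1/L)))"
    using True L first_ge(2)[of _ "1/L"] by (intro low_frequency_sum_le D) (auto intro: less_imp_le)
  also have "ln (1/L) = \<bar>ln L\<bar>" using True L by (simp add: ln_div)
  finally show ?thesis by simp
next
  case False
  \<comment> \<open>On an arc longer than 1 every frequency counts as high, since
    \<open>n 0 >= 1 > 1/L\<close>, so the sum is empty.\<close>
  have "1 / L \<le> real (n 0)" using False n_pos[of 0] by (simp add: divide_le_eq) (metis One_nat_def Suc_leI less_eq_real_def mult_le_cancel_left1 not_le of_nat_1 of_nat_le_iff order_trans mult.commute)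
  then have "first_ge (1/L) = 0" unfolding first_ge_def by (rule Least_eq_0)
  moreover have "D \<ge> 0" using D[of 0] one_plus_ln_n_ge[of 0] by (smt (verit) mult_nonneg_nonneg norm_ge_zero)
  moreover have "lac_const (sqrt lam) \<ge> 0" using lac_const_pos[of "sqrt lam"] lam by simp
  ultimately show ?thesis using L by simp
qed

text \<open>Over the arc the low frequencies change by at most \<open>L\<close> times the sum of
  \<open>n k * |a k|\<close>, hence by \<open>O(1/l)\<close> with \<open>l = 1 + |ln L|\<close>. The
  high frequencies have square mean \<open>O(1/l^2)\<close> by the tail condition.\<close>

lemma bdry_oscillation:
  assumes T: "tail_log C" and s: "summable (\<lambda>k. norm (a k))"
  obtains D where "D \<ge> 0" "\<And>b L. 0 < L \<Longrightarrow> L \<le> 2*pi \<Longrightarrow>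
     \<exists>P. integral {b..b+L} (\<lambda>t. norm (bdry t - P)) \<le> D * L / (1 + \<bar>ln L\<bar>)"
proof -
  define D1 where "D1 = 2 * sqrt C * lac_const (sqrt lam)"
  define D2 where "D2 = 1296 * lac_const lam * 9 * C"
  have C: "C \<ge> 0" using T by (simp add: tail_log_def)
  have D0: "D1 \<ge> 0" "D2 \<ge> 0" using C lam lac_const_pos[of lam] lac_const_pos[of "sqrt lam"] by (auto simp: D1_def D2_def)
  show thesis
  proof (rule that[of "D1 + (D2 + 1) / 2"])
    show "0 \<le> D1 + (D2 + 1) / 2" using D0 by simp
    fix b L :: real assume L: "0 < L" "L \<le> 2*pi"
    define l where "l = 1 + \<bar>ln L\<bar>"
    have l: "l \<ge> 1" by (simp add: l_def)
    define K where "K = first_ge (1/L)"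
    have KL: "1/L \<le> real (n K)" unfolding K_def by (rule first_ge)
    have LF: "(\<Sum>k<K. real (n k) * norm (a k)) \<le> D1 * (1 / (L * l))"
      unfolding K_def D1_def l_def using low_frequency_scale_le[OF tail_log_coeff[OF T] L(1)] by simp
    define P where "P = (\<Sum>k<K. a k * cis (real (n k) * b))"
    define h where "h t = (\<Sum>j. a (j + K) * cis (real (n (j + K)) * t))" for t
    have sK: "summable (\<lambda>j. norm (a (j + K)))" using s by (simp add: summable_iff_shift[of "\<lambda>j. norm (a j)"])
    have hc: "continuous_on S h" for S unfolding h_def by (rule continuous_on_cis_series[OF sK])
    have bc: "continuous_on S bdry" for S unfolding bdry_def[abs_def] by (rule continuous_on_cis_series[OF s])
    have low: "norm ((\<Sum>k<K. a k * cis (real (n k) * t)) - P) \<le> D1 / l" if t: "t \<in> {b..b+L}" for t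
    proof -
      have "norm ((\<Sum>k<K. a k * cis (real (n k) * t)) - P) \<le> (\<Sum>k<K. norm (a k) * (real (n k) * L))"
        unfolding P_def sum_subtractf[symmetric]
      proof (rule sum_norm_le)
        fix k
        have "norm (cis (real (n k) * t) - cis (real (n k) * b)) \<le> \<bar>real (n k) * t - real (n k) * b\<bar>" by (rule norm_cis_diff_le)
        also have "\<dots> = real (n k) * (t - b)" using t by (simp flip: right_diff_distrib)
        also have "\<dots> \<le> real (n k) * L" using t by (intro mult_left_mono) auto
        finally have "norm (a k) * norm (cis (real (n k) * t) - cis (real (n k) * b)) \<le> norm (a k) * (real (n k) * L)"
          by (intro mult_left_mono) auto
        then show "norm (a k * cis (real (n k) * t) - a k * cis (real (n k) * b)) \<le> norm (a k) * (real (n k) * L)"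
          by (simp add: norm_mult flip: right_diff_distrib)
      qed
      also have "\<dots> = L * (\<Sum>k<K. real (n k) * norm (a k))" by (simp add: sum_distrib_left mult_ac)
      also have "\<dots> \<le> L * (D1 * (1 / (L * l)))" using L LF by (intro mult_left_mono) auto
      also have "\<dots> = D1 / l" using L by simp
      finally show ?thesis .
    qed
    have h2: "integral {b..b+L} (\<lambda>t. (norm (h t))\<^sup>2) \<le> D2 * L / l\<^sup>2"
    proof -
      have "integral {b..b+L} (\<lambda>t. (norm (h t))\<^sup>2) \<le> 1296 * lac_const lam * L * (\<Sum>j. (norm (a (j + K)))\<^sup>2)"
        unfolding h_def
      proof (rule lacunary_series_square_upper[OF lac_shift L(1) sK])
        show "1 \<le> L * real (n (j + K))" for j
        proof -
          have "1 / L \<le> real (n (j + K))" using KL n_mono[of K "j+K"] by linarith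
          then show ?thesis using L by (simp add: field_simps)
        qed
        show "summable (\<lambda>j. (norm (a (j + K)))\<^sup>2)" by (rule summable_norm_square[OF sK])
      qed
      also have "\<dots> \<le> 1296 * lac_const lam * L * (9 * C / l\<^sup>2)"
      proof (intro mult_left_mono)
        have "(\<Sum>j. (norm (a (j + K)))\<^sup>2) \<ge> 0" by (intro suminf_nonneg summable_norm_square sK) auto
        moreover have "l\<^sup>2 \<le> (3 * (1 + ln (real (n K))))\<^sup>2" using log_scale_le[OF L KL] l by (intro power_mono) (auto simp: l_def)
        ultimately have "(\<Sum>j. (norm (a (j + K)))\<^sup>2) * l\<^sup>2 \<le> (\<Sum>j. (norm (a (j + K)))\<^sup>2) * (3 * (1 + ln (real (n K))))\<^sup>2"
          by (intro mult_left_mono) auto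
        also have "\<dots> \<le> 9 * C" using tail_log_suminf[OF T s, of K] unfolding power_mult_distrib[of 3] by (simp add: mult_ac)
        finally show "(\<Sum>j. (norm (a (j + K)))\<^sup>2) \<le> 9 * C / l\<^sup>2" using l by (subst pos_le_divide_eq) auto
        show "0 \<le> 1296 * lac_const lam * L" using L lac_const_pos[OF lam] by simp
      qed
      finally show ?thesis by (simp add: D2_def mult_ac)
    qed
    have "integral {b..b+L} (\<lambda>t. norm (bdry t - P)) \<le> integral {b..b+L} (\<lambda>t. (D1 / l + 1 / (2 * l)) + l / 2 * (norm (h t))\<^sup>2)"
    proof (rule integral_le)
      fix t assume t: "t \<in> {b..b+L}"
      have "bdry t - P = ((\<Sum>k<K. a k * cis (real (n k) * t)) - P) + h t"
        unfolding bdry_def h_def by (subst split_series[OF s, of t K]) simp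
      then have "norm (bdry t - P) \<le> D1 / l + norm (h t)" using low[OF t] norm_triangle_ineq order_trans by (smt (verit))
      \<comment> \<open>Cauchy-Schwarz in pointwise form, balanced at
        \<open>norm (h t) = 1 / l\<close>, the expected size.\<close>
      moreover have "norm (h t) \<le> 1 / (2 * l) + l / 2 * (norm (h t))\<^sup>2"
      proof -
        have "0 \<le> (l * norm (h t) - 1)\<^sup>2" by simp
        then have "2 * l * norm (h t) \<le> 1 + l\<^sup>2 * (norm (h t))\<^sup>2" by (simp add: power2_diff power_mult_distrib)
        then have "2 * l * norm (h t) \<le> 2 * l * (1 / (2 * l) + l / 2 * (norm (h t))\<^sup>2)" using l by (simp add: distrib_left power2_eq_square)
        then show ?thesis using l by (subst (asm) mult_le_cancel_left_pos) auto
      qed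
      ultimately show "norm (bdry t - P) \<le> (D1 / l + 1 / (2 * l)) + l / 2 * (norm (h t))\<^sup>2" by linarith
    qed (intro integrable_continuous_interval continuous_intros bc hc)+
    also have "\<dots> = L * (D1 / l + 1 / (2 * l)) + l / 2 * integral {b..b+L} (\<lambda>t. (norm (h t))\<^sup>2)"
      using L by (subst integral_add) (auto intro!: integrable_continuous_interval continuous_intros hc)
    also have "\<dots> \<le> L * (D1 / l + 1 / (2 * l)) + l / 2 * (D2 * L / l\<^sup>2)"
      using l by (intro add_left_mono mult_left_mono h2) auto
    also have "\<dots> = (D1 + (D2 + 1) / 2) * L / l" using l by (simp add: field_simps power2_eq_square)
    finally show "\<exists>P. integral {b..b+L} (\<lambda>t. norm (bdry t - P)) \<le> (D1 + (D2 + 1) / 2) * L / (1 + \<bar>ln L\<bar>)"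
      unfolding l_def by blast
  qed
qed

lemma norm_g_le:
  assumes s: "summable (\<lambda>k. norm (a k))" and z: "z \<in> udisc"
  shows "norm (g z) \<le> (\<Sum>k. norm (a k))"
proof -
  have le: "norm (a k * z ^ n k) \<le> norm (a k)" for k
    using z by (simp add: norm_mult norm_power mult_left_le power_le_one)
  have sm: "summable (\<lambda>k. norm (a k * z ^ n k))" by (rule summable_comparison_test'[OF s]) (use le in auto)
  have "norm (g z) \<le> (\<Sum>k. norm (a k * z ^ n k))"
    using summable_norm[OF sm] g_sums[OF z] by (simp add: sums_iff)
  also have "\<dots> \<le> (\<Sum>k. norm (a k))" by (intro suminf_le le sm s)
  finally show ?thesis .
qed

lemma norm_bdry_le: "summable (\<lambda>k. norm (a k)) \<Longrightarrow> norm (bdry t) \<le> (\<Sum>k. norm (a k))"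
  unfolding bdry_def by (rule norm_cis_series_le)

lemma continuous_bdry: "summable (\<lambda>k. norm (a k)) \<Longrightarrow> continuous_on S bdry"
  unfolding bdry_def[abs_def] by (rule continuous_on_cis_series)

text \<open>The series converges uniformly on the closed disc, so the radial limit exists at every
  angle.\<close>

lemma radial_limit_g:
  assumes s: "summable (\<lambda>k. norm (a k))"
  shows "((\<lambda>r. g (of_real r * cis t)) \<longlongrightarrow> bdry t) (at_left 1)"
proof -
  define H where "H w = (\<Sum>k. a k * w ^ n k)" for w
  have "uniform_limit (cball 0 1) (\<lambda>m w. \<Sum>k<m. a k * w ^ n k) H sequentially"
    unfolding H_def[abs_def] by (rule Weierstrass_m_test[OF _ s]) (auto simp: norm_mult norm_power mult_left_le power_le_one)
  then have "continuous_on (cball 0 1) H"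
    by (rule uniform_limit_theorem[rotated]) (auto intro!: always_eventually continuous_intros)
  then have "continuous_on {0..1} (\<lambda>r. H (of_real r * cis t))"
    by (rule continuous_on_compose2) (auto intro!: continuous_intros simp: norm_mult)
  then have "((\<lambda>r. H (of_real r * cis t)) \<longlongrightarrow> H (of_real 1 * cis t)) (at 1 within {0..1})"
    unfolding continuous_on_def by (rule bspec[where x=1]) simp
  moreover have "at (1::real) within {0..1} = at_left 1" by (rule at_within_Icc_at_left) simp
  moreover have "H (of_real 1 * cis t) = bdry t" by (simp add: H_def bdry_def Complex.DeMoivre)
  ultimately have lim: "((\<lambda>r. H (of_real r * cis t)) \<longlongrightarrow> bdry t) (at_left 1)" by simp
  have "eventually (\<lambda>r. r \<in> {0<..<1}) (at_left (1::real))" by (rule eventually_at_leftI[of 0]) auto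
  then have "eventually (\<lambda>r. H (of_real r * cis t) = g (of_real r * cis t)) (at_left 1)"
  proof eventually_elim
    case (elim r)
    then have "of_real r * cis t \<in> udisc" by (simp add: norm_mult)
    from g_sums[OF this] show ?case by (simp add: H_def sums_iff)
  qed
  then show ?thesis using lim by (rule Lim_transform_eventually[rotated])
qed

text \<open>The means of \<open>F\<close> may grow like \<open>1 + |ln L|\<close>, exactly the rate
  at which the oscillation of \<open>bdry\<close> decays. The product is compared with the constant
  \<open>m * P\<close>.\<close>

lemma mult_mem_BMOA:
  assumes f: "f \<in> BMOA" and T: "tail_log C" and s: "summable (\<lambda>k. norm (a k))"
  shows "(\<lambda>z. f z * g z) \<in> BMOA"
proof -
  obtain F where fH: "f \<in> H1" and bd: "boundary_function f F" and bmo: "bounded_mean_osc F"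
    using f by (auto simp: BMOA_def)
  obtain B where B: "B \<ge> 0" and int: "\<And>a L. 0 < L \<Longrightarrow> L \<le> 2*pi \<Longrightarrow> set_integrable lborel {a..a+L} F"
    and osc: "\<And>a L. 0 < L \<Longrightarrow> L \<le> 2*pi \<Longrightarrow> (LINT t:{a..a+L}|lborel. norm (F t - arc_mean F a L)) \<le> B * L"
    using bounded_mean_oscD[OF bmo] by metis
  obtain E where E: "E \<ge> 0" "\<And>a L. 0 < L \<Longrightarrow> L \<le> 2*pi \<Longrightarrow> norm (arc_mean F a L) \<le> E * (1 + \<bar>ln L\<bar>)"
    using arc_mean_log_growth[OF fH bd B int osc] by metis
  obtain D where D: "D \<ge> 0" "\<And>b L. 0 < L \<Longrightarrow> L \<le> 2*pi \<Longrightarrow>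
     \<exists>P. integral {b..b+L} (\<lambda>t. norm (bdry t - P)) \<le> D * L / (1 + \<bar>ln L\<bar>)"
    using bdry_oscillation[OF T s] by metis
  define G where "G = (\<Sum>k. norm (a k))"
  have G: "G \<ge> 0" using norm_bdry_le[OF s, of 0] by (auto simp: G_def intro: order_trans[OF norm_ge_zero])
  have bG: "norm (bdry t) \<le> G" for t unfolding G_def by (rule norm_bdry_le[OF s])
  have "bounded_mean_osc (\<lambda>t. F t * bdry t)"
  proof (rule bounded_mean_oscI)
    fix b L :: real assume L: "0 < L" "L \<le> 2*pi"
    show i: "set_integrable lborel {b..b+L} (\<lambda>t. F t * bdry t)"
      by (rule set_integrable_mult_bounded[OF int[OF L] continuous_bdry[OF s] bG])
    obtain P where P: "integral {b..b+L} (\<lambda>t. norm (bdry t - P)) \<le> D * L / (1 + \<bar>ln L\<bar>)" using D(2)[OF L] by blast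
    define m where "m = arc_mean F b L"
    have ib: "set_integrable lborel {b..b+L} (\<lambda>t. norm (bdry t - P))"
      by (intro borel_integrable_atLeastAtMost' continuous_intros continuous_bdry s)
    have iF: "set_integrable lborel {b..b+L} (\<lambda>t. norm (F t - m))"
      using L by (intro set_integrable_norm_diff int) auto
    have "(LINT t:{b..b+L}|lborel. norm (F t * bdry t - m * P)) \<le> (LINT t:{b..b+L}|lborel. G * norm (F t - m) + norm m * norm (bdry t - P))"
    proof (rule set_integral_mono)
      show "set_integrable lborel {b..b+L} (\<lambda>t. norm (F t * bdry t - m * P))"
        using L by (intro set_integrable_norm_diff i) auto
      show "set_integrable lborel {b..b+L} (\<lambda>t. G * norm (F t - m) + norm m * norm (bdry t - P))"
        by (intro set_integral_add set_integrable_mult_right ib iF)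
      fix t
      have "F t * bdry t - m * P = (F t - m) * bdry t + m * (bdry t - P)" by (simp add: algebra_simps)
      then have "norm (F t * bdry t - m * P) \<le> norm (F t - m) * norm (bdry t) + norm m * norm (bdry t - P)"
        by (metis norm_mult norm_triangle_ineq)
      also have "norm (F t - m) * norm (bdry t) \<le> G * norm (F t - m)" using bG[of t] by (simp add: mult.commute[of G] mult_left_mono)
      finally show "norm (F t * bdry t - m * P) \<le> G * norm (F t - m) + norm m * norm (bdry t - P)" by simp
    qed
    also have "\<dots> = G * (LINT t:{b..b+L}|lborel. norm (F t - m)) + norm m * (LINT t:{b..b+L}|lborel. norm (bdry t - P))"
      using ib iF by (subst set_integral_add(2)) auto
    also have "(LINT t:{b..b+L}|lborel. norm (bdry t - P)) = integral {b..b+L} (\<lambda>t. norm (bdry t - P))"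
      by (rule set_borel_integral_eq_integral(2)[OF ib])
    also have "G * (LINT t:{b..b+L}|lborel. norm (F t - m)) + norm m * integral {b..b+L} (\<lambda>t. norm (bdry t - P))
       \<le> G * (B * L) + (E * (1 + \<bar>ln L\<bar>)) * (D * L / (1 + \<bar>ln L\<bar>))"
      using G osc[OF L] P E L unfolding m_def
      by (intro add_mono mult_left_mono mult_mono) (auto intro!: integral_nonneg integrable_continuous_interval continuous_intros continuous_bdry s)
    also have "\<dots> = (G * B + E * D) * L" using abs_ge_zero[of "ln L"] by (simp add: field_simps)
    finally show "\<exists>c. (LINT t:{b..b+L}|lborel. norm (F t * bdry t - c)) \<le> (G * B + E * D) * L" by blast
  qed
  moreover have "boundary_function (\<lambda>z. f z * g z) (\<lambda>t. F t * bdry t)"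
    using bd unfolding boundary_function_def by eventually_elim (intro tendsto_mult radial_limit_g[OF s])
  moreover have "(\<lambda>z. f z * g z) \<in> H1"
    by (rule H1_mult_bounded[OF fH hol_g norm_g_le[OF s]])
  ultimately show ?thesis by (auto simp: BMOA_def)
qed

subsection \<open>The logarithmic Carleson condition\<close>

text \<open>Again over \<open>m\<close> turns. All coefficients are kept at once, which later allows
  overlapping ranges of radii.\<close>

lemma deriv_g_circle_square_lower:
  assumes r: "0 < r" "r < 1"
  shows "ennreal (2*pi/3 * (\<Sum>j<J. (norm (dcoeff r j))\<^sup>2)) \<le> (\<integral>\<^sup>+t\<in>{0..2*pi}. ennreal ((norm (deriv g (of_real r * cis t)))\<^sup>2) \<partial>lborel)"
proof -
  define m where "m = nat \<lceil>lac_threshold lam\<rceil>"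
  have m: "real m \<ge> lac_threshold lam" "m > 0"
    using lac_threshold_ge[OF lam] unfolding m_def by linarith+
  define L where "L = 2 * pi * real m"
  have L: "L > 0" using m by (simp add: L_def)
  have big: "lac_threshold lam \<le> L * real (n k)" for k
  proof -
    have "1 * 1 \<le> 2 * pi * real (n k)" using n_pos[of k] pi_gt3 by (intro mult_mono) auto
    then have "real m * 1 \<le> real m * (2 * pi * real (n k))" by (intro mult_left_mono) auto
    moreover have "L * real (n k) = real m * (2 * pi * real (n k))" by (simp add: L_def)
    ultimately show ?thesis using m by linarith
  qed
  let ?h = "\<lambda>t. \<Sum>k. dcoeff r k * cis (real (n k) * t)"
  have sm: "summable (\<lambda>k. norm (dcoeff r k))" using r by (intro summable_norm_dcoeff) auto
  have hc: "continuous_on S ?h" for S by (rule continuous_on_cis_series[OF sm])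
  have hq: "continuous_on S (\<lambda>t. (norm (?h t))\<^sup>2)" for S by (intro continuous_intros hc)
  have [measurable]: "(\<lambda>t. (norm (?h t))\<^sup>2) \<in> borel_measurable borel" by (rule borel_measurable_continuous_onI[OF hq])
  have per: "?h (t + 2*pi) = ?h t" for t
  proof -
    have "cis (real (n k) * (t + 2*pi)) = cis (real (n k) * t)" for k
    proof -
      have "cis (real (n k) * (2*pi)) = cis (2*pi) ^ n k" by (rule Complex.DeMoivre[symmetric])
      then show ?thesis by (simp only: distrib_left cis_mult[symmetric] cis_2pi power_one mult_1_right)
    qed
    then show ?thesis by simp
  qed
  let ?X = "\<integral>\<^sup>+t\<in>{0..2*pi}. ennreal ((norm (?h t))\<^sup>2) \<partial>lborel"
  let ?S = "\<Sum>j<J. (norm (dcoeff r j))\<^sup>2"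
  \<comment> \<open>Against the maximum \<open>L^2 / 4\<close> of the weight this leaves
    \<open>L / 3\<close>, that is \<open>2 * pi / 3\<close> per turn.\<close>
  have "L^3/12 * ?S \<le> integral {0..0+L} (\<lambda>t. arc_weight 0 L t * (norm (?h t))\<^sup>2)"
    by (rule lacunary_series_square_lower[OF lac L sm big])
  also have "\<dots> \<le> integral {0..L} (\<lambda>t. L\<^sup>2/4 * (norm (?h t))\<^sup>2)"
    unfolding add_0_left by (intro integral_le integrable_continuous_interval continuous_intros hc mult_right_mono arc_weight_le) auto
  also have "\<dots> = L\<^sup>2/4 * integral {0..L} (\<lambda>t. (norm (?h t))\<^sup>2)" by simp
  finally have A: "L\<^sup>2/4 * (L/3 * ?S) \<le> L\<^sup>2/4 * integral {0..L} (\<lambda>t. (norm (?h t))\<^sup>2)"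
    by (simp add: power2_eq_square power3_eq_cube)
  have "L\<^sup>2/4 > 0" using L by simp
  from A have "L/3 * ?S \<le> integral {0..L} (\<lambda>t. (norm (?h t))\<^sup>2)"
    by (subst (asm) mult_le_cancel_left_pos[OF \<open>L\<^sup>2/4 > 0\<close>])
  then have "ennreal (L/3 * ?S) \<le> ennreal (integral {0..L} (\<lambda>t. (norm (?h t))\<^sup>2))" by (rule ennreal_leI)
  also have "ennreal (integral {0..L} (\<lambda>t. (norm (?h t))\<^sup>2)) = (\<integral>\<^sup>+t\<in>{0..L}. ennreal ((norm (?h t))\<^sup>2) \<partial>lborel)"
    by (rule nn_integral_eq_integral_continuous[OF hq, symmetric]) auto
  also have "\<dots> \<le> of_nat m * ?X"
    unfolding L_def by (intro nn_integral_periodic_multiple_le) (auto simp: per)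
  finally have B: "ennreal (L/3 * ?S) \<le> of_nat m * ?X" .
  have S0: "?S \<ge> 0" by (intro sum_nonneg) auto
  have m0: "real m > 0" using m by simp
  have "ennreal (2*pi/3 * ?S) = ennreal (1 / real m) * ennreal (L/3 * ?S)"
    using m0 S0 by (subst ennreal_mult[symmetric]) (auto simp: L_def)
  also have "\<dots> \<le> ennreal (1 / real m) * (of_nat m * ?X)" by (intro mult_left_mono B) auto
  also have "\<dots> = ?X"
  proof -
    have "ennreal (1 / real m) * of_nat m = 1"
      using m0 unfolding ennreal_of_nat_eq_real_of_nat by (subst ennreal_mult[symmetric]) auto
    then show ?thesis by (simp only: mult.assoc[symmetric] mult_1_left)
  qed
  finally show ?thesis using deriv_g_circle[of r] r by simp
qed

lemma continuous_carleson_integrand: "continuous_on udisc (\<lambda>z. (1 - (cmod z)\<^sup>2) * (cmod (deriv g z))\<^sup>2 / pi)"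
  by (intro continuous_intros continuous_deriv_g) auto

lemma carleson_integrand_nonneg: "z \<in> udisc \<Longrightarrow> 0 \<le> (1 - (cmod z)\<^sup>2) * (cmod (deriv g z))\<^sup>2 / pi"
  by (auto intro!: divide_nonneg_nonneg mult_nonneg_nonneg simp: abs_square_le_1)

text \<open>The term \<open>j\<close> is collected where \<open>1 - r\<close> lies between
  \<open>1 / (2 * n j)\<close> and \<open>1 / n j\<close>. This range lies in the annulus because
  \<open>n j >= m\<close>. Different ranges may overlap, as the lower bound on a circle holds for
  the sum of all terms.\<close>

lemma annulus_lower:
  assumes m: "m \<ge> 2" and k: "m \<le> n k"
  shows "ennreal ((\<Sum>j=k..<J. (norm (a j))\<^sup>2) / 108)
    \<le> (\<integral>\<^sup>+z\<in>{z. 1 - 1/real m \<le> cmod z \<and> cmod z < 1}. ennreal ((1 - (cmod z)\<^sup>2) * (cmod (deriv g z))\<^sup>2 / pi) \<partial>lborel)"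
proof -
  let ?A = "{z :: complex. 1 - 1/real m \<le> cmod z \<and> cmod z < 1}"
  have Am: "?A \<in> sets borel" by measurable
  have Asub: "?A \<subseteq> udisc" by auto
  have [measurable]: "(\<lambda>r. norm (dcoeff r k)) \<in> borel_measurable borel" for k unfolding dcoeff_def by measurable
  let ?v = "\<lambda>j r. ennreal (r * (1 - r\<^sup>2) / pi * (2*pi/3) * (norm (dcoeff r j))\<^sup>2) * indicator {1 - 1/real m..<1} r"
  have each: "ennreal ((norm (a j))\<^sup>2 / 108) \<le> (\<integral>\<^sup>+r. ?v j r \<partial>lborel)" if j: "j \<ge> k" for j
  proof -
    let ?N = "real (n j)"
    have Nm: "?N \<ge> real m" using n_mono[OF j] k by simp
    have N: "?N \<ge> 2" using Nm m by simp
    have "ennreal ((norm (a j))\<^sup>2 / 108) = ennreal (?N * (norm (a j))\<^sup>2 / 54) * ennreal (1 / (2 * ?N))"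
      using N by (subst ennreal_mult[symmetric]) auto
    also have "ennreal (1 / (2 * ?N)) = emeasure lborel {1 - 1/?N..1 - 1/(2*?N)}"
    proof -
      have "(1 - 1/(2*?N)) - (1 - 1/?N) = 1 / (2 * ?N)" using N by (simp add: field_simps)
      moreover have "1 - 1/?N \<le> 1 - 1/(2*?N)" using N by (simp add: field_simps)
      ultimately show ?thesis by (subst emeasure_lborel_Icc) auto
    qed
    also have "ennreal (?N * (norm (a j))\<^sup>2 / 54) * emeasure lborel {1 - 1/?N..1 - 1/(2*?N)}
      = (\<integral>\<^sup>+r. ennreal (?N * (norm (a j))\<^sup>2 / 54) * indicator {1 - 1/?N..1 - 1/(2*?N)} r \<partial>lborel)"
      by (rule nn_integral_cmult_indicator[symmetric]) auto
    also have "\<dots> \<le> (\<integral>\<^sup>+r. ?v j r \<partial>lborel)"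
    proof (rule nn_integral_mono)
      fix r
      show "ennreal (?N * (norm (a j))\<^sup>2 / 54) * indicator {1 - 1/?N..1 - 1/(2*?N)} r \<le> ?v j r"
      proof (cases "r \<in> {1 - 1/?N..1 - 1/(2*?N)}")
        case True
        then have r1: "1 - 1/?N \<le> r" "r \<le> 1 - 1/(2*?N)" by auto
        have p: "1/(2*?N) > 0" using N by simp
        then have r2: "r < 1" using r1 by linarith
        have "1/?N \<le> 1/2" using N by (intro divide_left_mono) auto
        then have r3: "r \<ge> 1/2" using r1 by linarith
        have "1/?N \<le> 1/real m" using Nm m by (intro frac_le) auto
        then have rin: "r \<in> {1 - 1/real m..<1}" using r1 r2 by auto
        have "1 - r \<le> 1 - r\<^sup>2" using r2 r3 by (simp add: power2_eq_square mult_left_le)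
        then have q1: "1/(2*?N) \<le> 1 - r\<^sup>2" using r1 by linarith
        have "1/3 \<le> (1 - 1/?N) ^ (n j - 1)" by (rule power_one_minus_inverse_ge[OF n_pos])
        also have "\<dots> \<le> r ^ (n j - 1)" using r1 N by (intro power_mono) auto
        finally have "(1/3)\<^sup>2 \<le> (r ^ (n j - 1))\<^sup>2" by (intro power_mono) auto
        then have q2: "1/9 \<le> (r ^ (n j - 1))\<^sup>2" by (simp add: power2_eq_square)
        \<comment> \<open>The factors are \<open>r >= 1/2\<close>,
          \<open>1 - r^2 >= 1 / (2 * n j)\<close>, \<open>2 / 3\<close> from the circle and
          \<open>1/9\<close> from the squared power of \<open>r\<close>. The length
          \<open>1 / (2 * n j)\<close> of the range turns 54 into 108.\<close>
        have "?N * (norm (a j))\<^sup>2 / 54 = 1/2 * (1/(2*?N)) / pi * (2*pi/3) * ((?N\<^sup>2 * (norm (a j))\<^sup>2) * (1/9))"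
          using N by (simp add: power2_eq_square)
        also have "\<dots> \<le> r * (1 - r\<^sup>2) / pi * (2*pi/3) * ((?N\<^sup>2 * (norm (a j))\<^sup>2) * (r ^ (n j - 1))\<^sup>2)"
        proof (rule mult_mono)
          have f1: "1/2 * (1/(2*?N)) \<le> r * (1 - r\<^sup>2)" using q1 r3 p by (intro mult_mono) linarith+
          then show "1/2 * (1/(2*?N)) / pi * (2*pi/3) \<le> r * (1 - r\<^sup>2) / pi * (2*pi/3)"
            by (intro mult_right_mono divide_right_mono) auto
          have "0 \<le> r * (1 - r\<^sup>2)" using f1 p by linarith
          then have "0 \<le> r * (1 - r\<^sup>2) / pi" by (rule divide_nonneg_nonneg) simp
          then show "0 \<le> r * (1 - r\<^sup>2) / pi * (2*pi/3)" by (rule mult_nonneg_nonneg) simp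
          show "(?N\<^sup>2 * (norm (a j))\<^sup>2) * (1/9) \<le> (?N\<^sup>2 * (norm (a j))\<^sup>2) * (r ^ (n j - 1))\<^sup>2"
            by (intro mult_left_mono q2) auto
        qed auto
        also have "\<dots> = r * (1 - r\<^sup>2) / pi * (2*pi/3) * (norm (dcoeff r j))\<^sup>2"
          using r3 by (simp add: norm_dcoeff power_mult_distrib)
        finally have "ennreal (?N * (norm (a j))\<^sup>2 / 54) \<le> ennreal (r * (1 - r\<^sup>2) / pi * (2*pi/3) * (norm (dcoeff r j))\<^sup>2)"
          by (rule ennreal_leI)
        then show ?thesis using True rin by (simp only: indicator_simps mult_1_right)
      qed simp
    qed
    finally show ?thesis .
  qed
  have "ennreal ((\<Sum>j=k..<J. (norm (a j))\<^sup>2) / 108) = (\<Sum>j=k..<J. ennreal ((norm (a j))\<^sup>2 / 108))"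
    by (simp add: sum_divide_distrib sum_ennreal)
  also have "\<dots> \<le> (\<Sum>j=k..<J. \<integral>\<^sup>+r. ?v j r \<partial>lborel)" by (intro sum_mono each) auto
  also have "\<dots> = (\<integral>\<^sup>+r. (\<Sum>j=k..<J. ?v j r) \<partial>lborel)" by (rule nn_integral_sum[symmetric]) measurable
  also have "\<dots> \<le> (\<integral>\<^sup>+r\<in>{0<..<1}. (\<integral>\<^sup>+t\<in>{0..0+2*pi}. ennreal (r * ((1 - (cmod (of_real r * cis t))\<^sup>2) * (cmod (deriv g (of_real r * cis t)))\<^sup>2 / pi)) * indicator ?A (of_real r * cis t) \<partial>lborel) \<partial>lborel)"
  proof (rule nn_integral_mono)
    fix r :: real
    let ?R = "(\<integral>\<^sup>+t\<in>{0..0+2*pi}. ennreal (r * ((1 - (cmod (of_real r * cis t))\<^sup>2) * (cmod (deriv g (of_real r * cis t)))\<^sup>2 / pi)) * indicator ?A (of_real r * cis t) \<partial>lborel) * indicator {0<..<1} r"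
    show "(\<Sum>j=k..<J. ?v j r) \<le> ?R"
    proof (cases "r \<in> {1 - 1/real m..<1}")
      case True
      have "1/real m < 1" using m by simp
      then have r: "0 < r" "r < 1" using True by auto
      have q: "r * (1 - r\<^sup>2) / pi \<ge> 0" using r by (auto intro!: divide_nonneg_nonneg mult_nonneg_nonneg simp: power_le_one)
      have dc: "continuous_on S (\<lambda>t. deriv g (of_real r * cis t))" for S
        by (rule analytic_disc_radial(1)[OF holomorphic_deriv[OF hol_g] r]) auto
      have [measurable]: "(\<lambda>t. deriv g (of_real r * cis t)) \<in> borel_measurable borel"
        by (rule borel_measurable_continuous_onI[OF dc])
      have "(\<Sum>j=k..<J. ?v j r) = (\<Sum>j=k..<J. ennreal (r * (1 - r\<^sup>2) / pi * (2*pi/3) * (norm (dcoeff r j))\<^sup>2))"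
        using True by simp
      also have "\<dots> = ennreal (\<Sum>j=k..<J. r * (1 - r\<^sup>2) / pi * (2*pi/3) * (norm (dcoeff r j))\<^sup>2)"
        by (intro sum_ennreal mult_nonneg_nonneg[OF mult_nonneg_nonneg[OF q]]) auto
      also have "\<dots> \<le> ennreal (r * (1 - r\<^sup>2) / pi * (2*pi/3 * (\<Sum>j<J. (norm (dcoeff r j))\<^sup>2)))"
      proof (rule ennreal_leI)
        have "(\<Sum>j=k..<J. (norm (dcoeff r j))\<^sup>2) \<le> (\<Sum>j<J. (norm (dcoeff r j))\<^sup>2)" by (intro sum_mono2) auto
        then have "(r * (1 - r\<^sup>2) / pi * (2*pi/3)) * (\<Sum>j=k..<J. (norm (dcoeff r j))\<^sup>2) \<le> (r * (1 - r\<^sup>2) / pi * (2*pi/3)) * (\<Sum>j<J. (norm (dcoeff r j))\<^sup>2)"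
          by (intro mult_left_mono[OF _ mult_nonneg_nonneg[OF q]]) auto
        then show "(\<Sum>j=k..<J. r * (1 - r\<^sup>2) / pi * (2*pi/3) * (norm (dcoeff r j))\<^sup>2) \<le> r * (1 - r\<^sup>2) / pi * (2*pi/3 * (\<Sum>j<J. (norm (dcoeff r j))\<^sup>2))"
          by (simp only: sum_distrib_left mult.assoc)
      qed
      also have "\<dots> = ennreal (r * (1 - r\<^sup>2) / pi) * ennreal (2*pi/3 * (\<Sum>j<J. (norm (dcoeff r j))\<^sup>2))"
        by (rule ennreal_mult'[OF q])
      also have "\<dots> \<le> ennreal (r * (1 - r\<^sup>2) / pi) * (\<integral>\<^sup>+t\<in>{0..2*pi}. ennreal ((norm (deriv g (of_real r * cis t)))\<^sup>2) \<partial>lborel)"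
        by (intro mult_left_mono deriv_g_circle_square_lower r) auto
      also have "\<dots> = (\<integral>\<^sup>+t. ennreal (r * (1 - r\<^sup>2) / pi) * (ennreal ((norm (deriv g (of_real r * cis t)))\<^sup>2) * indicator {0..2*pi} t) \<partial>lborel)"
        by (rule nn_integral_cmult[symmetric]) measurable
      also have "\<dots> = ?R"
      proof -
        have "ennreal (r * (1 - r\<^sup>2) / pi) * ennreal ((norm (deriv g (of_real r * cis t)))\<^sup>2)
          = ennreal (r * ((1 - (cmod (of_real r * cis t))\<^sup>2) * (cmod (deriv g (of_real r * cis t)))\<^sup>2 / pi)) * indicator ?A (of_real r * cis t)" for t
        proof -
          have "of_real r * cis t \<in> ?A" using r True by (simp add: norm_mult)
          moreover have "ennreal (r * (1 - r\<^sup>2) / pi) * ennreal ((norm (deriv g (of_real r * cis t)))\<^sup>2) = ennreal (r * (1 - r\<^sup>2) / pi * (norm (deriv g (of_real r * cis t)))\<^sup>2)"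
            by (rule ennreal_mult'[OF q, symmetric])
          ultimately show ?thesis using r by (simp add: norm_mult mult.assoc)
        qed
        then have "ennreal (r * (1 - r\<^sup>2) / pi) * (ennreal ((norm (deriv g (of_real r * cis t)))\<^sup>2) * indicator {0..2*pi} t)
          = ennreal (r * ((1 - (cmod (of_real r * cis t))\<^sup>2) * (cmod (deriv g (of_real r * cis t)))\<^sup>2 / pi)) * indicator ?A (of_real r * cis t) * indicator {0..0+2*pi} t" for t
          by (simp only: mult.assoc[symmetric] add_0_left)
        then show ?thesis using r by simp
      qed
      finally show ?thesis .
    qed simp
  qed
  also have "\<dots> = (\<integral>\<^sup>+z\<in>?A. ennreal ((1 - (cmod z)\<^sup>2) * (cmod (deriv g z))\<^sup>2 / pi) \<partial>lborel)"
    by (rule nn_integral_udisc_polar[symmetric, OF continuous_carleson_integrand carleson_integrand_nonneg Am Asub])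
  finally show ?thesis .
qed

text \<open>The annulus of width \<open>1/m\<close> is covered by \<open>m\<close> boxes over arcs
  of length \<open>2*pi / m\<close>. Their bounds add up to \<open>2 * pi * C\<close>, independent
  of \<open>m\<close>, and \<open>m = n k\<close> is then the right scale for the tail from
  \<open>k\<close> on.\<close>

lemma BMOA_log_imp_tail_log:
  assumes "g \<in> BMOA_log"
  obtains C where "tail_log C"
proof -
  obtain C where C: "C > 0" and Cb: "\<And>b L. 0 < L \<Longrightarrow> L \<le> 2*pi \<Longrightarrow>
      (\<integral>\<^sup>+ z \<in> carleson_box b L. ennreal ((1 - (cmod z)\<^sup>2) * (cmod (deriv g z))\<^sup>2 / pi) \<partial>lborel)
        * ennreal ((ln (2 / L))\<^sup>2) \<le> ennreal (C * L)"
    using assms unfolding BMOA_log_def by blast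
  let ?h = "\<lambda>z. ennreal ((1 - (cmod z)\<^sup>2) * (cmod (deriv g z))\<^sup>2 / pi)"
  have hm: "(\<lambda>z. ?h z * indicator (carleson_box b L) z) \<in> borel_measurable lborel" if "L \<le> 2*pi" for b L
  proof -
    have [measurable]: "carleson_box b L \<in> sets borel" by (rule borel_carleson_box)
    have "(\<lambda>z. indicator udisc z *\<^sub>R ((1 - (cmod z)\<^sup>2) * (cmod (deriv g z))\<^sup>2 / pi)) \<in> borel_measurable borel"
      by (intro borel_measurable_continuous_on_indicator continuous_carleson_integrand) auto
    then have "(\<lambda>z. ennreal (indicator udisc z *\<^sub>R ((1 - (cmod z)\<^sup>2) * (cmod (deriv g z))\<^sup>2 / pi)) * indicator (carleson_box b L) z) \<in> borel_measurable borel"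
      by measurable
    also have "(\<lambda>z. ennreal (indicator udisc z *\<^sub>R ((1 - (cmod z)\<^sup>2) * (cmod (deriv g z))\<^sup>2 / pi)) * indicator (carleson_box b L) z)
       = (\<lambda>z. ?h z * indicator (carleson_box b L) z)"
      using carleson_box_subset_udisc[OF that, of b] by (auto simp: fun_eq_iff indicator_def)
    finally show ?thesis by simp
  qed
  have key: "(\<Sum>j=k..<J. (norm (a j))\<^sup>2) * (ln (real m / pi))\<^sup>2 \<le> 216 * pi * C" if m: "m \<ge> 2" "m \<le> n k" for m k J
  proof -
    let ?A = "{z :: complex. 1 - 1/real m \<le> cmod z \<and> cmod z < 1}"
    define L where "L = 2*pi / real m"
    have L: "0 < L" "L \<le> 2*pi" using m by (auto simp: L_def field_simps)
    have L2: "2 / L = real m / pi" using m by (simp add: L_def)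
    have "(\<integral>\<^sup>+z\<in>?A. ?h z \<partial>lborel) \<le> (\<integral>\<^sup>+z. (\<Sum>j<m. ?h z * indicator (carleson_box (2*pi*real j / real m) L) z) \<partial>lborel)"
    proof (rule nn_integral_mono)
      fix z :: complex
      show "?h z * indicator ?A z \<le> (\<Sum>j<m. ?h z * indicator (carleson_box (2*pi*real j / real m) L) z)"
      proof (cases "z \<in> ?A")
        case True
        then obtain j where j: "j < m" "z \<in> carleson_box (2*pi*real j / real m) L"
          unfolding L_def using carleson_boxes_cover[of m z] m by auto
        have "?h z * indicator ?A z = ?h z * indicator (carleson_box (2*pi*real j / real m) L) z" using j True by simp
        also have "\<dots> \<le> (\<Sum>j<m. ?h z * indicator (carleson_box (2*pi*real j / real m) L) z)"
          using j by (intro member_le_sum) auto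
        finally show ?thesis .
      qed simp
    qed
    also have "\<dots> = (\<Sum>j<m. \<integral>\<^sup>+z\<in>carleson_box (2*pi*real j / real m) L. ?h z \<partial>lborel)"
      by (rule nn_integral_sum) (rule hm[OF L(2)])
    finally have "(\<integral>\<^sup>+z\<in>?A. ?h z \<partial>lborel) * ennreal ((ln (2/L))\<^sup>2)
       \<le> (\<Sum>j<m. \<integral>\<^sup>+z\<in>carleson_box (2*pi*real j / real m) L. ?h z \<partial>lborel) * ennreal ((ln (2/L))\<^sup>2)"
      by (rule mult_right_mono) simp
    also have "\<dots> = (\<Sum>j<m. (\<integral>\<^sup>+z\<in>carleson_box (2*pi*real j / real m) L. ?h z \<partial>lborel) * ennreal ((ln (2/L))\<^sup>2))"
      by (rule sum_distrib_right)
    also have "\<dots> \<le> (\<Sum>j<m. ennreal (C * L))" by (intro sum_mono Cb L)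
    also have "\<dots> = ennreal (real m * (C * L))"
      using C L by (simp add: ennreal_mult' ennreal_of_nat_eq_real_of_nat)
    also have "real m * (C * L) = 2 * pi * C" using m by (simp add: L_def)
    finally have U: "(\<integral>\<^sup>+z\<in>?A. ?h z \<partial>lborel) * ennreal ((ln (real m / pi))\<^sup>2) \<le> ennreal (2 * pi * C)" by (simp only: L2)
    let ?S = "\<Sum>j=k..<J. (norm (a j))\<^sup>2"
    have S0: "?S \<ge> 0" by (intro sum_nonneg) auto
    have "ennreal (?S / 108 * (ln (real m / pi))\<^sup>2) = ennreal (?S / 108) * ennreal ((ln (real m / pi))\<^sup>2)"
      using S0 by (intro ennreal_mult) auto
    also have "\<dots> \<le> (\<integral>\<^sup>+z\<in>?A. ?h z \<partial>lborel) * ennreal ((ln (real m / pi))\<^sup>2)"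
      by (intro mult_right_mono annulus_lower m) auto
    also note U
    finally have "?S / 108 * (ln (real m / pi))\<^sup>2 \<le> 2 * pi * C" using C by (subst (asm) ennreal_le_iff) auto
    then show ?thesis by simp
  qed
  define C1 where "C1 = 16 * (216 * pi * C)"
  \<comment> \<open>\<open>k >= 15\<close> forces \<open>n k >= 16\<close>. Near
    \<open>L = 2\<close> the logarithm vanishes and the condition says nothing, so the first 15
    indices are absorbed into the constant.\<close>
  have k15: "(\<Sum>j=k..<J. (norm (a j))\<^sup>2) * (1 + ln (real (n k)))\<^sup>2 \<le> C1" if k: "k \<ge> 15" for k J
  proof -
    have nk: "real (n k) \<ge> 16" using n_ge[of k] k by simp
    have "((1 + ln (real (n k))) / 4)\<^sup>2 \<le> (ln (real (n k) / pi))\<^sup>2"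
      using ln_over_pi_ge[OF nk] one_plus_ln_n_ge[of k] by (intro power_mono) auto
    then have "(\<Sum>j=k..<J. (norm (a j))\<^sup>2) * ((1 + ln (real (n k))) / 4)\<^sup>2 \<le> (\<Sum>j=k..<J. (norm (a j))\<^sup>2) * (ln (real (n k) / pi))\<^sup>2"
      by (intro mult_left_mono sum_nonneg) auto
    also have "\<dots> \<le> 216 * pi * C" using nk by (intro key) auto
    finally show ?thesis by (simp add: C1_def power_divide)
  qed
  define S0 where "S0 = (\<Sum>j<15. (norm (a j))\<^sup>2)"
  have S0: "S0 \<ge> 0" by (auto simp: S0_def intro: sum_nonneg)
  have C1: "C1 \<ge> 0" using C by (simp add: C1_def)
  show thesis
  proof (rule that[of "C1 + S0 * (1 + ln (real (n 15)))\<^sup>2"], unfold tail_log_def, intro conjI allI)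
    show "0 \<le> C1 + S0 * (1 + ln (real (n 15)))\<^sup>2" using C1 S0 by simp
    fix k J
    show "(\<Sum>j=k..<J. (norm (a j))\<^sup>2) * (1 + ln (real (n k)))\<^sup>2 \<le> C1 + S0 * (1 + ln (real (n 15)))\<^sup>2"
    proof (cases "k \<ge> 15")
      case True
      moreover have "0 \<le> S0 * (1 + ln (real (n 15)))\<^sup>2" using S0 by simp
      ultimately show ?thesis using k15[of k J] by linarith
    next
      case False
      have "(\<Sum>j=k..<J. (norm (a j))\<^sup>2) \<le> (\<Sum>j\<in>{..<15} \<union> {15..<J}. (norm (a j))\<^sup>2)"
        using False by (intro sum_mono2) auto
      also have "\<dots> = S0 + (\<Sum>j=15..<J. (norm (a j))\<^sup>2)"
        unfolding S0_def by (subst sum.union_disjoint) auto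
      finally have 1: "(\<Sum>j=k..<J. (norm (a j))\<^sup>2) \<le> S0 + (\<Sum>j=15..<J. (norm (a j))\<^sup>2)" .
      have "ln (real (n k)) \<le> ln (real (n 15))" using n_mono[of k 15] False n_pos[of k] by simp
      then have 2: "(1 + ln (real (n k)))\<^sup>2 \<le> (1 + ln (real (n 15)))\<^sup>2" using one_plus_ln_n_ge[of k] by (intro power_mono) auto
      have "(\<Sum>j=k..<J. (norm (a j))\<^sup>2) * (1 + ln (real (n k)))\<^sup>2 \<le> (S0 + (\<Sum>j=15..<J. (norm (a j))\<^sup>2)) * (1 + ln (real (n 15)))\<^sup>2"
        by (intro mult_mono 1 2 add_nonneg_nonneg S0 sum_nonneg) auto
      also have "\<dots> \<le> S0 * (1 + ln (real (n 15)))\<^sup>2 + C1" using k15[of 15 J] by (simp add: distrib_right)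
      finally show ?thesis by simp
    qed
  qed
qed

text \<open>The series of \<open>g'\<close> is split at frequency \<open>1/L\<close>. The low part
  is at most \<open>D1 / (L * l)\<close> pointwise on the box, which has area of order
  \<open>L^2\<close>. The high part is integrated in square mean over the arc and then radially,
  leaving the tail sum of \<open>|a j|^2\<close>.\<close>

lemma tail_log_imp_BMOA_log:
  assumes T: "tail_log C" and s: "summable (\<lambda>k. norm (a k))"
  shows "g \<in> BMOA_log"
proof -
  define D1 where "D1 = 2 * sqrt C * lac_const (sqrt lam)"
  have C: "C \<ge> 0" using T by (simp add: tail_log_def)
  have D10: "D1 \<ge> 0" using C lam lac_const_pos[of "sqrt lam"] by (auto simp: D1_def)
  define A where "A = 2592 * lac_const lam"
  have A0: "A \<ge> 0" using lac_const_pos[OF lam] by (simp add: A_def)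
  define E where "E = 2 * D1\<^sup>2 + A * (9 * C) + 1"
  have E: "E > 0" using A0 C by (simp add: E_def add_nonneg_pos)
  have "g \<in> H1" using H1_mult_bounded[OF one_mem_H1 hol_g norm_g_le[OF s]] by simp
  moreover have "(\<integral>\<^sup>+ z \<in> carleson_box b L. ennreal ((1 - (cmod z)\<^sup>2) * (cmod (deriv g z))\<^sup>2 / pi) \<partial>lborel)
        * ennreal ((ln (2 / L))\<^sup>2) \<le> ennreal (E * L)" if L: "0 < L" "L \<le> 2*pi" for b L
  proof -
    define l where "l = 1 + \<bar>ln L\<bar>"
    have l: "l \<ge> 1" by (simp add: l_def)
    define K where "K = first_ge (1/L)"
    have KL: "1/L \<le> real (n K)" unfolding K_def by (rule first_ge)
    have LF: "(\<Sum>k<K. real (n k) * norm (a k)) \<le> D1 * (1 / (L * l))"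
      unfolding K_def D1_def l_def using low_frequency_scale_le[OF tail_log_coeff[OF T] L(1)] by simp
    let ?I = "{b..b+L}"
    let ?R = "{0<..<1} \<inter> {1 - L/(2*pi)..}"
    let ?c1 = "2 * D1\<^sup>2 / (L * l\<^sup>2)"
    have inner: "(\<integral>\<^sup>+t\<in>?I. ennreal (r * ((1 - (cmod (of_real r * cis t))\<^sup>2) * (cmod (deriv g (of_real r * cis t)))\<^sup>2 / pi)) \<partial>lborel)
       \<le> ennreal ?c1 * ennreal L + ennreal (A * L) * (\<Sum>j. ennreal (r * (1 - r\<^sup>2) * (norm (dcoeff r (j + K)))\<^sup>2))"
      if r: "0 < r" "r < 1" "1 - L/(2*pi) \<le> r" for r
    proof -
      have sm: "summable (\<lambda>k. norm (dcoeff r k))" using r by (intro summable_norm_dcoeff) auto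
      define h where "h t = (\<Sum>j. dcoeff r (j + K) * cis (real (n (j + K)) * t))" for t
      have sK: "summable (\<lambda>j. norm (dcoeff r (j + K)))" using sm by (simp add: summable_iff_shift[of "\<lambda>j. norm (dcoeff r j)"])
      have hc: "continuous_on S h" for S unfolding h_def by (rule continuous_on_cis_series[OF sK])
      have gb: "(cmod (deriv g (of_real r * cis t)))\<^sup>2 \<le> 2 * (D1 / (L * l))\<^sup>2 + 2 * (norm (h t))\<^sup>2" for t
      proof -
        have "cmod (deriv g (of_real r * cis t)) = norm ((\<Sum>k<K. dcoeff r k * cis (real (n k) * t)) + h t)"
          using r unfolding h_def by (subst deriv_g_circle) (auto simp: split_series[OF sm, of t K])
        also have "\<dots> \<le> norm (\<Sum>k<K. dcoeff r k * cis (real (n k) * t)) + norm (h t)" by (rule norm_triangle_ineq)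
        also have "norm (\<Sum>k<K. dcoeff r k * cis (real (n k) * t)) \<le> (\<Sum>k<K. real (n k) * norm (a k))"
        proof (rule sum_norm_le)
          fix k
          have "real (n k) * norm (a k) * r ^ (n k - 1) \<le> real (n k) * norm (a k) * 1"
            using r by (intro mult_left_mono power_le_one) auto
          then show "norm (dcoeff r k * cis (real (n k) * t)) \<le> real (n k) * norm (a k)"
            using r by (simp add: norm_mult norm_dcoeff)
        qed
        also note LF
        finally have "cmod (deriv g (of_real r * cis t)) \<le> D1 / (L * l) + norm (h t)" by simp
        then have "(cmod (deriv g (of_real r * cis t)))\<^sup>2 \<le> (D1 / (L * l) + norm (h t))\<^sup>2" by (intro power_mono) auto
        also have "\<dots> \<le> 2 * (D1 / (L * l))\<^sup>2 + 2 * (norm (h t))\<^sup>2"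
          using sum_squares_bound[of "D1 / (L * l)" "norm (h t)"] unfolding power2_sum by linarith
        finally show ?thesis .
      qed
      define w where "w = r * (1 - r\<^sup>2)"
      have w0: "w \<ge> 0" using r by (auto simp: w_def power_le_one)
      \<comment> \<open>Inside the box \<open>1 - r <= L / (2*pi)\<close>. For the low part only
        this crude size of the weight counts.\<close>
      have wL: "w \<le> L"
      proof -
        have "w = (r * (1 + r)) * (1 - r)" by (simp add: w_def power2_eq_square algebra_simps)
        also have "\<dots> \<le> (1 * 2) * (L/(2*pi))" using r by (intro mult_mono) auto
        also have "\<dots> \<le> L" using L pi_gt3 by (simp add: field_simps)
        finally show ?thesis .
      qed
      have pt: "r * ((1 - (cmod (of_real r * cis t))\<^sup>2) * (cmod (deriv g (of_real r * cis t)))\<^sup>2 / pi) \<le> ?c1 + 2 * w * (norm (h t))\<^sup>2" for t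
      proof -
        have "r * ((1 - (cmod (of_real r * cis t))\<^sup>2) * (cmod (deriv g (of_real r * cis t)))\<^sup>2 / pi) = w * (cmod (deriv g (of_real r * cis t)))\<^sup>2 / pi"
          using r by (simp add: norm_mult w_def)
        also have "\<dots> \<le> w * (cmod (deriv g (of_real r * cis t)))\<^sup>2 / 1"
          using w0 pi_gt3 by (intro divide_left_mono mult_nonneg_nonneg) auto
        also have "\<dots> \<le> w * (2 * (D1 / (L * l))\<^sup>2 + 2 * (norm (h t))\<^sup>2)" using gb[of t] w0 by (simp add: mult_left_mono)
        also have "\<dots> = w * (2 * (D1 / (L * l))\<^sup>2) + 2 * w * (norm (h t))\<^sup>2" by (simp add: algebra_simps)
        also have "w * (2 * (D1 / (L * l))\<^sup>2) \<le> L * (2 * (D1 / (L * l))\<^sup>2)" using wL by (intro mult_right_mono) auto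
        also have "L * (2 * (D1 / (L * l))\<^sup>2) = ?c1" using L l by (simp add: power2_eq_square)
        finally show ?thesis by simp
      qed
      have "(\<integral>\<^sup>+t\<in>?I. ennreal (r * ((1 - (cmod (of_real r * cis t))\<^sup>2) * (cmod (deriv g (of_real r * cis t)))\<^sup>2 / pi)) \<partial>lborel)
        \<le> (\<integral>\<^sup>+t\<in>?I. ennreal (?c1 + 2 * w * (norm (h t))\<^sup>2) \<partial>lborel)"
        by (intro nn_integral_mono mult_right_mono ennreal_leI pt) auto
      also have "\<dots> = ennreal (integral ?I (\<lambda>t. ?c1 + 2 * w * (norm (h t))\<^sup>2))"
        using w0 L by (intro nn_integral_eq_integral_continuous continuous_intros hc) (auto intro!: add_nonneg_nonneg)
      also have "integral ?I (\<lambda>t. ?c1 + 2 * w * (norm (h t))\<^sup>2) = ?c1 * L + 2 * w * integral ?I (\<lambda>t. (norm (h t))\<^sup>2)"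
        using L by (subst integral_add) (auto intro!: integrable_continuous_interval continuous_intros hc)
      also have "ennreal (?c1 * L + 2 * w * integral ?I (\<lambda>t. (norm (h t))\<^sup>2)) \<le> ennreal (?c1 * L + 2 * w * (1296 * lac_const lam * L * (\<Sum>j. (norm (dcoeff r (j + K)))\<^sup>2)))"
      proof (intro ennreal_leI add_left_mono mult_left_mono)
        show "integral ?I (\<lambda>t. (norm (h t))\<^sup>2) \<le> 1296 * lac_const lam * L * (\<Sum>j. (norm (dcoeff r (j + K)))\<^sup>2)"
          unfolding h_def
        proof (rule lacunary_series_square_upper[OF lac_shift L(1) sK])
          show "1 \<le> L * real (n (j + K))" for j
          proof -
            have "1 / L \<le> real (n (j + K))" using KL n_mono[of K "j+K"] by linarith
            then show ?thesis using L by (simp add: field_simps)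
          qed
          show "summable (\<lambda>j. (norm (dcoeff r (j + K)))\<^sup>2)" by (rule summable_norm_square[OF sK])
        qed
      qed (use w0 in auto)
      also have "\<dots> = ennreal (?c1 * L + (A * L) * (\<Sum>j. w * (norm (dcoeff r (j + K)))\<^sup>2))"
        using summable_norm_square[OF sK] by (simp add: suminf_mult A_def mult_ac)
      also have "\<dots> = ennreal (?c1 * L) + ennreal ((A * L) * (\<Sum>j. w * (norm (dcoeff r (j + K)))\<^sup>2))"
        using L A0 w0 summable_norm_square[OF sK] by (intro ennreal_plus mult_nonneg_nonneg suminf_nonneg summable_mult) auto
      also have "ennreal (?c1 * L) = ennreal ?c1 * ennreal L" using L by (intro ennreal_mult) auto
      also have "ennreal ((A * L) * (\<Sum>j. w * (norm (dcoeff r (j + K)))\<^sup>2)) = ennreal (A * L) * ennreal (\<Sum>j. w * (norm (dcoeff r (j + K)))\<^sup>2)"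
        using L A0 by (intro ennreal_mult') auto
      also have "ennreal (\<Sum>j. w * (norm (dcoeff r (j + K)))\<^sup>2) = (\<Sum>j. ennreal (w * (norm (dcoeff r (j + K)))\<^sup>2))"
        using w0 summable_norm_square[OF sK] by (intro suminf_ennreal2[symmetric] summable_mult) auto
      finally show ?thesis by (simp add: w_def)
    qed
    have [measurable]: "(\<lambda>r. norm (dcoeff r k)) \<in> borel_measurable borel" for k unfolding dcoeff_def by measurable
    \<comment> \<open>With the weight \<open>r * (1 - r^2)\<close> the integral is elementary:
      \<open>n^2 * (1 / (2*n) - 1 / (2*n + 2))\<close>, which is bounded by 1.\<close>
    have radial: "(\<integral>\<^sup>+r\<in>{0<..<1}. ennreal (r * (1 - r\<^sup>2) * (norm (dcoeff r j))\<^sup>2) \<partial>lborel) \<le> ennreal ((norm (a j))\<^sup>2)" for j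
    proof -
      let ?N = "real (n j)"
      have N: "?N \<ge> 1" using n_pos[of j] by simp
      have "(\<integral>\<^sup>+r\<in>{0<..<1}. ennreal (r * (1 - r\<^sup>2) * (norm (dcoeff r j))\<^sup>2) \<partial>lborel)
         \<le> (\<integral>\<^sup>+r\<in>{0..1}. ennreal ((?N * norm (a j))\<^sup>2 * (r ^ (2 * n j - 1) - r ^ (2 * n j + 1))) \<partial>lborel)"
      proof (rule nn_integral_mono)
        fix r :: real
        have e: "r * (1 - r\<^sup>2) * (norm (dcoeff r j))\<^sup>2 = (?N * norm (a j))\<^sup>2 * (r ^ (2 * n j - 1) - r ^ (2 * n j + 1))" if "r > 0"
        proof -
          have p: "r * (r ^ (n j - 1))\<^sup>2 = r ^ (2 * n j - 1)" "r ^ (2 * n j + 1) = r ^ (2 * n j - 1) * r\<^sup>2"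
          proof -
            obtain i where i: "n j = Suc i" using n_pos[of j] gr0_conv_Suc by blast
            show "r * (r ^ (n j - 1))\<^sup>2 = r ^ (2 * n j - 1)" by (simp add: i power_mult[symmetric] mult.commute)
            show "r ^ (2 * n j + 1) = r ^ (2 * n j - 1) * r\<^sup>2" by (simp add: i power2_eq_square)
          qed
          have "r * (1 - r\<^sup>2) * (norm (dcoeff r j))\<^sup>2 = (?N * norm (a j))\<^sup>2 * ((r * (r ^ (n j - 1))\<^sup>2) * (1 - r\<^sup>2))"
            using that by (simp add: norm_dcoeff power_mult_distrib mult_ac)
          also have "\<dots> = (?N * norm (a j))\<^sup>2 * (r ^ (2 * n j - 1) - r ^ (2 * n j + 1))" unfolding p by (simp add: right_diff_distrib)
          finally show ?thesis .
        qed
        show "ennreal (r * (1 - r\<^sup>2) * (norm (dcoeff r j))\<^sup>2) * indicator {0<..<1} r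
           \<le> ennreal ((?N * norm (a j))\<^sup>2 * (r ^ (2 * n j - 1) - r ^ (2 * n j + 1))) * indicator {0..1} r"
          using e by (auto simp: indicator_def)
      qed
      also have "\<dots> = ennreal ((?N * norm (a j))\<^sup>2 * (1 / (2 * ?N) - 1 / (2 * ?N + 2)))"
      proof (rule nn_integral_has_integral_lebesgue')
        show "0 \<le> (?N * norm (a j))\<^sup>2 * (r ^ (2 * n j - 1) - r ^ (2 * n j + 1))" if "r \<in> {0..1}" for r
        proof -
          have "r ^ (2 * n j + 1) \<le> r ^ (2 * n j - 1)" using that by (intro power_decreasing) auto
          then show ?thesis by (intro mult_nonneg_nonneg zero_le_power2) (simp only: diff_ge_0_iff_ge)
        qed
        have ftc: "((\<lambda>r. (?N * norm (a j))\<^sup>2 * (r ^ (2 * n j - 1) - r ^ (2 * n j + 1))) has_integral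
           (?N * norm (a j))\<^sup>2 * (1 ^ (2 * n j) / (2 * ?N) - 1 ^ (2 * n j + 2) / (2 * ?N + 2)) - (?N * norm (a j))\<^sup>2 * (0 ^ (2 * n j) / (2 * ?N) - 0 ^ (2 * n j + 2) / (2 * ?N + 2))) {0..1}"
        proof (rule fundamental_theorem_of_calculus)
          fix r :: real
          show "((\<lambda>r. (?N * norm (a j))\<^sup>2 * (r ^ (2 * n j) / (2 * ?N) - r ^ (2 * n j + 2) / (2 * ?N + 2))) has_vector_derivative
             (?N * norm (a j))\<^sup>2 * (r ^ (2 * n j - 1) - r ^ (2 * n j + 1))) (at r within {0..1})"
            unfolding has_real_derivative_iff_has_vector_derivative[symmetric]
          proof (intro DERIV_cmult DERIV_diff)
            show "((\<lambda>r. r ^ (2 * n j) / (2 * ?N)) has_real_derivative r ^ (2 * n j - 1)) (at r within {0..1})"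
              using N by (auto intro!: derivative_eq_intros)
            show "((\<lambda>r. r ^ (2 * n j + 2) / (2 * ?N + 2)) has_real_derivative r ^ (2 * n j + 1)) (at r within {0..1})"
            proof -
              have "((\<lambda>r. r ^ (2 * n j + 2) / (2 * ?N + 2)) has_real_derivative real (2 * n j + 2) * r ^ (2 * n j + 2 - Suc 0) / (2 * ?N + 2)) (at r within {0..1})"
                by (intro DERIV_cdivide DERIV_pow)
              moreover have "real (2 * n j + 2) = 2 * ?N + 2" "2 * n j + 2 - Suc 0 = 2 * n j + 1" by simp_all
              moreover have "(2 * ?N + 2) * x / (2 * ?N + 2) = x" for x using N by simp
              ultimately show ?thesis by (simp only:)
            qed
          qed
        qed simp
        show "((\<lambda>r. (?N * norm (a j))\<^sup>2 * (r ^ (2 * n j - 1) - r ^ (2 * n j + 1))) has_integral (?N * norm (a j))\<^sup>2 * (1 / (2 * ?N) - 1 / (2 * ?N + 2))) {0..1}"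
        proof -
          have "(0::real) ^ (2 * n j) = 0" "(0::real) ^ (2 * n j + 2) = 0" using n_pos[of j] by auto
          with ftc show ?thesis
            by (simp only: power_one div_0 diff_self mult_zero_right diff_zero)
        qed
      qed
      also have "\<dots> \<le> ennreal ((norm (a j))\<^sup>2)"
      proof (rule ennreal_leI)
        have "1 / (2 * ?N) - 1 / (2 * ?N + 2) = 1 / (2 * ?N * (?N + 1))" using N by (simp add: field_simps)
        also have "\<dots> \<le> 1 / ?N\<^sup>2" using N by (intro frac_le) (auto simp: power2_eq_square algebra_simps intro: add_increasing2)
        finally have "(?N * norm (a j))\<^sup>2 * (1 / (2 * ?N) - 1 / (2 * ?N + 2)) \<le> (?N * norm (a j))\<^sup>2 * (1 / ?N\<^sup>2)"
          by (intro mult_left_mono) auto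
        also have "\<dots> = (norm (a j))\<^sup>2" using N by (simp add: power_mult_distrib)
        finally show "(?N * norm (a j))\<^sup>2 * (1 / (2 * ?N) - 1 / (2 * ?N + 2)) \<le> (norm (a j))\<^sup>2" .
      qed
      finally show ?thesis .
    qed
    have sa: "summable (\<lambda>j. (norm (a (j + K)))\<^sup>2)"
      using summable_norm_square[OF s] by (simp add: summable_iff_shift[of "\<lambda>j. (norm (a j))\<^sup>2"])
    have tail: "(\<Sum>j. (norm (a (j + K)))\<^sup>2) \<le> 9 * C / l\<^sup>2"
    proof -
      have "(\<Sum>j. (norm (a (j + K)))\<^sup>2) \<ge> 0" by (intro suminf_nonneg sa) auto
      moreover have "l\<^sup>2 \<le> (3 * (1 + ln (real (n K))))\<^sup>2" using log_scale_le[OF L KL] l by (intro power_mono) (auto simp: l_def)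
      ultimately have "(\<Sum>j. (norm (a (j + K)))\<^sup>2) * l\<^sup>2 \<le> (\<Sum>j. (norm (a (j + K)))\<^sup>2) * (3 * (1 + ln (real (n K))))\<^sup>2"
        by (intro mult_left_mono) auto
      also have "\<dots> \<le> 9 * C" using tail_log_suminf[OF T s, of K] unfolding power_mult_distrib[of 3] by (simp add: mult_ac)
      finally show ?thesis using l by (subst pos_le_divide_eq) auto
    qed
    have "(\<integral>\<^sup>+ z \<in> carleson_box b L. ennreal ((1 - (cmod z)\<^sup>2) * (cmod (deriv g z))\<^sup>2 / pi) \<partial>lborel)
      \<le> (\<integral>\<^sup>+r\<in>?R. (\<integral>\<^sup>+t\<in>?I. ennreal (r * ((1 - (cmod (of_real r * cis t))\<^sup>2) * (cmod (deriv g (of_real r * cis t)))\<^sup>2 / pi)) \<partial>lborel) \<partial>lborel)"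
      by (rule nn_integral_carleson_box_le[OF continuous_carleson_integrand carleson_integrand_nonneg L])
    also have "\<dots> \<le> (\<integral>\<^sup>+r. ennreal ?c1 * ennreal L * indicator {1 - L/(2*pi)..1} r + ennreal (A * L) * (\<Sum>j. ennreal (r * (1 - r\<^sup>2) * (norm (dcoeff r (j + K)))\<^sup>2) * indicator {0<..<1} r) \<partial>lborel)"
    proof (rule nn_integral_mono)
      fix r :: real
      show "(\<integral>\<^sup>+t\<in>?I. ennreal (r * ((1 - (cmod (of_real r * cis t))\<^sup>2) * (cmod (deriv g (of_real r * cis t)))\<^sup>2 / pi)) \<partial>lborel) * indicator ?R r
        \<le> ennreal ?c1 * ennreal L * indicator {1 - L/(2*pi)..1} r + ennreal (A * L) * (\<Sum>j. ennreal (r * (1 - r\<^sup>2) * (norm (dcoeff r (j + K)))\<^sup>2) * indicator {0<..<1} r)"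
      proof (cases "r \<in> ?R")
        case True
        then have r: "0 < r" "r < 1" "1 - L/(2*pi) \<le> r" by auto
        show ?thesis using inner[OF r] r by simp
      qed simp
    qed
    also have "\<dots> = ennreal ?c1 * ennreal L * emeasure lborel {1 - L/(2*pi)..1} + ennreal (A * L) * (\<Sum>j. \<integral>\<^sup>+r\<in>{0<..<1}. ennreal (r * (1 - r\<^sup>2) * (norm (dcoeff r (j + K)))\<^sup>2) \<partial>lborel)"
    proof -
      have "(\<integral>\<^sup>+r. ennreal (A * L) * (\<Sum>j. ennreal (r * (1 - r\<^sup>2) * (norm (dcoeff r (j + K)))\<^sup>2) * indicator {0<..<1} r) \<partial>lborel)
        = ennreal (A * L) * (\<Sum>j. \<integral>\<^sup>+r\<in>{0<..<1}. ennreal (r * (1 - r\<^sup>2) * (norm (dcoeff r (j + K)))\<^sup>2) \<partial>lborel)"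
        by (subst nn_integral_cmult, measurable, subst nn_integral_suminf) measurable
      moreover have "(\<integral>\<^sup>+r. ennreal ?c1 * ennreal L * indicator {1 - L/(2*pi)..1} r \<partial>lborel) = ennreal ?c1 * ennreal L * emeasure lborel {1 - L/(2*pi)..1}"
        by (rule nn_integral_cmult_indicator) auto
      ultimately show ?thesis by (subst nn_integral_add) measurable
    qed
    also have "\<dots> \<le> ennreal ?c1 * ennreal L * ennreal L + ennreal (A * L) * ennreal (9 * C / l\<^sup>2)"
    proof (intro add_mono mult_left_mono)
      have "L / (2*pi) \<le> L / 1" using L pi_gt3 by (intro divide_left_mono) auto
      then show "emeasure lborel {1 - L/(2*pi)..1} \<le> ennreal L" using L by (subst emeasure_lborel_Icc) (auto intro!: ennreal_leI)
      have "(\<Sum>j. \<integral>\<^sup>+r\<in>{0<..<1}. ennreal (r * (1 - r\<^sup>2) * (norm (dcoeff r (j + K)))\<^sup>2) \<partial>lborel) \<le> (\<Sum>j. ennreal ((norm (a (j + K)))\<^sup>2))"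
        by (intro suminf_le radial) auto
      also have "\<dots> = ennreal (\<Sum>j. (norm (a (j + K)))\<^sup>2)" using sa by (intro suminf_ennreal2) auto
      also have "\<dots> \<le> ennreal (9 * C / l\<^sup>2)" by (intro ennreal_leI tail)
      finally show "(\<Sum>j. \<integral>\<^sup>+r\<in>{0<..<1}. ennreal (r * (1 - r\<^sup>2) * (norm (dcoeff r (j + K)))\<^sup>2) \<partial>lborel) \<le> ennreal (9 * C / l\<^sup>2)" .
    qed auto
    also have "\<dots> = ennreal ((2 * D1\<^sup>2 + A * (9 * C)) * L / l\<^sup>2)"
    proof -
      have "ennreal ?c1 * ennreal L * ennreal L = ennreal (?c1 * L * L)"
        by (simp only: ennreal_mult''[OF less_imp_le[OF L(1)]])
      moreover have "ennreal (A * L) * ennreal (9 * C / l\<^sup>2) = ennreal (A * L * (9 * C / l\<^sup>2))" using L A0 by (intro ennreal_mult'[symmetric]) auto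
      moreover have "?c1 * L * L + A * L * (9 * C / l\<^sup>2) = (2 * D1\<^sup>2 + A * (9 * C)) * L / l\<^sup>2" using L l by (simp add: field_simps)
      moreover have "ennreal (?c1 * L * L) + ennreal (A * L * (9 * C / l\<^sup>2)) = ennreal (?c1 * L * L + A * L * (9 * C / l\<^sup>2))"
        using L A0 C by (intro ennreal_plus[symmetric]) auto
      ultimately show ?thesis by (simp only:)
    qed
    also have "\<dots> \<le> ennreal (E * L / l\<^sup>2)"
      unfolding E_def using L by (intro ennreal_leI divide_right_mono mult_right_mono) auto
    finally have "(\<integral>\<^sup>+ z \<in> carleson_box b L. ennreal ((1 - (cmod z)\<^sup>2) * (cmod (deriv g z))\<^sup>2 / pi) \<partial>lborel) * ennreal ((ln (2 / L))\<^sup>2)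
      \<le> ennreal (E * L / l\<^sup>2) * ennreal (l\<^sup>2)"
    proof (rule mult_mono)
      \<comment> \<open>Since \<open>0 < ln 2 < 1\<close>, the weight \<open>l = 1 + |ln L|\<close>
        dominates \<open>|ln (2/L)|\<close> on all arcs, also on those with
        \<open>L > 2\<close>.\<close>
      have "ln (2/L) = ln 2 - ln L" "0 < ln (2::real)" using L by (auto simp: ln_div)
      then have "\<bar>ln (2/L)\<bar> \<le> l" unfolding l_def using ln_2_less_1 by linarith
      then have "(ln (2/L))\<^sup>2 \<le> l\<^sup>2" using l by (intro abs_le_square_iff[THEN iffD1]) auto
      then show "ennreal ((ln (2/L))\<^sup>2) \<le> ennreal (l\<^sup>2)" by (rule ennreal_leI)
    qed auto
    also have "\<dots> = ennreal (E * L)" using L E l by (subst ennreal_mult[symmetric]) auto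
    finally show ?thesis .
  qed
  ultimately show ?thesis using E unfolding BMOA_log_def by blast
qed

end

subsection \<open>The logarithm as a test function\<close>

lemma ln_le_two_sqrt: "x > 0 \<Longrightarrow> ln x \<le> 2 * sqrt (x::real)"
proof -
  assume x: "x > 0"
  have "ln (sqrt x) \<le> sqrt x - 1" using x by (intro ln_le_minus_one) auto
  moreover have "ln (sqrt x) = ln x / 2" using x by (simp add: ln_sqrt)
  ultimately show ?thesis by linarith
qed

text \<open>The inverse square root is the integrable majorant used for the logarithmic singularity,
  both for integrability and for oscillation on short arcs.\<close>

lemma nn_integral_inverse_sqrt_le:
  assumes h: "h \<ge> 0"
  shows "(\<integral>\<^sup>+t\<in>{c-h..c+h}. ennreal (\<bar>t - c\<bar> powr (-1/2)) \<partial>lborel) \<le> ennreal (4 * sqrt h)"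
proof -
  have half: "(\<integral>\<^sup>+x\<in>{0..h}. ennreal (x powr (-1/2)) \<partial>lborel) = ennreal (2 * sqrt h)"
    using nn_integral_powr_unit[of "-1/2" h] h by (simp add: powr_half_sqrt)
  have "(\<integral>\<^sup>+t\<in>{c-h..c+h}. ennreal (\<bar>t - c\<bar> powr (-1/2)) \<partial>lborel)
     = ennreal \<bar>1\<bar> * (\<integral>\<^sup>+x. ennreal (\<bar>(c + 1 * x) - c\<bar> powr (-1/2)) * indicator {c-h..c+h} (c + 1 * x) \<partial>lborel)"
    by (rule nn_integral_real_affine) auto
  also have "\<dots> = (\<integral>\<^sup>+x\<in>{-h..h}. ennreal (\<bar>x\<bar> powr (-1/2)) \<partial>lborel)"
    by (auto intro!: nn_integral_cong simp: indicator_def)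
  also have "\<dots> \<le> (\<integral>\<^sup>+x. ennreal (x powr (-1/2)) * indicator {0..h} x + ennreal ((-x) powr (-1/2)) * indicator {0..h} (-x) \<partial>lborel)"
    by (intro nn_integral_mono) (auto simp: indicator_def abs_if)
  also have "\<dots> = (\<integral>\<^sup>+x\<in>{0..h}. ennreal (x powr (-1/2)) \<partial>lborel) + (\<integral>\<^sup>+x. ennreal ((-x) powr (-1/2)) * indicator {0..h} (-x) \<partial>lborel)"
    by (rule nn_integral_add) measurable
  also have "(\<integral>\<^sup>+x. ennreal ((-x) powr (-1/2)) * indicator {0..h} (-x) \<partial>lborel) = (\<integral>\<^sup>+x\<in>{0..h}. ennreal (x powr (-1/2)) \<partial>lborel)"
  proof -
    have "(\<integral>\<^sup>+x\<in>{0..h}. ennreal (x powr (-1/2)) \<partial>lborel)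
      = ennreal \<bar>-1\<bar> * (\<integral>\<^sup>+x. ennreal ((0 + -1 * x) powr (-1/2)) * indicator {0..h} (0 + -1 * x) \<partial>lborel)"
      by (rule nn_integral_real_affine) auto
    then show ?thesis by simp
  qed
  also have "(\<integral>\<^sup>+x\<in>{0..h}. ennreal (x powr (-1/2)) \<partial>lborel) + (\<integral>\<^sup>+x\<in>{0..h}. ennreal (x powr (-1/2)) \<partial>lborel) = ennreal (4 * sqrt h)"
    unfolding half using h by (subst ennreal_plus[symmetric]) auto
  finally show ?thesis .
qed

definition chord :: "real \<Rightarrow> real" where "chord t = norm (1 - cis t)"

lemma chord_eq: "chord t = norm (cis t - cis 0)" by (simp add: chord_def norm_minus_commute)

lemma chord_le_2: "chord t \<le> 2"
  unfolding chord_def using norm_triangle_ineq4[of 1 "cis t"] by simp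

lemma chord_periodic: "chord (t + 2 * pi * of_int k) = chord t"
proof -
  have "cis (2 * pi * of_int k) = 1" using cis_multiple_2pi[of "of_int k"] by simp
  then show ?thesis by (simp add: chord_def flip: cis_mult)
qed

lemma chord_lipschitz: "\<bar>chord s - chord t\<bar> \<le> \<bar>s - t\<bar>"
proof -
  have "\<bar>chord s - chord t\<bar> \<le> norm ((1 - cis s) - (1 - cis t))" unfolding chord_def by (rule norm_triangle_ineq3)
  also have "\<dots> = norm (cis t - cis s)" by simp
  also have "\<dots> \<le> \<bar>t - s\<bar>" by (rule norm_cis_diff_le)
  finally show ?thesis by simp
qed

lemma chord_upper: "chord t \<le> \<bar>t\<bar>" using norm_cis_diff_le[of t 0] by (simp add: chord_eq)

lemma chord_lower: "\<bar>t\<bar> \<le> pi \<Longrightarrow> chord t \<ge> 2 / pi * \<bar>t\<bar>" using norm_cis_diff_ge[of t 0] by (simp add: chord_eq)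

lemma chord_lower_half: "\<bar>t\<bar> \<le> pi \<Longrightarrow> chord t \<ge> \<bar>t\<bar> / 2"
proof -
  assume t: "\<bar>t\<bar> \<le> pi"
  have "1/2 \<le> 2/pi" using pi_less_4 by (simp add: field_simps)
  then have "1/2 * \<bar>t\<bar> \<le> 2/pi * \<bar>t\<bar>" by (intro mult_right_mono) auto
  then show ?thesis using chord_lower[OF t] by simp
qed

lemma borel_measurable_chord [measurable]: "chord \<in> borel_measurable borel"
  unfolding chord_def[abs_def] by measurable

lemma cis_eq_1_iff: "cis t = 1 \<longleftrightarrow> (\<exists>k::int. t = 2 * pi * of_int k)"
proof
  assume "cis t = 1"
  then have "exp (\<i> * of_real t) = 1" by (simp add: cis_conv_exp)
  then obtain k where "Im (\<i> * of_real t) = of_int (2 * k) * pi" unfolding exp_eq_1 by blast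
  then have "t = 2 * pi * of_int k" by simp
  then show "\<exists>k::int. t = 2 * pi * of_int k" by blast
next
  assume "\<exists>k::int. t = 2 * pi * of_int k"
  then obtain k :: int where "t = 2 * pi * of_int k" by blast
  then show "cis t = 1" using cis_multiple_2pi[of "of_int k"] by simp
qed

lemma countable_cis_eq_1: "countable {t. cis t = 1}"
proof -
  have "{t. cis t = 1} = range (\<lambda>k::int. 2 * pi * of_int k)" by (auto simp: cis_eq_1_iff)
  then show ?thesis by simp
qed

lemma AE_cis_ne_1: "AE t in lborel. cis t \<noteq> 1"
proof -
  have "{t. cis t = 1} \<in> null_sets lborel" by (rule countable_imp_null_set_lborel[OF countable_cis_eq_1])
  then show ?thesis by (rule AE_I') auto
qed

lemma chord_pos_iff: "chord t > 0 \<longleftrightarrow> cis t \<noteq> 1" by (auto simp: chord_def)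

lemma nn_integral_chord_le:
  "(\<integral>\<^sup>+t\<in>{b..b+2*pi}. ennreal (chord t powr (-1/2)) \<partial>lborel) \<le> ennreal 12"
proof -
  have "(\<integral>\<^sup>+t\<in>{b..b+2*pi}. ennreal (chord t powr (-1/2)) \<partial>lborel) = (\<integral>\<^sup>+t\<in>{-pi..-pi+2*pi}. ennreal (chord t powr (-1/2)) \<partial>lborel)"
    using chord_periodic[of _ 1] by (intro nn_integral_periodic_shift) auto
  also have "\<dots> \<le> (\<integral>\<^sup>+t. ennreal (sqrt 2) * (ennreal (\<bar>t - 0\<bar> powr (-1/2)) * indicator {0-pi..0+pi} t) \<partial>lborel)"
  proof (rule nn_integral_mono)
    fix t
    show "ennreal (chord t powr (-1/2)) * indicator {-pi..-pi+2*pi} t \<le> ennreal (sqrt 2) * (ennreal (\<bar>t - 0\<bar> powr (-1/2)) * indicator {0-pi..0+pi} t)"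
    proof (cases "t \<in> {-pi..pi} \<and> t \<noteq> 0")
      case True
      then have "chord t \<ge> \<bar>t\<bar>/2" by (intro chord_lower_half) auto
      then have "chord t powr (-1/2) \<le> (\<bar>t\<bar>/2) powr (-1/2)" using True by (intro powr_mono2') auto
      also have "\<dots> = sqrt 2 * \<bar>t\<bar> powr (-1/2)"
        by (simp add: powr_divide powr_minus powr_half_sqrt field_simps)
      finally have "ennreal (chord t powr (-1/2)) \<le> ennreal (sqrt 2) * ennreal (\<bar>t\<bar> powr (-1/2))"
        by (subst ennreal_mult[symmetric]) (auto intro: ennreal_leI)
      then show ?thesis using True by simp
    next
      \<comment> \<open>At \<open>t = 0\<close> both sides vanish: \<open>chord 0 = 0\<close>, and
        \<open>0 powr\<close> anything is 0.\<close>
      case False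
      then show ?thesis by (auto simp: indicator_def chord_def)
    qed
  qed
  also have "\<dots> = ennreal (sqrt 2) * (\<integral>\<^sup>+t\<in>{0-pi..0+pi}. ennreal (\<bar>t - 0\<bar> powr (-1/2)) \<partial>lborel)"
    by (rule nn_integral_cmult) measurable
  also have "\<dots> \<le> ennreal (sqrt 2) * ennreal (4 * sqrt pi)"
    by (intro mult_left_mono nn_integral_inverse_sqrt_le) auto
  also have "\<dots> = ennreal (4 * sqrt (2 * pi))" by (subst ennreal_mult[symmetric]) (auto simp: real_sqrt_mult)
  also have "\<dots> \<le> ennreal 12"
  proof (rule ennreal_leI)
    have "sqrt (2*pi) \<le> sqrt (3\<^sup>2)" using pi_less_4 by (intro real_sqrt_le_mono) simp
    then show "4 * sqrt (2 * pi) \<le> 12" by simp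
  qed
  finally show ?thesis .
qed

text \<open>Two competing bounds, radial and angular. The second follows from the first, because
  moving from radius \<open>r\<close> to the circle costs at most \<open>1 - r\<close>.\<close>

lemma norm_one_minus_ge:
  assumes "0 \<le> r" "r \<le> 1"
  shows "norm (1 - of_real r * cis t) \<ge> 1 - r" "norm (1 - of_real r * cis t) \<ge> chord t / 2"
proof -
  show 1: "norm (1 - of_real r * cis t) \<ge> 1 - r"
    using norm_triangle_ineq2[of 1 "of_real r * cis t"] assms by (simp add: norm_mult)
  have "1 - cis t = (1 - of_real r * cis t) + of_real (r - 1) * cis t" by (simp add: algebra_simps)
  then have "chord t \<le> norm (1 - of_real r * cis t) + norm (of_real (r - 1) * cis t)"
    unfolding chord_def by (metis norm_triangle_ineq)
  also have "norm (of_real (r - 1) * cis t) = 1 - r" using assms by (simp only: norm_mult norm_cis norm_of_real) simp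
  finally show "norm (1 - of_real r * cis t) \<ge> chord t / 2" using 1 by linarith
qed

definition log_test :: "complex \<Rightarrow> complex" where "log_test z = - Ln (1 - z)"

definition log_bdry :: "real \<Rightarrow> complex" where "log_bdry t = - Ln (1 - cis t)"

lemma Re_pos_disc: "z \<in> udisc \<Longrightarrow> Re (1 - z) > 0"
  using abs_Re_le_cmod[of z] by auto

lemma log_test_deriv:
  assumes "z \<in> udisc" shows "(log_test has_field_derivative 1 / (1 - z)) (at z)"
proof -
  have "1 - z \<notin> \<real>\<^sub>\<le>\<^sub>0" using Re_pos_disc[OF assms] by (auto simp: complex_nonpos_Reals_iff)
  then show ?thesis unfolding log_test_def[abs_def] by (auto intro!: derivative_eq_intros simp: inverse_eq_divide)
qed

lemma log_test_holomorphic: "log_test holomorphic_on udisc"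
  unfolding holomorphic_on_open[OF open_ball] using log_test_deriv by blast

text \<open>The argument contributes at most \<open>pi\<close>, so only the logarithm of the modulus
  remains to be controlled.\<close>

lemma norm_Ln_minus_le: "z \<noteq> 0 \<Longrightarrow> norm (Ln z - of_real c) \<le> \<bar>ln (norm z) - c\<bar> + pi"
proof -
  assume z: "z \<noteq> 0"
  have "norm (Ln z - of_real c) \<le> \<bar>Re (Ln z - of_real c)\<bar> + \<bar>Im (Ln z - of_real c)\<bar>" by (rule cmod_le)
  moreover have "\<bar>Im (Ln z)\<bar> \<le> pi" using mpi_less_Im_Ln[OF z] Im_Ln_le_pi[OF z] by (simp add: abs_le_iff)
  ultimately show ?thesis using z by simp
qed

text \<open>A logarithm is at most twice a square root. The form with \<open>u\<close> between
  \<open>chord t / 2\<close> and 2 serves interior points and the circle alike.\<close>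

lemma abs_ln_le_chord:
  assumes "u > 0" "chord t / 2 \<le> u" "u \<le> 2" "chord t > 0"
  shows "\<bar>ln u\<bar> \<le> 1 + 3 * chord t powr (-1/2)"
proof -
  have "ln u \<le> ln 2" using assms by simp
  then have 1: "ln u \<le> 1" using ln_2_less_1 by linarith
  have "- ln u = ln (1/u)" using assms by (simp add: ln_div)
  also have "\<dots> \<le> ln (2 / chord t)" using assms by (subst ln_le_cancel_iff) (auto simp: field_simps)
  also have "\<dots> \<le> 2 * sqrt (2 / chord t)" using assms by (intro ln_le_two_sqrt) auto
  also have "\<dots> = 2 * sqrt 2 * chord t powr (-1/2)"
    using assms by (simp add: real_sqrt_divide powr_minus powr_half_sqrt field_simps)
  also have "\<dots> \<le> 3 * chord t powr (-1/2)"
  proof (intro mult_right_mono)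
    have "sqrt 2 \<le> sqrt ((3/2)\<^sup>2)" by (intro real_sqrt_le_mono) (simp add: power2_eq_square)
    then show "2 * sqrt 2 \<le> 3" by simp
  qed simp
  finally have 2: "- ln u \<le> 3 * chord t powr (-1/2)" .
  moreover have "3 * chord t powr (-1/2) \<ge> 0" by simp
  ultimately show ?thesis using 1 by (intro abs_leI) linarith+
qed

lemma log_test_mem_Dspace:
  assumes p: "0 < p" "p \<le> 1" shows "log_test \<in> Dspace p"
proof -
  have dl: "deriv log_test z = 1 / (1 - z)" if "z \<in> udisc" for z using log_test_deriv[OF that] by (rule DERIV_imp_deriv)
  have cd: "continuous_on udisc (deriv log_test)"
    by (intro holomorphic_on_imp_continuous_on holomorphic_deriv log_test_holomorphic) auto
  have "(\<integral>\<^sup>+ z \<in> udisc. ennreal ((1 - cmod z) powr (p - 1) * cmod (deriv log_test z) powr p / pi) \<partial>lborel)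
    = (\<integral>\<^sup>+r\<in>{0<..<1}. (\<integral>\<^sup>+t\<in>{0..0+2*pi}. ennreal (r * ((1 - cmod (of_real r * cis t)) powr (p - 1) * cmod (deriv log_test (of_real r * cis t)) powr p / pi)) \<partial>lborel) \<partial>lborel)"
    by (rule nn_integral_udisc_polar_full) (intro continuous_Dspace_integrand[OF cd] p, auto)
  also have "\<dots> \<le> (\<integral>\<^sup>+r. ennreal 24 * (ennreal ((1 - r) powr (p/2 - 1)) * indicator {1-1..1} r) \<partial>lborel)"
  proof (rule nn_integral_mono)
    fix r :: real
    show "(\<integral>\<^sup>+t\<in>{0..0+2*pi}. ennreal (r * ((1 - cmod (of_real r * cis t)) powr (p - 1) * cmod (deriv log_test (of_real r * cis t)) powr p / pi)) \<partial>lborel) * indicator {0<..<1} r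
      \<le> ennreal 24 * (ennreal ((1 - r) powr (p/2 - 1)) * indicator {1-1..1} r)"
    proof (cases "0 < r \<and> r < 1")
      case True
      then have r: "0 < r" "r < 1" by auto
      let ?e = "(1 - r) powr (p/2 - 1)"
      have "(\<integral>\<^sup>+t\<in>{0..0+2*pi}. ennreal (r * ((1 - cmod (of_real r * cis t)) powr (p - 1) * cmod (deriv log_test (of_real r * cis t)) powr p / pi)) \<partial>lborel)
        \<le> (\<integral>\<^sup>+t. ennreal (2 * ?e) * (ennreal (chord t powr (-1/2)) * indicator {0..0+2*pi} t) \<partial>lborel)"
      proof (rule nn_integral_mono_AE, use AE_cis_ne_1 in eventually_elim)
        case (elim t)
        then have ch: "chord t > 0" by (simp add: chord_pos_iff)
        define u where "u = norm (1 - of_real r * cis t)"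
        have u: "u \<ge> 1 - r" "u \<ge> chord t / 2" "u > 0" using norm_one_minus_ge[of r t] r ch by (auto simp: u_def)
        have z: "of_real r * cis t \<in> udisc" using r by (simp add: norm_mult)
        have "cmod (deriv log_test (of_real r * cis t)) powr p = u powr (-p)"
          unfolding dl[OF z] u_def by (simp add: norm_divide powr_divide powr_minus_divide)
        \<comment> \<open>One half of the power goes to \<open>1 - r\<close>, the other to the
          chord. Either bound alone would leave a divergent radial or angular integral in part of
          the range of \<open>p\<close>; the split leaves the exponents \<open>p/2 - 1\<close> and
          \<open>-p/2\<close>, both above -1.\<close>
        also have "\<dots> = u powr (-p/2) * u powr (-p/2)" by (simp flip: powr_add)
        also have "\<dots> \<le> (1 - r) powr (-p/2) * (chord t / 2) powr (-p/2)"
          using u r ch p by (intro mult_mono powr_mono2') auto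
        \<comment> \<open>As \<open>chord t / 2 <= 1\<close> and \<open>p <= 1\<close>, the exponent
          may be lowered to \<open>-1/2\<close>, for which the angular integral is known.\<close>
        also have "(chord t / 2) powr (-p/2) \<le> (chord t / 2) powr (-1/2)"
          using ch chord_le_2[of t] p by (intro powr_mono') auto
        also have "(chord t / 2) powr (-1/2) = sqrt 2 * chord t powr (-1/2)"
          by (simp add: powr_divide powr_minus powr_half_sqrt field_simps)
        also have "sqrt 2 * chord t powr (-1/2) \<le> 2 * chord t powr (-1/2)"
          by (intro mult_right_mono) (auto intro: real_le_lsqrt)
        finally have A: "cmod (deriv log_test (of_real r * cis t)) powr p \<le> (1 - r) powr (-p/2) * (2 * chord t powr (-1/2))"
          by (simp add: mult_left_mono)
        have "r * ((1 - r) powr (p - 1) * cmod (deriv log_test (of_real r * cis t)) powr p / pi)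
          \<le> 1 * ((1 - r) powr (p - 1) * ((1 - r) powr (-p/2) * (2 * chord t powr (-1/2))) / 1)"
          using A r pi_gt3 by (intro mult_mono frac_le mult_left_mono) auto
        also have "\<dots> = (2 * ?e) * chord t powr (-1/2)"
        proof -
          have "(1 - r) powr (p - 1) * (1 - r) powr (-p/2) = ?e" by (simp flip: powr_add add: algebra_simps)
          then show ?thesis by (simp add: mult_ac)
        qed
        finally have "ennreal (r * ((1 - cmod (of_real r * cis t)) powr (p - 1) * cmod (deriv log_test (of_real r * cis t)) powr p / pi)) \<le> ennreal (2 * ?e) * ennreal (chord t powr (-1/2))"
          using r by (subst ennreal_mult[symmetric]) (auto intro!: ennreal_leI simp: norm_mult)
        then show ?case by (auto simp: indicator_def)
      qed
      also have "\<dots> = ennreal (2 * ?e) * (\<integral>\<^sup>+t\<in>{0..0+2*pi}. ennreal (chord t powr (-1/2)) \<partial>lborel)"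
        by (rule nn_integral_cmult) measurable
      also have "\<dots> \<le> ennreal (2 * ?e) * ennreal 12" by (intro mult_left_mono nn_integral_chord_le) auto
      also have "\<dots> = ennreal 24 * ennreal ?e" by (subst (1 2) ennreal_mult[symmetric]) auto
      finally show ?thesis using r by simp
    qed simp
  qed
  also have "\<dots> = ennreal 24 * (\<integral>\<^sup>+r\<in>{1-1..1}. ennreal ((1 - r) powr (p/2 - 1)) \<partial>lborel)"
    by (rule nn_integral_cmult) measurable
  also have "\<dots> = ennreal 24 * ennreal (1 powr (p/2 - 1 + 1) / (p/2 - 1 + 1))"
    using p by (subst nn_integral_one_minus_powr) auto
  also have "\<dots> < \<infinity>" by (simp add: ennreal_mult_less_top)
  finally show ?thesis using log_test_holomorphic by (simp add: Dspace_def analytic_disc_def)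
qed

lemma log_test_mem_H1: "log_test \<in> H1"
  unfolding H1_def analytic_disc_def
\<comment> \<open>Pointwise bound \<open>5 + 3 * chord t powr (-1/2)\<close>, with
  \<open>pi < 4\<close> used for the argument; the integral of the last power is at most 12.\<close>
proof (intro CollectI conjI exI[of _ "10*pi + 36"] allI impI log_test_holomorphic)
  fix r :: real assume "0 < r \<and> r < 1"
  then have r: "0 < r" "r < 1" by auto
  have "(\<integral>\<^sup>+ t \<in> {0..2*pi}. ennreal (cmod (log_test (of_real r * cis t)) / (2*pi)) \<partial>lborel)
    \<le> (\<integral>\<^sup>+ t. ennreal 5 * indicator {0..2*pi} t + ennreal 3 * (ennreal (chord t powr (-1/2)) * indicator {0..0+2*pi} t) \<partial>lborel)"
  proof (rule nn_integral_mono_AE, use AE_cis_ne_1 in eventually_elim)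
    case (elim t)
    then have ch: "chord t > 0" by (simp add: chord_pos_iff)
    define u where "u = norm (1 - of_real r * cis t)"
    have u: "u \<ge> chord t / 2" "u > 0" using norm_one_minus_ge[of r t] r ch by (auto simp: u_def)
    have u2: "u \<le> 2" using norm_triangle_ineq4[of 1 "of_real r * cis t"] r by (simp add: u_def norm_mult)
    have "1 - of_real r * cis t \<noteq> 0" using u by (auto simp: u_def)
    then have "cmod (log_test (of_real r * cis t)) \<le> \<bar>ln u\<bar> + pi"
      using norm_Ln_minus_le[of "1 - of_real r * cis t" 0] by (simp add: log_test_def u_def)
    also have "\<bar>ln u\<bar> \<le> 1 + 3 * chord t powr (-1/2)" by (rule abs_ln_le_chord[OF u(2,1) u2 ch])
    finally have "cmod (log_test (of_real r * cis t)) \<le> 5 + 3 * chord t powr (-1/2)" using pi_less_4 by simp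
    moreover have "cmod (log_test (of_real r * cis t)) / (2*pi) \<le> cmod (log_test (of_real r * cis t)) / 1"
      using pi_gt3 by (intro divide_left_mono) auto
    ultimately have "ennreal (cmod (log_test (of_real r * cis t)) / (2*pi)) \<le> ennreal (5 + 3 * chord t powr (-1/2))" by (intro ennreal_leI) simp
    also have "\<dots> = ennreal 5 + ennreal 3 * ennreal (chord t powr (-1/2))"
      by (subst ennreal_mult[symmetric], simp, simp, subst ennreal_plus[symmetric]) auto
    finally show ?case by (auto simp: indicator_def)
  qed
  also have "\<dots> = ennreal 5 * emeasure lborel {0..2*pi} + ennreal 3 * (\<integral>\<^sup>+t\<in>{0..0+2*pi}. ennreal (chord t powr (-1/2)) \<partial>lborel)"
    by (subst nn_integral_add, measurable, subst nn_integral_cmult, measurable, subst nn_integral_cmult_indicator) auto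
  also have "\<dots> \<le> ennreal 5 * ennreal (2*pi) + ennreal 3 * ennreal 12"
    by (intro add_mono mult_left_mono nn_integral_chord_le) auto
  also have "\<dots> = ennreal (10*pi + 36)"
    by (subst (1 2) ennreal_mult[symmetric], simp, simp, simp, simp, subst ennreal_plus[symmetric]) (auto simp: mult.commute)
  finally show "(\<integral>\<^sup>+ t \<in> {0..2*pi}. ennreal (cmod (log_test (of_real r * cis t)) / (2*pi)) \<partial>lborel) \<le> ennreal (10*pi + 36)" .
qed

lemma log_test_boundary: "boundary_function log_test log_bdry"
  unfolding boundary_function_def using AE_cis_ne_1
proof eventually_elim
  case (elim t)
  have "Re (cis t) < 1"
  proof -
    have "Re (cis t) \<le> 1" using complex_Re_le_cmod[of "cis t"] by simp
    moreover have "Re (cis t) \<noteq> 1"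
    proof
      assume c: "Re (cis t) = 1"
      then have "sin t = 0" using sin_cos_squared_add[of t] by simp
      then show False using elim c by (simp add: complex_eq_iff)
    qed
    ultimately show ?thesis by linarith
  qed
  then have np: "1 - cis t \<notin> \<real>\<^sub>\<le>\<^sub>0" by (auto simp: complex_nonpos_Reals_iff)
  have "((\<lambda>r. 1 - of_real r * cis t) \<longlongrightarrow> 1 - of_real 1 * cis t) (at_left (1::real))"
    by (intro tendsto_intros)
  then have "((\<lambda>r. 1 - of_real r * cis t) \<longlongrightarrow> 1 - cis t) (at_left (1::real))" by simp
  then show ?case unfolding log_test_def log_bdry_def by (intro tendsto_minus tendsto_Ln np)
qed

lemma borel_measurable_log_bdry [measurable]: "log_bdry \<in> borel_measurable borel"
proof (rule borel_measurable_continuous_countable_exceptions[OF countable_cis_eq_1])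
  have "1 - cis t \<notin> \<real>\<^sub>\<le>\<^sub>0" if "cis t \<noteq> 1" for t
  proof -
    have "Re (cis t) < 1"
    proof -
      have "Re (cis t) \<le> 1" using complex_Re_le_cmod[of "cis t"] by simp
      moreover have "Re (cis t) \<noteq> 1"
      proof
        assume c: "Re (cis t) = 1"
        then have "sin t = 0" using sin_cos_squared_add[of t] by simp
        then show False using that c by (simp add: complex_eq_iff)
      qed
      ultimately show ?thesis by linarith
    qed
    then show ?thesis by (auto simp: complex_nonpos_Reals_iff)
  qed
  then show "continuous_on (- {t. cis t = 1}) log_bdry"
    unfolding log_bdry_def[abs_def] by (intro continuous_intros) auto
qed

lemma norm_log_bdry_minus_le: "cis t \<noteq> 1 \<Longrightarrow> norm (log_bdry t - of_real (- c)) \<le> \<bar>ln (chord t) - c\<bar> + pi"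
proof -
  assume "cis t \<noteq> 1"
  then have "norm (Ln (1 - cis t) - of_real c) \<le> \<bar>ln (chord t) - c\<bar> + pi"
    unfolding chord_def by (intro norm_Ln_minus_le) auto
  moreover have "norm (log_bdry t - of_real (- c)) = norm (Ln (1 - cis t) - of_real c)"
    by (simp add: log_bdry_def norm_minus_commute)
  ultimately show ?thesis by simp
qed

lemma nn_integral_log_bdry_le:
  assumes "0 < L" "L \<le> 2*pi"
  shows "(\<integral>\<^sup>+t\<in>{b..b+L}. ennreal (norm (log_bdry t)) \<partial>lborel) \<le> ennreal (5 * L + 36)"
proof -
  have "(\<integral>\<^sup>+t\<in>{b..b+L}. ennreal (norm (log_bdry t)) \<partial>lborel)
    \<le> (\<integral>\<^sup>+ t. ennreal 5 * indicator {b..b+L} t + ennreal 3 * (ennreal (chord t powr (-1/2)) * indicator {b..b+2*pi} t) \<partial>lborel)"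
  proof (rule nn_integral_mono_AE, use AE_cis_ne_1 in eventually_elim)
    case (elim t)
    then have ch: "chord t > 0" by (simp add: chord_pos_iff)
    have "norm (log_bdry t) \<le> \<bar>ln (chord t)\<bar> + pi" using norm_log_bdry_minus_le[OF elim, of 0] by simp
    also have "\<bar>ln (chord t)\<bar> \<le> 1 + 3 * chord t powr (-1/2)" using ch chord_le_2[of t] by (intro abs_ln_le_chord) auto
    finally have "norm (log_bdry t) \<le> 5 + 3 * chord t powr (-1/2)" using pi_less_4 by simp
    then have "ennreal (norm (log_bdry t)) \<le> ennreal (5 + 3 * chord t powr (-1/2))" by (rule ennreal_leI)
    also have "\<dots> = ennreal 5 + ennreal 3 * ennreal (chord t powr (-1/2))"
      by (subst ennreal_mult[symmetric], simp, simp, subst ennreal_plus[symmetric]) auto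
    finally show ?case using assms by (auto simp: indicator_def)
  qed
  also have "\<dots> = ennreal 5 * emeasure lborel {b..b+L} + ennreal 3 * (\<integral>\<^sup>+t\<in>{b..b+2*pi}. ennreal (chord t powr (-1/2)) \<partial>lborel)"
    by (subst nn_integral_add, measurable, subst nn_integral_cmult, measurable, subst nn_integral_cmult_indicator) auto
  also have "\<dots> \<le> ennreal 5 * ennreal L + ennreal 3 * ennreal 12"
    using assms by (intro add_mono mult_left_mono nn_integral_chord_le) auto
  also have "\<dots> = ennreal (5 * L + 36)"
    using assms by (subst (1 2) ennreal_mult[symmetric], simp, simp, simp, simp, subst ennreal_plus[symmetric]) auto
  finally show ?thesis .
qed

lemma set_integrable_log_bdry:
  assumes "0 < L" "L \<le> 2*pi" shows "set_integrable lborel {b..b+L} log_bdry"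
  unfolding set_integrable_def
proof (rule integrableI_bounded)
  show "(\<lambda>t. indicator {b..b+L} t *\<^sub>R log_bdry t) \<in> borel_measurable lborel" by measurable
  have "(\<integral>\<^sup>+t. ennreal (norm (indicator {b..b+L} t *\<^sub>R log_bdry t)) \<partial>lborel) = (\<integral>\<^sup>+t\<in>{b..b+L}. ennreal (norm (log_bdry t)) \<partial>lborel)"
    by (intro nn_integral_cong) (auto simp: indicator_def)
  also have "\<dots> \<le> ennreal (5 * L + 36)" by (rule nn_integral_log_bdry_le[OF assms])
  also have "\<dots> < \<infinity>" by simp
  finally show "(\<integral>\<^sup>+t. ennreal (norm (indicator {b..b+L} t *\<^sub>R log_bdry t)) \<partial>lborel) < \<infinity>" .
qed

text \<open>Long arcs are covered by the plain \<open>L^1\<close> bound. On arcs at distance at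
  least \<open>L\<close> from the point 1, \<open>ln (chord t)\<close> varies by at most 1. Arcs
  closer to it are compared with the value at distance \<open>3 * L\<close>. The three cases need
  \<open>41 * L\<close>, \<open>5 * L\<close> and \<open>44 * L\<close>.\<close>

lemma log_bdry_oscillation:
  assumes L: "0 < L" "L \<le> 2*pi"
  shows "\<exists>c. (\<integral>\<^sup>+t\<in>{b..b+L}. ennreal (norm (log_bdry t - c)) \<partial>lborel) \<le> ennreal (50 * L)"
proof (cases "L \<ge> 1")
  case True
  have "(\<integral>\<^sup>+t\<in>{b..b+L}. ennreal (norm (log_bdry t - 0)) \<partial>lborel) \<le> ennreal (5 * L + 36)" using nn_integral_log_bdry_le[OF L, of b] by simp
  also have "\<dots> \<le> ennreal (50 * L)" using True by (intro ennreal_leI) simp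
  finally show ?thesis by blast
next
  case L1: False
  show ?thesis
  proof (cases "\<forall>t\<in>{b..b+L}. chord t \<ge> L")
    case True
    define c where "c = ln (chord b)"
    have "(\<integral>\<^sup>+t\<in>{b..b+L}. ennreal (norm (log_bdry t - of_real (- c))) \<partial>lborel) \<le> (\<integral>\<^sup>+t. ennreal 5 * indicator {b..b+L} t \<partial>lborel)"
    proof (rule nn_integral_mono_AE, use AE_cis_ne_1 in eventually_elim)
      case (elim t)
      show ?case
      proof (cases "t \<in> {b..b+L}")
        case t: True
        have d: "chord t \<ge> L" "chord b \<ge> L" using True t L by auto
        \<comment> \<open>The chord is Lipschitz with constant 1, so it changes by at most
          \<open>L\<close> on the arc, while its value there is at least \<open>L\<close>.\<close>
        have ln1: "ln x - ln y \<le> 1" if "x \<ge> L" "y \<ge> L" "\<bar>x - y\<bar> \<le> L" for x y :: real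
        proof -
          have "ln x - ln y = ln (x / y)" using that L by (simp add: ln_div)
          also have "\<dots> \<le> x / y - 1" using that L by (intro ln_le_minus_one) auto
          also have "x / y - 1 = (x - y) / y" using that L by (simp add: diff_divide_distrib)
          also have "\<dots> \<le> 1" using that L by (simp add: divide_le_eq)
          finally show ?thesis .
        qed
        have "\<bar>chord t - chord b\<bar> \<le> L" using chord_lipschitz[of t b] t by simp
        then have "\<bar>ln (chord t) - c\<bar> \<le> 1"
          using ln1[OF d] ln1[OF d(2,1)] unfolding c_def by (simp add: abs_le_iff abs_minus_commute)
        then have "norm (log_bdry t - of_real (- c)) \<le> 5" using norm_log_bdry_minus_le[OF elim, of c] pi_less_4 by linarith
        then have "ennreal (norm (log_bdry t - of_real (- c))) \<le> ennreal 5" by (rule ennreal_leI)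
        then show ?thesis by (rule mult_right_mono) simp
      qed simp
    qed
    also have "\<dots> = ennreal 5 * emeasure lborel {b..b+L}" by (rule nn_integral_cmult_indicator) auto
    also have "\<dots> = ennreal (5 * L)" using L by (subst ennreal_mult) auto
    also have "\<dots> \<le> ennreal (50 * L)" using L by (intro ennreal_leI) simp
    finally show ?thesis by blast
  next
    case False
    then obtain t0 where t0: "t0 \<in> {b..b+L}" "chord t0 < L" by force
    \<comment> \<open>\<open>x\<close> is the multiple of \<open>2*pi\<close> nearest to
      \<open>t0\<close>, the singularity lying on or near this arc.\<close>
    define m where "m = \<lfloor>(t0 + pi) / (2*pi)\<rfloor>"
    define x where "x = 2 * pi * of_int m"
    have "of_int m \<le> (t0 + pi) / (2*pi)" "(t0 + pi) / (2*pi) < of_int m + 1" unfolding m_def by linarith+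
    then have "\<bar>t0 - x\<bar> \<le> pi" by (auto simp: x_def field_simps abs_le_iff)
    have chx: "chord t = chord (t - x)" for t using chord_periodic[of "t - x" m] by (simp add: x_def)
    have "\<bar>t0 - x\<bar> / 2 \<le> chord (t0 - x)" by (rule chord_lower_half) fact
    then have "\<bar>t0 - x\<bar> / 2 \<le> chord t0" by (simp only: chx[symmetric])
    then have "\<bar>t0 - x\<bar> / 2 \<le> L" by (rule order_trans[OF _ less_imp_le[OF t0(2)]])
    then have t0x: "\<bar>t0 - x\<bar> \<le> 2 * L" by simp
    have I3: "\<bar>t - x\<bar> \<le> 3 * L" if "t \<in> {b..b+L}" for t using that t0 t0x by (auto simp: abs_le_iff)
    have L3: "3 * L \<le> pi" using L1 pi_gt3 by simp
    \<comment> \<open>\<open>t0\<close> is within \<open>2 * L\<close> of the singularity and the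
      arc has length \<open>L\<close>, so the chord never exceeds \<open>3 * L\<close> and
      \<open>ln (chord t) - c\<close> has one sign.\<close>
    define c where "c = ln (3 * L)"
    have "(\<integral>\<^sup>+t\<in>{b..b+L}. ennreal (norm (log_bdry t - of_real (- c))) \<partial>lborel)
      \<le> (\<integral>\<^sup>+t. ennreal 4 * indicator {b..b+L} t + ennreal (5 * sqrt L) * (ennreal (\<bar>t - x\<bar> powr (-1/2)) * indicator {x - 3*L..x + 3*L} t) \<partial>lborel)"
    proof (rule nn_integral_mono_AE, use AE_cis_ne_1 in eventually_elim)
      case (elim t)
      show ?case
      proof (cases "t \<in> {b..b+L}")
        case t: True
        have s3: "\<bar>t - x\<bar> \<le> 3 * L" by (rule I3[OF t])
        have ch: "chord t > 0" using elim by (simp add: chord_pos_iff)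
        have cu: "chord t \<le> \<bar>t - x\<bar>" using chord_upper[of "t - x"] by (simp only: chx[symmetric])
        have s0: "\<bar>t - x\<bar> > 0" by (rule less_le_trans[OF ch cu])
        have up: "chord t \<le> 3 * L" by (rule order_trans[OF cu s3])
        have "\<bar>t - x\<bar> \<le> pi" by (rule order_trans[OF s3 L3])
        then have lo: "\<bar>t - x\<bar> / 2 \<le> chord t" using chord_lower_half[of "t - x"] by (simp only: chx[symmetric])
        have "ln (chord t) \<le> c" unfolding c_def using up ch by (subst ln_le_cancel_iff) auto
        then have "\<bar>ln (chord t) - c\<bar> = ln (3 * L / chord t)" using ch L by (simp add: c_def ln_div)
        also have "\<dots> \<le> ln (6 * L / \<bar>t - x\<bar>)"
          using lo s0 ch L by (subst ln_le_cancel_iff) (auto simp: field_simps)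
        also have "\<dots> \<le> 2 * sqrt (6 * L / \<bar>t - x\<bar>)" using s0 L by (intro ln_le_two_sqrt) auto
        also have "\<dots> = 2 * sqrt 6 * sqrt L * \<bar>t - x\<bar> powr (-1/2)"
        proof -
          have "\<bar>t - x\<bar> powr (-1/2) = 1 / sqrt \<bar>t - x\<bar>" using s0 by (simp add: powr_minus_divide powr_half_sqrt)
          moreover have "sqrt (6 * L / \<bar>t - x\<bar>) = sqrt 6 * sqrt L / sqrt \<bar>t - x\<bar>" by (simp only: real_sqrt_divide real_sqrt_mult)
          ultimately show ?thesis by simp
        qed
        also have "\<dots> \<le> 5 * sqrt L * \<bar>t - x\<bar> powr (-1/2)"
        proof (intro mult_right_mono)
          have "sqrt 6 \<le> sqrt ((5/2)\<^sup>2)" by (intro real_sqrt_le_mono) (simp add: power2_eq_square)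
          then show "2 * sqrt 6 \<le> 5" by simp
        qed (use L in auto)
        finally have "\<bar>ln (chord t) - c\<bar> + pi \<le> 5 * sqrt L * \<bar>t - x\<bar> powr (-1/2) + 4"
          using pi_less_4 by (intro add_mono) auto
        then have "norm (log_bdry t - of_real (- c)) \<le> 4 + 5 * sqrt L * \<bar>t - x\<bar> powr (-1/2)"
          using norm_log_bdry_minus_le[OF elim, of c] by (simp only: add.commute[of _ 4])
        then have "ennreal (norm (log_bdry t - of_real (- c))) \<le> ennreal (4 + 5 * sqrt L * \<bar>t - x\<bar> powr (-1/2))" by (rule ennreal_leI)
        also have "\<dots> = ennreal 4 + ennreal (5 * sqrt L) * ennreal (\<bar>t - x\<bar> powr (-1/2))"
          using L by (subst ennreal_mult[symmetric], simp, simp, subst ennreal_plus[symmetric]) auto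
        finally show ?thesis using t s3 by (auto simp: indicator_def abs_le_iff)
      qed simp
    qed
    also have "\<dots> = ennreal 4 * emeasure lborel {b..b+L} + ennreal (5 * sqrt L) * (\<integral>\<^sup>+t\<in>{x - 3*L..x + 3*L}. ennreal (\<bar>t - x\<bar> powr (-1/2)) \<partial>lborel)"
      by (subst nn_integral_add, measurable, subst nn_integral_cmult, measurable, subst nn_integral_cmult_indicator) auto
    also have "\<dots> \<le> ennreal 4 * ennreal L + ennreal (5 * sqrt L) * ennreal (4 * sqrt (3*L))"
      using L by (intro add_mono mult_left_mono nn_integral_inverse_sqrt_le) auto
    also have "\<dots> = ennreal (4 * L + 5 * sqrt L * (4 * sqrt (3*L)))"
      using L by (subst (1 2) ennreal_mult[symmetric], simp, simp, simp, simp, subst ennreal_plus[symmetric]) auto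
    also have "\<dots> \<le> ennreal (50 * L)"
    proof (rule ennreal_leI)
      have "sqrt (3*L) \<le> sqrt (4*L)" using L by (intro real_sqrt_le_mono) simp
      also have "\<dots> = 2 * sqrt L" by (simp add: real_sqrt_mult)
      finally have "5 * sqrt L * (4 * sqrt (3*L)) \<le> 5 * sqrt L * (4 * (2 * sqrt L))" using L by (intro mult_left_mono) auto
      also have "\<dots> = 40 * L" using L by simp
      finally show "4 * L + 5 * sqrt L * (4 * sqrt (3*L)) \<le> 50 * L" using L by linarith
    qed
    finally show ?thesis by blast
  qed
qed

lemma log_test_mem_BMOA: "log_test \<in> BMOA"
proof -
  have "bounded_mean_osc log_bdry"
  proof (rule bounded_mean_oscI[OF set_integrable_log_bdry])
    fix b L :: real assume L: "0 < L" "L \<le> 2*pi"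
    obtain c where c: "(\<integral>\<^sup>+t\<in>{b..b+L}. ennreal (norm (log_bdry t - c)) \<partial>lborel) \<le> ennreal (50 * L)"
      using log_bdry_oscillation[OF L] by blast
    then have "ennreal (LINT t:{b..b+L}|lborel. norm (log_bdry t - c)) \<le> ennreal (50 * L)"
      using L by (subst (asm) set_nn_integral_eq_set_integral_norm[OF set_integrable_log_bdry[OF L]]) auto
    then show "\<exists>c. (LINT t:{b..b+L}|lborel. norm (log_bdry t - c)) \<le> 50 * L"
      using L by (subst (asm) ennreal_le_iff) auto
  qed
  then show ?thesis using log_test_mem_H1 log_test_boundary by (auto simp: BMOA_def)
qed

subsection \<open>Necessity of the logarithmic decay\<close>

text \<open>On \<open>[L, 2*L]\<close> the chord lies between \<open>L/2\<close> and
  \<open>2*L\<close>, so its logarithm is within \<open>ln 2\<close> of \<open>ln L\<close>; the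
  argument adds less than 4.\<close>

lemma log_bdry_near:
  assumes L: "0 < L" "L \<le> 1/4" and t: "t \<in> {L..L+L}"
  shows "norm (log_bdry t - of_real (ln (1/L))) \<le> 5"
proof -
  have tpi: "\<bar>t\<bar> \<le> pi" using t L pi_gt3 by simp
  have lo: "chord t \<ge> L / 2" using chord_lower_half[OF tpi] t L by simp
  have up: "chord t \<le> 2 * L" using chord_upper[of t] t L by simp
  have ch: "chord t > 0" using lo L by linarith
  have "ln (chord t / L) \<le> ln 2" using up ch L by (subst ln_le_cancel_iff) (auto simp: field_simps)
  moreover have "ln (1/2) \<le> ln (chord t / L)" using lo ch L by (subst ln_le_cancel_iff) (auto simp: field_simps)
  ultimately have "\<bar>ln (chord t / L)\<bar> \<le> 1" using ln_2_less_1 by (auto simp: ln_div abs_le_iff)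
  moreover have "ln (chord t / L) = ln (chord t) - ln L" using ch L by (simp add: ln_div)
  ultimately have "\<bar>ln (chord t) - ln L\<bar> + pi \<le> 1 + 4" using pi_less_4 by (intro add_mono) auto
  moreover have "cis t \<noteq> 1" using ch by (simp add: chord_pos_iff)
  note norm_log_bdry_minus_le[OF this, of "ln L"]
  moreover have "ln (1/L) = - ln L" using L by (simp add: ln_div)
  ultimately show ?thesis by (simp only:)
qed

context lacunary_function begin

text \<open>On this arc the test function is the large constant \<open>\<Lambda> = ln (1/L)\<close>
  up to a bounded error. Dividing the bounded oscillation of the product by \<open>\<Lambda>\<close>
  leaves the oscillation of \<open>bdry\<close>.\<close>

lemma local_oscillation:
  assumes fg: "(\<lambda>z. log_test z * g z) \<in> BMOA" and s: "summable (\<lambda>k. norm (a k))"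
  obtains A where "A \<ge> 0" "\<And>L. 0 < L \<Longrightarrow> L \<le> 1/4 \<Longrightarrow>
     \<exists>P. integral {L..L+L} (\<lambda>t. norm (bdry t - P)) \<le> A * L / ln (1/L)"
proof -
  obtain H where bd: "boundary_function (\<lambda>z. log_test z * g z) H" and bmo: "bounded_mean_osc H"
    using fg by (auto simp: BMOA_def)
  obtain C where C: "C \<ge> 0" and int: "\<And>a L. 0 < L \<Longrightarrow> L \<le> 2*pi \<Longrightarrow> set_integrable lborel {a..a+L} H"
    and osc: "\<And>a L. 0 < L \<Longrightarrow> L \<le> 2*pi \<Longrightarrow> (LINT t:{a..a+L}|lborel. norm (H t - arc_mean H a L)) \<le> C * L"
    using bounded_mean_oscD[OF bmo] by metis
  define G where "G = (\<Sum>k. norm (a k))"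
  have bG: "norm (bdry t) \<le> G" for t unfolding G_def by (rule norm_bdry_le[OF s])
  have G: "G \<ge> 0" using bG[of 0] norm_ge_zero order_trans by blast
  \<comment> \<open>Membership in \<open>BMOA\<close> supplies some boundary function; uniqueness of
    radial limits identifies it with the product almost everywhere.\<close>
  have HF: "AE t in lborel. H t = log_bdry t * bdry t"
    using bd[unfolded boundary_function_def] log_test_boundary[unfolded boundary_function_def]
  proof eventually_elim
    case (elim t)
    have "((\<lambda>r. log_test (of_real r * cis t) * g (of_real r * cis t)) \<longlongrightarrow> log_bdry t * bdry t) (at_left 1)"
      by (intro tendsto_mult elim radial_limit_g[OF s])
    then show ?case using elim(1) tendsto_unique[of "at_left (1::real)"] trivial_limit_at_left_real by blast
  qed
  show thesis
  proof (rule that[of "C + 5 * G"])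
    show "0 \<le> C + 5 * G" using C G by simp
    fix L :: real assume L: "0 < L" "L \<le> 1/4"
    have L2: "L \<le> 2*pi" using L pi_gt3 by simp
    let ?I = "{L..L+L}"
    define \<Lambda> where "\<Lambda> = ln (1/L)"
    have "1 < 1/L" using L by (simp add: field_simps)
    then have Lam: "\<Lambda> > 0" unfolding \<Lambda>_def by (rule ln_gt_zero)
    define m where "m = arc_mean H L L"
    define P where "P = m / of_real \<Lambda>"
    have bc: "continuous_on S bdry" for S by (rule continuous_bdry[OF s])
    have ib: "set_integrable lborel ?I (\<lambda>t. \<Lambda> * norm (bdry t - P))"
      by (intro borel_integrable_atLeastAtMost' continuous_intros bc)
    have iH: "set_integrable lborel ?I (\<lambda>t. norm (H t - m))" using L by (intro set_integrable_norm_diff int L2) auto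
    have ic: "set_integrable lborel ?I (\<lambda>t. 5 * G)" "(LINT t:?I|lborel. 5 * G) = 5 * G * L"
      using set_integral_const_Icc[of L "L+L" "5 * G"] L by auto
    have "\<Lambda> * integral ?I (\<lambda>t. norm (bdry t - P)) = integral ?I (\<lambda>t. \<Lambda> * norm (bdry t - P))" by simp
    also have "\<dots> = (LINT t:?I|lborel. \<Lambda> * norm (bdry t - P))"
      by (rule set_borel_integral_eq_integral(2)[OF ib, symmetric])
    also have "\<dots> \<le> (LINT t:?I|lborel. norm (H t - m) + 5 * G)"
    proof (rule set_integral_mono_AE[OF ib])
      show "set_integrable lborel ?I (\<lambda>t. norm (H t - m) + 5 * G)" by (intro set_integral_add iH ic)
      show "AE t\<in>?I in lborel. \<Lambda> * norm (bdry t - P) \<le> norm (H t - m) + 5 * G"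
        using HF
      proof eventually_elim
        case (elim t)
        show ?case
        proof
          assume t: "t \<in> ?I"
          \<comment> \<open>With \<open>P = m / \<Lambda>\<close> the constants match, and the two
            terms on the right have mean \<open>O(1)\<close> over the arc.\<close>
          have "of_real \<Lambda> * (bdry t - P) = (H t - m) - (log_bdry t - of_real \<Lambda>) * bdry t"
            using Lam elim by (simp add: P_def algebra_simps)
          then have "norm (of_real \<Lambda> * (bdry t - P)) \<le> norm (H t - m) + norm ((log_bdry t - of_real \<Lambda>) * bdry t)"
            by (metis norm_triangle_ineq4)
          moreover have "norm (of_real \<Lambda> * (bdry t - P)) = \<Lambda> * norm (bdry t - P)" using Lam by (simp add: norm_mult)
          moreover have "norm ((log_bdry t - of_real \<Lambda>) * bdry t) \<le> 5 * G"
            unfolding norm_mult \<Lambda>_def by (intro mult_mono log_bdry_near L t bG) auto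
          ultimately show "\<Lambda> * norm (bdry t - P) \<le> norm (H t - m) + 5 * G" by linarith
        qed
      qed
    qed
    also have "\<dots> = (LINT t:?I|lborel. norm (H t - m)) + 5 * G * L"
      using iH ic by (subst set_integral_add(2)) auto
    also have "\<dots> \<le> C * L + 5 * G * L" unfolding m_def by (intro add_right_mono osc L L2)
    finally have "\<Lambda> * integral ?I (\<lambda>t. norm (bdry t - P)) \<le> (C + 5 * G) * L" by (simp add: distrib_right)
    then have "integral ?I (\<lambda>t. norm (bdry t - P)) \<le> (C + 5 * G) * L / \<Lambda>"
      using Lam by (simp add: pos_le_divide_eq mult.commute)
    then show "\<exists>P. integral ?I (\<lambda>t. norm (bdry t - P)) \<le> (C + 5 * G) * L / ln (1/L)" unfolding \<Lambda>_def by blast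
  qed
qed

text \<open>Arcs of length \<open>n k powr (-1/2)\<close> are so long compared with the wave length that all
  frequencies other than \<open>n k\<close> are negligible, while \<open>ln (1/L)\<close> is still comparable to \<open>ln (n k)\<close>.\<close>

lemma coeff_log_bound:
  assumes s: "summable (\<lambda>k. norm (a k))" and A: "A \<ge> 0"
    and osc: "\<And>L. 0 < L \<Longrightarrow> L \<le> 1/4 \<Longrightarrow> \<exists>P. integral {L..L+L} (\<lambda>t. norm (bdry t - P)) \<le> A * L / ln (1/L)"
  obtains D where "D \<ge> 0" "\<And>k. norm (a k) * (1 + ln (real (n k))) \<le> D"
proof -
  define G where "G = (\<Sum>k. norm (a k))"
  have bG: "norm (bdry t) \<le> G" for t unfolding G_def by (rule norm_bdry_le[OF s])
  have G: "G \<ge> 0" using bG[of 0] norm_ge_zero order_trans by blast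
  have aG: "norm (a k) \<le> G" for k
    using sum_le_suminf[OF s, of "{k}"] by (simp add: G_def)
  define \<kappa> where "\<kappa> = 1 - 1/lam"
  have kap: "\<kappa> > 0" "\<kappa> \<le> 1" using lam by (auto simp: \<kappa>_def)
  have bc: "continuous_on S bdry" for S by (rule continuous_bdry[OF s])
  \<comment> \<open>Both summands arise on multiplying the final estimate by
    \<open>6 * ln (n k)\<close>: \<open>72 = 6 * 12\<close> from the kernel bound, and
    \<open>3 * A\<close> because \<open>ln (1/L)\<close> is half of \<open>ln (n k)\<close>.\<close>
  define D1 where "D1 = 72 * (2 * G + A) / \<kappa>\<^sup>2 + 3 * A"
  have D1: "D1 \<ge> 0" using G A by (simp add: D1_def)
  have large: "norm (a k) * ln (real (n k)) \<le> D1" if nk: "n k \<ge> 16" for k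
  proof -
    let ?N = "real (n k)"
    have N: "?N \<ge> 16" using nk by simp
    define L where "L = 1 / sqrt ?N"
    have sN: "sqrt ?N \<ge> 4"
    proof -
      have "sqrt (4\<^sup>2) \<le> sqrt ?N" using N by (intro real_sqrt_le_mono) simp
      then show ?thesis by simp
    qed
    have "1 / sqrt ?N \<le> 1/4" using sN by (intro frac_le) auto
    then have L: "0 < L" "L \<le> 1/4" using sN n_pos[of k] by (auto simp: L_def)
    have LN: "(L * ?N)\<^sup>2 = ?N" using N by (simp add: L_def power_mult_distrib power_divide power2_eq_square)
    have lnL: "ln (1/L) = ln ?N / 2" using N by (simp add: L_def ln_sqrt)
    have lnN: "ln ?N \<ge> 2"
    proof -
      have "ln (16::real) = 4 * ln 2" using ln_realpow[of 2 4] by simp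
      then have "ln (16::real) \<ge> 2" using ln2_ge_two_thirds by simp
      moreover have "ln 16 \<le> ln ?N" using N by simp
      ultimately show ?thesis by linarith
    qed
    obtain P where P: "integral {L..L+L} (\<lambda>t. norm (bdry t - P)) \<le> A * L / ln (1/L)" using osc[OF L] by blast
    have ALb: "A * L / ln (1/L) \<le> A * L"
    proof -
      have "A * L / ln (1/L) \<le> A * L / 1" using A L lnN lnL by (intro divide_left_mono) auto
      then show ?thesis by simp
    qed
    \<comment> \<open>The centre \<open>P\<close> is arbitrary; its size has to be recovered from
      that of \<open>bdry\<close> and the oscillation bound.\<close>
    have PG: "norm P \<le> G + A"
    proof -
      have "L * norm P = integral {L..L+L} (\<lambda>t. norm P)" using L by simp
      also have "\<dots> \<le> integral {L..L+L} (\<lambda>t. G + norm (bdry t - P))"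
      proof (rule integral_le)
        fix t
        show "norm P \<le> G + norm (bdry t - P)" using norm_triangle_ineq4[of "bdry t" "bdry t - P"] bG[of t] by simp
      qed (intro integrable_continuous_interval continuous_intros bc)+
      also have "\<dots> = G * L + integral {L..L+L} (\<lambda>t. norm (bdry t - P))"
        using L by (subst integral_add) (auto intro!: integrable_continuous_interval continuous_intros bc)
      also have "\<dots> \<le> G * L + A * L" using P ALb by linarith
      finally have "L * norm P \<le> L * (G + A)" by (simp add: algebra_simps)
      then show ?thesis using L by simp
    qed
    \<comment> \<open>Since \<open>(L * n k)^2 = n k\<close>, any frequency at distance at least
      \<open>\<kappa> * n k\<close> is damped by a factor of order \<open>1 / n k\<close>.\<close>
    have small: "L^3 * (12 / (1 + (L * \<xi>)\<^sup>2)) \<le> L^3 * (12 / (\<kappa>\<^sup>2 * ?N))" if xi: "\<bar>\<xi>\<bar> \<ge> \<kappa> * ?N" for \<xi>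
    proof -
      have "(L * (\<kappa> * ?N))\<^sup>2 \<le> (L * \<xi>)\<^sup>2"
        using xi L kap N by (intro abs_le_square_iff[THEN iffD1]) (simp add: abs_mult mult_left_mono)
      moreover have "(L * (\<kappa> * ?N))\<^sup>2 = \<kappa>\<^sup>2 * (L * ?N)\<^sup>2" by (simp add: power_mult_distrib)
      ultimately have "\<kappa>\<^sup>2 * ?N \<le> 1 + (L * \<xi>)\<^sup>2" unfolding LN by simp
      moreover have "\<kappa>\<^sup>2 * ?N > 0" using kap N by simp
      ultimately show ?thesis using L by (intro mult_left_mono frac_le) auto
    qed
    have ftbound: "norm (arc_weight_ft L L \<xi>) \<le> L^3 * (12 / (\<kappa>\<^sup>2 * ?N))" if "\<bar>\<xi>\<bar> \<ge> \<kappa> * ?N" for \<xi>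
      using norm_arc_weight_ft_le[OF L(1), of L \<xi>] small[OF that] by linarith
    define q where "q = 12 / (\<kappa>\<^sup>2 * ?N)"
    have q0: "q \<ge> 0" by (simp add: q_def)
    \<comment> \<open>The weighted Fourier coefficient of \<open>bdry - P\<close> at frequency
      \<open>n k\<close> is bounded by the oscillation, and it equals \<open>a k * L^3 / 6\<close>
      up to terms of relative size \<open>q\<close>. The error \<open>\<epsilon>\<close> comes from
      cutting the series to a finite sum.\<close>
    have main: "norm (a k) / 6 \<le> q * (2 * G + A) + (A / ln (1/L) + \<epsilon>) / 4" if eps: "\<epsilon> > 0" for \<epsilon>
    proof -
      have ul: "uniform_limit UNIV (\<lambda>m t. \<Sum>j<m. a j * cis (real (n j) * t)) bdry sequentially"
        unfolding bdry_def[abs_def] by (rule uniform_limit_cis_series[OF s])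
      then have "\<forall>\<^sub>F m in sequentially. \<forall>t. dist (\<Sum>j<m. a j * cis (real (n j) * t)) (bdry t) < \<epsilon>"
        using eps by (simp add: uniform_limit_iff)
      then obtain m0 where m0: "\<And>m t. m \<ge> m0 \<Longrightarrow> dist (\<Sum>j<m. a j * cis (real (n j) * t)) (bdry t) < \<epsilon>"
        unfolding eventually_sequentially by blast
      define m where "m = max m0 (Suc k)"
      define S where "S t = (\<Sum>j<m. a j * cis (real (n j) * t))" for t
      have Sc: "continuous_on T S" for T unfolding S_def by (intro continuous_intros)
      have Sb: "norm (S t - P) \<le> norm (bdry t - P) + \<epsilon>" for t
      proof -
        have "norm (S t - bdry t) \<le> \<epsilon>" using m0[of m t] by (simp add: m_def S_def dist_norm less_imp_le)
        then show ?thesis using norm_triangle_ineq[of "S t - bdry t" "bdry t - P"] by simp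
      qed
      let ?w = "\<lambda>t. of_real (arc_weight L L t) * ((S t - P) * cis (- ?N * t))"
      have ft: "(?w has_integral (\<Sum>j<m. a j * arc_weight_ft L L (real (n j) - ?N)) - P * arc_weight_ft L L (- ?N)) {L..L+L}"
      proof -
        have "((\<lambda>t. (\<Sum>j<m. a j * (of_real (arc_weight L L t) * cis ((real (n j) - ?N) * t))) - P * (of_real (arc_weight L L t) * cis (- ?N * t)))
          has_integral (\<Sum>j<m. a j * arc_weight_ft L L (real (n j) - ?N)) - P * arc_weight_ft L L (- ?N)) {L..L+L}"
          unfolding arc_weight_ft_def
          by (intro has_integral_diff has_integral_sum has_integral_mult_right integrable_integral integrable_continuous_interval continuous_intros) auto
        moreover have "(\<Sum>j<m. a j * (of_real (arc_weight L L t) * cis ((real (n j) - ?N) * t))) - P * (of_real (arc_weight L L t) * cis (- ?N * t)) = ?w t" for t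
        proof -
          have "cis ((real (n j) - ?N) * t) = cis (real (n j) * t) * cis (- ?N * t)" for j
            by (simp add: cis_mult left_diff_distrib)
          then show ?thesis by (simp add: S_def sum_distrib_left sum_distrib_right left_diff_distrib right_diff_distrib mult_ac)
        qed
        ultimately show ?thesis by simp
      qed
      have up: "norm (integral {L..L+L} ?w) \<le> L\<^sup>2/4 * (A * L / ln (1/L) + \<epsilon> * L)"
      proof -
        have "norm (integral {L..L+L} ?w) \<le> integral {L..L+L} (\<lambda>t. L\<^sup>2/4 * (norm (bdry t - P) + \<epsilon>))"
        proof (rule integral_norm_bound_integral)
          show "?w integrable_on {L..L+L}" by (intro integrable_continuous_interval continuous_intros Sc)
          show "(\<lambda>t. L\<^sup>2/4 * (norm (bdry t - P) + \<epsilon>)) integrable_on {L..L+L}" by (intro integrable_continuous_interval continuous_intros bc)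
          fix t assume t: "t \<in> {L..L+L}"
          have "norm (?w t) = arc_weight L L t * norm (S t - P)" using arc_weight_nonneg[OF t] by (simp add: norm_mult)
          also have "\<dots> \<le> L\<^sup>2/4 * (norm (bdry t - P) + \<epsilon>)" using arc_weight_nonneg[OF t] by (intro mult_mono arc_weight_le Sb) auto
          finally show "norm (?w t) \<le> L\<^sup>2/4 * (norm (bdry t - P) + \<epsilon>)" .
        qed
        also have "\<dots> = L\<^sup>2/4 * (integral {L..L+L} (\<lambda>t. norm (bdry t - P)) + \<epsilon> * L)"
        proof -
          have "integral {L..L+L} (\<lambda>t. norm (bdry t - P) + \<epsilon>) = integral {L..L+L} (\<lambda>t. norm (bdry t - P)) + \<epsilon> * L"
            using L by (subst integral_add) (auto intro!: integrable_continuous_interval continuous_intros bc)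
          then show ?thesis by (simp only: integral_mult_right)
        qed
        also have "\<dots> \<le> L\<^sup>2/4 * (A * L / ln (1/L) + \<epsilon> * L)" using P by (intro mult_left_mono add_right_mono) auto
        finally show ?thesis .
      qed
      have km: "k < m" by (simp add: m_def)
      have split: "(\<Sum>j<m. a j * arc_weight_ft L L (real (n j) - ?N)) = a k * of_real (L^3/6) + (\<Sum>j\<in>{..<m}-{k}. a j * arc_weight_ft L L (real (n j) - ?N))"
        using km arc_weight_ft_0[of L L] L by (subst sum.remove[of _ k]) auto
      have rest: "norm (\<Sum>j\<in>{..<m}-{k}. a j * arc_weight_ft L L (real (n j) - ?N)) \<le> G * (L^3 * q)"
      proof -
        have "norm (\<Sum>j\<in>{..<m}-{k}. a j * arc_weight_ft L L (real (n j) - ?N)) \<le> (\<Sum>j\<in>{..<m}-{k}. norm (a j) * (L^3 * q))"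
        proof (rule sum_norm_le)
          fix j assume "j \<in> {..<m}-{k}"
          then have "\<bar>real (n j) - ?N\<bar> \<ge> \<kappa> * ?N" unfolding \<kappa>_def by (intro lacunary_real_gap_abs[OF lac]) auto
          then show "norm (a j * arc_weight_ft L L (real (n j) - ?N)) \<le> norm (a j) * (L^3 * q)"
            unfolding norm_mult q_def by (intro mult_left_mono ftbound) auto
        qed
        also have "\<dots> = (\<Sum>j\<in>{..<m}-{k}. norm (a j)) * (L^3 * q)" by (rule sum_distrib_right[symmetric])
        also have "\<dots> \<le> G * (L^3 * q)"
          unfolding G_def using L q0 s by (intro mult_right_mono sum_le_suminf) auto
        finally show ?thesis .
      qed
      \<comment> \<open>The constant \<open>P\<close> has frequency 0, at distance
        \<open>n k >= \<kappa> * n k\<close> from the selected one.\<close>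
      have Pb: "norm (P * arc_weight_ft L L (- ?N)) \<le> (G + A) * (L^3 * q)"
      proof -
        have "\<kappa> * ?N \<le> \<bar>- ?N\<bar>" using kap N by (simp add: mult_le_cancel_right1)
        then show ?thesis unfolding norm_mult q_def using PG G A by (intro mult_mono ftbound) auto
      qed
      have tri: "norm (x - y + w) \<le> norm x + norm y + norm w" for x y w :: complex
        using norm_triangle_ineq[of "x - y" w] norm_triangle_ineq4[of x y] by linarith
      have "a k * of_real (L^3/6) = integral {L..L+L} ?w - (\<Sum>j\<in>{..<m}-{k}. a j * arc_weight_ft L L (real (n j) - ?N)) + P * arc_weight_ft L L (- ?N)"
        using integral_unique[OF ft] split by simp
      then have "norm (a k * of_real (L^3/6)) \<le> norm (integral {L..L+L} ?w) + norm (\<Sum>j\<in>{..<m}-{k}. a j * arc_weight_ft L L (real (n j) - ?N)) + norm (P * arc_weight_ft L L (- ?N))"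
        by (simp only: tri)
      also have "\<dots> \<le> L\<^sup>2/4 * (A * L / ln (1/L) + \<epsilon> * L) + G * (L^3 * q) + (G + A) * (L^3 * q)"
        by (intro add_mono up rest Pb)
      also have "\<dots> = L^3 * (q * (2 * G + A) + (A / ln (1/L) + \<epsilon>) / 4)"
        by (simp add: algebra_simps power2_eq_square power3_eq_cube)
      also have "norm (a k * of_real (L^3/6)) = L^3 * (norm (a k) / 6)"
      proof -
        have "norm (of_real (L^3/6) :: complex) = L^3/6" using L by (simp only: norm_of_real) simp
        then show ?thesis by (simp add: norm_mult)
      qed
      finally have "L^3 * (norm (a k) / 6) \<le> L^3 * (q * (2 * G + A) + (A / ln (1/L) + \<epsilon>) / 4)" .
      moreover have "L^3 > 0" using L by simp
      ultimately show ?thesis by (subst (asm) mult_le_cancel_left_pos)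
    qed
    have "norm (a k) / 6 \<le> q * (2 * G + A) + A / ln (1/L) / 4"
    proof (rule field_le_epsilon)
      fix e :: real assume "e > 0"
      then show "norm (a k) / 6 \<le> q * (2 * G + A) + A / ln (1/L) / 4 + e" using main[of "4 * e"] by (simp add: add_divide_distrib)
    qed
    also have "A / ln (1/L) / 4 = A / (2 * ln ?N)" unfolding lnL by simp
    finally have "norm (a k) / 6 * (6 * ln ?N) \<le> (q * (2 * G + A) + A / (2 * ln ?N)) * (6 * ln ?N)"
      using lnN by (intro mult_right_mono) auto
    also have "\<dots> = 72 * (2 * G + A) / \<kappa>\<^sup>2 * (ln ?N / ?N) + 3 * A"
      using lnN N kap by (simp add: q_def field_simps)
    also have "\<dots> \<le> 72 * (2 * G + A) / \<kappa>\<^sup>2 * 1 + 3 * A"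
    proof (intro add_right_mono mult_left_mono)
      have "ln ?N \<le> ?N - 1" using N by (intro ln_le_minus_one) auto
      then show "ln ?N / ?N \<le> 1" using N by (simp add: divide_le_eq)
      show "0 \<le> 72 * (2 * G + A) / \<kappa>\<^sup>2" using G A by simp
    qed
    finally show ?thesis by (simp add: D1_def)
  qed
  show thesis
  proof (rule that[of "D1 + G * (1 + ln 16)"])
    show "0 \<le> D1 + G * (1 + ln 16)" using D1 G by simp
    fix k
    show "norm (a k) * (1 + ln (real (n k))) \<le> D1 + G * (1 + ln 16)"
    proof (cases "n k \<ge> 16")
      case True
      have "norm (a k) * (1 + ln (real (n k))) = norm (a k) + norm (a k) * ln (real (n k))" by (simp add: distrib_left)
      also have "\<dots> \<le> G + D1" by (intro add_mono aG large True)
      also have "\<dots> \<le> D1 + G * (1 + ln 16)" using G by (simp add: distrib_left)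
      finally show ?thesis .
    next
      case False
      then have "ln (real (n k)) \<le> ln 16" using n_pos[of k] by simp
      then have "norm (a k) * (1 + ln (real (n k))) \<le> G * (1 + ln 16)"
        using one_plus_ln_n_ge[of k] G by (intro mult_mono aG) auto
      then show ?thesis using D1 by linarith
    qed
  qed
qed

text \<open>On \<open>[L, 2*L]\<close> with \<open>L = M / n k\<close> the coefficient bound keeps
  the frequencies below \<open>n k\<close> within \<open>O(1 / l)\<close> of a constant, where
  \<open>l = 1 + ln (n k)\<close>. Hence the tail plus some constant has mean
  \<open>O(1 / l)\<close>, and the lower bound for first means turns this into a bound on its
  coefficients.\<close>

lemma oscillation_imp_tail_log:
  assumes s: "summable (\<lambda>k. norm (a k))" and A: "A \<ge> 0"
    and osc: "\<And>L. 0 < L \<Longrightarrow> L \<le> 1/4 \<Longrightarrow> \<exists>P. integral {L..L+L} (\<lambda>t. norm (bdry t - P)) \<le> A * L / ln (1/L)"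
  obtains C where "tail_log C"
proof -
  obtain D where D0: "D \<ge> 0" and D: "\<And>k. norm (a k) * (1 + ln (real (n k))) \<le> D"
    using coeff_log_bound[OF s A osc] by metis
  define M where "M = lac_threshold lam"
  have M: "M \<ge> 12" unfolding M_def by (rule lac_threshold_ge[OF lam])
  have bc: "continuous_on S bdry" for S by (rule continuous_bdry[OF s])
  \<comment> \<open>The constant of the lower bound for the exponent 1, without the factor
    \<open>L^3\<close>.\<close>
  define \<delta> where "\<delta> = 1 / (24 * (39168 * (lac_const lam + 1)\<^sup>2) powr (1 - 1/2))"
  have del: "\<delta> > 0" using lac_const_pos[OF lam] unfolding \<delta>_def by (intro divide_pos_pos mult_pos_pos) auto
  define c where "c = lac_const (sqrt lam)"
  have c0: "c \<ge> 0" using lac_const_pos[of "sqrt lam"] lam by (simp add: c_def)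
  \<comment> \<open>\<open>2 * D * c * M\<close> comes from the low frequencies and
    \<open>4 * A\<close> from the oscillation; the division by 4 reflects the maximum
    \<open>L^2 / 4\<close> of the weight.\<close>
  define E where "E = (2 * D * c * M + 4 * A) / 4"
  have E0: "E \<ge> 0" using D0 c0 M A by (simp add: E_def)
  have large: "(\<Sum>j=k..<J. (norm (a j))\<^sup>2) * (1 + ln (real (n k)))\<^sup>2 \<le> (E / \<delta>)\<^sup>2" if nk: "real (n k) \<ge> M\<^sup>2" for k J
  proof -
    let ?N = "real (n k)"
    let ?l = "1 + ln ?N"
    have M12: "12 * M \<le> M\<^sup>2" using M by (simp add: power2_eq_square)
    have N: "?N \<ge> 12 * M" "?N \<ge> 144" using nk M12 M by auto
    define L where "L = M / ?N"
    have L: "0 < L" "L \<le> 1/4" using M N n_pos[of k] by (auto simp: L_def divide_le_eq)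
    have lnN: "ln ?N \<ge> 1"
    proof -
      have "ln (exp 1) \<le> ln ?N" using N e_less_272 by (subst ln_le_cancel_iff) auto
      then show ?thesis by simp
    qed
    \<comment> \<open>\<open>n k >= M^2\<close> gives \<open>ln M <= ln (n k) / 2\<close>, so the
      passage from \<open>n k\<close> to \<open>1/L = n k / M\<close> keeps at least half of the
      logarithm.\<close>
    have lnL: "ln (1/L) \<ge> ?l / 4"
    proof -
      have "ln (M\<^sup>2) \<le> ln ?N" using nk M n_pos[of k] by (subst ln_le_cancel_iff) auto
      then have "2 * ln M \<le> ln ?N" using M by (simp add: ln_realpow)
      then have "?l / 4 \<le> ln ?N - ln M" using lnN by argo
      also have "\<dots> = ln (1/L)" using M N n_pos[of k] by (simp add: L_def ln_div)
      finally show ?thesis .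
    qed
    have l: "?l \<ge> 1" by (rule one_plus_ln_n_ge)
    obtain P where P: "integral {L..L+L} (\<lambda>t. norm (bdry t - P)) \<le> A * L / ln (1/L)" using osc[OF L] by blast
    have P': "integral {L..L+L} (\<lambda>t. norm (bdry t - P)) \<le> 4 * A * L / ?l"
    proof -
      have "A * L / ln (1/L) \<le> A * L / (?l / 4)" using A L lnL l by (intro divide_left_mono) auto
      also have "\<dots> = 4 * A * L / ?l" by simp
      finally show ?thesis using P by linarith
    qed
    define low where "low t = (\<Sum>j<k. a j * cis (real (n j) * t))" for t
    define S where "S t = (\<Sum>j. a (j + k) * cis (real (n (j + k)) * t))" for t
    have sk: "summable (\<lambda>j. norm (a (j + k)))" using s by (simp add: summable_iff_shift[of "\<lambda>j. norm (a j)"])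
    have split: "bdry t = low t + S t" for t unfolding bdry_def low_def S_def by (rule split_series[OF s])
    have Sc: "continuous_on T S" for T unfolding S_def by (rule continuous_on_cis_series[OF sk])
    have LF: "(\<Sum>j<k. real (n j) * norm (a j)) \<le> 2 * D * c * (?N / ?l)"
      unfolding c_def using N n_mono by (intro low_frequency_sum_le D) auto
    have lowd: "norm (low t - low L) \<le> 2 * D * c * M / ?l" if t: "t \<in> {L..L+L}" for t
    proof -
      have "norm (low t - low L) \<le> (\<Sum>j<k. norm (a j) * (real (n j) * L))"
        unfolding low_def sum_subtractf[symmetric]
      proof (rule sum_norm_le)
        fix j
        have "norm (cis (real (n j) * t) - cis (real (n j) * L)) \<le> \<bar>real (n j) * t - real (n j) * L\<bar>" by (rule norm_cis_diff_le)
        also have "\<dots> = real (n j) * (t - L)" using t by (simp flip: right_diff_distrib)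
        also have "\<dots> \<le> real (n j) * L" using t by (intro mult_left_mono) auto
        finally have "norm (a j) * norm (cis (real (n j) * t) - cis (real (n j) * L)) \<le> norm (a j) * (real (n j) * L)"
          by (intro mult_left_mono) auto
        then show "norm (a j * cis (real (n j) * t) - a j * cis (real (n j) * L)) \<le> norm (a j) * (real (n j) * L)"
          by (simp add: norm_mult flip: right_diff_distrib)
      qed
      also have "\<dots> = L * (\<Sum>j<k. real (n j) * norm (a j))" by (simp add: sum_distrib_left mult_ac)
      also have "\<dots> \<le> L * (2 * D * c * (?N / ?l))" using L LF by (intro mult_left_mono) auto
      also have "\<dots> = 2 * D * c * M / ?l" using N by (simp add: L_def)
      finally show ?thesis .
    qed
    define c0' where "c0' = low L - P"
    have int: "integral {L..L+L} (\<lambda>t. norm (c0' + S t)) \<le> L * (4 * E / ?l)"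
    proof -
      have "integral {L..L+L} (\<lambda>t. norm (c0' + S t)) \<le> integral {L..L+L} (\<lambda>t. norm (bdry t - P) + 2 * D * c * M / ?l)"
      proof (rule integral_le)
        fix t assume t: "t \<in> {L..L+L}"
        have "c0' + S t = (bdry t - P) - (low t - low L)" by (simp add: c0'_def split)
        then have "norm (c0' + S t) \<le> norm (bdry t - P) + norm (low t - low L)" by (metis norm_triangle_ineq4)
        then show "norm (c0' + S t) \<le> norm (bdry t - P) + 2 * D * c * M / ?l" using lowd[OF t] by linarith
      qed (intro integrable_continuous_interval continuous_intros bc Sc)+
      also have "\<dots> = integral {L..L+L} (\<lambda>t. norm (bdry t - P)) + L * (2 * D * c * M / ?l)"
        using L by (subst integral_add) (auto intro!: integrable_continuous_interval continuous_intros bc)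
      also have "\<dots> \<le> 4 * A * L / ?l + L * (2 * D * c * M / ?l)" using P' by simp
      also have "\<dots> = L * ((2 * D * c * M + 4 * A) / ?l)" unfolding add_divide_distrib by (simp add: distrib_left)
      also have "2 * D * c * M + 4 * A = 4 * E" by (simp add: E_def)
      finally show ?thesis .
    qed
    have X: "(\<Sum>j<J-k. (norm (a (j + k)))\<^sup>2) powr (1/2) * \<delta> \<le> E / ?l"
    proof -
      have "L^3 / (24 * (39168 * (lac_const lam + 1)\<^sup>2) powr (1 - 1/2)) * (\<Sum>j<J-k. (norm (a (j + k)))\<^sup>2) powr (1/2)
        \<le> integral {L..L+L} (\<lambda>t. arc_weight L L t * norm (c0' + (\<Sum>j. a (j + k) * cis (real (n (j + k)) * t))) powr 1)"
      proof (rule lacunary_series_powr_lower[OF lac_shift L(1) _ _ sk])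
        show "lac_threshold lam \<le> L * real (n (j + k))" for j
        proof -
          have "?N \<le> real (n (j + k))" using n_mono[of k "j+k"] by simp
          then have "L * ?N \<le> L * real (n (j + k))" using L by (intro mult_left_mono) auto
          moreover have "L * ?N = M" using N by (simp add: L_def)
          ultimately show ?thesis by (simp add: M_def)
        qed
      qed auto
      also have "\<dots> \<le> integral {L..L+L} (\<lambda>t. L\<^sup>2/4 * norm (c0' + S t))"
        unfolding S_def[symmetric] powr_one[OF norm_ge_zero]
        by (intro integral_le integrable_continuous_interval continuous_intros Sc mult_right_mono arc_weight_le) auto
      also have "\<dots> = L\<^sup>2/4 * integral {L..L+L} (\<lambda>t. norm (c0' + S t))" by simp
      also have "\<dots> \<le> L\<^sup>2/4 * (L * (4 * E / ?l))" using int by (intro mult_left_mono) auto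
      also have "\<dots> = L^3 * (E / ?l)" by (simp add: power2_eq_square power3_eq_cube)
      finally have "L^3 * ((\<Sum>j<J-k. (norm (a (j + k)))\<^sup>2) powr (1/2) * \<delta>) \<le> L^3 * (E / ?l)"
        by (simp add: \<delta>_def)
      moreover have "L^3 > 0" using L by simp
      ultimately show ?thesis by (subst (asm) mult_le_cancel_left_pos)
    qed
    define T where "T = (\<Sum>j<J-k. (norm (a (j + k)))\<^sup>2)"
    have T0: "T \<ge> 0" by (auto simp: T_def intro: sum_nonneg)
    have TT: "(\<Sum>j=k..<J. (norm (a j))\<^sup>2) = T"
    proof (cases "k \<le> J")
      case True
      then show ?thesis unfolding T_def
        by (intro sum.reindex_bij_witness[of _ "\<lambda>j. j + k" "\<lambda>j. j - k"]) auto
    qed (simp add: T_def)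
    have "sqrt T * \<delta> \<le> E / ?l" using X T0 by (simp add: T_def powr_half_sqrt)
    then have "sqrt T * ?l \<le> E / \<delta>" using del l by (simp add: field_simps)
    then have "(sqrt T * ?l)\<^sup>2 \<le> (E / \<delta>)\<^sup>2" using T0 l by (intro power_mono) auto
    then show ?thesis unfolding TT using T0 by (simp add: power_mult_distrib)
  qed
  \<comment> \<open>For \<open>n k < M^2\<close> the logarithm is bounded, and the full sum of
    squares serves as a bound for every tail.\<close>
  define S0 where "S0 = (\<Sum>j. (norm (a j))\<^sup>2)"
  have s2: "summable (\<lambda>j. (norm (a j))\<^sup>2)" by (rule summable_norm_square[OF s])
  have S0: "S0 \<ge> 0" unfolding S0_def by (intro suminf_nonneg s2) auto
  show thesis
  proof (rule that[of "(E / \<delta>)\<^sup>2 + S0 * (1 + ln (M\<^sup>2))\<^sup>2"], unfold tail_log_def, intro conjI allI)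
    show "0 \<le> (E / \<delta>)\<^sup>2 + S0 * (1 + ln (M\<^sup>2))\<^sup>2" using S0 by simp
    fix k J
    show "(\<Sum>j=k..<J. (norm (a j))\<^sup>2) * (1 + ln (real (n k)))\<^sup>2 \<le> (E / \<delta>)\<^sup>2 + S0 * (1 + ln (M\<^sup>2))\<^sup>2"
    proof (cases "real (n k) \<ge> M\<^sup>2")
      case True
      have "0 \<le> S0 * (1 + ln (M\<^sup>2))\<^sup>2" using S0 by simp
      then show ?thesis using large[OF True, of J] by linarith
    next
      case False
      have "(\<Sum>j=k..<J. (norm (a j))\<^sup>2) \<le> S0" unfolding S0_def using s2 by (intro sum_le_suminf) auto
      moreover have "ln (real (n k)) \<le> ln (M\<^sup>2)" using False n_pos[of k] M by (subst ln_le_cancel_iff) auto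
      then have "(1 + ln (real (n k)))\<^sup>2 \<le> (1 + ln (M\<^sup>2))\<^sup>2" using one_plus_ln_n_ge[of k] by (intro power_mono) auto
      ultimately have "(\<Sum>j=k..<J. (norm (a j))\<^sup>2) * (1 + ln (real (n k)))\<^sup>2 \<le> S0 * (1 + ln (M\<^sup>2))\<^sup>2"
        using S0 by (intro mult_mono) auto
      moreover have "0 \<le> (E / \<delta>)\<^sup>2" by simp
      ultimately show ?thesis by linarith
    qed
  qed
qed

end

section \<open>The constant test function and the equivalence\<close>

lemma one_mem_Dspace: "p > 0 \<Longrightarrow> (\<lambda>z. 1) \<in> Dspace p"
  by (simp add: Dspace_def analytic_disc_def)

lemma one_mem_BMOA: "(\<lambda>z. 1) \<in> BMOA"
proof -
  have "bounded_mean_osc (\<lambda>t. 1)"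
  proof (rule bounded_mean_oscI[where C=0])
    fix a L :: real assume L: "0 < L" "L \<le> 2*pi"
    show "set_integrable lborel {a..a+L} (\<lambda>t. 1::complex)" using L by (intro set_integral_const_Icc) auto
    show "\<exists>c::complex. (LINT t:{a..a+L}|lborel. norm (1 - c)) \<le> 0 * L" by (rule exI[of _ 1]) simp
  qed
  moreover have "boundary_function (\<lambda>z. 1) (\<lambda>t. 1)" by (simp add: boundary_function_def)
  ultimately show ?thesis using one_mem_H1 by (auto simp: BMOA_def)
qed

theorem mainTheorem19:
  fixes p q :: real and g :: "complex \<Rightarrow> complex"
  assumes "0 < p" and "p \<le> q" and "q \<le> 1"
    and "analytic_disc g" and "lacunary_series g"
  shows "g \<in> multipliers (Dspace p \<inter> BMOA) (Dspace q \<inter> BMOA) \<longleftrightarrow> g \<in> Dspace q \<inter> BMOA_log"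
proof -
  have q: "0 < q" "q \<le> 1" using assms by auto
  obtain a n lam where "lam > 1" and lac: "\<forall>k. 0 < n k \<and> lam * real (n k) \<le> real (n (Suc k))"
    and sums: "\<forall>z\<in>udisc. (\<lambda>k. a k * z ^ n k) sums g z"
    using assms(5) unfolding lacunary_series_def by blast
  then interpret lacunary_function g a n lam
    by (intro lacunary_function.intro) (use lac sums in blast)+
  show ?thesis
  proof
    assume m: "g \<in> multipliers (Dspace p \<inter> BMOA) (Dspace q \<inter> BMOA)"
    have mult: "(\<lambda>z. f z * g z) \<in> Dspace q \<inter> BMOA" if "f \<in> Dspace p" "f \<in> BMOA" for f
      using m that by (simp add: multipliers_def)
    have gD: "g \<in> Dspace q" using mult[OF one_mem_Dspace[OF assms(1)] one_mem_BMOA] by simp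
    have s: "summable (\<lambda>k. norm (a k))"
      by (rule summable_norm_coeff[OF Dspace_imp_summable[OF gD q] q])
    \<comment> \<open>From \<open>p <= q <= 1\<close> the logarithm lies in \<open>Dspace p\<close>,
      so it is an admissible test function.\<close>
    have "(\<lambda>z. log_test z * g z) \<in> BMOA"
      using mult[OF log_test_mem_Dspace log_test_mem_BMOA] assms by simp
    then obtain A where A: "A \<ge> 0" "\<And>L. 0 < L \<Longrightarrow> L \<le> 1/4 \<Longrightarrow>
       \<exists>P. integral {L..L+L} (\<lambda>t. norm (bdry t - P)) \<le> A * L / ln (1/L)"
      using local_oscillation[OF _ s] by metis
    obtain C where "tail_log C" using oscillation_imp_tail_log[OF s A] by blast
    then show "g \<in> Dspace q \<inter> BMOA_log" using gD tail_log_imp_BMOA_log[OF _ s] by blast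
  next
    assume g: "g \<in> Dspace q \<inter> BMOA_log"
    then obtain C where C: "tail_log C" using BMOA_log_imp_tail_log by blast
    have sq: "summable (\<lambda>k. norm (a k) powr q)" using g by (intro Dspace_imp_summable q) auto
    have s: "summable (\<lambda>k. norm (a k))" by (rule summable_norm_coeff[OF sq q])
    have "(\<lambda>z. f z * g z) \<in> Dspace q \<inter> BMOA" if f: "f \<in> Dspace p \<inter> BMOA" for f
    proof
      have "f \<in> Dspace q" using f by (intro Dspace_mono_BMOA[OF _ _ assms(1,2)]) blast+
      moreover have "f \<in> H1" using f by (simp add: BMOA_def)
      ultimately show "(\<lambda>z. f z * g z) \<in> Dspace q" by (rule mult_mem_Dspace[OF _ _ q sq norm_g_le[OF s]])
      show "(\<lambda>z. f z * g z) \<in> BMOA" using f by (intro mult_mem_BMOA[OF _ C s]) blast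
    qed
    then show "g \<in> multipliers (Dspace p \<inter> BMOA) (Dspace q \<inter> BMOA)"
      using assms(4) by (simp add: multipliers_def)
  qed
qed

end
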